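(* There exist universal constants $C,c>0$ such that for every increasing function $f:\mathbb{N}\to\mathbb{N}$ with $f(d)\ge d$ for all $d$, writing $N=f(d)$: A generic $d$-dimensional quotient of $\ell_1^N$ contains a $C$-complemented subspace $C$-isomorphic to $\ell_p^k$ for some $k\ge c\sqrt d$, with either $p=1$ or $p=2$. Respectively, a generic $d$-dimensional subspace of $\ell_\infty^N$ contains a $C$-complemented subspace $C$-isomorphic to $\ell_p^k$ for some $k\ge c\sqrt d$, with either $p=\infty$ or $p=2$.
   Context: $\ell_p^k=(\mathbb{R}^k,\|\cdot\|_p)$. $G_{d,N}$ is the Grassmann manifold of all $d$-dimensional linear subspaces of $\mathbb{R}^N$, with (normalized, rotation-invariant) Haar measure $\mu_{d,N}$. Generic: let $P=\{P_d\}_{d\in\mathbb{N}}$ be a sequence of properties of $d$-dimensional Banach spaces and let $f:\mathbb{N}\to\mathbb{N}$ be increasing, $N=f(d)$. A generic $d$-dimensional subspace of $\ell_\infty^N$ has property $P$ if there is $\varepsilon\in(0,1)$, independent of $d$, such that for every $d\in\mathbb{N}$, $\mu_{d,N}\{E\in G_{d,N} : (E,\|\cdot\|_\infty)\text{ satisfies }P_d\}\ge 1-\varepsilon^d$. A generic $d$-dimensional quotient of $\ell_1^N$ has property $P$ if there is $\varepsilon\in(0,1)$, independent of $d$, such that for every $d\in\mathbb{N}$, $\mu_{d,N}\{E\in G_{d,N} : \ell_1^N/E^\perp\text{ satisfies }P_d\}\ge 1-\varepsilon^d$, where $E^\perp$ is the orthogonal complement of $E$ in $\mathbb{R}^N$.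 Two $k$-dimensional normed spaces are $C$-isomorphic if their Banach–Mazur distance $\mathrm{d}(\cdot,\cdot)$ is at most $C$. A subspace $F$ of $X$ is $C$-complemented if there is a linear projection of $X$ onto $F$ of norm at most $C$. *)

theory Defs
  imports "HOL-Probability.Probability" "HOL-Library.Function_Algebras"
begin

section \<open>Coordinate spaces of varying dimension\<close>

text \<open>
  The dimension \<open>N = f d\<close> depends on a quantified \<open>d\<close>, so \<open>\<real>\<^sup>N\<close> cannot be a type here.  It is the
  subspace \<open>rvecs N\<close> of the sequences vanishing from index \<open>N\<close> on.  The instance below makes the library
  notions \<open>subspace\<close>, \<open>dim\<close>, \<open>linear\<close> available on such sequences.
\<close>

instantiation "fun" :: (type, real_vector) real_vector
begin

definition scaleR_fun :: "real \<Rightarrow> ('a \<Rightarrow> 'b) \<Rightarrow> 'a \<Rightarrow> 'b"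
  where "scaleR_fun r f = (\<lambda>x. r *\<^sub>R f x)"

instance
  by standard (simp_all add: scaleR_fun_def fun_eq_iff scaleR_add_right scaleR_add_left)

end

definition rvecs :: "nat \<Rightarrow> (nat \<Rightarrow> real) set"
  where "rvecs N = {x. \<forall>i\<ge>N. x i = 0}"

definition rinner :: "nat \<Rightarrow> (nat \<Rightarrow> real) \<Rightarrow> (nat \<Rightarrow> real) \<Rightarrow> real"
  where "rinner N x y = (\<Sum>i<N. x i * y i)"

definition orth_compl :: "nat \<Rightarrow> (nat \<Rightarrow> real) set \<Rightarrow> (nat \<Rightarrow> real) set"
  where "orth_compl N E = {x \<in> rvecs N. \<forall>y\<in>E. rinner N x y = 0}"

definition orth_proj :: "nat \<Rightarrow> (nat \<Rightarrow> real) set \<Rightarrow> (nat \<Rightarrow> real) \<Rightarrow> (nat \<Rightarrow> real)"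
  where "orth_proj N E x = (THE y. y \<in> E \<and> x - y \<in> orth_compl N E)"

text \<open>
  An element of the orthogonal group \<open>O(N)\<close>; linearity is required on all sequences, which is no
  restriction since every linear self-map of \<open>rvecs N\<close> extends.
\<close>

definition orthogonal_map :: "nat \<Rightarrow> ((nat \<Rightarrow> real) \<Rightarrow> (nat \<Rightarrow> real)) \<Rightarrow> bool"
  where "orthogonal_map N U \<longleftrightarrow> linear U \<and> U ` rvecs N = rvecs N \<and>
    (\<forall>x\<in>rvecs N. \<forall>y\<in>rvecs N. rinner N (U x) (U y) = rinner N x y)"

section \<open>The Grassmann manifold and its Haar measure\<close>

definition grassmannian :: "nat \<Rightarrow> nat \<Rightarrow> (nat \<Rightarrow> real) set set"
  where "grassmannian d N = {E. subspace E \<and> E \<subseteq> rvecs N \<and> dim E = d}"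

definition proj_matrix :: "nat \<Rightarrow> (nat \<Rightarrow> real) set \<Rightarrow> nat \<Rightarrow> nat \<Rightarrow> real"
  where "proj_matrix N E = (\<lambda>i j. if i < N \<and> j < N
     then orth_proj N E (\<lambda>l. of_bool (l = j)) i else 0)"

text \<open>
  The topology of the Grassmann manifold is the one induced by the embedding that sends \<open>E\<close> to the matrix
  of the orthogonal projection onto \<open>E\<close>.  Its Borel sets are therefore the preimages of Borel sets of
  matrices.
\<close>

definition grassmann_borel :: "nat \<Rightarrow> nat \<Rightarrow> (nat \<Rightarrow> real) set measure"
  where "grassmann_borel d N = vimage_algebra (grassmannian d N) (proj_matrix N) borel"

definition is_grassmann_haar :: "nat \<Rightarrow> nat \<Rightarrow> (nat \<Rightarrow> real) set measure \<Rightarrow> bool"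
  where "is_grassmann_haar d N \<mu> \<longleftrightarrow> prob_space \<mu> \<and> sets \<mu> = sets (grassmann_borel d N) \<and>
    (\<forall>U. orthogonal_map N U \<longrightarrow> (\<forall>A\<in>sets \<mu>. emeasure \<mu> ((\<lambda>E. U ` E) ` A) = emeasure \<mu> A))"

text \<open>For \<open>d \<le> N\<close> the rotation-invariant Borel probability measure exists and is unique.\<close>

definition grassmann_haar :: "nat \<Rightarrow> nat \<Rightarrow> (nat \<Rightarrow> real) set measure"
  where "grassmann_haar d N = (THE \<mu>. is_grassmann_haar d N \<mu>)"

section \<open>Normed spaces with explicit carrier\<close>

text \<open>
  Quotient spaces consist of cosets, which do not form a vector space type, so a normed space carries its
  own carrier, operations and norm.
\<close>

record 'a nspace =
  ns_carrier :: "'a set"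
  ns_add :: "'a \<Rightarrow> 'a \<Rightarrow> 'a"
  ns_scale :: "real \<Rightarrow> 'a \<Rightarrow> 'a"
  ns_norm :: "'a \<Rightarrow> real"

definition lp_norm :: "ereal \<Rightarrow> nat \<Rightarrow> (nat \<Rightarrow> real) \<Rightarrow> real"
  where "lp_norm p n x = (if p = \<infinity> then Max (insert 0 ((\<lambda>i. \<bar>x i\<bar>) ` {..<n}))
     else (\<Sum>i<n. \<bar>x i\<bar> powr real_of_ereal p) powr (1 / real_of_ereal p))"

definition lp_space :: "ereal \<Rightarrow> nat \<Rightarrow> (nat \<Rightarrow> real) nspace"
  where "lp_space p n =
    \<lparr>ns_carrier = rvecs n, ns_add = (+), ns_scale = (*\<^sub>R), ns_norm = lp_norm p n\<rparr>"

definition ns_subspace :: "'a nspace \<Rightarrow> 'a set \<Rightarrow> bool"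
  where "ns_subspace X F \<longleftrightarrow> F \<noteq> {} \<and> F \<subseteq> ns_carrier X \<and>
    (\<forall>x\<in>F. \<forall>y\<in>F. ns_add X x y \<in> F) \<and> (\<forall>a. \<forall>x\<in>F. ns_scale X a x \<in> F)"

definition ns_restrict :: "'a nspace \<Rightarrow> 'a set \<Rightarrow> 'a nspace"
  where "ns_restrict X F = X\<lparr>ns_carrier := F\<rparr>"

text \<open>
  Quotient by a closed subspace \<open>M\<close>.  Adding \<open>M\<close> in the scalar multiplication matters only for the
  scalar \<open>0\<close>.  The infimum of the norm over the coset \<open>x + M\<close> is the distance from \<open>x\<close> to \<open>M\<close>.
\<close>

definition ns_quotient :: "'a nspace \<Rightarrow> 'a set \<Rightarrow> 'a set nspace"
  where "ns_quotient X M =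
    \<lparr>ns_carrier = {ns_add X x ` M | x. x \<in> ns_carrier X},
     ns_add = (\<lambda>A B. {ns_add X a b | a b. a \<in> A \<and> b \<in> B}),
     ns_scale = (\<lambda>r A. {ns_add X (ns_scale X r a) m | a m. a \<in> A \<and> m \<in> M}),
     ns_norm = (\<lambda>A. INF x\<in>A. ns_norm X x)\<rparr>"

definition ns_linear :: "'a nspace \<Rightarrow> 'b nspace \<Rightarrow> ('a \<Rightarrow> 'b) \<Rightarrow> bool"
  where "ns_linear X Y T \<longleftrightarrow> (\<forall>x\<in>ns_carrier X. T x \<in> ns_carrier Y) \<and>
    (\<forall>x\<in>ns_carrier X. \<forall>y\<in>ns_carrier X. T (ns_add X x y) = ns_add Y (T x) (T y)) \<and>
    (\<forall>a. \<forall>x\<in>ns_carrier X. T (ns_scale X a x) = ns_scale Y a (T x))"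

definition ns_opnorm :: "'a nspace \<Rightarrow> 'b nspace \<Rightarrow> ('a \<Rightarrow> 'b) \<Rightarrow> ennreal"
  where "ns_opnorm X Y T = (SUP x\<in>{x \<in> ns_carrier X. ns_norm X x \<le> 1}. ennreal (ns_norm Y (T x)))"

definition ns_iso :: "'a nspace \<Rightarrow> 'b nspace \<Rightarrow> ('a \<Rightarrow> 'b) \<Rightarrow> bool"
  where "ns_iso X Y T \<longleftrightarrow> ns_linear X Y T \<and> bij_betw T (ns_carrier X) (ns_carrier Y)"

text \<open>The value is \<open>\<infinity>\<close> if the spaces are not linearly isomorphic.\<close>

definition banach_mazur :: "'a nspace \<Rightarrow> 'b nspace \<Rightarrow> ennreal"
  where "banach_mazur X Y =
    (INF T\<in>{T. ns_iso X Y T}. ns_opnorm X Y T * ns_opnorm Y X (inv_into (ns_carrier X) T))"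

definition C_isomorphic :: "real \<Rightarrow> 'a nspace \<Rightarrow> 'b nspace \<Rightarrow> bool"
  where "C_isomorphic C X Y \<longleftrightarrow> banach_mazur X Y \<le> ennreal C"

definition C_complemented :: "real \<Rightarrow> 'a nspace \<Rightarrow> 'a set \<Rightarrow> bool"
  where "C_complemented C X F \<longleftrightarrow> (\<exists>Q. ns_linear X X Q \<and> Q ` ns_carrier X = F \<and>
    (\<forall>x\<in>F. Q x = x) \<and> ns_opnorm X X Q \<le> ennreal C)"

definition contains_complemented_lp :: "real \<Rightarrow> ereal \<Rightarrow> nat \<Rightarrow> 'a nspace \<Rightarrow> bool"
  where "contains_complemented_lp C p k X \<longleftrightarrow> (\<exists>F. ns_subspace X F \<and> C_complemented C X F \<and>
    C_isomorphic C (ns_restrict X F) (lp_space p k))"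

section \<open>Generic subspaces and quotients\<close>

text \<open>
  Here \<open>\<nat> = {1, 2, \<dots>}\<close>.  A property is a family of predicates \<open>P d\<close> on normed spaces.
\<close>

definition generic_subspace_linf ::
    "(nat \<Rightarrow> nat) \<Rightarrow> (nat \<Rightarrow> (nat \<Rightarrow> real) nspace \<Rightarrow> bool) \<Rightarrow> bool"
  where "generic_subspace_linf f P \<longleftrightarrow> (\<exists>\<epsilon>::real. 0 < \<epsilon> \<and> \<epsilon> < 1 \<and>
    (\<forall>d\<ge>1. measure (grassmann_haar d (f d))
        {E \<in> grassmannian d (f d). P d (ns_restrict (lp_space \<infinity> (f d)) E)} \<ge> 1 - \<epsilon> ^ d))"

definition generic_quotient_l1 ::
    "(nat \<Rightarrow> nat) \<Rightarrow> (nat \<Rightarrow> (nat \<Rightarrow> real) set nspace \<Rightarrow> bool) \<Rightarrow> bool"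
  where "generic_quotient_l1 f P \<longleftrightarrow> (\<exists>\<epsilon>::real. 0 < \<epsilon> \<and> \<epsilon> < 1 \<and>
    (\<forall>d\<ge>1. measure (grassmann_haar d (f d))
        {E \<in> grassmannian d (f d). P d (ns_quotient (lp_space 1 (f d)) (orth_compl (f d) E))}
      \<ge> 1 - \<epsilon> ^ d))"

end

theory Submission
  imports Defs
begin

text \<open>
  The column span of an \<open>N \<times> d\<close> Gaussian matrix \<open>G\<close> with rows \<open>g\<^sub>1, \<dots>, g\<^sub>N \<in> \<real>\<^sup>d\<close> is Haar distributed, and
  carries the norm \<open>x \<mapsto> max\<^sub>i \<bar>\<langle>g\<^sub>i, x\<rangle>\<bar>\<close>.  Let \<open>k\<close> be a small multiple of \<open>\<surd>d\<close>.
  If \<open>N \<le> exp (\<surd>d)\<close>, split the first \<open>d\<close> rows into blocks of length \<open>k\<close>.  A block \<open>J\<close> such that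
  \<open>\<Sum>\<^sub>j \<bar>\<langle>g\<^sub>i, g\<^sub>j\<rangle>\<bar>\<close>, summed over \<open>j \<in> J - {i}\<close>, is at most \<open>d / 8\<close> for all \<open>i\<close> makes the restriction to the
  coordinates in \<open>J\<close> the projection onto a copy of \<open>\<ell>\<^sub>\<infinity>\<^sup>k\<close>.  If all blocks fail, a union bound over the offending
  indices, after decoupling, reduces to the tail of a Gaussian linear form; as there are about \<open>\<surd>d\<close> blocks, this
  gains the exponent \<open>d\<close>.
  If \<open>N \<ge> exp (\<surd>d)\<close>, then \<open>max\<^sub>i \<bar>\<langle>g\<^sub>i, x\<rangle>\<bar>\<close> is at least of order \<open>\<surd>(ln N) \<bar>x\<bar>\<close> on all of \<open>\<real>\<^sup>d\<close> by a net
  argument, and at most of that order on some coordinate block of length \<open>k\<close>, which therefore spans a complemented copy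
  of \<open>\<ell>\<^sub>2\<^sup>k\<close>.  Quotients of \<open>\<ell>\<^sub>1\<^sup>N\<close> follow by duality.
\<close>

section \<open>Gram--Schmidt and orthogonal projections in coordinate spaces\<close>

text \<open>The order sqrt d of k is where two union bounds meet. For a single block the available
  failure bound is only of the form exp (- c sqrt d), too weak for
  \<open>1 - \<epsilon> ^ d\<close>; hence the event that all m disjoint blocks fail at once. For
  sup-norm blocks this costs a choice of m rows and of d signs, \<open>N ^ m * 3 ^ d\<close>,
  against a tail exp (- m^2 / 8192), which is affordable while ln N is at most of order m. For
  Euclidean blocks a row restricted to a block has length of order sqrt (k + ln N), comparable to
  the lower bound sqrt (ln N) once k is at most ln N. With m and k both of order sqrt d the two
  ranges of N cover everything. The constant 32 is the ratio of the two Euclidean bounds.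

  The definitions add two obligations. \<open>grassmann_haar\<close> is a definite description, so
  existence and uniqueness must come before any estimate. And \<open>measure\<close> is 0 on sets
  that are not measurable, so the sets of good subspaces have to be proved measurable: they are
  countable unions of relatively closed sets, by compactness of bounded families of
  matrices.\<close>

lemma sum_fun_apply: "(\<Sum>i\<in>A. f i) x = (\<Sum>i\<in>A. f i x)"
  by (induction A rule: infinite_finite_induct) auto

lemma scaleR_fun_apply: "(r *\<^sub>R f) x = r *\<^sub>R f x"
  by (simp add: scaleR_fun_def)

text \<open>Pointwise evaluation is kept out of the simplifier so that vectors stay atomic in linear
  algebra; \<open>fun_apply\<close> switches it on where coordinates are meant.\<close>

declare plus_fun_apply [simp del] zero_fun_apply [simp del] minus_apply [simp del]

lemmas fun_apply = plus_fun_apply zero_fun_apply minus_apply scaleR_fun_apply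

lemma subspace_rvecs: "subspace (rvecs N)"
  by (auto simp: subspace_def rvecs_def fun_apply)

lemma rvecs_memD: "x \<in> rvecs N \<Longrightarrow> i \<ge> N \<Longrightarrow> x i = 0"
  by (simp add: rvecs_def)

lemma rinner_commute: "rinner N x y = rinner N y x"
  by (simp add: rinner_def mult.commute)

lemma rinner_add_left: "rinner N (x + y) z = rinner N x z + rinner N y z"
  by (simp add: rinner_def fun_apply algebra_simps sum.distrib)

lemma rinner_diff_left: "rinner N (x - y) z = rinner N x z - rinner N y z"
  by (simp add: rinner_def fun_apply algebra_simps sum_subtractf)

lemma rinner_scale_left: "rinner N (a *\<^sub>R x) z = a * rinner N x z"
  by (simp add: rinner_def fun_apply algebra_simps sum_distrib_left)

lemma rinner_zero_left [simp]: "rinner N 0 z = 0"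
  by (simp add: rinner_def fun_apply)

lemma rinner_sum_left: "rinner N (\<Sum>i\<in>A. f i) z = (\<Sum>i\<in>A. rinner N (f i) z)"
  by (induction A rule: infinite_finite_induct) (auto simp: rinner_add_left)

lemma rinner_add_right: "rinner N z (x + y) = rinner N z x + rinner N z y"
  by (metis rinner_add_left rinner_commute)

lemma rinner_diff_right: "rinner N z (x - y) = rinner N z x - rinner N z y"
  by (metis rinner_diff_left rinner_commute)

lemma rinner_scale_right: "rinner N z (a *\<^sub>R x) = a * rinner N z x"
  by (metis rinner_scale_left rinner_commute)

lemma rinner_zero_right [simp]: "rinner N z 0 = 0"
  by (simp add: rinner_def fun_apply)

lemma rinner_sum_right: "rinner N z (\<Sum>i\<in>A. f i) = (\<Sum>i\<in>A. rinner N z (f i))"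
  by (induction A rule: infinite_finite_induct) (auto simp: rinner_add_right)

lemmas rinner_left = rinner_add_left rinner_diff_left rinner_scale_left rinner_sum_left
lemmas rinner_right = rinner_add_right rinner_diff_right rinner_scale_right rinner_sum_right

lemma rinner_self_nonneg: "rinner N x x \<ge> 0"
  by (auto simp: rinner_def intro: sum_nonneg)

lemma rinner_self_eq_0:
  assumes "x \<in> rvecs N" "rinner N x x = 0" shows "x = 0"
proof
  fix i
  have "\<forall>i\<in>{..<N}. x i * x i = 0"
    using assms(2) unfolding rinner_def by (subst (asm) sum_nonneg_eq_0_iff) auto
  thus "x i = 0 i" using rvecs_memD[OF assms(1), of i] by (cases "i < N") (auto simp: fun_apply)
qed

lemma rinner_span_zero:
  assumes "\<And>b. b \<in> B \<Longrightarrow> rinner N x b = 0" "y \<in> span B"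
  shows "rinner N x y = 0"
  using assms(2)
  by (induction rule: span_induct_alt) (auto simp: rinner_right assms(1))

definition uvec :: "nat \<Rightarrow> nat \<Rightarrow> real" where "uvec j = (\<lambda>i. of_bool (i = j))"

lemma rinner_uvec: "j < N \<Longrightarrow> rinner N x (uvec j) = x j"
  by (simp add: rinner_def uvec_def of_bool_def if_distrib sum.delta cong: if_cong)

lemma rinner_uvec_left: "j < N \<Longrightarrow> rinner N (uvec j) x = x j"
  by (simp add: rinner_commute[of _ "uvec j"] rinner_uvec)

lemma uvec_rvecs: "j < N \<Longrightarrow> uvec j \<in> rvecs N"
  by (auto simp: uvec_def rvecs_def)

lemma rvecs_expand:
  assumes "x \<in> rvecs N" shows "x = (\<Sum>j<N. x j *\<^sub>R uvec j)"
proof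
  fix i show "x i = (\<Sum>j<N. x j *\<^sub>R uvec j) i"
    using rvecs_memD[OF assms, of i]
    by (simp add: sum_fun_apply fun_apply uvec_def of_bool_def if_distrib sum.delta cong: if_cong)
qed

section \<open>Orthonormal bases of subspaces\<close>

definition orthonormal :: "nat \<Rightarrow> (nat \<Rightarrow> nat \<Rightarrow> real) \<Rightarrow> nat \<Rightarrow> bool" where
  "orthonormal N e d \<longleftrightarrow> (\<forall>l<d. e l \<in> rvecs N) \<and>
     (\<forall>l<d. \<forall>m<d. rinner N (e l) (e m) = of_bool (l = m))"

definition onb :: "nat \<Rightarrow> (nat \<Rightarrow> nat \<Rightarrow> real) \<Rightarrow> nat \<Rightarrow> (nat \<Rightarrow> real) set \<Rightarrow> bool" where
  "onb N e d E \<longleftrightarrow> orthonormal N e d \<and> span (e ` {..<d}) = E"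

lemma onb_uvec: "onb N uvec N (rvecs N)"
proof -
  have "x \<in> span (uvec ` {..<N})" if "x \<in> rvecs N" for x
  proof -
    have "(\<Sum>j<N. x j *\<^sub>R uvec j) \<in> span (uvec ` {..<N})"
      by (intro span_sum span_scale span_base) auto
    then show ?thesis using rvecs_expand[OF that] by simp
  qed
  moreover have "span (uvec ` {..<N}) \<subseteq> rvecs N"
    by (rule span_minimal) (auto simp: subspace_rvecs uvec_rvecs)
  moreover have "orthonormal N uvec N"
    by (auto simp: orthonormal_def uvec_rvecs rinner_uvec) (auto simp: uvec_def)
  ultimately show ?thesis by (auto simp: onb_def)
qed

lemma onb_subset: "onb N e d E \<Longrightarrow> E \<subseteq> rvecs N"
  unfolding onb_def orthonormal_def by (metis (no_types, lifting) image_subsetI lessThan_iff span_minimal subspace_rvecs)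

lemma onb_subspace: "onb N e d E \<Longrightarrow> subspace E"
  unfolding onb_def by auto

lemma orthonormal_onb: "orthonormal N e d \<Longrightarrow> onb N e d (span (e ` {..<d}))"
  by (simp add: onb_def)

lemma onb_mem: "onb N e d E \<Longrightarrow> l < d \<Longrightarrow> e l \<in> E"
  unfolding onb_def by (auto intro: span_base)

lemma orthonormal_inj: assumes "orthonormal N e d" shows "inj_on e {..<d}"
proof (rule inj_onI)
  fix l m assume *: "l \<in> {..<d}" "m \<in> {..<d}" "e l = e m"
  then have "rinner N (e l) (e m) = of_bool (l = m)" "rinner N (e l) (e l) = of_bool (l = l)"
    using assms unfolding orthonormal_def lessThan_iff by blast+
  then have "of_bool (l = m) = (of_bool (l = l) :: real)" using *(3) by simp
  thus "l = m" by (simp split: if_splits)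
qed

lemma orthonormal_coeff:
  assumes "orthonormal N e d" "l < d"
  shows "rinner N (\<Sum>m<d. a m *\<^sub>R e m) (e l) = a l"
proof -
  have "rinner N (\<Sum>m<d. a m *\<^sub>R e m) (e l) = (\<Sum>m<d. a m * of_bool (m = l))"
    unfolding rinner_left using assms by (intro sum.cong) (auto simp: orthonormal_def)
  thus ?thesis using assms(2) by (simp add: of_bool_def if_distrib sum.delta cong: if_cong)
qed

lemma orthonormal_independent:
  assumes "orthonormal N e d" shows "independent (e ` {..<d})"
proof (rule independent_if_scalars_zero)
  fix f x assume 0: "(\<Sum>x\<in>e ` {..<d}. f x *\<^sub>R x) = 0" and "x \<in> e ` {..<d}"
  then obtain l where l: "l < d" "x = e l" by auto
  have "(\<Sum>m<d. f (e m) *\<^sub>R e m) = 0"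
    using 0 by (subst (asm) sum.reindex[OF orthonormal_inj[OF assms]]) simp
  thus "f x = 0" using orthonormal_coeff[OF assms l(1), of "\<lambda>m. f (e m)"] l by simp
qed auto

lemma onb_dim: "onb N e d E \<Longrightarrow> dim E = d"
  using orthonormal_independent[of N e d] orthonormal_inj[of N e d]
  by (auto simp: onb_def dim_eq_card_independent card_image)

lemma onb_grassmannian: "onb N e d E \<Longrightarrow> E \<in> grassmannian d N"
  using onb_dim onb_subspace onb_subset by (auto simp: grassmannian_def)

section \<open>Orthogonal projections in an orthonormal basis\<close>

definition oproj :: "nat \<Rightarrow> (nat \<Rightarrow> nat \<Rightarrow> real) \<Rightarrow> nat \<Rightarrow> (nat \<Rightarrow> real) \<Rightarrow> (nat \<Rightarrow> real)" where
  "oproj N e d x = (\<Sum>l<d. rinner N x (e l) *\<^sub>R e l)"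

lemma oproj_mem: "onb N e d E \<Longrightarrow> oproj N e d x \<in> E"
  unfolding oproj_def by (metis (no_types, lifting) lessThan_iff onb_mem onb_subspace subspace_scale subspace_sum)

lemma oproj_fix:
  assumes "onb N e d E" "x \<in> E" shows "oproj N e d x = x"
proof -
  have "x \<in> span (e ` {..<d})" using assms by (simp add: onb_def)
  thus ?thesis
  proof (induction rule: span_induct_alt)
    case base show ?case by (simp add: oproj_def)
  next
    case (step c y z)
    then obtain m where m: "m < d" "y = e m" by auto
    have "oproj N e d y = (\<Sum>l<d. (of_bool (l = m) :: real) *\<^sub>R e l)"
      unfolding oproj_def using assms(1) m by (intro sum.cong) (auto simp: onb_def orthonormal_def)
    also have "\<dots> = (\<Sum>l<d. if l = m then e l else 0)" by (intro sum.cong) auto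
    finally have 1: "oproj N e d y = y" using m by simp
    have "oproj N e d (c *\<^sub>R y + z) = c *\<^sub>R oproj N e d y + oproj N e d z"
      unfolding oproj_def rinner_left by (simp add: scaleR_add_left sum.distrib scaleR_sum_right)
    thus ?case using step 1 by simp
  qed
qed

lemma oproj_orth:
  assumes "onb N e d E" "y \<in> E" shows "rinner N (x - oproj N e d x) y = 0"
proof -
  have "y \<in> span (e ` {..<d})" using assms by (simp add: onb_def)
  show ?thesis
  proof (rule rinner_span_zero[OF _ \<open>y \<in> span _\<close>])
    fix b assume "b \<in> e ` {..<d}"
    then obtain m where m: "m < d" "b = e m" by auto
    show "rinner N (x - oproj N e d x) b = 0"
      using orthonormal_coeff[of N e d m "\<lambda>l. rinner N x (e l)"] assms(1) m
      by (simp add: onb_def oproj_def rinner_diff_left)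
  qed
qed

lemma orth_proj_onb:
  assumes "onb N e d E" "x \<in> rvecs N" shows "orth_proj N E x = oproj N e d x"
  unfolding orth_proj_def
proof (rule the_equality)
  show "oproj N e d x \<in> E \<and> x - oproj N e d x \<in> orth_compl N E"
    using oproj_mem[OF assms(1)] oproj_orth[OF assms(1)] onb_subset[OF assms(1)] assms(2)
    by (auto simp: orth_compl_def intro!: subspace_diff[OF subspace_rvecs])
next
  fix y assume y: "y \<in> E \<and> x - y \<in> orth_compl N E"
  let ?w = "oproj N e d x - y"
  have w: "?w \<in> E" using y oproj_mem[OF assms(1)] onb_subspace[OF assms(1)] subspace_diff by blast
  have "rinner N ?w ?w = rinner N (x - y) ?w - rinner N (x - oproj N e d x) ?w"
    by (simp add: rinner_left)
  also have "\<dots> = 0" using y w oproj_orth[OF assms(1) w] by (simp add: orth_compl_def)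
  finally have "?w = 0" using rinner_self_eq_0 w onb_subset[OF assms(1)] by blast
  thus "y = oproj N e d x" by simp
qed

text \<open>Any orthonormal basis of \<open>E\<close> gives the same matrix. Both the measurability
  of the column span and the action of orthogonal maps on projection matrices are read off from this
  polynomial expression.\<close>

lemma proj_matrix_onb:
  assumes "onb N e d E" shows "proj_matrix N E i j = (\<Sum>l<d. e l i * e l j)"
proof (cases "i < N \<and> j < N")
  case True
  then have "proj_matrix N E i j = oproj N e d (uvec j) i"
    using orth_proj_onb[OF assms uvec_rvecs[of j N]] by (simp add: proj_matrix_def uvec_def)
  thus ?thesis using True
    by (simp add: oproj_def sum_fun_apply fun_apply rinner_uvec_left mult.commute)
next
  case False
  have "e l i * e l j = 0" if "l < d" for l
    using False that rvecs_memD[of "e l" N] assms unfolding onb_def orthonormal_def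
    by (metis linorder_not_less mult_eq_0_iff)
  then have "(\<Sum>l<d. e l i * e l j) = 0" by (intro sum.neutral) auto
  thus ?thesis using False unfolding proj_matrix_def by (metis (full_types))
qed

text \<open>
  Linear independence is not required: a vanishing vector of the process contributes nothing to the later ones,
  as division by \<open>0\<close> yields \<open>0\<close>.
\<close>

fun gs :: "nat \<Rightarrow> (nat \<Rightarrow> nat \<Rightarrow> real) \<Rightarrow> nat \<Rightarrow> nat \<Rightarrow> real" where
  "gs N c l = c l - (\<Sum>m<l. (rinner N (c l) (gs N c m) / rinner N (gs N c m) (gs N c m)) *\<^sub>R gs N c m)"

declare gs.simps [simp del]

lemma gs_rvecs: "(\<And>m. m \<le> l \<Longrightarrow> c m \<in> rvecs N) \<Longrightarrow> gs N c l \<in> rvecs N"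
proof (induction l rule: less_induct)
  case (less l)
  then have "gs N c m \<in> rvecs N" if "m < l" for m using that by auto
  then have "(\<Sum>m<l. (rinner N (c l) (gs N c m) / rinner N (gs N c m) (gs N c m)) *\<^sub>R gs N c m) \<in> rvecs N"
    by (auto intro!: subspace_sum subspace_scale subspace_rvecs)
  then show ?case using less.prems[of l] subspace_diff[OF subspace_rvecs]
    by (subst gs.simps) auto
qed

lemma gs_orth:
  assumes "\<And>m. m < n \<Longrightarrow> c m \<in> rvecs N"
  shows "l < n \<Longrightarrow> m < l \<Longrightarrow> rinner N (gs N c l) (gs N c m) = 0"
proof (induction l arbitrary: m rule: less_induct)
  case (less l)
  have "(\<Sum>k<l. rinner N (c l) (gs N c k) / rinner N (gs N c k) (gs N c k) * rinner N (gs N c k) (gs N c m))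
     = (\<Sum>k<l. if k = m then rinner N (c l) (gs N c m) else 0)"
  proof (intro sum.cong refl)
    fix k assume k: "k \<in> {..<l}"
    show "rinner N (c l) (gs N c k) / rinner N (gs N c k) (gs N c k) * rinner N (gs N c k) (gs N c m)
      = (if k = m then rinner N (c l) (gs N c m) else 0)"
    proof (cases "k = m")
      case True
      show ?thesis
      proof (cases "rinner N (gs N c m) (gs N c m) = 0")
        case t: True
        have "gs N c m \<in> rvecs N" using less.prems assms by (intro gs_rvecs) auto
        then have "gs N c m = 0" using rinner_self_eq_0 t by blast
        then show ?thesis using True by simp
      qed (use True in auto)
    next
      case False
      have "rinner N (gs N c k) (gs N c m) = 0"
      proof (cases "m < k")
        case True
        then show ?thesis using less.IH[of k m] k less.prems by auto
      next
        case f: False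
        then show ?thesis using less.IH[of m k] k less.prems False rinner_commute[of N] by auto
      qed
      then show ?thesis using False by simp
    qed
  qed
  then show ?case using less.prems
    by (subst gs.simps) (simp add: rinner_left)
qed

lemma span_insert_diff:
  fixes a b :: "'a::real_vector"
  assumes "a - b \<in> span S" shows "span (insert a S) = span (insert b S)"
proof -
  have 1: "a \<in> span (insert b S)" using assms
    by (metis diff_add_cancel insertI1 span_add span_base span_mono subsetD subset_insertI)
  have "b - a \<in> span S" using assms by (metis minus_diff_eq span_neg)
  then have 2: "b \<in> span (insert a S)"
    by (metis diff_add_cancel insertI1 span_add span_base span_mono subsetD subset_insertI)
  show ?thesis using 1 2 
    by (auto simp: span_eq intro: span_base)
qed

lemma gs_span: "span (gs N c ` {..<n}) = span (c ` {..<n})"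
proof (induction n)
  case (Suc n)
  have "c n - gs N c n \<in> span (gs N c ` {..<n})"
    by (subst gs.simps) (simp, intro span_sum span_scale span_base imageI)
  then have "gs N c n - c n \<in> span (gs N c ` {..<n})"
    by (metis minus_diff_eq span_neg)
  then have "span (insert (gs N c n) (gs N c ` {..<n})) = span (insert (c n) (gs N c ` {..<n}))"
    by (rule span_insert_diff)
  also have "\<dots> = span (insert (c n) (c ` {..<n}))"
    using Suc by (simp add: span_insert)
  finally show ?case by (simp add: lessThan_Suc)
qed simp

definition gse :: "nat \<Rightarrow> (nat \<Rightarrow> nat \<Rightarrow> real) \<Rightarrow> nat \<Rightarrow> nat \<Rightarrow> real" where
  "gse N c l = (1 / sqrt (rinner N (gs N c l) (gs N c l))) *\<^sub>R gs N c l"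

lemma gse_onb:
  assumes c: "\<And>m. m < n \<Longrightarrow> c m \<in> rvecs N" and nz: "\<And>l. l < n \<Longrightarrow> gs N c l \<noteq> 0"
  shows "onb N (gse N c) n (span (c ` {..<n}))"
proof -
  have r: "gs N c l \<in> rvecs N" if "l < n" for l using that c by (intro gs_rvecs) auto
  have pos: "rinner N (gs N c l) (gs N c l) > 0" if "l < n" for l
    using rinner_self_eq_0[OF r[OF that]] nz[OF that] rinner_self_nonneg[of N "gs N c l"] by fastforce
  have "rinner N (gse N c l) (gse N c m) = of_bool (l = m)" if "l < n" "m < n" for l m
  proof (cases "l = m")
    case True
    then show ?thesis using pos[OF that(1)]
      by (simp add: gse_def rinner_left rinner_right flip: power2_eq_square)
  next
    case False
    have "rinner N (gs N c l) (gs N c m) = 0"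
    proof (cases "m < l")
      case True then show ?thesis using gs_orth[OF c that(1)] by auto
    next
      case f: False
      then show ?thesis using gs_orth[OF c that(2)] False rinner_commute[of N] by auto
    qed
    then show ?thesis using False by (simp add: gse_def rinner_left rinner_right)
  qed
  moreover have "gse N c l \<in> rvecs N" if "l < n" for l
    using r[OF that] unfolding gse_def by (intro subspace_scale subspace_rvecs)
  ultimately have on: "orthonormal N (gse N c) n" by (auto simp: orthonormal_def)
  have "span (gse N c ` {..<n}) = span (gs N c ` {..<n})"
  proof (rule span_unique)
    show "gse N c ` {..<n} \<subseteq> span (gs N c ` {..<n})"
    proof (rule image_subsetI)
      fix l assume "l \<in> {..<n}"
      then have "gs N c l \<in> span (gs N c ` {..<n})" by (intro span_base imageI)
      then show "gse N c l \<in> span (gs N c ` {..<n})" unfolding gse_def by (rule span_scale)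
    qed
    fix V assume V: "gse N c ` {..<n} \<subseteq> V" "subspace V"
    have "gs N c l \<in> V" if "l < n" for l
    proof -
      have "gs N c l = sqrt (rinner N (gs N c l) (gs N c l)) *\<^sub>R gse N c l"
        using pos[OF that] by (simp add: gse_def)
      also have "\<dots> \<in> V" using V that by (intro subspace_scale) auto
      finally show ?thesis .
    qed
    then show "span (gs N c ` {..<n}) \<subseteq> V" using V(2) by (intro span_minimal) auto
  qed auto
  then show ?thesis using on gs_span[of N c n] by (simp add: onb_def)
qed

text \<open>A vanishing vector could be left out, and then \<open>n - 1\<close> vectors would span a
  space of dimension \<open>n\<close>.\<close>

lemma gs_nonzero:
  assumes "dim (span (c ` {..<n})) = n" "l < n" shows "gs N c l \<noteq> 0"
proof
  assume 0: "gs N c l = 0"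
  have "gs N c ` {..<n} \<subseteq> insert 0 (gs N c ` ({..<n} - {l}))" using 0 by auto
  then have "span (gs N c ` {..<n}) \<subseteq> span (gs N c ` ({..<n} - {l}))"
    by (metis span_insert_0 span_mono)
  then have "dim (span (gs N c ` {..<n})) \<le> card (gs N c ` ({..<n} - {l}))"
    by (intro dim_le_card) auto
  also have "\<dots> \<le> card ({..<n} - {l})" by (rule card_image_le) auto
  also have "\<dots> < n" using assms(2) by simp
  finally show False using assms(1) gs_span[of N c n] by simp
qed

section \<open>Bases of the whole space adapted to a subspace\<close>

lemma dim_rvecs: "dim (rvecs N) = N"
  using onb_dim[OF onb_uvec] .

lemma independent_rvecs_finite:
  assumes "independent B" "B \<subseteq> rvecs N" shows "finite B \<and> card B \<le> N"
proof -
  have "rvecs N = span (uvec ` {..<N})" using onb_uvec by (simp add: onb_def)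
  then have "finite B \<and> card B \<le> card (uvec ` {..<N})"
    using assms by (intro independent_span_bound) auto
  then show ?thesis using card_image_le[of "{..<N}" uvec] by simp
qed

text \<open>The process is run on a basis of \<open>rvecs N\<close> whose first \<open>dim E\<close>
  members form a basis of \<open>E\<close>. Its l-th output depends only on the inputs up to l, so a
  single run serves both spaces.\<close>

lemma onb_extension:
  assumes E: "subspace E" "E \<subseteq> rvecs N"
  shows "\<exists>e. onb N e (dim E) E \<and> onb N e N (rvecs N)"
proof -
  obtain B0 where B0: "B0 \<subseteq> E" "independent B0" "E \<subseteq> span B0" "card B0 = dim E"
    using basis_exists by metis
  have spB0: "span B0 = E" using B0 E by (simp add: subset_antisym span_minimal)
  obtain B where B: "B0 \<subseteq> B" "B \<subseteq> rvecs N" "independent B" "rvecs N \<subseteq> span B"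
    using maximal_independent_subset_extend[of B0 "rvecs N"] B0 E(2) by (metis order_trans)
  have fB: "finite B" using independent_rvecs_finite[OF B(3,2)] by simp
  have spB: "span B = rvecs N" using B by (simp add: subset_antisym span_minimal subspace_rvecs)
  have cB: "card B = N" using dim_eq_card_independent[OF B(3)] spB dim_rvecs by (metis dim_span)
  let ?d = "dim E"
  have fB0: "finite B0" using fB B(1) finite_subset by blast
  obtain c0 where c0: "bij_betw c0 {0..<?d} B0" using ex_bij_betw_nat_finite[OF fB0] B0(4) by auto
  have "card (B - B0) = N - ?d" using card_Diff_subset[OF fB0 B(1)] cB B0(4) by simp
  then obtain c1 where c1: "bij_betw c1 {0..<N - ?d} (B - B0)"
    using ex_bij_betw_nat_finite[of "B - B0"] fB by auto
  have dN: "?d \<le> N" using card_mono[OF fB B(1)] cB B0(4) by simp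
  define c where "c l = (if l < ?d then c0 l else c1 (l - ?d))" for l
  have i1: "c ` {..<?d} = B0" using c0 by (auto simp: c_def bij_betw_def)
  have "c ` {?d..<N} = c1 ` {0..<N - ?d}"
  proof -
    have "{?d..<N} = (\<lambda>l. l + ?d) ` {0..<N - ?d}" using dN by (auto simp: image_add_atLeastLessThan)
    then have "c ` {?d..<N} = c ` (\<lambda>l. l + ?d) ` {0..<N - ?d}" by (rule arg_cong)
    also have "\<dots> = (\<lambda>l. c (l + ?d)) ` {0..<N - ?d}" by (simp only: image_image)
    also have "\<dots> = c1 ` {0..<N - ?d}" by (intro image_cong) (auto simp: c_def)
    finally show ?thesis .
  qed
  then have i2: "c ` {?d..<N} = B - B0" using c1 by (simp add: bij_betw_def)
  have "{..<N} = {..<?d} \<union> {?d..<N}" using dN by auto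
  then have i3: "c ` {..<N} = B" using i1 i2 B(1) by (simp add: image_Un Un_absorb1)
  have r: "c m \<in> rvecs N" if "m < N" for m using i3 B(2) that by auto
  have nz: "gs N c l \<noteq> 0" if "l < N" for l
    using that i3 spB dim_rvecs by (intro gs_nonzero[of c N]) auto
  have "onb N (gse N c) N (rvecs N)" using gse_onb[of N c N] r nz i3 spB by auto
  moreover have "onb N (gse N c) ?d E" using gse_onb[of ?d c N] r nz dN i1 spB0 by auto
  ultimately show ?thesis by blast
qed

section \<open>The orthogonal group acting on the Grassmannian\<close>

lemma grassmannian_onb_ext:
  assumes "E \<in> grassmannian d N"
  shows "\<exists>e. onb N e d E \<and> onb N e N (rvecs N)"
  using onb_extension[of E N] assms by (auto simp: grassmannian_def)

lemma grassmannian_onb: "E \<in> grassmannian d N \<Longrightarrow> \<exists>e. onb N e d E"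
  using grassmannian_onb_ext by blast

lemma grassmannian_le: assumes "E \<in> grassmannian d N" shows "d \<le> N"
proof -
  obtain e where e: "onb N e d E" using grassmannian_onb[OF assms] by blast
  then have "independent (e ` {..<d})" "card (e ` {..<d}) = d" "e ` {..<d} \<subseteq> rvecs N"
    using orthonormal_independent[of N e d] card_image[OF orthonormal_inj[of N e d]]
    by (auto simp: onb_def orthonormal_def)
  then show ?thesis using independent_rvecs_finite by force
qed

lemma grassmannian_nonempty: assumes "d \<le> N" shows "span (uvec ` {..<d}) \<in> grassmannian d N"
proof -
  have "orthonormal N uvec d" using onb_uvec[of N] assms by (auto simp: onb_def orthonormal_def)
  then show ?thesis by (intro onb_grassmannian[of N uvec] orthonormal_onb)
qed

section \<open>The action of orthogonal maps on subspaces\<close>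

lemma orthogonal_mapD:
  assumes "orthogonal_map N U"
  shows "linear U" "U ` rvecs N = rvecs N" "x \<in> rvecs N \<Longrightarrow> U x \<in> rvecs N"
    "x \<in> rvecs N \<Longrightarrow> y \<in> rvecs N \<Longrightarrow> rinner N (U x) (U y) = rinner N x y"
  using assms by (auto simp: orthogonal_map_def)

lemma onb_orthogonal_map:
  assumes "orthogonal_map N U" "onb N e d E"
  shows "onb N (U \<circ> e) d (U ` E)"
proof -
  have "span ((U \<circ> e) ` {..<d}) = U ` E"
    using linear_span_image[OF orthogonal_mapD(1)[OF assms(1)], of "e ` {..<d}"] assms(2)
    by (simp add: onb_def image_comp)
  then show ?thesis using assms orthogonal_mapD[OF assms(1)] by (auto simp: onb_def orthonormal_def)
qed

lemma grassmannian_orthogonal_map: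
  "orthogonal_map N U \<Longrightarrow> E \<in> grassmannian d N \<Longrightarrow> U ` E \<in> grassmannian d N"
  using onb_orthogonal_map grassmannian_onb onb_grassmannian by blast

text \<open>The Hilbert-Schmidt inner product of two projections involves only inner products of
  basis vectors, which orthogonal maps preserve. This is why \<open>gdist\<close> is
  invariant.\<close>

lemma proj_matrix_inner:
  assumes "onb N e d E" "onb N f d' F"
  shows "(\<Sum>i<N. \<Sum>j<N. proj_matrix N E i j * proj_matrix N F i j) =
    (\<Sum>l<d. \<Sum>m<d'. (rinner N (e l) (f m))\<^sup>2)"
proof -
  have "(\<Sum>i<N. \<Sum>j<N. proj_matrix N E i j * proj_matrix N F i j)
     = (\<Sum>i<N. \<Sum>j<N. \<Sum>l<d. \<Sum>m<d'. (e l i * f m i) * (e l j * f m j))"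
    unfolding proj_matrix_onb[OF assms(1)] proj_matrix_onb[OF assms(2)]
    by (simp add: sum_product algebra_simps)
  also have "\<dots> = (\<Sum>i<N. \<Sum>l<d. \<Sum>j<N. \<Sum>m<d'. (e l i * f m i) * (e l j * f m j))"
    by (intro sum.cong refl sum.swap)
  also have "\<dots> = (\<Sum>l<d. \<Sum>i<N. \<Sum>j<N. \<Sum>m<d'. (e l i * f m i) * (e l j * f m j))"
    by (rule sum.swap)
  also have "\<dots> = (\<Sum>l<d. \<Sum>i<N. \<Sum>m<d'. \<Sum>j<N. (e l i * f m i) * (e l j * f m j))"
    by (intro sum.cong refl sum.swap)
  also have "\<dots> = (\<Sum>l<d. \<Sum>m<d'. \<Sum>i<N. \<Sum>j<N. (e l i * f m i) * (e l j * f m j))"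
    by (intro sum.cong refl sum.swap)
  also have "\<dots> = (\<Sum>l<d. \<Sum>m<d'. (rinner N (e l) (f m))\<^sup>2)"
    by (simp add: rinner_def power2_eq_square sum_product)
  finally show ?thesis .
qed

text \<open>The square of the Hilbert-Schmidt distance of the two projections; being polynomial in
  the matrix entries, it is measurable at sight.\<close>

definition gdist :: "nat \<Rightarrow> (nat \<Rightarrow> real) set \<Rightarrow> (nat \<Rightarrow> real) set \<Rightarrow> real" where
  "gdist N E F = (\<Sum>i<N. \<Sum>j<N. (proj_matrix N E i j - proj_matrix N F i j)\<^sup>2)"

lemma gdist_commute: "gdist N E F = gdist N F E"
  by (simp add: gdist_def power2_commute)

lemma gdist_orthogonal_map:
  assumes U: "orthogonal_map N U" and "E \<in> grassmannian d N" "F \<in> grassmannian d N"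
  shows "gdist N (U ` E) (U ` F) = gdist N E F"
proof -
  obtain e f where e: "onb N e d E" and f: "onb N f d F" using grassmannian_onb assms by metis
  define K where "K E F = (\<Sum>i<N. \<Sum>j<N. proj_matrix N E i j * proj_matrix N F i j)" for E F
  have g: "gdist N E F = K E E - 2 * K E F + K F F" for E F
    by (simp add: gdist_def K_def power2_diff sum.distrib sum_subtractf sum_distrib_left
        power2_eq_square algebra_simps)
  have K: "K (U ` E) (U ` F) = K E F" if e: "onb N e d E" and f: "onb N f d F" for E F e f
  proof -
    have er: "e l \<in> rvecs N" if "l < d" for l using e that by (auto simp: onb_def orthonormal_def)
    have fr: "f l \<in> rvecs N" if "l < d" for l using f that by (auto simp: onb_def orthonormal_def)
    show ?thesis
    unfolding K_def proj_matrix_inner[OF e f]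
      proj_matrix_inner[OF onb_orthogonal_map[OF U e] onb_orthogonal_map[OF U f]]
    using orthogonal_mapD(4)[OF U er fr] by simp
  qed
  show ?thesis unfolding g using K[OF e f] K[OF e e] K[OF f f] by simp
qed

lemma sum_rinner_scale_linear: "linear (\<lambda>x. \<Sum>l<n. rinner N x (e l) *\<^sub>R f l)"
  by (rule linearI)
    (simp_all add: rinner_left scaleR_add_left sum.distrib scaleR_sum_right)

lemma linear_eq_on_rvecs:
  assumes "linear f" "linear g" "onb N e N (rvecs N)" "\<And>l. l < N \<Longrightarrow> f (e l) = g (e l)" "x \<in> rvecs N"
  shows "f x = g x"
  using assms by (intro linear_eq_on[of f g x "e ` {..<N}"]) (auto simp: onb_def)

lemma orthogonal_map_of_onb:
  assumes e: "onb N e N (rvecs N)" and f: "onb N f N (rvecs N)"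
  defines "U \<equiv> \<lambda>x. \<Sum>l<N. rinner N x (e l) *\<^sub>R f l"
  shows "orthogonal_map N U" "l < N \<Longrightarrow> U (e l) = f l"
proof -
  have lin: "linear U" unfolding U_def by (rule sum_rinner_scale_linear)
  have Ue: "U (e l) = f l" if "l < N" for l
  proof -
    have "U (e l) = (\<Sum>m<N. if m = l then f m else 0)"
      unfolding U_def using e that by (intro sum.cong) (auto simp: onb_def orthonormal_def)
    then show ?thesis using that by simp
  qed
  show "U (e l) = f l" if "l < N" using Ue that .
  have "U ` rvecs N = span (U ` e ` {..<N})"
    using linear_span_image[OF lin, of "e ` {..<N}"] e by (simp add: onb_def)
  also have "U ` e ` {..<N} = f ` {..<N}" using Ue by (auto simp: image_image)
  finally have im: "U ` rvecs N = rvecs N" using f by (simp add: onb_def)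
  have ip: "rinner N (U x) (U y) = rinner N x y" if "x \<in> rvecs N" "y \<in> rvecs N" for x y
  proof -
    have "rinner N (U x) (U y) = (\<Sum>l<N. rinner N y (e l) * rinner N (U x) (f l))"
      by (subst U_def) (simp add: rinner_right)
    also have "\<dots> = (\<Sum>l<N. rinner N y (e l) * rinner N x (e l))"
    proof (intro sum.cong refl)
      fix l assume "l \<in> {..<N}"
      then have "rinner N (U x) (f l) = rinner N x (e l)"
        unfolding U_def using orthonormal_coeff[of N f N l] f by (simp add: onb_def)
      then show "rinner N y (e l) * rinner N (U x) (f l) = rinner N y (e l) * rinner N x (e l)" by simp
    qed
    also have "\<dots> = rinner N x (oproj N e N y)"
      by (simp add: oproj_def rinner_right)
    finally show ?thesis using oproj_fix[OF e that(2)] by simp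
  qed
  show "orthogonal_map N U" unfolding orthogonal_map_def using lin im ip by auto
qed

text \<open>Orthonormal bases of \<open>E\<close> and \<open>F\<close> are extended to the whole
  space, and the first extended basis is mapped to the second.\<close>

lemma grassmannian_transitive:
  assumes "E \<in> grassmannian d N" "F \<in> grassmannian d N"
  shows "\<exists>U. orthogonal_map N U \<and> U ` E = F"
proof -
  obtain e f where e: "onb N e d E" "onb N e N (rvecs N)" and f: "onb N f d F" "onb N f N (rvecs N)"
    using grassmannian_onb_ext assms by metis
  have dN: "d \<le> N" using grassmannian_le[OF assms(1)] .
  let ?U = "\<lambda>x. \<Sum>l<N. rinner N x (e l) *\<^sub>R f l"
  note U = orthogonal_map_of_onb[OF e(2) f(2)]
  have "?U ` E = span (?U ` e ` {..<d})"
    using linear_span_image[OF orthogonal_mapD(1)[OF U(1)], of "e ` {..<d}"] e by (simp add: onb_def)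
  also have "?U ` e ` {..<d} = f ` {..<d}" 
    unfolding image_image using U(2) dN by (intro image_cong) auto
  finally have "?U ` E = F" using f by (simp add: onb_def)
  then show ?thesis using U(1) by blast
qed

text \<open>Only an inverse on \<open>rvecs N\<close> can be expected: outside this space an
  orthogonal map is constrained by linearity alone.\<close>

lemma orthogonal_map_inverse:
  assumes U: "orthogonal_map N U"
  shows "\<exists>V. orthogonal_map N V \<and> (\<forall>x\<in>rvecs N. V (U x) = x \<and> U (V x) = x)"
proof -
  have f: "onb N (U \<circ> uvec) N (rvecs N)"
    using onb_orthogonal_map[OF U onb_uvec] orthogonal_mapD(2)[OF U] by simp
  let ?V = "\<lambda>x. \<Sum>l<N. rinner N x ((U \<circ> uvec) l) *\<^sub>R uvec l"
  note V = orthogonal_map_of_onb[OF f onb_uvec]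
  have 1: "?V (U x) = x" if "x \<in> rvecs N" for x
  proof -
    have "(?V \<circ> U) x = (\<lambda>x. x) x"
    proof (rule linear_eq_on_rvecs[OF _ _ onb_uvec _ that])
      show "linear (?V \<circ> U)" using orthogonal_mapD(1)[OF U] orthogonal_mapD(1)[OF V(1)] linear_compose by blast
      show "linear (\<lambda>x::nat \<Rightarrow> real. x)" by (simp add: linear_iff)
      show "(?V \<circ> U) (uvec l) = uvec l" if "l < N" for l using V(2)[OF that] by simp
    qed
    then show ?thesis by simp
  qed
  have 2: "U (?V x) = x" if "x \<in> rvecs N" for x
  proof -
    have "x \<in> U ` rvecs N" using orthogonal_mapD(2)[OF U] that by simp
    then obtain y where "y \<in> rvecs N" "x = U y" by blast
    then show ?thesis using 1 by simp
  qed
  show ?thesis using V(1) 1 2 by blast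
qed

lemma linear_rvecs_expand:
  assumes "linear U" "x \<in> rvecs N"
  shows "U x i = (\<Sum>a<N. x a * U (uvec a) i)"
proof -
  have "U x = U (\<Sum>j<N. x j *\<^sub>R uvec j)" using rvecs_expand[OF assms(2)] by simp
  also have "\<dots> = (\<Sum>j<N. x j *\<^sub>R U (uvec j))"
    using assms(1) by (simp add: linear_sum linear_scale)
  finally show ?thesis by (simp add: sum_fun_apply fun_apply)
qed

text \<open>This is the conjugation of the projection matrix by the matrix of \<open>U\<close>. It
  is linear in the entries for \<open>E\<close>, hence measurable in \<open>E\<close>.\<close>

lemma proj_matrix_orthogonal_map:
  assumes U: "orthogonal_map N U" and E: "E \<in> grassmannian d N"
  shows "proj_matrix N (U ` E) i j =
    (\<Sum>a<N. \<Sum>b<N. U (uvec a) i * U (uvec b) j * proj_matrix N E a b)"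
proof -
  obtain e where e: "onb N e d E" using grassmannian_onb[OF E] by blast
  have er: "e l \<in> rvecs N" if "l < d" for l using e that by (auto simp: onb_def orthonormal_def)
  have "proj_matrix N (U ` E) i j = (\<Sum>l<d. U (e l) i * U (e l) j)"
    using proj_matrix_onb[OF onb_orthogonal_map[OF U e]] by simp
  also have "\<dots> = (\<Sum>l<d. \<Sum>a<N. \<Sum>b<N. (U (uvec a) i * U (uvec b) j) * (e l a * e l b))"
    using linear_rvecs_expand[OF orthogonal_mapD(1)[OF U] er]
    by (intro sum.cong refl) (simp add: sum_product algebra_simps)
  also have "\<dots> = (\<Sum>a<N. \<Sum>l<d. \<Sum>b<N. (U (uvec a) i * U (uvec b) j) * (e l a * e l b))"
    by (rule sum.swap)
  also have "\<dots> = (\<Sum>a<N. \<Sum>b<N. \<Sum>l<d. (U (uvec a) i * U (uvec b) j) * (e l a * e l b))"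
    by (intro sum.cong refl sum.swap)
  finally show ?thesis
    unfolding proj_matrix_onb[OF e] by (simp add: sum_distrib_left)
qed

lemma orthogonal_map_image_inj:
  assumes U: "orthogonal_map N U" "E \<in> grassmannian d N" "F \<in> grassmannian d' N" "U ` E = U ` F"
  shows "E = F"
proof -
  obtain V where V: "\<forall>x\<in>rvecs N. V (U x) = x" using orthogonal_map_inverse[OF U(1)] by blast
  have "inj_on U (rvecs N)" using V by (metis inj_onI)
  then show ?thesis using assms by (metis (no_types, lifting) grassmannian_def inj_on_image_eq_iff mem_Collect_eq)
qed

section \<open>Gaussian product measures and their rotation invariance\<close>

abbreviation lebI :: "'i set \<Rightarrow> ('i \<Rightarrow> real) measure" where
  "lebI I \<equiv> PiM I (\<lambda>_. lborel)"

interpretation lebI: product_sigma_finite "\<lambda>_::'i. lborel :: real measure"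
  by standard

lemma space_lebI: "space (lebI I) = PiE I (\<lambda>_. UNIV)"
  by (simp add: space_PiM)

text \<open>The case s = 1 is translation and s = -1 is reflection in a point; both substitutions
  occur in the proof of rotation invariance.\<close>

lemma distr_lebI_affine:
  assumes I: "finite I" and s: "\<bar>s\<bar> = (1::real)"
  shows "distr (lebI I) (lebI I) (\<lambda>x. \<lambda>i\<in>I. a i + s * x i) = lebI I"
proof (rule lebI.PiM_eqI[OF I])
  fix A :: "'a \<Rightarrow> real set" assume A: "\<And>i. i \<in> I \<Longrightarrow> A i \<in> sets lborel"
  have [measurable]: "(\<lambda>x. \<lambda>i\<in>I. a i + s * x i) \<in> measurable (lebI I) (lebI I)" by measurable
  have m: "emeasure lborel ((\<lambda>t. a i + s * t) -` A i) = emeasure lborel (A i)" if "i \<in> I" for i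
  proof -
    have s0: "s \<noteq> 0" using s by auto
    have "lborel = density (distr lborel borel (\<lambda>x. a i + s * x)) (\<lambda>_. ennreal 1)"
      using lborel_real_affine[OF s0, of "a i"] s by simp
    then have "emeasure lborel (A i) = emeasure (distr lborel borel (\<lambda>x. a i + s * x)) (A i)"
      by (simp add: density_1)
    then show ?thesis using A[OF that] by (simp add: emeasure_distr)
  qed
  have mm: "(\<lambda>t. a i + s * t) -` A i \<in> sets lborel" if "i \<in> I" for i
    using measurable_sets[of "\<lambda>t. a i + s * t" lborel borel "A i"] A[OF that] by simp
  have eq: "(\<lambda>x. \<lambda>i\<in>I. a i + s * x i) -` (Pi\<^sub>E I A) \<inter> space (lebI I) = (\<Pi>\<^sub>E i\<in>I. (\<lambda>t. a i + s * t) -` A i)"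
    by (auto simp: space_lebI PiE_iff)
  show "emeasure (distr (lebI I) (lebI I) (\<lambda>x. \<lambda>i\<in>I. a i + s * x i)) (Pi\<^sub>E I A) = (\<Prod>i\<in>I. emeasure lborel (A i))"
    using A mm m I by (simp add: emeasure_distr sets_PiM_I_finite eq lebI.emeasure_PiM)
qed simp

lemma nn_integral_lebI_affine:
  assumes "finite I" "\<bar>s\<bar> = (1::real)" "f \<in> borel_measurable (lebI I)"
  shows "(\<integral>\<^sup>+x. f (\<lambda>i\<in>I. a i + s * x i) \<partial>lebI I) = (\<integral>\<^sup>+x. f x \<partial>lebI I)"
proof -
  have m: "(\<lambda>x. \<lambda>i\<in>I. a i + s * x i) \<in> measurable (lebI I) (lebI I)" by measurable
  have "(\<integral>\<^sup>+x. f x \<partial>lebI I) = (\<integral>\<^sup>+x. f x \<partial>distr (lebI I) (lebI I) (\<lambda>x. \<lambda>i\<in>I. a i + s * x i))"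
    using distr_lebI_affine[OF assms(1,2), of a] by simp
  also have "\<dots> = (\<integral>\<^sup>+x. f (\<lambda>i\<in>I. a i + s * x i) \<partial>lebI I)"
    using nn_integral_distr[OF m, of f] assms(3) by simp
  finally show ?thesis by simp
qed

definition lmul :: "'i set \<Rightarrow> ('i \<Rightarrow> 'i \<Rightarrow> real) \<Rightarrow> ('i \<Rightarrow> real) \<Rightarrow> 'i \<Rightarrow> real" where
  "lmul I M x = (\<lambda>p\<in>I. \<Sum>q\<in>I. M p q * x q)"

text \<open>Both relations are recorded: the one for the rows makes the transpose a right inverse
  (\<open>lmul_transpose\<close>), the one for the columns makes the map an isometry
  (\<open>lmul_norm\<close>).\<close>

definition orth_matrix :: "'i set \<Rightarrow> ('i \<Rightarrow> 'i \<Rightarrow> real) \<Rightarrow> bool" where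
  "orth_matrix I M \<longleftrightarrow> (\<forall>p\<in>I. \<forall>q\<in>I. (\<Sum>r\<in>I. M p r * M q r) = of_bool (p = q) \<and>
     (\<Sum>r\<in>I. M r p * M r q) = of_bool (p = q))"

lemma sum_of_bool_mult:
  "finite I \<Longrightarrow> p \<in> I \<Longrightarrow> (\<Sum>q\<in>I. of_bool (p = q) * f q) = (f p :: real)"
  by (simp add: of_bool_def if_distrib[of "\<lambda>x. x * _"] sum.delta' cong: if_cong)

lemma lmul_transpose:
  assumes I: "finite I" and M: "orth_matrix I M" and x: "x \<in> PiE I (\<lambda>_. UNIV)"
  shows "lmul I M (lmul I (\<lambda>p q. M q p) x) = x"
proof
  fix p
  show "lmul I M (lmul I (\<lambda>p q. M q p) x) p = x p"
  proof (cases "p \<in> I")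
    case True
    have "lmul I M (lmul I (\<lambda>p q. M q p) x) p = (\<Sum>q\<in>I. \<Sum>r\<in>I. M p q * M r q * x r)"
      using True by (simp add: lmul_def sum_distrib_left mult.assoc)
    also have "\<dots> = (\<Sum>r\<in>I. \<Sum>q\<in>I. M p q * M r q * x r)" by (rule sum.swap)
    also have "\<dots> = (\<Sum>r\<in>I. of_bool (p = r) * x r)"
      using M True by (intro sum.cong refl) (simp add: orth_matrix_def flip: sum_distrib_right)
    finally show ?thesis using sum_of_bool_mult[OF I True] by simp
  next
    case False
    then show ?thesis using x by (auto simp: lmul_def PiE_def extensional_def)
  qed
qed

lemma lmul_norm:
  assumes I: "finite I" and M: "orth_matrix I M"
  shows "(\<Sum>p\<in>I. (lmul I M x p)\<^sup>2) = (\<Sum>p\<in>I. (x p)\<^sup>2)"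
proof -
  have "(\<Sum>p\<in>I. (lmul I M x p)\<^sup>2) = (\<Sum>p\<in>I. \<Sum>q\<in>I. \<Sum>r\<in>I. (M p q * M p r) * (x q * x r))"
    by (simp add: lmul_def power2_eq_square sum_product algebra_simps)
  also have "\<dots> = (\<Sum>q\<in>I. \<Sum>p\<in>I. \<Sum>r\<in>I. (M p q * M p r) * (x q * x r))" by (rule sum.swap)
  also have "\<dots> = (\<Sum>q\<in>I. \<Sum>r\<in>I. \<Sum>p\<in>I. (M p q * M p r) * (x q * x r))"
    by (intro sum.cong refl sum.swap)
  also have "\<dots> = (\<Sum>q\<in>I. \<Sum>r\<in>I. of_bool (q = r) * (x q * x r))"
    using M by (intro sum.cong refl) (simp add: orth_matrix_def flip: sum_distrib_right)
  also have "\<dots> = (\<Sum>q\<in>I. x q * x q)"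
    using sum_of_bool_mult[OF I] by (intro sum.cong refl) auto
  finally show ?thesis by (simp add: power2_eq_square)
qed

lemma measurable_lmul [measurable]:
  "finite I \<Longrightarrow> lmul I M \<in> measurable (lebI I) (lebI I)"
  unfolding lmul_def by measurable

definition ballI :: "'i set \<Rightarrow> ('i \<Rightarrow> real) set" where
  "ballI I = {x\<in>space (lebI I). (\<Sum>p\<in>I. (x p)\<^sup>2) \<le> 1}"

lemma ballI_sets [measurable]: "finite I \<Longrightarrow> ballI I \<in> sets (lebI I)"
  unfolding ballI_def by measurable

text \<open>The ball lies between two cubes. Both bounds are required to cancel its measure in
  \<open>distr_lebI_lmul\<close>.\<close>

lemma emeasure_ballI:
  assumes I: "finite I"
  shows "emeasure (lebI I) (ballI I) \<noteq> 0" "emeasure (lebI I) (ballI I) \<noteq> \<infinity>"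
proof -
  \<comment> \<open>The summand 1 keeps the side positive for empty \<open>I\<close>; in all cases
    card I times the square of \<open>\<delta>\<close> is at most 1.\<close>
  define \<delta> where "\<delta> = 1 / (real (card I) + 1)"
  have d: "\<delta> > 0" "real (card I) * \<delta>\<^sup>2 \<le> 1"
  proof -
    have "real (card I) * 1 \<le> (real (card I) + 1)\<^sup>2" by (simp add: power2_eq_square algebra_simps)
    then show "real (card I) * \<delta>\<^sup>2 \<le> 1" by (simp add: \<delta>_def power_divide divide_le_eq)
  qed (simp add: \<delta>_def)
  have sub: "(\<Pi>\<^sub>E p\<in>I. {-\<delta>..\<delta>}) \<subseteq> ballI I"
  proof
    fix x assume x: "x \<in> (\<Pi>\<^sub>E p\<in>I. {-\<delta>..\<delta>})"
    have "(\<Sum>p\<in>I. (x p)\<^sup>2) \<le> (\<Sum>p\<in>I. \<delta>\<^sup>2)"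
    proof (rule sum_mono)
      fix p assume "p \<in> I"
      then have "x p \<in> {-\<delta>..\<delta>}" using x by blast
      then have "\<bar>x p\<bar> \<le> \<delta>" by auto
      then show "(x p)\<^sup>2 \<le> \<delta>\<^sup>2" by (metis abs_ge_zero power2_abs power_mono)
    qed
    also have "\<dots> = real (card I) * \<delta>\<^sup>2" by simp
    also have "\<dots> \<le> 1" by fact
    finally have "(\<Sum>p\<in>I. (x p)\<^sup>2) \<le> 1" .
    moreover have "x \<in> space (lebI I)" using x PiE_mono[of I "\<lambda>_. {-\<delta>..\<delta>}" "\<lambda>_. UNIV"] unfolding space_lebI by blast
    ultimately show "x \<in> ballI I" by (simp add: ballI_def)
  qed
  have "0 < (\<Prod>p\<in>I. ennreal (2 * \<delta>))"
    unfolding zero_less_iff_neq_zero using d(1) by simp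
  also have "\<dots> = emeasure (lebI I) (\<Pi>\<^sub>E p\<in>I. {-\<delta>..\<delta>})"
    using I d(1) by (simp add: lebI.emeasure_PiM)
  also have "\<dots> \<le> emeasure (lebI I) (ballI I)"
    using sub I by (intro emeasure_mono) auto
  finally show "emeasure (lebI I) (ballI I) \<noteq> 0" by simp
  have "ballI I \<subseteq> (\<Pi>\<^sub>E p\<in>I. {-1..1})"
  proof
    fix x assume x: "x \<in> ballI I"
    have "\<bar>x p\<bar> \<le> 1" if "p \<in> I" for p
    proof -
      have "(x p)\<^sup>2 \<le> (\<Sum>p\<in>I. (x p)\<^sup>2)" using I that by (intro member_le_sum) auto
      then have "(x p)\<^sup>2 \<le> 1\<^sup>2" using x by (simp add: ballI_def)
      then show ?thesis using abs_le_square_iff[of "x p" 1] by simp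
    qed
    then have "x p \<in> {-1..1}" if "p \<in> I" for p using that by fastforce
    then show "x \<in> (\<Pi>\<^sub>E p\<in>I. {-1..1})" using x by (simp add: ballI_def space_lebI PiE_iff)
  qed
  then have "emeasure (lebI I) (ballI I) \<le> emeasure (lebI I) (\<Pi>\<^sub>E p\<in>I. {-1..1})"
    using I by (intro emeasure_mono) (auto intro!: sets_PiM_I_finite)
  also have "\<dots> = (\<Prod>p\<in>I. ennreal 2)" using I by (simp add: lebI.emeasure_PiM)
  also have "\<dots> < \<infinity>" by (simp add: power_less_top_ennreal)
  finally show "emeasure (lebI I) (ballI I) \<noteq> \<infinity>" by simp
qed

text \<open>
  Evaluating \<open>\<integral>\<integral> 1\<^sub>A x \<cdot> 1\<^sub>B (T y - x)\<close> in both orders, with \<open>B\<close> the unit ball, compares the Lebesgue measure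
  with its image under the orthogonal map \<open>T\<close>.
\<close>

lemma distr_lebI_lmul:
  assumes I: "finite I" and M: "orth_matrix I M"
  shows "distr (lebI I) (lebI I) (lmul I M) = lebI I"
proof (rule measure_eqI)
  fix A assume "A \<in> sets (distr (lebI I) (lebI I) (lmul I M))"
  then have A[measurable]: "A \<in> sets (lebI I)" by simp
  note I[simp, measurable]
  let ?T = "lmul I M" and ?T' = "lmul I (\<lambda>p q. M q p)"
  let ?B = "ballI I"
  let ?D = "\<lambda>y x. (\<lambda>p\<in>I. ?T y p - x p)"
  interpret S: sigma_finite_measure "lebI I" by (rule lebI.sigma_finite) fact
  interpret P: pair_sigma_finite "lebI I" "lebI I" ..
  have [measurable]: "(\<lambda>w. ?T (snd w)) \<in> measurable (lebI I \<Otimes>\<^sub>M lebI I) (lebI I)" by measurable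
  have c: "(\<lambda>x. x p) \<in> borel_measurable (lebI I)" if "p \<in> I" for p using that by measurable
  have Dm[measurable]: "(\<lambda>w. ?D (snd w) (fst w)) \<in> measurable (lebI I \<Otimes>\<^sub>M lebI I) (lebI I)"
  proof (rule measurable_restrict)
    fix p assume p: "p \<in> I"
    have "(\<lambda>w. ?T (snd w) p) \<in> borel_measurable (lebI I \<Otimes>\<^sub>M lebI I)"
      by (rule measurable_compose[OF _ c[OF p]]) measurable
    moreover have "(\<lambda>w. fst w p) \<in> borel_measurable (lebI I \<Otimes>\<^sub>M lebI I)"
      by (rule measurable_compose[OF measurable_fst c[OF p]])
    ultimately show "(\<lambda>w. ?T (snd w) p - fst w p) \<in> measurable (lebI I \<Otimes>\<^sub>M lebI I) lborel" by simp
  qed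
  have Dx: "(\<lambda>y. ?D y x) \<in> measurable (lebI I) (lebI I)" if "x \<in> space (lebI I)" for x
    using measurable_compose[OF measurable_Pair1'[OF that] Dm] by simp
  have Dy: "(\<lambda>x. ?D y x) \<in> measurable (lebI I) (lebI I)" if "y \<in> space (lebI I)" for y
    using measurable_compose[OF measurable_Pair2'[OF that] Dm] by simp
  define f :: "('a \<Rightarrow> real) \<Rightarrow> ('a \<Rightarrow> real) \<Rightarrow> ennreal"
    where "f x y = indicator A x * indicator ?B (?D y x)" for x y
  define g :: "('a \<Rightarrow> real) \<Rightarrow> ('a \<Rightarrow> real) \<Rightarrow> ennreal"
    where "g x y = indicator A (?D y x) * indicator ?B x" for x y
  have fm[measurable]: "case_prod f \<in> borel_measurable (lebI I \<Otimes>\<^sub>M lebI I)"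
    unfolding f_def split_beta' by measurable
  have gm[measurable]: "case_prod g \<in> borel_measurable (lebI I \<Otimes>\<^sub>M lebI I)"
    unfolding g_def split_beta' by measurable
  have Tmem: "?T y \<in> space (lebI I)" for y by (auto simp: lmul_def space_lebI)
  \<comment> \<open>The unit ball is invariant under an isometry; this is where orthogonality of
    \<open>M\<close> enters.\<close>
  have BT: "(\<integral>\<^sup>+y. indicator ?B (?T y) \<partial>lebI I) = emeasure (lebI I) ?B"
  proof -
    have "(\<integral>\<^sup>+y. indicator ?B (?T y) \<partial>lebI I) = (\<integral>\<^sup>+y. indicator ?B y \<partial>lebI I)"
      using Tmem lmul_norm[OF I M] by (intro nn_integral_cong) (auto simp: ballI_def indicator_def)
    then show ?thesis by simp
  qed
    \<comment> \<open>T y - x = T (y - T' x) with T' the transpose, so a translation in y removes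
      x.\<close>
    have xD: "?D y x = ?T (\<lambda>p\<in>I. - ?T' x p + 1 * y p)" if x: "x \<in> space (lebI I)" for x y
    proof
      fix p
      have "?T y p - x p = ?T (\<lambda>p\<in>I. - ?T' x p + 1 * y p) p" if p: "p \<in> I"
      proof -
        have "?T (\<lambda>p\<in>I. - ?T' x p + 1 * y p) p = ?T y p - ?T (?T' x) p"
          using p by (simp add: lmul_def algebra_simps sum_subtractf)
        also have "?T (?T' x) = x" using lmul_transpose[OF I M] x by (simp add: space_lebI)
        finally show ?thesis by (rule sym)
      qed
      then show "?D y x p = ?T (\<lambda>p\<in>I. - ?T' x p + 1 * y p) p" by (auto simp: lmul_def)
    qed
  have 1: "(\<integral>\<^sup>+y. f x y \<partial>lebI I) = indicator A x * emeasure (lebI I) ?B" if x: "x \<in> space (lebI I)" for x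
  proof -
    have "(\<integral>\<^sup>+y. f x y \<partial>lebI I) = indicator A x * (\<integral>\<^sup>+y. indicator ?B (?D y x) \<partial>lebI I)"
      unfolding f_def by (rule nn_integral_cmult) (use Dx[OF x] in measurable)
    also have "(\<integral>\<^sup>+y. indicator ?B (?D y x) \<partial>lebI I) = (\<integral>\<^sup>+y. indicator ?B (?T y) \<partial>lebI I)"
      unfolding xD[OF x] by (rule nn_integral_lebI_affine[of I 1 "\<lambda>y. indicator ?B (?T y)"]) auto
    finally show ?thesis using BT by simp
  qed
  \<comment> \<open>The substitution of T y - x for x exchanges the arguments of the two
    indicators.\<close>
  have 2: "(\<integral>\<^sup>+x. f x y \<partial>lebI I) = (\<integral>\<^sup>+x. g x y \<partial>lebI I)" if y: "y \<in> space (lebI I)" for y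
  proof -
    have fy: "(\<lambda>x. f x y) \<in> borel_measurable (lebI I)"
      unfolding f_def using Dy[OF y] by measurable
    have "(\<integral>\<^sup>+x. f x y \<partial>lebI I) = (\<integral>\<^sup>+x. f (\<lambda>p\<in>I. ?T y p + (-1) * x p) y \<partial>lebI I)"
      by (rule nn_integral_lebI_affine[symmetric]) (use fy in auto)
    also have "\<dots> = (\<integral>\<^sup>+x. g x y \<partial>lebI I)"
    proof (rule nn_integral_cong)
      fix x assume x: "x \<in> space (lebI I)"
      then have "?D y (\<lambda>p\<in>I. ?T y p + (-1) * x p) = x"
        by (auto simp: space_lebI PiE_def extensional_def)
      then show "f (\<lambda>p\<in>I. ?T y p + (-1) * x p) y = g x y" by (simp add: f_def g_def)
    qed
    finally show ?thesis .
  qed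
  have 3: "(\<integral>\<^sup>+y. g x y \<partial>lebI I) = indicator ?B x * emeasure (lebI I) (?T -` A \<inter> space (lebI I))"
    if x: "x \<in> space (lebI I)" for x
  proof -
    have "(\<integral>\<^sup>+y. g x y \<partial>lebI I) = (\<integral>\<^sup>+y. indicator ?B x * indicator A (?D y x) \<partial>lebI I)"
      unfolding g_def by (simp add: mult.commute)
    also have "\<dots> = indicator ?B x * (\<integral>\<^sup>+y. indicator A (?D y x) \<partial>lebI I)"
      by (rule nn_integral_cmult) (use Dx[OF x] in measurable)
    also have "(\<integral>\<^sup>+y. indicator A (?D y x) \<partial>lebI I) = (\<integral>\<^sup>+y. indicator A (?T y) \<partial>lebI I)"
      unfolding xD[OF x] by (rule nn_integral_lebI_affine[of I 1 "\<lambda>y. indicator A (?T y)"]) auto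
    also have "\<dots> = (\<integral>\<^sup>+y. indicator (?T -` A \<inter> space (lebI I)) y \<partial>lebI I)"
      by (intro nn_integral_cong) (auto simp: indicator_def)
    also have "\<dots> = emeasure (lebI I) (?T -` A \<inter> space (lebI I))" by (rule nn_integral_indicator) measurable
    finally show ?thesis .
  qed
  have "emeasure (lebI I) A * emeasure (lebI I) ?B = (\<integral>\<^sup>+x. \<integral>\<^sup>+y. f x y \<partial>lebI I \<partial>lebI I)"
    using 1 by (simp add: nn_integral_multc cong: nn_integral_cong)
  also have "\<dots> = (\<integral>\<^sup>+y. \<integral>\<^sup>+x. f x y \<partial>lebI I \<partial>lebI I)" by (rule P.Fubini'[symmetric]) fact
  also have "\<dots> = (\<integral>\<^sup>+y. \<integral>\<^sup>+x. g x y \<partial>lebI I \<partial>lebI I)" using 2 by (rule nn_integral_cong)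
  also have "\<dots> = (\<integral>\<^sup>+x. \<integral>\<^sup>+y. g x y \<partial>lebI I \<partial>lebI I)" by (rule P.Fubini') fact
  also have "\<dots> = emeasure (lebI I) ?B * emeasure (lebI I) (?T -` A \<inter> space (lebI I))"
    using 3 by (simp add: nn_integral_multc cong: nn_integral_cong)
  finally have "emeasure (lebI I) ?B * emeasure (lebI I) A = emeasure (lebI I) ?B * emeasure (lebI I) (?T -` A \<inter> space (lebI I))"
    by (simp add: mult.commute)
  then have "emeasure (lebI I) A = emeasure (lebI I) (?T -` A \<inter> space (lebI I))"
    using emeasure_ballI[OF I] by (simp add: ennreal_mult_cancel_left)
  then show "emeasure (distr (lebI I) (lebI I) ?T) A = emeasure (lebI I) A"
    by (simp add: emeasure_distr)
qed simp

section \<open>The standard Gaussian measure\<close>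

definition gauss :: "'i set \<Rightarrow> ('i \<Rightarrow> real) measure" where
  "gauss I = PiM I (\<lambda>_. density lborel std_normal_density)"

interpretation gauss: product_sigma_finite "\<lambda>_::'i. density lborel std_normal_density"
  by (intro product_sigma_finite.intro prob_space_imp_sigma_finite prob_space_normal_density) simp

lemma space_gauss: "space (gauss I) = PiE I (\<lambda>_. UNIV)"
  by (simp add: gauss_def space_PiM)

lemma sets_gauss [measurable_cong]: "sets (gauss I) = sets (PiM I (\<lambda>_. borel))"
  unfolding gauss_def by (intro sets_PiM_cong) auto

lemma prob_space_gauss: "prob_space (gauss I)"
  unfolding gauss_def by (intro prob_space_PiM prob_space_normal_density) simp

lemma gauss_eq_density:
  assumes I: "finite I"
  shows "gauss I = density (lebI I) (\<lambda>x. \<Prod>i\<in>I. ennreal (std_normal_density (x i)))"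
  unfolding gauss_def
proof (rule gauss.PiM_eqI[OF I, symmetric])
  show "sets (density (lebI I) (\<lambda>x. \<Prod>i\<in>I. ennreal (std_normal_density (x i)))) =
      sets (PiM I (\<lambda>_. density lborel std_normal_density))"
    by (simp, intro sets_PiM_cong) auto
  fix A :: "'a \<Rightarrow> real set" assume A: "\<And>i. i \<in> I \<Longrightarrow> A i \<in> sets (density lborel std_normal_density)"
  have [measurable]: "Pi\<^sub>E I A \<in> sets (lebI I)" using A I by (intro sets_PiM_I_finite) auto
  have "emeasure (density (lebI I) (\<lambda>x. \<Prod>i\<in>I. ennreal (std_normal_density (x i)))) (Pi\<^sub>E I A)
    = (\<integral>\<^sup>+x. (\<Prod>i\<in>I. ennreal (std_normal_density (x i))) * indicator (Pi\<^sub>E I A) x \<partial>lebI I)"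
    using I by (intro emeasure_density) measurable
  also have "\<dots> = (\<integral>\<^sup>+x. (\<Prod>i\<in>I. ennreal (std_normal_density (x i)) * indicator (A i) (x i)) \<partial>lebI I)"
    using I by (intro nn_integral_cong)
      (auto simp: prod.distrib indicator_def space_lebI PiE_iff prod_zero_iff if_distrib intro!: prod.neutral)
  also have "\<dots> = (\<Prod>i\<in>I. \<integral>\<^sup>+t. ennreal (std_normal_density t) * indicator (A i) t \<partial>lborel)"
    using A I by (intro lebI.product_nn_integral_prod) auto
  also have "\<dots> = (\<Prod>i\<in>I. emeasure (density lborel std_normal_density) (A i))"
    using A by (intro prod.cong refl emeasure_density[symmetric]) auto
  finally show "emeasure (density (lebI I) (\<lambda>x. \<Prod>i\<in>I. ennreal (std_normal_density (x i)))) (Pi\<^sub>E I A)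
    = (\<Prod>i\<in>I. emeasure (density lborel std_normal_density) (A i))" .
qed

lemma prod_std_normal:
  assumes "finite I"
  shows "(\<Prod>i\<in>I. ennreal (std_normal_density (x i))) =
    ennreal ((1 / sqrt (2 * pi)) ^ card I * exp (- (\<Sum>i\<in>I. (x i)\<^sup>2) / 2))"
proof -
  have "(\<Prod>i\<in>I. ennreal (std_normal_density (x i))) = ennreal (\<Prod>i\<in>I. std_normal_density (x i))"
    by (rule prod_ennreal) simp
  also have "(\<Prod>i\<in>I. std_normal_density (x i)) = (\<Prod>i\<in>I. (1 / sqrt (2 * pi))) * (\<Prod>i\<in>I. exp (- (x i)\<^sup>2 / 2))"
    unfolding std_normal_density_def by (rule prod.distrib)
  also have "(\<Prod>i\<in>I. exp (- (x i)\<^sup>2 / 2)) = exp (\<Sum>i\<in>I. - (x i)\<^sup>2 / 2)"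
    using assms by (simp add: exp_sum)
  also have "(\<Sum>i\<in>I. - (x i)\<^sup>2 / 2) = - (\<Sum>i\<in>I. (x i)\<^sup>2) / 2"
    by (simp add: sum_negf sum_divide_distrib)
  finally show ?thesis by simp
qed

text \<open>The density is a function of the Euclidean norm alone, and Lebesgue measure is
  invariant.\<close>

lemma emeasure_gauss_lmul:
  assumes I: "finite I" and M: "orth_matrix I M" and A: "A \<in> sets (gauss I)"
  shows "emeasure (gauss I) (lmul I M -` A \<inter> space (gauss I)) = emeasure (gauss I) A"
proof -
  define \<phi> :: "('a \<Rightarrow> real) \<Rightarrow> ennreal" where "\<phi> x = (\<Prod>i\<in>I. ennreal (std_normal_density (x i)))" for x
  have s: "sets (gauss I) = sets (lebI I)" unfolding sets_gauss by (intro sets_PiM_cong) auto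
  have A'[measurable]: "A \<in> sets (lebI I)" using A s by simp
  note I[simp, measurable]
  have [measurable]: "\<phi> \<in> borel_measurable (lebI I)" unfolding \<phi>_def by measurable
  have sp: "space (gauss I) = space (lebI I)" by (simp add: space_gauss space_lebI)
  have \<phi>: "\<phi> (lmul I M x) = \<phi> x" for x
    unfolding \<phi>_def prod_std_normal[OF I] lmul_norm[OF I M] ..
  have "emeasure (gauss I) (lmul I M -` A \<inter> space (gauss I)) =
      (\<integral>\<^sup>+x. \<phi> x * indicator (lmul I M -` A \<inter> space (lebI I)) x \<partial>lebI I)"
    unfolding gauss_eq_density[OF I] \<phi>_def[symmetric] by (subst emeasure_density) auto
  also have "\<dots> = (\<integral>\<^sup>+x. \<phi> (lmul I M x) * indicator A (lmul I M x) \<partial>lebI I)"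
    by (intro nn_integral_cong) (auto simp: \<phi> indicator_def)
  also have "\<dots> = (\<integral>\<^sup>+x. \<phi> x * indicator A x \<partial>distr (lebI I) (lebI I) (lmul I M))"
    by (subst nn_integral_distr) auto
  also have "\<dots> = emeasure (gauss I) A"
    unfolding distr_lebI_lmul[OF I M] gauss_eq_density[OF I] \<phi>_def[symmetric] by (subst emeasure_density) auto
  finally show ?thesis .
qed

lemma gauss_component:
  assumes "i \<in> I" shows "distr (gauss I) borel (\<lambda>x. x i) = density lborel std_normal_density"
proof -
  have "distr (gauss I) borel (\<lambda>x. x i) = distr (gauss I) (density lborel std_normal_density) (\<lambda>x. x i)"
    by (rule distr_cong) auto
  then show ?thesis unfolding gauss_def
    using distr_PiM_component[of I "\<lambda>_. density lborel std_normal_density" i] assms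
    by (simp add: prob_space_normal_density)
qed

lemma gauss_indep:
  assumes "I \<noteq> {}" shows "prob_space.indep_vars (gauss I) (\<lambda>_. borel) (\<lambda>i x. x i) I"
proof -
  interpret prob_space "gauss I" by (rule prob_space_gauss)
  have "distr (gauss I) (PiM I (\<lambda>_. borel)) (\<lambda>x. \<lambda>i\<in>I. x i) = distr (gauss I) (gauss I) (\<lambda>x. x)"
    by (rule distr_cong) (auto simp: sets_gauss space_gauss PiE_def extensional_restrict)
  also have "\<dots> = gauss I" by (simp add: distr_id2)
  also have "\<dots> = PiM I (\<lambda>i. distr (gauss I) borel (\<lambda>x. x i))"
    unfolding gauss_def by (intro PiM_cong refl gauss_component[unfolded gauss_def, symmetric])
  finally show ?thesis
    using assms by (subst indep_vars_iff_distr_eq_PiM') auto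
qed

lemma gauss_linear_form:
  assumes I: "finite I" and a: "\<exists>i\<in>I. a i \<noteq> 0"
  shows "distributed (gauss I) lborel (\<lambda>x. \<Sum>i\<in>I. a i * x i) (normal_density 0 (sqrt (\<Sum>i\<in>I. (a i)\<^sup>2)))"
proof -
  interpret prob_space "gauss I" by (rule prob_space_gauss)
  \<comment> \<open>Normal densities are available for positive standard deviation only, so
    coordinates with coefficient 0 are dropped.\<close>
  define J where "J = {i\<in>I. a i \<noteq> 0}"
  have J: "finite J" "J \<noteq> {}" "J \<subseteq> I" using I a by (auto simp: J_def)
  have ind: "indep_vars (\<lambda>_. borel) (\<lambda>i x. a i * x i) J"
    using indep_vars_compose2[OF indep_vars_subset[OF gauss_indep J(3)], of "\<lambda>i t. a i * t" "\<lambda>_. borel"] a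
    by auto
  have d: "distributed (gauss I) lborel (\<lambda>x. a i * x i) (normal_density 0 \<bar>a i\<bar>)" if "i \<in> J" for i
  proof -
    have "distributed (gauss I) lborel (\<lambda>x. x i) std_normal_density"
      using gauss_component[of i I] that J unfolding distributed_def
      by (auto cong: distr_cong)
    from normal_density_affine[OF this, of "a i" 0] show ?thesis using that by (auto simp: J_def)
  qed
  have "distributed (gauss I) lborel (\<lambda>x. \<Sum>i\<in>J. a i * x i) (normal_density (\<Sum>i\<in>J. 0) (sqrt (\<Sum>i\<in>J. \<bar>a i\<bar>\<^sup>2)))"
    by (rule sum_indep_normal[OF J(1,2) ind _ d]) (auto simp: J_def)
  moreover have "(\<Sum>i\<in>J. a i * x i) = (\<Sum>i\<in>I. a i * x i)" for x
    using I by (intro sum.mono_neutral_left) (auto simp: J_def)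
  moreover have "(\<Sum>i\<in>J. \<bar>a i\<bar>\<^sup>2) = (\<Sum>i\<in>I. (a i)\<^sup>2)"
    using I by simp (intro sum.mono_neutral_left, auto simp: J_def)
  ultimately show ?thesis by simp
qed

lemma gauss_hyperplane_null:
  assumes I: "finite I" and a: "\<exists>i\<in>I. a i \<noteq> 0"
  shows "emeasure (gauss I) {x\<in>space (gauss I). (\<Sum>i\<in>I. a i * x i) = 0} = 0"
proof -
  have "{x\<in>space (gauss I). (\<Sum>i\<in>I. a i * x i) = 0} = (\<lambda>x. \<Sum>i\<in>I. a i * x i) -` {0} \<inter> space (gauss I)"
    by auto
  also have "emeasure (gauss I) \<dots> = (\<integral>\<^sup>+t. ennreal (normal_density 0 (sqrt (\<Sum>i\<in>I. (a i)\<^sup>2)) t) * indicator {0} t \<partial>lborel)"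
    by (rule distributed_emeasure[OF gauss_linear_form[OF assms]]) simp
  also have "\<dots> = 0" by (simp add: nn_integral_0_iff_AE AE_lborel_singleton indicator_def)
      (use AE_lborel_singleton[of "0::real"] in eventually_elim, auto)
  finally show ?thesis .
qed

section \<open>Uniqueness of the Haar measure\<close>

lemma tendsto_componentwiseI:
  fixes f :: "'c \<Rightarrow> 'a \<Rightarrow> 'b::topological_space"
  assumes "\<And>i. ((\<lambda>n. f n i) \<longlongrightarrow> l i) F" shows "(f \<longlongrightarrow> l) F"
proof -
  have "limitin (product_topology (\<lambda>i. euclidean) UNIV) f l F"
    unfolding limitin_componentwise using assms by auto
  then show ?thesis by (simp add: euclidean_product_topology)
qed

lemma tendsto_componentwiseD:
  fixes f :: "'c \<Rightarrow> 'a \<Rightarrow> 'b::topological_space"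
  assumes "(f \<longlongrightarrow> l) F" shows "((\<lambda>n. f n i) \<longlongrightarrow> l i) F"
proof -
  have "limitin (product_topology (\<lambda>i. euclidean) UNIV) f l F"
    using assms by (simp add: euclidean_product_topology)
  then show ?thesis unfolding limitin_componentwise by auto
qed

section \<open>The Borel structure of the Grassmannian\<close>

lemma space_grassmann_borel: "space (grassmann_borel d N) = grassmannian d N"
  by (simp add: grassmann_borel_def)

lemma measurable_proj_matrix: "(\<lambda>E. proj_matrix N E i j) \<in> borel_measurable (grassmann_borel d N)"
proof -
  have *: "proj_matrix N \<in> measurable (grassmann_borel d N) borel"
    unfolding grassmann_borel_def by (rule measurable_vimage_algebra1) simp
  show ?thesis
    by (rule measurable_product_then_coordinatewise[OF measurable_product_then_coordinatewise[OF *]])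
qed

lemma measurable_grassmann_borelI:
  assumes "\<And>x. x \<in> space M \<Longrightarrow> f x \<in> grassmannian d N"
    "\<And>i j. (\<lambda>x. proj_matrix N (f x) i j) \<in> borel_measurable M"
  shows "f \<in> measurable M (grassmann_borel d N)"
  unfolding grassmann_borel_def
proof (rule measurable_vimage_algebra2)
  show "(\<lambda>x. proj_matrix N (f x)) \<in> borel_measurable M"
    by (rule measurable_coordinatewise_then_product, rule measurable_coordinatewise_then_product, rule assms(2))
qed (use assms(1) in auto)

lemma measurable_orthogonal_map_image:
  assumes "orthogonal_map N U"
  shows "(\<lambda>E. U ` E) \<in> measurable (grassmann_borel d N) (grassmann_borel d N)"
proof (rule measurable_grassmann_borelI)
  fix i j
  have "(\<lambda>E. \<Sum>a<N. \<Sum>b<N. U (uvec a) i * U (uvec b) j * proj_matrix N E a b) \<in> borel_measurable (grassmann_borel d N)"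
    using measurable_proj_matrix by (intro borel_measurable_sum borel_measurable_times borel_measurable_const)
  then show "(\<lambda>E. proj_matrix N (U ` E) i j) \<in> borel_measurable (grassmann_borel d N)"
    using proj_matrix_orthogonal_map[OF assms]
    by (subst measurable_cong) (auto simp: space_grassmann_borel)
qed (use grassmannian_orthogonal_map[OF assms] in \<open>auto simp: space_grassmann_borel\<close>)

text \<open>Invariance is stated with images in \<open>is_grassmann_haar\<close>. The image under
  \<open>U\<close> is the preimage under the inverse map, hence measurable.\<close>

lemma orthogonal_image_sets:
  assumes U: "orthogonal_map N U" and A: "A \<in> sets (grassmann_borel d N)"
  shows "(\<lambda>E. U ` E) ` A \<in> sets (grassmann_borel d N)"
proof -
  obtain V where V: "orthogonal_map N V" "\<forall>x\<in>rvecs N. V (U x) = x \<and> U (V x) = x"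
    using orthogonal_map_inverse[OF U] by blast
  have AG: "A \<subseteq> grassmannian d N" using sets.sets_into_space[OF A] by (simp add: space_grassmann_borel)
  have 1: "V ` U ` E = E" "U ` V ` E = E" if "E \<in> grassmannian d N" for E
  proof -
    have "E \<subseteq> rvecs N" using that by (simp add: grassmannian_def)
    then show "V ` U ` E = E" "U ` V ` E = E" using V(2) unfolding image_image by (auto simp: subset_iff image_iff)
  qed
  have "(\<lambda>E. U ` E) ` A = (\<lambda>E. V ` E) -` A \<inter> space (grassmann_borel d N)"
  proof (intro set_eqI iffI)
    fix F assume "F \<in> (\<lambda>E. U ` E) ` A"
    then obtain E where "E \<in> A" "F = U ` E" by auto
    then show "F \<in> (\<lambda>E. V ` E) -` A \<inter> space (grassmann_borel d N)"
      using 1 AG grassmannian_orthogonal_map[OF U] by (auto simp: space_grassmann_borel)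
  next
    fix F assume "F \<in> (\<lambda>E. V ` E) -` A \<inter> space (grassmann_borel d N)"
    then have "V ` F \<in> A" "U ` V ` F = F" using 1 by (auto simp: space_grassmann_borel)
    then show "F \<in> (\<lambda>E. U ` E) ` A" by (metis imageI)
  qed
  then show ?thesis using measurable_sets[OF measurable_orthogonal_map_image[OF V(1)] A] by simp
qed

section \<open>Balls in the Grassmannian and their measure\<close>

definition gball :: "nat \<Rightarrow> nat \<Rightarrow> (nat \<Rightarrow> real) set \<Rightarrow> nat \<Rightarrow> (nat \<Rightarrow> real) set set" where
  "gball d N E n = {F \<in> grassmannian d N. gdist N E F < 1 / real (Suc n)}"

lemma gdist_nonneg: "gdist N E F \<ge> 0"
  by (auto simp: gdist_def intro!: sum_nonneg)

lemma gdist_entry: "i < N \<Longrightarrow> j < N \<Longrightarrow> (proj_matrix N E i j - proj_matrix N F i j)\<^sup>2 \<le> gdist N E F"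
proof -
  assume ij: "i < N" "j < N"
  let ?g = "\<lambda>i j. (proj_matrix N E i j - proj_matrix N F i j)\<^sup>2"
  have "?g i j \<le> (\<Sum>j<N. ?g i j)" using ij by (intro member_le_sum) auto
  also have "\<dots> \<le> (\<Sum>i<N. \<Sum>j<N. ?g i j)" using ij by (intro member_le_sum[of i _ "\<lambda>i. \<Sum>j<N. ?g i j"]) (auto intro: sum_nonneg)
  finally show ?thesis by (simp add: gdist_def)
qed

lemma proj_matrix_0: "\<not> (i < N \<and> j < N) \<Longrightarrow> proj_matrix N E i j = 0"
  by (auto simp: proj_matrix_def)

lemma gdist_tendsto_proj:
  assumes "((\<lambda>n. gdist N E (F n)) \<longlongrightarrow> 0) A"
  shows "((\<lambda>n. proj_matrix N (F n)) \<longlongrightarrow> proj_matrix N E) A"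
proof (intro tendsto_componentwiseI)
  fix i j
  show "((\<lambda>n. proj_matrix N (F n) i j) \<longlongrightarrow> proj_matrix N E i j) A"
  proof (cases "i < N \<and> j < N")
    case True
    have "((\<lambda>n. sqrt (gdist N E (F n))) \<longlongrightarrow> sqrt 0) A" using assms by (rule tendsto_real_sqrt)
    then have s: "((\<lambda>n. sqrt (gdist N E (F n))) \<longlongrightarrow> 0) A" by simp
    have "((\<lambda>n. proj_matrix N (F n) i j - proj_matrix N E i j) \<longlongrightarrow> 0) A"
    proof (rule Lim_null_comparison[OF _ s], rule always_eventually, rule allI)
      fix n
      have "\<bar>proj_matrix N E i j - proj_matrix N (F n) i j\<bar> \<le> sqrt (gdist N E (F n))"
        using gdist_entry[of i N j E "F n"] True by (simp add: real_le_rsqrt flip: real_sqrt_abs)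
      then show "norm (proj_matrix N (F n) i j - proj_matrix N E i j) \<le> sqrt (gdist N E (F n))"
        by (simp add: abs_minus_commute)
    qed
    then show ?thesis by (simp add: LIM_zero_iff)
  next
    case False
    then show ?thesis by (simp add: proj_matrix_0)
  qed
qed

lemma gball_image:
  assumes U: "orthogonal_map N U" and E: "E \<in> grassmannian d N"
  shows "(\<lambda>F. U ` F) ` gball d N E n = gball d N (U ` E) n"
proof (intro set_eqI iffI)
  fix F assume "F \<in> (\<lambda>F. U ` F) ` gball d N E n"
  then show "F \<in> gball d N (U ` E) n"
    using grassmannian_orthogonal_map[OF U] gdist_orthogonal_map[OF U E] by (auto simp: gball_def)
next
  fix F assume F: "F \<in> gball d N (U ` E) n"
  obtain V where V: "orthogonal_map N V" "\<forall>x\<in>rvecs N. V (U x) = x \<and> U (V x) = x"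
    using orthogonal_map_inverse[OF U] by blast
  have FG: "F \<in> grassmannian d N" using F by (simp add: gball_def)
  then have "F \<subseteq> rvecs N" by (simp add: grassmannian_def)
  then have UV: "U ` V ` F = F" using V(2) unfolding image_image by (auto simp: subset_iff image_iff)
  have VF: "V ` F \<in> grassmannian d N" using grassmannian_orthogonal_map[OF V(1) FG] .
  have "gdist N E (V ` F) = gdist N (U ` E) F"
    using gdist_orthogonal_map[OF U E VF] UV by simp
  then have "V ` F \<in> gball d N E n" using F VF by (simp add: gball_def)
  then show "F \<in> (\<lambda>F. U ` F) ` gball d N E n" using UV by (metis imageI)
qed

lemma gdist_measurable:
  assumes "sets \<mu> = sets (grassmann_borel d N)" "sets \<nu> = sets (grassmann_borel d N)"
  shows "(\<lambda>w. gdist N (fst w) (snd w)) \<in> borel_measurable (\<mu> \<Otimes>\<^sub>M \<nu>)"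
proof -
  have p: "(\<lambda>E. proj_matrix N E i j) \<in> borel_measurable M" if "sets M = sets (grassmann_borel d N)" for M i j
    using measurable_proj_matrix measurable_cong_sets[OF that refl] by blast
  show ?thesis unfolding gdist_def
    by (intro borel_measurable_sum borel_measurable_power borel_measurable_diff
        measurable_compose[OF measurable_fst p[OF assms(1)]] measurable_compose[OF measurable_snd p[OF assms(2)]])
qed

lemma gdist_measurable1:
  assumes "sets \<mu> = sets (grassmann_borel d N)" 
  shows "(\<lambda>F. gdist N E F) \<in> borel_measurable \<mu>"
proof -
  have p: "(\<lambda>E. proj_matrix N E i j) \<in> borel_measurable \<mu>" for i j
    using measurable_proj_matrix measurable_cong_sets[OF assms refl] by blast
  show ?thesis unfolding gdist_def
    by (intro borel_measurable_sum borel_measurable_power borel_measurable_diff p borel_measurable_const)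
qed

lemma gball_sets:
  assumes "sets \<mu> = sets (grassmann_borel d N)" 
  shows "gball d N E n \<in> sets \<mu>"
proof -
  have "gball d N E n = {F\<in>space \<mu>. gdist N E F < 1 / real (Suc n)}"
    using sets_eq_imp_space_eq[OF assms] by (simp add: gball_def space_grassmann_borel)
  also have "\<dots> \<in> sets \<mu>" using gdist_measurable1[OF assms, of E] by measurable
  finally show ?thesis .
qed

lemma haar_gball:
  assumes "is_grassmann_haar d N \<mu>" "E \<in> grassmannian d N" "F \<in> grassmannian d N"
  shows "emeasure \<mu> (gball d N E n) = emeasure \<mu> (gball d N F n)"
proof -
  obtain U where U: "orthogonal_map N U" "U ` E = F" using grassmannian_transitive[OF assms(2,3)] by blast
  have "gball d N E n \<in> sets \<mu>" using assms(1) by (intro gball_sets) (simp add: is_grassmann_haar_def)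
  then have "emeasure \<mu> ((\<lambda>F. U ` F) ` gball d N E n) = emeasure \<mu> (gball d N E n)"
    using assms(1) U(1) unfolding is_grassmann_haar_def by blast
  then show ?thesis using gball_image[OF U(1) assms(2)] U(2) by simp
qed

lemma haar_space: "is_grassmann_haar d N \<mu> \<Longrightarrow> space \<mu> = grassmannian d N"
  unfolding is_grassmann_haar_def using sets_eq_imp_space_eq space_grassmann_borel by metis

text \<open>Separability is inherited from the space of all matrices: every member of a countable
  dense set that comes close to the Grassmannian is replaced by a subspace nearby.\<close>

lemma countable_gballs:
  "\<exists>C. countable C \<and> C \<subseteq> grassmannian d N \<and> grassmannian d N \<subseteq> (\<Union>E\<in>C. gball d N E n)"
proof -
  let ?G = "grassmannian d N"
  obtain D :: "(nat \<Rightarrow> nat \<Rightarrow> real) set" where D: "countable D" "\<And>X. open X \<Longrightarrow> X \<noteq> {} \<Longrightarrow> \<exists>d\<in>D. d \<in> X"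
    using countable_dense_setE by blast
  define m where "m M E = (\<Sum>i<N. \<Sum>j<N. (proj_matrix N E i j - M i j)\<^sup>2)" for M :: "nat \<Rightarrow> nat \<Rightarrow> real" and E
  \<comment> \<open>A quarter of the radius, since passing through a third matrix bounds
    \<open>gdist\<close> by twice the sum of the two squared distances.\<close>
  define \<delta> where "\<delta> = 1 / (4 * real (Suc n))"
  define c where "c M = (SOME E. E \<in> ?G \<and> m M E < \<delta>)" for M
  let ?D = "{M\<in>D. \<exists>E. E \<in> ?G \<and> m M E < \<delta>}"
  have c: "c M \<in> ?G \<and> m M (c M) < \<delta>" if "M \<in> ?D" for M
  proof -
    have "\<exists>E. E \<in> ?G \<and> m M E < \<delta>" using that by simp
    then show ?thesis unfolding c_def by (rule someI_ex)
  qed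
  have "\<exists>M\<in>?D. E \<in> gball d N (c M) n" if E: "E \<in> ?G" for E
  proof -
    have c1: "continuous_on UNIV (\<lambda>M::nat \<Rightarrow> nat \<Rightarrow> real. M i j)" for i j
      by (rule continuous_on_product_then_coordinatewise[OF continuous_on_product_coordinates])
    have cont: "continuous_on UNIV (\<lambda>M. m M E)"
      unfolding m_def by (intro continuous_on_sum continuous_on_power continuous_on_diff continuous_on_const c1)
    have "open {M. m M E < \<delta>}"
      using open_Collect_less[OF cont continuous_on_const] .
    moreover have "proj_matrix N E \<in> {M. m M E < \<delta>}" by (simp add: m_def \<delta>_def)
    ultimately obtain M where M: "M \<in> D" "m M E < \<delta>" using D(2) by blast
    then have MD: "M \<in> ?D" using E by auto
    have "gdist N (c M) E \<le> 2 * m M (c M) + 2 * m M E"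
    proof -
      have "(proj_matrix N (c M) i j - proj_matrix N E i j)\<^sup>2 \<le>
        2 * (proj_matrix N (c M) i j - M i j)\<^sup>2 + 2 * (proj_matrix N E i j - M i j)\<^sup>2" for i j
      proof -
        have "(a - b)\<^sup>2 \<le> 2 * (a - t)\<^sup>2 + 2 * (b - t)\<^sup>2" for a b t :: real
        proof -
          have "2 * (a - t)\<^sup>2 + 2 * (b - t)\<^sup>2 - (a - b)\<^sup>2 = (a + b - 2 * t)\<^sup>2"
            by (simp add: power2_eq_square algebra_simps)
          then show ?thesis by (smt (verit) zero_le_power2)
        qed
        then show ?thesis .
      qed
      then have "gdist N (c M) E \<le> (\<Sum>i<N. \<Sum>j<N. 2 * (proj_matrix N (c M) i j - M i j)\<^sup>2 + 2 * (proj_matrix N E i j - M i j)\<^sup>2)"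
        unfolding gdist_def by (intro sum_mono)
      then show ?thesis unfolding m_def by (simp add: sum.distrib sum_distrib_left)
    qed
    also have "\<dots> < 1 / real (Suc n)" using c[OF MD] M(2) by (simp add: \<delta>_def field_simps)
    finally show ?thesis using MD E by (auto simp: gball_def)
  qed
  then show ?thesis using c D(1) by (intro exI[of _ "c ` ?D"]) auto
qed

text \<open>Otherwise, by transitivity, all balls of this radius would be null, and countably many
  of them cover the space.\<close>

lemma haar_gball_pos:
  assumes \<mu>: "is_grassmann_haar d N \<mu>" and E: "E \<in> grassmannian d N"
  shows "emeasure \<mu> (gball d N E n) \<noteq> 0"
proof
  assume 0: "emeasure \<mu> (gball d N E n) = 0"
  interpret prob_space \<mu> using \<mu> by (simp add: is_grassmann_haar_def)
  obtain C where C: "countable C" "C \<subseteq> grassmannian d N" "grassmannian d N \<subseteq> (\<Union>E\<in>C. gball d N E n)"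
    using countable_gballs[of d N n] by (elim exE conjE)
  have s: "sets \<mu> = sets (grassmann_borel d N)" using \<mu> by (simp add: is_grassmann_haar_def)
  have "(\<Union>E\<in>C. gball d N E n) \<in> null_sets \<mu>"
  proof (rule null_sets_UN'[OF C(1)])
    fix F assume "F \<in> C"
    then have "F \<in> grassmannian d N" using C(2) by blast
    then show "gball d N F n \<in> null_sets \<mu>"
      using 0 haar_gball[OF \<mu> _ E] gball_sets[OF s] by (intro null_setsI) auto
  qed
  then have "space \<mu> \<in> null_sets \<mu>" using C(3) haar_space[OF \<mu>] null_sets_subset sets.top by metis
  then show False using emeasure_space_1 by auto
qed

text \<open>
  All balls of a given radius have the same measure.  By Fubini, the \<open>\<mu>\<close>-average over \<open>W\<close> of the \<open>\<nu>\<close>-measure of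
  \<open>W\<close> intersected with small balls is the \<open>\<nu>\<close>-average over \<open>W\<close> of the corresponding \<open>\<mu>\<close>-measures; letting
  the radius tend to \<open>0\<close> compares \<open>\<mu> W\<close> with \<open>\<nu> W\<close>.
\<close>

lemma haar_dominated_open:
  fixes s :: "nat \<Rightarrow> nat"
  assumes \<mu>: "is_grassmann_haar d N \<mu>" and \<nu>: "is_grassmann_haar d N \<nu>" and E0: "E0 \<in> grassmannian d N"
    and s: "strict_mono s" "\<And>n. emeasure \<mu> (gball d N E0 (s n)) \<le> emeasure \<nu> (gball d N E0 (s n))"
    and V: "open V"
  shows "emeasure \<mu> (proj_matrix N -` V \<inter> grassmannian d N) \<le> emeasure \<nu> (proj_matrix N -` V \<inter> grassmannian d N)"
proof -
  let ?G = "grassmannian d N"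
  define W where "W = proj_matrix N -` V \<inter> ?G"
  interpret M: prob_space \<mu> using \<mu> by (simp add: is_grassmann_haar_def)
  interpret K: prob_space \<nu> using \<nu> by (simp add: is_grassmann_haar_def)
  interpret P: pair_sigma_finite \<mu> \<nu> ..
  have sm: "sets \<mu> = sets (grassmann_borel d N)" and sn: "sets \<nu> = sets (grassmann_borel d N)"
    using \<mu> \<nu> by (simp_all add: is_grassmann_haar_def)
  have spm: "space \<mu> = ?G" and spn: "space \<nu> = ?G" using haar_space \<mu> \<nu> by auto
  have "W \<in> sets (grassmann_borel d N)"
    unfolding W_def grassmann_borel_def using V by (intro in_vimage_algebra) auto
  then have Wm[measurable]: "W \<in> sets \<mu>" and Wn[measurable]: "W \<in> sets \<nu>" using sm sn by auto
  define h where "h n = emeasure \<nu> (gball d N E0 (s n))" for n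
  have h0: "h n \<noteq> 0" "h n \<noteq> \<infinity>" for n
    using haar_gball_pos[OF \<nu> E0] K.emeasure_finite by (auto simp: h_def)
  \<comment> \<open>The indicator of pairs of points of \<open>W\<close> at small distance.
    Integrating y first gives the \<open>\<nu>\<close>-measure of a ball cut with \<open>W\<close>;
    integrating x first gives a \<open>\<mu>\<close>-measure.\<close>
  define T where "T n x y = (indicator W x * indicator W y * indicator {z. z < 1 / real (Suc (s n))} (gdist N x y) :: ennreal)" for n x y
  have g[measurable]: "(\<lambda>w. gdist N (fst w) (snd w)) \<in> borel_measurable (\<mu> \<Otimes>\<^sub>M \<nu>)"
    by (rule gdist_measurable[OF sm sn])
  have Tm[measurable]: "(\<lambda>(x,y). T n x y) \<in> borel_measurable (\<mu> \<Otimes>\<^sub>M \<nu>)" for n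
    unfolding T_def split_beta' by measurable
  have Tnu: "(\<integral>\<^sup>+y. T n x y \<partial>\<nu>) = indicator W x * emeasure \<nu> (W \<inter> gball d N x (s n))" if "x \<in> ?G" for x n
  proof -
    have "(\<integral>\<^sup>+y. T n x y \<partial>\<nu>) = (\<integral>\<^sup>+y. indicator W x * indicator (W \<inter> gball d N x (s n)) y \<partial>\<nu>)"
      by (intro nn_integral_cong) (auto simp: T_def indicator_def gball_def spn)
    also have "\<dots> = indicator W x * emeasure \<nu> (W \<inter> gball d N x (s n))"
      using gball_sets[OF sn] Wn by (subst nn_integral_cmult_indicator) auto
    finally show ?thesis .
  qed
  \<comment> \<open>The comparison of ball measures enters here: the ball is measured by
    \<open>\<mu>\<close> but bounded by \<open>h n\<close>, which is defined by
    \<open>\<nu>\<close>.\<close>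
  have Tmu: "(\<integral>\<^sup>+x. T n x y \<partial>\<mu>) \<le> indicator W y * h n" if "y \<in> ?G" for y n
  proof -
    have "(\<integral>\<^sup>+x. T n x y \<partial>\<mu>) \<le> (\<integral>\<^sup>+x. indicator W y * indicator (gball d N y (s n)) x \<partial>\<mu>)"
      by (intro nn_integral_mono) (auto simp: T_def indicator_def gball_def spm gdist_commute[of N y])
    also have "\<dots> = indicator W y * emeasure \<mu> (gball d N y (s n))"
      using gball_sets[OF sm] by (subst nn_integral_cmult_indicator) auto
    also have "\<dots> \<le> indicator W y * h n"
      using s(2)[of n] haar_gball[OF \<mu> that E0] by (intro mult_left_mono) (auto simp: h_def)
    finally show ?thesis .
  qed
  have ub: "(\<integral>\<^sup>+x. (\<integral>\<^sup>+y. T n x y \<partial>\<nu>) / h n \<partial>\<mu>) \<le> emeasure \<nu> W" for n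
  proof -
    have "(\<integral>\<^sup>+x. (\<integral>\<^sup>+y. T n x y \<partial>\<nu>) / h n \<partial>\<mu>) = (\<integral>\<^sup>+x. \<integral>\<^sup>+y. T n x y \<partial>\<nu> \<partial>\<mu>) / h n"
      by (rule nn_integral_divide) measurable
    also have "(\<integral>\<^sup>+x. \<integral>\<^sup>+y. T n x y \<partial>\<nu> \<partial>\<mu>) = (\<integral>\<^sup>+y. \<integral>\<^sup>+x. T n x y \<partial>\<mu> \<partial>\<nu>)"
      by (rule P.Fubini'[symmetric]) measurable
    also have "\<dots> \<le> (\<integral>\<^sup>+y. indicator W y * h n \<partial>\<nu>)"
      using Tmu by (intro nn_integral_mono) (simp add: spn)
    also have "\<dots> = emeasure \<nu> W * h n" by (simp add: nn_integral_multc)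
    finally have "(\<integral>\<^sup>+x. (\<integral>\<^sup>+y. T n x y \<partial>\<nu>) / h n \<partial>\<mu>) \<le> emeasure \<nu> W * h n / h n"
      by (simp add: divide_right_mono_ennreal)
    then show ?thesis using h0[of n] by (simp add: ennreal_mult_divide_eq)
  qed
  have ev: "(\<lambda>n. (\<integral>\<^sup>+y. T n x y \<partial>\<nu>) / h n) \<longlonglongrightarrow> 1" if xW: "x \<in> W" for x
  proof -
    have xG: "x \<in> ?G" using xW by (simp add: W_def)
    \<comment> \<open>Subspaces in shrinking balls around x but outside \<open>W\<close> would have
      projection matrices converging to that of x, contradicting openness of
      \<open>V\<close>.\<close>
    have "\<exists>n0. \<forall>n\<ge>n0. gball d N x n \<subseteq> W"
    proof (rule ccontr)
      assume neg: "\<not> (\<exists>n0. \<forall>n\<ge>n0. gball d N x n \<subseteq> W)"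
      have "\<forall>n. \<exists>F. F \<in> gball d N x n \<and> F \<notin> W"
      proof -
        have "gball d N x m \<subseteq> gball d N x n" if "n \<le> m" for m n
        proof -
          have "1 / real (Suc m) \<le> 1 / real (Suc n)" using that by (intro divide_left_mono) auto
          then show ?thesis by (auto simp: gball_def)
        qed
        then show ?thesis using neg by blast
      qed
      then obtain F where F: "\<And>n. F n \<in> gball d N x n" "\<And>n. F n \<notin> W" by metis
      have "(\<lambda>n. gdist N x (F n)) \<longlonglongrightarrow> 0"
        by (rule tendsto_sandwich[OF _ _ tendsto_const LIMSEQ_inverse_real_of_nat[unfolded inverse_eq_divide]])
          (use F(1) gdist_nonneg in \<open>auto simp: gball_def intro!: always_eventually less_imp_le\<close>)
      then have "(\<lambda>n. proj_matrix N (F n)) \<longlonglongrightarrow> proj_matrix N x" by (rule gdist_tendsto_proj)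
      then have "\<forall>\<^sub>F n in sequentially. proj_matrix N (F n) \<in> V"
        using V xW by (intro topological_tendstoD) (auto simp: W_def)
      then obtain n where "proj_matrix N (F n) \<in> V" by (auto simp: eventually_sequentially)
      then show False using F[of n] by (auto simp: W_def gball_def)
    qed
    then obtain n0 where n0: "\<And>n. n \<ge> n0 \<Longrightarrow> gball d N x n \<subseteq> W" by blast
    have "(\<integral>\<^sup>+y. T n x y \<partial>\<nu>) / h n = 1" if "n \<ge> n0" for n
    proof -
      have "s n \<ge> n0" using strict_mono_imp_increasing[OF s(1), of n] that by simp
      then have "W \<inter> gball d N x (s n) = gball d N x (s n)" using n0 by blast
      then have "(\<integral>\<^sup>+y. T n x y \<partial>\<nu>) = h n" using Tnu[OF xG] xW haar_gball[OF \<nu> xG E0] by (simp add: h_def)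
      then show ?thesis using h0[of n] by (simp add: ennreal_divide_self less_top)
    qed
    then show ?thesis by (intro tendsto_eventually) (auto simp: eventually_sequentially)
  qed
  have "emeasure \<mu> W = (\<integral>\<^sup>+x. indicator W x \<partial>\<mu>)" by simp
  also have "\<dots> \<le> (\<integral>\<^sup>+x. liminf (\<lambda>n. (\<integral>\<^sup>+y. T n x y \<partial>\<nu>) / h n) \<partial>\<mu>)"
  proof (rule nn_integral_mono)
    fix x
    show "indicator W x \<le> liminf (\<lambda>n. (\<integral>\<^sup>+y. T n x y \<partial>\<nu>) / h n)"
      using lim_imp_Liminf[OF sequentially_bot ev[of x]] by (cases "x \<in> W") auto
  qed
  \<comment> \<open>Fatou's lemma: the integrands tend to 1 at every point of \<open>W\<close>,
    while their integrals never exceed \<open>emeasure \<nu> W\<close>.\<close>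
  also have "\<dots> \<le> liminf (\<lambda>n. \<integral>\<^sup>+x. (\<integral>\<^sup>+y. T n x y \<partial>\<nu>) / h n \<partial>\<mu>)"
    by (rule nn_integral_liminf) measurable
  also have "\<dots> \<le> liminf (\<lambda>n. emeasure \<nu> W)"
    using ub by (intro Liminf_mono always_eventually) auto
  also have "\<dots> = emeasure \<nu> W" by (simp add: Liminf_const)
  finally show ?thesis by (simp add: W_def)
qed

text \<open>Both measures have mass 1, so domination on open sets turns into the opposite inequality
  on closed sets. Open sets are increasing unions of closed ones, so the opposite inequality holds
  for them as well, and open sets generate.\<close>

lemma haar_dominated_eq:
  assumes \<mu>: "is_grassmann_haar d N \<mu>" and \<nu>: "is_grassmann_haar d N \<nu>"
    and dom: "\<And>V. open V \<Longrightarrow> emeasure \<mu> (proj_matrix N -` V \<inter> grassmannian d N) \<le> emeasure \<nu> (proj_matrix N -` V \<inter> grassmannian d N)"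
  shows "\<mu> = \<nu>"
proof -
  let ?G = "grassmannian d N"
  interpret M: prob_space \<mu> using \<mu> by (simp add: is_grassmann_haar_def)
  interpret K: prob_space \<nu> using \<nu> by (simp add: is_grassmann_haar_def)
  have sm: "sets \<mu> = sets (grassmann_borel d N)" and sn: "sets \<nu> = sets (grassmann_borel d N)"
    using \<mu> \<nu> by (simp_all add: is_grassmann_haar_def)
  have spm: "space \<mu> = ?G" and spn: "space \<nu> = ?G" using haar_space \<mu> \<nu> by auto
  have gset: "proj_matrix N -` A \<inter> ?G \<in> sets (grassmann_borel d N)" if "A \<in> sets borel" for A
    unfolding grassmann_borel_def using that by (intro in_vimage_algebra) auto
  have closed: "emeasure \<nu> (proj_matrix N -` A \<inter> ?G) \<le> emeasure \<mu> (proj_matrix N -` A \<inter> ?G)" if "closed A" for A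
  proof -
    have o: "open (- A)" using that by (simp add: open_Compl)
    have e: "?G - (proj_matrix N -` (- A) \<inter> ?G) = proj_matrix N -` A \<inter> ?G" by auto
    have s: "proj_matrix N -` (- A) \<inter> ?G \<in> sets (grassmann_borel d N)" using o by (intro gset) auto
    have "emeasure \<nu> (proj_matrix N -` A \<inter> ?G) = 1 - emeasure \<nu> (proj_matrix N -` (- A) \<inter> ?G)"
      using emeasure_compl[of "proj_matrix N -` (- A) \<inter> ?G" \<nu>] s sn e K.emeasure_space_1 by (simp add: spn)
    also have "\<dots> \<le> 1 - emeasure \<mu> (proj_matrix N -` (- A) \<inter> ?G)"
      using dom[OF o] by (intro ennreal_minus_mono) auto
    also have "\<dots> = emeasure \<mu> (proj_matrix N -` A \<inter> ?G)"
      using emeasure_compl[of "proj_matrix N -` (- A) \<inter> ?G" \<mu>] s sm e M.emeasure_space_1 by (simp add: spm)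
    finally show ?thesis .
  qed
  have open_ge: "emeasure \<nu> (proj_matrix N -` V \<inter> ?G) \<le> emeasure \<mu> (proj_matrix N -` V \<inter> ?G)" if V: "open V" for V
  proof (cases "V = UNIV")
    case True
    then show ?thesis using closed[of UNIV] by simp
  next
    case False
    \<comment> \<open>Closed sets exhausting \<open>V\<close>. The distance to the empty set is 0 by
      convention, whence the separate case \<open>V = UNIV\<close>.\<close>
    define A where "A n = {x. 1 / real (Suc n) \<le> infdist x (- V)}" for n
    have clA: "closed (A n)" for n unfolding A_def by (intro closed_Collect_le continuous_intros)
    have incA: "A m \<subseteq> A n" if "m \<le> n" for m n
    proof -
      have "1 / real (Suc n) \<le> 1 / real (Suc m)" using that by (intro divide_left_mono) auto
      then show ?thesis by (auto simp: A_def)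
    qed
    have UA: "(\<Union>n. A n) = V"
    proof (intro set_eqI iffI)
      fix x assume "x \<in> (\<Union>n. A n)"
      then obtain n where n: "1 / real (Suc n) \<le> infdist x (- V)" by (auto simp: A_def)
      have "0 < 1 / real (Suc n)" by simp
      then have "infdist x (- V) \<noteq> 0" using n by linarith
      then show "x \<in> V" using infdist_zero[of x "- V"] by blast
    next
      fix x assume "x \<in> V"
      then have "infdist x (- V) > 0" using V False by (intro infdist_pos_not_in_closed) (auto simp: closed_Compl)
      then obtain n where "inverse (real (Suc n)) < infdist x (- V)" using reals_Archimedean by blast
      then show "x \<in> (\<Union>n. A n)" by (auto simp: A_def inverse_eq_divide intro!: exI[of _ n])
    qed
    have eq: "(\<Union>n. proj_matrix N -` A n \<inter> ?G) = proj_matrix N -` V \<inter> ?G" using UA by auto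
    have inc: "incseq (\<lambda>n. proj_matrix N -` A n \<inter> ?G)" using incA by (auto simp: incseq_def)
    have r: "range (\<lambda>n. proj_matrix N -` A n \<inter> ?G) \<subseteq> sets (grassmann_borel d N)" using gset clA by auto
    have "emeasure \<nu> (proj_matrix N -` V \<inter> ?G) = (SUP n. emeasure \<nu> (proj_matrix N -` A n \<inter> ?G))"
      using SUP_emeasure_incseq[of "\<lambda>n. proj_matrix N -` A n \<inter> ?G" \<nu>] inc r sn eq by simp
    also have "\<dots> \<le> (SUP n. emeasure \<mu> (proj_matrix N -` A n \<inter> ?G))"
      using closed clA by (intro SUP_mono) auto
    also have "\<dots> = emeasure \<mu> (proj_matrix N -` V \<inter> ?G)"
      using SUP_emeasure_incseq[of "\<lambda>n. proj_matrix N -` A n \<inter> ?G" \<mu>] inc r sm eq by simp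
    finally show ?thesis .
  qed
  let ?E = "{proj_matrix N -` V \<inter> ?G | V. V \<in> {S. open S}}"
  have gb: "sets (grassmann_borel d N) = sigma_sets ?G ?E"
    unfolding grassmann_borel_def borel_def
    by (subst vimage_algebra_sigma) (auto intro!: sets_measure_of)
  show ?thesis
  proof (rule measure_eqI_generator_eq[of ?E ?G \<mu> \<nu> "\<lambda>_. ?G"])
    show "Int_stable ?E"
    proof (rule Int_stableI)
      fix a b assume "a \<in> ?E" "b \<in> ?E"
      then obtain V V' where "open V" "open V'" "a = proj_matrix N -` V \<inter> ?G" "b = proj_matrix N -` V' \<inter> ?G" by blast
      then have "a \<inter> b = proj_matrix N -` (V \<inter> V') \<inter> ?G" "open (V \<inter> V')" by auto
      then show "a \<inter> b \<in> ?E" by blast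
    qed
    show "emeasure \<mu> X = emeasure \<nu> X" if "X \<in> ?E" for X
      using that dom open_ge by (auto intro: antisym)
    have "?G = proj_matrix N -` UNIV \<inter> ?G" by auto
    then show "range (\<lambda>_. ?G) \<subseteq> ?E" by blast
  qed (use gb sm sn in auto)
qed

text \<open>One of the two possible inequalities between the ball measures holds for infinitely many
  radii. Along these radii one measure dominates the other, so convergence of the ratios need not be
  discussed.\<close>

lemma haar_unique:
  assumes \<mu>: "is_grassmann_haar d N \<mu>" and \<nu>: "is_grassmann_haar d N \<nu>" and dN: "d \<le> N"
  shows "\<mu> = \<nu>"
proof -
  obtain E0 where E0: "E0 \<in> grassmannian d N" using grassmannian_nonempty[OF dN] by blast
  let ?P = "\<lambda>n. emeasure \<mu> (gball d N E0 n) \<le> emeasure \<nu> (gball d N E0 n)"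
  show ?thesis
  proof (cases "infinite {n. ?P n}")
    case True
    let ?s = "enumerate {n. ?P n}"
    have "strict_mono ?s" "\<And>n. ?P (?s n)"
      using strict_mono_enumerate[OF True] enumerate_in_set[OF True] by auto
    then show ?thesis using haar_dominated_open[OF \<mu> \<nu> E0] haar_dominated_eq[OF \<mu> \<nu>] by blast
  next
    case False
    then have f: "finite {n. ?P n}" by simp
    have "infinite {n. \<not> ?P n}"
    proof
      assume "finite {n. \<not> ?P n}"
      then have "finite ({n. ?P n} \<union> {n. \<not> ?P n})" using f by (rule finite_UnI[rotated])
      moreover have "{n. ?P n} \<union> {n. \<not> ?P n} = UNIV" by blast
      ultimately show False using infinite_UNIV_nat by simp
    qed
    then have T: "infinite {n. emeasure \<nu> (gball d N E0 n) \<le> emeasure \<mu> (gball d N E0 n)}" (is "infinite ?S")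
      by (rule contrapos_nn) (erule finite_subset[rotated], auto)
    have "strict_mono (enumerate ?S)" "\<And>n. enumerate ?S n \<in> ?S"
      using strict_mono_enumerate[OF T] enumerate_in_set[OF T] by auto
    then have "\<nu> = \<mu>" using haar_dominated_open[OF \<nu> \<mu> E0] haar_dominated_eq[OF \<nu> \<mu>] by blast
    then show ?thesis by simp
  qed
qed

section \<open>The column span of a Gaussian matrix\<close>

definition idx :: "nat \<Rightarrow> nat \<Rightarrow> (nat \<times> nat) set" where "idx N d = {..<N} \<times> {..<d}"

definition col :: "nat \<Rightarrow> (nat \<times> nat \<Rightarrow> real) \<Rightarrow> nat \<Rightarrow> nat \<Rightarrow> real" where
  "col N G l = (\<lambda>i. if i < N then G (i, l) else 0)"

lemma finite_idx [simp]: "finite (idx N d)"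
  by (simp add: idx_def)

lemma col_rvecs: "col N G l \<in> rvecs N"
  by (simp add: col_def rvecs_def)

lemma measurable_gs [measurable]:
  assumes "l < d"
  shows "(\<lambda>G. gs N (col N G) l i) \<in> borel_measurable (gauss (idx N d))"
  using assms
proof (induction l arbitrary: i rule: less_induct)
  case (less l)
  have c: "(\<lambda>G. col N G l i) \<in> borel_measurable (gauss (idx N d))" for i
  proof (cases "i < N")
    case True
    then have "(\<lambda>G. G (i, l)) \<in> borel_measurable (gauss (idx N d))"
      using less.prems by (subst measurable_cong_sets[OF sets_gauss refl], intro measurable_component_singleton) (simp add: idx_def)
    then show ?thesis using True by (simp add: col_def)
  qed (simp add: col_def)
  have g: "(\<lambda>G. gs N (col N G) m i) \<in> borel_measurable (gauss (idx N d))" if "m \<in> {..<l}" for m i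
    using less that by auto
  have "(\<lambda>G. col N G l i - (\<Sum>m<l. (\<Sum>i<N. col N G l i * gs N (col N G) m i) /
      (\<Sum>i<N. gs N (col N G) m i * gs N (col N G) m i) * gs N (col N G) m i)) \<in> borel_measurable (gauss (idx N d))"
    by (intro borel_measurable_diff borel_measurable_sum borel_measurable_times borel_measurable_divide c g) 
  then show ?case
    by (subst gs.simps) (simp add: fun_apply sum_fun_apply rinner_def)
qed

text \<open>Linear independence of the columns, phrased through the process because this form is
  visibly measurable; \<open>nondeg_iff_dim\<close> gives the form that is visibly
  invariant.\<close>

definition nondeg :: "nat \<Rightarrow> nat \<Rightarrow> (nat \<times> nat \<Rightarrow> real) \<Rightarrow> bool" where
  "nondeg N d G \<longleftrightarrow> (\<forall>l<d. gs N (col N G) l \<noteq> 0)"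

lemma nondeg_onb: "nondeg N d G \<Longrightarrow> onb N (gse N (col N G)) d (span (col N G ` {..<d}))"
  unfolding nondeg_def by (intro gse_onb col_rvecs) auto

lemma nondeg_iff_dim: "nondeg N d G \<longleftrightarrow> dim (span (col N G ` {..<d})) = d"
  using onb_dim[OF nondeg_onb] gs_nonzero[of "col N G" d] unfolding nondeg_def by blast

lemma gs_rvecs_zero_iff: "gs N (col N G) l = 0 \<longleftrightarrow> (\<forall>i<N. gs N (col N G) l i = 0)"
proof
  assume *: "\<forall>i<N. gs N (col N G) l i = 0"
  have "gs N (col N G) l \<in> rvecs N" by (intro gs_rvecs col_rvecs)
  then show "gs N (col N G) l = 0" using * rvecs_memD by (metis ext leI zero_fun_apply)
qed (simp add: zero_fun_apply)

lemma sets_gs_zero: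
  assumes "l < d"
  shows "{G\<in>space (gauss (idx N d)). gs N (col N G) l = 0} \<in> sets (gauss (idx N d))"
proof -
  have "{G\<in>space (gauss (idx N d)). gs N (col N G) l = 0} =
      {G\<in>space (gauss (idx N d)). \<forall>i\<in>{..<N}. gs N (col N G) l i = 0}"
    using gs_rvecs_zero_iff by auto
  also have "\<dots> \<in> sets (gauss (idx N d))" using measurable_gs[OF assms] by measurable
  finally show ?thesis .
qed

text \<open>The l-th vector vanishes only if column l lies in the span of the earlier columns. For
  fixed other columns this forces column l into a hyperplane, a Gaussian null set; Fubini does the
  rest.\<close>

lemma gs_zero_null:
  assumes l: "l < d" and dN: "d \<le> N"
  shows "emeasure (gauss (idx N d)) {G\<in>space (gauss (idx N d)). gs N (col N G) l = 0} = 0"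
proof -
  define J where "J = {..<N} \<times> {l}"
  define I where "I = idx N d - J"
  have IJ: "I \<inter> J = {}" "I \<union> J = idx N d" "finite I" "finite J"
    using l by (auto simp: I_def J_def idx_def)
  let ?D = "{G\<in>space (gauss (idx N d)). gs N (col N G) l = 0}"
  have D: "?D \<in> sets (gauss (idx N d))" by (rule sets_gs_zero[OF l])
  have m: "(indicator ?D :: _ \<Rightarrow> ennreal) \<in> borel_measurable (PiM (I \<union> J) (\<lambda>_. density lborel std_normal_density))"
    using D unfolding IJ gauss_def by simp
  have inner: "(\<integral>\<^sup>+y. indicator ?D (merge I J (x, y)) \<partial>gauss J) = 0" for x
  proof -
    define E where "E = span (col N x ` {..<l})"
    have "col N x ` {..<l} \<subseteq> rvecs N" using col_rvecs by auto
    then have E: "subspace E" "E \<subseteq> rvecs N"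
      unfolding E_def using span_minimal[OF _ subspace_rvecs] by auto
    have "dim E \<le> card (col N x ` {..<l})" unfolding E_def by (intro dim_le_card) auto
    also have "\<dots> \<le> l" using card_image_le[of "{..<l}"] by simp
    finally have dE: "dim E < N" using l dN by simp
    obtain e where e: "onb N e (dim E) E" "onb N e N (rvecs N)" using onb_extension[OF E] by blast
    \<comment> \<open>The first basis vector beyond \<open>E\<close>; it exists because dim E \<le>
      l < N. It is the normal vector of the hyperplane.\<close>
    define \<theta> where "\<theta> = e (dim E)"
    have \<theta>r: "\<theta> \<in> rvecs N" "rinner N \<theta> \<theta> = 1"
      using e(2) dE by (auto simp: onb_def orthonormal_def \<theta>_def)
    have \<theta>E: "rinner N \<theta> v = 0" if "v \<in> E" for v
    proof (rule rinner_span_zero[of "e ` {..<dim E}"])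
      show "v \<in> span (e ` {..<dim E})" using that e(1) by (simp add: onb_def)
      fix b assume "b \<in> e ` {..<dim E}"
      then show "rinner N \<theta> b = 0" using e(2) dE unfolding \<theta>_def by (auto simp: onb_def orthonormal_def)
    qed
    define a :: "nat \<times> nat \<Rightarrow> real" where "a p = \<theta> (fst p)" for p
    have a0: "\<exists>p\<in>J. a p \<noteq> 0"
    proof (rule ccontr)
      assume "\<not> ?thesis"
      then have "\<theta> i = 0" if "i < N" for i using that by (auto simp: J_def a_def)
      then have "rinner N \<theta> \<theta> = 0" by (simp add: rinner_def)
      then show False using \<theta>r by simp
    qed
    have "(\<integral>\<^sup>+y. indicator ?D (merge I J (x, y)) \<partial>gauss J)
      \<le> (\<integral>\<^sup>+y. indicator {y\<in>space (gauss J). (\<Sum>p\<in>J. a p * y p) = 0} y \<partial>gauss J)"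
    proof (rule nn_integral_mono)
      fix y assume y: "y \<in> space (gauss J)"
      have "(\<Sum>p\<in>J. a p * y p) = 0" if "merge I J (x, y) \<in> ?D"
      proof -
        let ?G = "merge I J (x, y)"
        have cm: "col N ?G m = col N x m" if "m < l" for m
          using that l IJ(1) unfolding col_def by (intro ext) (auto simp: I_def J_def idx_def)
        have 0: "gs N (col N ?G) l = 0" using that by simp
        have "col N ?G l = (\<Sum>m<l. (rinner N (col N ?G l) (gs N (col N ?G) m) / rinner N (gs N (col N ?G) m) (gs N (col N ?G) m)) *\<^sub>R gs N (col N ?G) m)"
          using 0 by (subst (asm) gs.simps) simp
        also have "\<dots> \<in> span (gs N (col N ?G) ` {..<l})"
          by (intro span_sum span_scale span_base imageI)
        also have "\<dots> = span (col N ?G ` {..<l})" by (rule gs_span)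
        also have "col N ?G ` {..<l} = col N x ` {..<l}" using cm by (intro image_cong) auto
        finally have "col N ?G l \<in> E" by (simp add: E_def)
        from \<theta>E[OF this] have "(\<Sum>i<N. \<theta> i * ?G (i, l)) = 0" by (simp add: rinner_def col_def)
        moreover have "(\<Sum>p\<in>J. a p * y p) = (\<Sum>i<N. \<theta> i * y (i, l))"
        proof -
          have "J = (\<lambda>i. (i, l)) ` {..<N}" by (auto simp: J_def)
          then show ?thesis by (simp add: sum.reindex inj_on_def a_def)
        qed
        moreover have "?G (i, l) = y (i, l)" if "i < N" for i
          using that IJ(1) by (simp add: J_def)
        ultimately show ?thesis by simp
      qed
      then show "indicator ?D (merge I J (x, y)) \<le> (indicator {y\<in>space (gauss J). (\<Sum>p\<in>J. a p * y p) = 0} y :: ennreal)"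
        using y by (auto simp: indicator_def)
    qed
    also have "\<dots> = emeasure (gauss J) {y\<in>space (gauss J). (\<Sum>p\<in>J. a p * y p) = 0}"
    proof (rule nn_integral_indicator)
      have [measurable]: "(\<lambda>y. y p) \<in> borel_measurable (gauss J)" if "p \<in> J" for p
        using that by (subst measurable_cong_sets[OF sets_gauss refl]) (rule measurable_component_singleton)
      show "{y\<in>space (gauss J). (\<Sum>p\<in>J. a p * y p) = 0} \<in> sets (gauss J)" by measurable
    qed
    also have "\<dots> = 0" using gauss_hyperplane_null[OF IJ(4) a0] .
    finally show ?thesis by simp
  qed
  have "emeasure (gauss (idx N d)) ?D = (\<integral>\<^sup>+G. indicator ?D G \<partial>gauss (idx N d))"
    using D by simp
  also have "\<dots> = (\<integral>\<^sup>+x. (\<integral>\<^sup>+y. indicator ?D (merge I J (x, y)) \<partial>gauss J) \<partial>gauss I)"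
    using gauss.product_nn_integral_fold[OF IJ(1,3,4) m] unfolding IJ(2) gauss_def .
  also have "\<dots> = 0" unfolding inner by simp
  finally show ?thesis .
qed

lemma AE_nondeg:
  assumes "d \<le> N" shows "AE G in gauss (idx N d). nondeg N d G"
proof -
  have "AE G in gauss (idx N d). \<forall>l\<in>{..<d}. gs N (col N G) l \<noteq> 0"
  proof (rule AE_finite_allI)
    fix l assume l: "l \<in> {..<d}"
    show "AE G in gauss (idx N d). gs N (col N G) l \<noteq> 0"
      by (rule AE_I[OF _ gs_zero_null[of l d N] sets_gs_zero[of l d N]]) (use l assms in auto)
  qed auto
  then show ?thesis by (simp add: nondeg_def Ball_def)
qed

text \<open>The value in the degenerate case is arbitrary; it makes the map total with values in the
  Grassmannian.\<close>

definition colspan :: "nat \<Rightarrow> nat \<Rightarrow> (nat \<times> nat \<Rightarrow> real) \<Rightarrow> (nat \<Rightarrow> real) set" where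
  "colspan N d G = (if nondeg N d G then span (col N G ` {..<d}) else span (uvec ` {..<d}))"

lemma colspan_grassmannian: "d \<le> N \<Longrightarrow> colspan N d G \<in> grassmannian d N"
  unfolding colspan_def using onb_grassmannian[OF nondeg_onb[of N d G]] grassmannian_nonempty by auto

lemma sets_nondeg: "{G\<in>space (gauss (idx N d)). nondeg N d G} \<in> sets (gauss (idx N d))"
proof -
  have "{G\<in>space (gauss (idx N d)). nondeg N d G} =
      space (gauss (idx N d)) - (\<Union>l\<in>{..<d}. {G\<in>space (gauss (idx N d)). gs N (col N G) l = 0})"
    by (auto simp: nondeg_def)
  also have "\<dots> \<in> sets (gauss (idx N d))"
    using sets_gs_zero by (intro sets.Diff sets.top sets.finite_UN) auto
  finally show ?thesis .
qed

lemma measurable_colspan: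
  assumes "d \<le> N"
  shows "colspan N d \<in> measurable (gauss (idx N d)) (grassmann_borel d N)"
proof (rule measurable_grassmann_borelI)
  fix i j
  define H where "H G = (\<Sum>l<d. (1 / sqrt (\<Sum>k<N. gs N (col N G) l k * gs N (col N G) l k) * gs N (col N G) l i) *
        (1 / sqrt (\<Sum>k<N. gs N (col N G) l k * gs N (col N G) l k) * gs N (col N G) l j))" for G
  have g: "(\<lambda>G. gs N (col N G) l i) \<in> borel_measurable (gauss (idx N d))" if "l \<in> {..<d}" for l i
    using that by (intro measurable_gs) auto
  have sq: "(\<lambda>G. sqrt (\<Sum>k<N. gs N (col N G) l k * gs N (col N G) l k)) \<in> borel_measurable (gauss (idx N d))"
    if "l \<in> {..<d}" for l
    using g[OF that] by measurable
  have "H \<in> borel_measurable (gauss (idx N d))"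
    unfolding H_def by (intro borel_measurable_sum borel_measurable_times borel_measurable_divide
       borel_measurable_const g sq)
  then have "(\<lambda>G. if nondeg N d G then H G else proj_matrix N (span (uvec ` {..<d})) i j) \<in> borel_measurable (gauss (idx N d))"
    using sets_nondeg by (intro measurable_If) auto
  moreover have "proj_matrix N (colspan N d G) i j = (if nondeg N d G then H G else proj_matrix N (span (uvec ` {..<d})) i j)" for G
    using proj_matrix_onb[OF nondeg_onb[of N d G], of i j]
    by (simp add: colspan_def H_def gse_def rinner_def fun_apply)
  ultimately show "(\<lambda>G. proj_matrix N (colspan N d G) i j) \<in> borel_measurable (gauss (idx N d))" by simp
qed (use colspan_grassmannian assms in auto)

definition gauss_haar :: "nat \<Rightarrow> nat \<Rightarrow> (nat \<Rightarrow> real) set measure" where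
  "gauss_haar d N = distr (gauss (idx N d)) (grassmann_borel d N) (colspan N d)"

text \<open>Applying \<open>U\<close> to the column span amounts to applying it to every column, and
  this acts on the N d matrix entries as an orthogonal matrix, under which the Gaussian measure is
  invariant.\<close>

lemma gauss_haar_invariant:
  assumes dN: "d \<le> N" and U: "orthogonal_map N U" and A: "A \<in> sets (grassmann_borel d N)"
  shows "emeasure (gauss_haar d N) ((\<lambda>E. U ` E) ` A) = emeasure (gauss_haar d N) A"
proof -
  let ?I = "idx N d"
  let ?g = "gauss ?I"
  \<comment> \<open>Block diagonal, with one copy of the matrix of \<open>U\<close> for each
    column.\<close>
  define M :: "nat \<times> nat \<Rightarrow> nat \<times> nat \<Rightarrow> real"
    where "M p q = of_bool (snd p = snd q) * U (uvec (fst q)) (fst p)" for p q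
  note lin = orthogonal_mapD(1)[OF U]
  have col1: "(\<Sum>i<N. U (uvec a) i * U (uvec b) i) = of_bool (a = b)" if "a < N" "b < N" for a b
    using orthogonal_mapD(4)[OF U uvec_rvecs uvec_rvecs, of a b] that
    by (simp add: rinner_def) (simp add: uvec_def of_bool_def if_distrib[of "\<lambda>x. x * _"] sum.delta cong: if_cong)
  \<comment> \<open>Orthonormality of the rows comes from surjectivity: a preimage of
    \<open>uvec i\<close> has the i-th row of \<open>U\<close> as its coordinates.\<close>
  have row1: "(\<Sum>a<N. U (uvec a) i * U (uvec a) j) = of_bool (i = j)" if "i < N" "j < N" for i j
  proof -
    have "uvec i \<in> U ` rvecs N" using orthogonal_mapD(2)[OF U] uvec_rvecs[OF that(1)] by simp
    then obtain w where w: "w \<in> rvecs N" "U w = uvec i" by auto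
    have wa: "w a = U (uvec a) i" if "a < N" for a
    proof -
      have "w a = rinner N w (uvec a)" using that by (simp add: rinner_uvec)
      also have "\<dots> = rinner N (U w) (U (uvec a))" using orthogonal_mapD(4)[OF U w(1) uvec_rvecs[OF that]] by simp
      also have "\<dots> = U (uvec a) i" using w(2) \<open>i < N\<close> by (simp add: rinner_uvec_left)
      finally show ?thesis .
    qed
    have "(\<Sum>a<N. U (uvec a) i * U (uvec a) j) = U w j"
      using linear_rvecs_expand[OF lin w(1), of j] wa by simp
    also have "\<dots> = of_bool (i = j)" using w(2) by (auto simp: uvec_def)
    finally show ?thesis .
  qed
  have sumI: "(\<Sum>r\<in>?I. f r) = (\<Sum>l<d. \<Sum>i<N. f (i, l))" for f :: "nat \<times> nat \<Rightarrow> real"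
    unfolding idx_def by (subst sum.swap) (simp add: sum.cartesian_product)
  have OM: "orth_matrix ?I M"
    unfolding orth_matrix_def
  proof (intro ballI conjI)
    fix p q assume "p \<in> ?I" "q \<in> ?I"
    then obtain i l j m where pq: "p = (i, l)" "q = (j, m)" "i < N" "j < N" "l < d" "m < d"
      by (auto simp: idx_def)
    have *: "(\<Sum>i<N. (of_bool P * x i) * (of_bool Q * y i)) = of_bool P * (of_bool Q * (\<Sum>i<N. x i * y i))"
      for P Q and x y :: "nat \<Rightarrow> real"
      by (cases P; cases Q; simp)
    have "(\<Sum>r\<in>?I. M p r * M q r) = (\<Sum>k<d. of_bool (l = k) * (of_bool (m = k) * (\<Sum>a<N. U (uvec a) i * U (uvec a) j)))"
      unfolding sumI pq M_def fst_conv snd_conv * ..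
    also have "\<dots> = of_bool (p = q)"
      using pq row1 by (subst sum_of_bool_mult) auto
    finally show "(\<Sum>r\<in>?I. M p r * M q r) = of_bool (p = q)" .
    have "(\<Sum>r\<in>?I. M r p * M r q) = (\<Sum>k<d. of_bool (l = k) * (of_bool (m = k) * (\<Sum>a<N. U (uvec i) a * U (uvec j) a)))"
      unfolding sumI pq M_def fst_conv snd_conv * by (simp only: eq_commute[of _ l] eq_commute[of _ m])
    also have "\<dots> = of_bool (p = q)"
      using pq col1 by (subst sum_of_bool_mult) auto
    finally show "(\<Sum>r\<in>?I. M r p * M r q) = of_bool (p = q)" .
  qed
  define T where "T = lmul ?I M"
  have colT: "col N (T G) l = U (col N G l)" if l: "l < d" for G l
  proof
    fix i
    show "col N (T G) l i = U (col N G l) i"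
    proof (cases "i < N")
      case True
      have "T G (i, l) = (\<Sum>r\<in>?I. M (i, l) r * G r)"
        using True l by (simp add: T_def lmul_def idx_def)
      also have "\<dots> = (\<Sum>k<d. of_bool (l = k) * (\<Sum>a<N. U (uvec a) i * G (a, k)))"
        unfolding sumI M_def by (simp add: sum_distrib_left mult.assoc)
      also have "\<dots> = (\<Sum>a<N. U (uvec a) i * G (a, l))" using l by (subst sum_of_bool_mult) auto
      also have "\<dots> = U (col N G l) i"
        using linear_rvecs_expand[OF lin col_rvecs[of N G l], of i] by (simp add: col_def mult.commute)
      finally show ?thesis using True by (simp add: col_def)
    next
      case False
      have "U (col N G l) \<in> rvecs N" using orthogonal_mapD(3)[OF U col_rvecs] .
      then show ?thesis using False rvecs_memD by (simp add: col_def)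
    qed
  qed
  have sp: "span (col N (T G) ` {..<d}) = U ` span (col N G ` {..<d})" for G
  proof -
    have "col N (T G) ` {..<d} = U ` col N G ` {..<d}"
      unfolding image_image using colT by (intro image_cong) auto
    then show ?thesis using linear_span_image[OF lin] by simp
  qed
  have ndT: "nondeg N d (T G)" "colspan N d (T G) = U ` colspan N d G" if "nondeg N d G" for G
  proof -
    have o: "onb N (U \<circ> gse N (col N G)) d (U ` span (col N G ` {..<d}))"
      using onb_orthogonal_map[OF U nondeg_onb[OF that]] .
    have "dim (span (col N (T G) ` {..<d})) = d" unfolding sp using onb_dim[OF o] .
    then show "nondeg N d (T G)" using nondeg_iff_dim by simp
    then show "colspan N d (T G) = U ` colspan N d G" using that sp by (simp add: colspan_def)
  qed
  let ?UA = "(\<lambda>E. U ` E) ` A"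
  have UA: "?UA \<in> sets (grassmann_borel d N)" by (rule orthogonal_image_sets[OF U A])
  note mc = measurable_colspan[OF dN]
  have AG: "A \<subseteq> grassmannian d N" using sets.sets_into_space[OF A] by (simp add: space_grassmann_borel)
  have inUA: "U ` E \<in> ?UA \<longleftrightarrow> E \<in> A" if "E \<in> grassmannian d N" for E
    using orthogonal_map_image_inj[OF U that] AG by blast
  have S: "colspan N d -` ?UA \<inter> space ?g \<in> sets ?g" using measurable_sets[OF mc UA] .
  have "emeasure (gauss_haar d N) ?UA = emeasure ?g (colspan N d -` ?UA \<inter> space ?g)"
    unfolding gauss_haar_def by (rule emeasure_distr[OF mc UA])
  also have "\<dots> = emeasure ?g (T -` (colspan N d -` ?UA \<inter> space ?g) \<inter> space ?g)"
    unfolding T_def using emeasure_gauss_lmul[OF _ OM S] by simp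
  also have "\<dots> = emeasure ?g (colspan N d -` A \<inter> space ?g)"
  proof (rule emeasure_eq_AE)
    show "AE G in ?g. (G \<in> T -` (colspan N d -` ?UA \<inter> space ?g) \<inter> space ?g) = (G \<in> colspan N d -` A \<inter> space ?g)"
      using AE_nondeg[OF dN] AE_space
    proof eventually_elim
      case (elim G)
      have "T G \<in> space ?g" by (simp add: T_def lmul_def space_gauss)
      then show ?case using elim ndT(2)[OF elim(1)] inUA[OF colspan_grassmannian[OF dN]] by simp
    qed
    have "lmul ?I M \<in> measurable ?g ?g"
    proof -
      have s: "sets ?g = sets (lebI ?I)" unfolding sets_gauss by (intro sets_PiM_cong) auto
      show ?thesis using measurable_lmul[of ?I M] measurable_cong_sets[OF s s] by auto
    qed
    from measurable_sets[OF this S] show "T -` (colspan N d -` ?UA \<inter> space ?g) \<inter> space ?g \<in> sets ?g" by (simp add: T_def)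
    show "colspan N d -` A \<inter> space ?g \<in> sets ?g" using measurable_sets[OF mc A] .
  qed
  also have "\<dots> = emeasure (gauss_haar d N) A"
    unfolding gauss_haar_def by (rule emeasure_distr[OF mc A, symmetric])
  finally show ?thesis .
qed

lemma is_grassmann_haar_gauss_haar:
  assumes "d \<le> N" shows "is_grassmann_haar d N (gauss_haar d N)"
  unfolding is_grassmann_haar_def
proof (intro conjI allI impI ballI)
  show "prob_space (gauss_haar d N)"
    unfolding gauss_haar_def using prob_space.prob_space_distr[OF prob_space_gauss measurable_colspan[OF assms]] .
qed (use gauss_haar_invariant[OF assms] in \<open>auto simp: gauss_haar_def\<close>)

lemma grassmann_haar_eq: "d \<le> N \<Longrightarrow> grassmann_haar d N = gauss_haar d N"
  unfolding grassmann_haar_def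
  using is_grassmann_haar_gauss_haar haar_unique by (intro the_equality) blast+

text \<open>The passage from Haar measure to Gaussian matrices: from here on only an exceptional set
  \<open>B\<close> of matrices has to be estimated.\<close>

lemma grassmann_haar_ge:
  assumes dN: "d \<le> N" and S: "S \<in> sets (grassmann_borel d N)" and B: "B \<in> sets (gauss (idx N d))"
    and good: "\<And>G. G \<in> space (gauss (idx N d)) \<Longrightarrow> G \<notin> B \<Longrightarrow> nondeg N d G \<Longrightarrow> span (col N G ` {..<d}) \<in> S"
  shows "measure (grassmann_haar d N) S \<ge> 1 - measure (gauss (idx N d)) B"
proof -
  interpret prob_space "gauss (idx N d)" by (rule prob_space_gauss)
  note mc = measurable_colspan[OF dN]
  have "1 - prob B = prob (space (gauss (idx N d)) - B)" using prob_compl[OF B] by simp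
  also have "\<dots> \<le> prob (colspan N d -` S \<inter> space (gauss (idx N d)))"
  proof (rule finite_measure_mono_AE)
    show "AE G in gauss (idx N d). G \<in> space (gauss (idx N d)) - B \<longrightarrow> G \<in> colspan N d -` S \<inter> space (gauss (idx N d))"
      using AE_nondeg[OF dN] AE_space
    proof eventually_elim
      case (elim G)
      then show ?case using good[of G] by (auto simp: colspan_def)
    qed
  qed (use measurable_sets[OF mc S] in auto)
  also have "\<dots> = measure (grassmann_haar d N) S"
    unfolding grassmann_haar_eq[OF dN] gauss_haar_def using measure_distr[OF mc S] by simp
  finally show ?thesis .
qed

section \<open>Complemented copies of \<open>\<ell>\<^sub>p\<^sup>k\<close> in terms of matrices\<close>

definition mv :: "nat \<Rightarrow> nat \<Rightarrow> (nat \<Rightarrow> nat \<Rightarrow> real) \<Rightarrow> (nat \<Rightarrow> real) \<Rightarrow> nat \<Rightarrow> real" where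
  "mv n m M x = (\<lambda>i. if i < n then \<Sum>j<m. M i j * x j else 0)"

lemma mv_rvecs: "mv n m M x \<in> rvecs n"
  by (simp add: mv_def rvecs_def)

lemma mv_add: "mv n m M (x + y) = mv n m M x + mv n m M y"
  by (auto simp: mv_def fun_eq_iff fun_apply algebra_simps sum.distrib)

lemma mv_scale: "mv n m M (a *\<^sub>R x) = a *\<^sub>R mv n m M x"
  by (auto simp: mv_def fun_eq_iff fun_apply algebra_simps sum_distrib_left)

lemma linear_mv: "linear (mv n m M)"
  by (rule linearI) (simp_all add: mv_add mv_scale)

text \<open>Maps between spaces with explicit carrier are linear on the carrier only, hence the
  restricted hypotheses. A matrix has finitely many entries, which is what the compactness argument
  needs.\<close>

lemma mv_of_additive:
  assumes add: "\<And>x y. x \<in> rvecs m \<Longrightarrow> y \<in> rvecs m \<Longrightarrow> T (x + y) = T x + T y"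
    and scale: "\<And>a x. x \<in> rvecs m \<Longrightarrow> T (a *\<^sub>R x) = a *\<^sub>R T x"
    and T: "\<And>x. x \<in> rvecs m \<Longrightarrow> T x \<in> rvecs n" and x: "x \<in> rvecs m"
  shows "T x = mv n m (\<lambda>i j. T (uvec j) i) x"
proof -
  have z: "(0 :: nat \<Rightarrow> real) \<in> rvecs m" by (rule subspace_0[OF subspace_rvecs])
  have T0: "T 0 = 0" using scale[OF z, of 0] by simp
  have "T (\<Sum>j<l. x j *\<^sub>R uvec j) = (\<Sum>j<l. x j *\<^sub>R T (uvec j))" if "l \<le> m" for l
    using that
  proof (induction l)
    case 0 show ?case using T0 by simp
  next
    case (Suc l)
    have "(\<Sum>j<l. x j *\<^sub>R uvec j) \<in> rvecs m"
      using Suc.prems by (intro subspace_sum subspace_scale subspace_rvecs uvec_rvecs) auto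
    moreover have "uvec l \<in> rvecs m" using Suc.prems by (intro uvec_rvecs) auto
    ultimately show ?case
      using Suc by (simp add: add scale subspace_scale[OF subspace_rvecs])
  qed
  from this[of m] have "T x = (\<Sum>j<m. x j *\<^sub>R T (uvec j))" using rvecs_expand[OF x] by simp
  then have e: "T x i = (\<Sum>j<m. T (uvec j) i * x j)" for i
    by (simp add: sum_fun_apply fun_apply mult.commute)
  show ?thesis
  proof
    fix i
    show "T x i = mv n m (\<lambda>i j. T (uvec j) i) x i"
      using e[of i] rvecs_memD[OF T[OF x], of i] by (auto simp: mv_def)
  qed
qed

lemma mv_uvec: "j < m \<Longrightarrow> i < n \<Longrightarrow> mv n m M (uvec j) i = M i j"
  by (simp add: mv_def uvec_def of_bool_def if_distrib sum.delta cong: if_cong)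

text \<open>The orthogonal projection as a map that is linear on all sequences and whose dependence
  on \<open>E\<close> is entirely through its matrix.\<close>

definition pmv :: "nat \<Rightarrow> (nat \<Rightarrow> real) set \<Rightarrow> (nat \<Rightarrow> real) \<Rightarrow> nat \<Rightarrow> real" where
  "pmv N E = mv N N (proj_matrix N E)"

lemma pmv_onb: assumes "onb N e d E" shows "pmv N E x = oproj N e d x"
proof
  fix i
  have "(\<Sum>j<N. (\<Sum>l<d. e l i * e l j) * x j) = (\<Sum>j<N. \<Sum>l<d. x j * e l j * e l i)"
    by (simp add: sum_distrib_left sum_distrib_right algebra_simps)
  also have "\<dots> = (\<Sum>l<d. \<Sum>j<N. x j * e l j * e l i)" by (rule sum.swap)
  finally have 1: "(\<Sum>j<N. (\<Sum>l<d. e l i * e l j) * x j) = oproj N e d x i"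
    by (simp add: oproj_def rinner_def sum_fun_apply fun_apply sum_distrib_right)
  have "oproj N e d x \<in> rvecs N" using oproj_mem[OF assms] onb_subset[OF assms] by blast
  then show "pmv N E x i = oproj N e d x i"
    using 1 rvecs_memD by (auto simp: pmv_def mv_def proj_matrix_onb[OF assms])
qed

lemma pmv_mem: "E \<in> grassmannian d N \<Longrightarrow> pmv N E x \<in> E"
  using grassmannian_onb pmv_onb oproj_mem by metis

lemma pmv_fix: "E \<in> grassmannian d N \<Longrightarrow> x \<in> E \<Longrightarrow> pmv N E x = x"
  using grassmannian_onb pmv_onb oproj_fix by metis

lemma pmv_orth: "E \<in> grassmannian d N \<Longrightarrow> y \<in> E \<Longrightarrow> rinner N (x - pmv N E x) y = 0"
  using grassmannian_onb pmv_onb oproj_orth by metis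

lemma linear_pmv: "linear (pmv N E)"
  unfolding pmv_def by (rule linear_mv)

lemma grassmannianD:
  "E \<in> grassmannian d N \<Longrightarrow> subspace E" "E \<in> grassmannian d N \<Longrightarrow> E \<subseteq> rvecs N"
  by (auto simp: grassmannian_def)

text \<open>A common form for subspaces of l_infinity and quotients of l_1: the latter are carried
  by \<open>E\<close> itself with the quotient norm.\<close>

definition espace :: "(nat \<Rightarrow> real) set \<Rightarrow> ((nat \<Rightarrow> real) \<Rightarrow> real) \<Rightarrow> (nat \<Rightarrow> real) nspace" where
  "espace E n = \<lparr>ns_carrier = E, ns_add = (+), ns_scale = (*\<^sub>R), ns_norm = n\<rparr>"

lemma espace_simps [simp]:
  "ns_carrier (espace E n) = E" "ns_add (espace E n) = (+)" "ns_scale (espace E n) = (*\<^sub>R)"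
  "ns_norm (espace E n) = n"
  by (simp_all add: espace_def)

lemma lp_space_simps [simp]:
  "ns_carrier (lp_space p n) = rvecs n" "ns_add (lp_space p n) = (+)" "ns_scale (lp_space p n) = (*\<^sub>R)"
  "ns_norm (lp_space p n) = lp_norm p n"
  by (simp_all add: lp_space_def)

lemma ns_restrict_simps [simp]:
  "ns_carrier (ns_restrict X F) = F" "ns_add (ns_restrict X F) = ns_add X"
  "ns_scale (ns_restrict X F) = ns_scale X" "ns_norm (ns_restrict X F) = ns_norm X"
  by (simp_all add: ns_restrict_def)

lemma ns_opnorm_leI:
  assumes "\<And>x. x \<in> ns_carrier X \<Longrightarrow> ns_norm X x \<le> 1 \<Longrightarrow> ns_norm Y (T x) \<le> c"
  shows "ns_opnorm X Y T \<le> ennreal c"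
  unfolding ns_opnorm_def using assms by (intro SUP_least) (auto intro: ennreal_leI)

text \<open>The record type imposes no axioms, so homogeneity is assumed only at the vector in
  question. Rescaling to norm 1 requires the separate hypothesis for norm 0.\<close>

lemma ns_opnorm_bound:
  assumes "ns_opnorm X Y T \<le> ennreal c" "c \<ge> 0" and x: "x \<in> ns_carrier X" "ns_norm X x \<ge> 0"
    and sc: "\<And>a. ns_scale X a x \<in> ns_carrier X" "\<And>a. ns_norm X (ns_scale X a x) = \<bar>a\<bar> * ns_norm X x"
      "\<And>a. ns_norm Y (T (ns_scale X a x)) = \<bar>a\<bar> * ns_norm Y (T x)"
    and z: "ns_norm X x = 0 \<Longrightarrow> ns_norm Y (T x) = 0"
  shows "ns_norm Y (T x) \<le> c * ns_norm X x"
proof (cases "ns_norm X x = 0")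
  case False
  let ?a = "1 / ns_norm X x"
  have pos: "ns_norm X x > 0" using False x(2) by simp
  then have "ns_norm X (ns_scale X ?a x) \<le> 1" unfolding sc(2) by simp
  then have "ennreal (ns_norm Y (T (ns_scale X ?a x))) \<le> ns_opnorm X Y T"
    unfolding ns_opnorm_def using sc(1) by (intro SUP_upper) auto
  also have "\<dots> \<le> ennreal c" by fact
  finally have "ns_norm Y (T (ns_scale X ?a x)) \<le> c" using assms(2) by (simp add: ennreal_le_iff)
  then show ?thesis unfolding sc(3) using pos by (simp add: field_simps)
qed (use z in simp)

text \<open>\<open>A\<close> embeds the model space, \<open>B\<close> is a left inverse of it, and A
  B is the projection onto the image. The normalisation puts the whole distortion on one side of the
  isomorphism.\<close>

lemma contains_complemented_lpI:
  assumes E: "subspace E" and AB: "linear A" "linear B" and C: "C \<ge> 0"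
    and A: "\<And>y. y \<in> rvecs k \<Longrightarrow> A y \<in> E" and B: "\<And>x. x \<in> E \<Longrightarrow> B x \<in> rvecs k"
    and BA: "\<And>y. y \<in> rvecs k \<Longrightarrow> B (A y) = y"
    and Q: "\<And>x. x \<in> E \<Longrightarrow> n (A (B x)) \<le> C * n x"
    and l: "\<And>y. y \<in> rvecs k \<Longrightarrow> lp_norm p k y \<le> n (A y)"
    and u: "\<And>y. y \<in> rvecs k \<Longrightarrow> n (A y) \<le> C * lp_norm p k y"
  shows "contains_complemented_lp C p k (espace E n)"
proof -
  define F where "F = A ` rvecs k"
  have FE: "F \<subseteq> E" using A by (auto simp: F_def)
  have AB': "A (B x) = x" if "x \<in> F" for x using that BA by (auto simp: F_def)
  have sF: "subspace F" unfolding F_def by (rule linear_subspace_image[OF AB(1) subspace_rvecs])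
  have "ns_subspace (espace E n) F"
    using sF FE subspace_0[OF sF] by (auto simp: ns_subspace_def subspace_def)
  moreover have "C_complemented C (espace E n) F"
    unfolding C_complemented_def
  proof (intro exI[of _ "\<lambda>x. A (B x)"] conjI)
    show "ns_linear (espace E n) (espace E n) (\<lambda>x. A (B x))"
      using A B AB by (auto simp: ns_linear_def linear_add linear_scale)
    show "(\<lambda>x. A (B x)) ` ns_carrier (espace E n) = F"
    proof
      show "F \<subseteq> (\<lambda>x. A (B x)) ` ns_carrier (espace E n)"
        using AB' FE by (auto simp: image_iff) (metis subsetD)
    qed (use B in \<open>auto simp: F_def\<close>)
    show "ns_opnorm (espace E n) (espace E n) (\<lambda>x. A (B x)) \<le> ennreal C"
    proof (rule ns_opnorm_leI)
      fix x assume x: "x \<in> ns_carrier (espace E n)" "ns_norm (espace E n) x \<le> 1"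
      then have "n (A (B x)) \<le> C * n x" using Q by simp
      also have "\<dots> \<le> C * 1" using x C by (intro mult_left_mono) auto
      finally show "ns_norm (espace E n) (A (B x)) \<le> C" by simp
    qed
  qed (use AB' in auto)
  moreover have "C_isomorphic C (ns_restrict (espace E n) F) (lp_space p k)"
  proof -
    let ?X = "ns_restrict (espace E n) F" and ?Y = "lp_space p k"
    have bij: "bij_betw B F (rvecs k)"
      by (rule bij_betw_byWitness[where f'=A]) (use AB' BA B FE in \<open>auto simp: F_def\<close>)
    have iso: "ns_iso ?X ?Y B"
      using bij AB B FE by (auto simp: ns_iso_def ns_linear_def linear_add linear_scale)
    have inv: "inv_into F B y = A y" if "y \<in> rvecs k" for y
      using that bij BA by (intro inv_into_f_eq) (auto simp: bij_betw_def F_def)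
    have 1: "ns_opnorm ?X ?Y B \<le> ennreal 1"
    proof (rule ns_opnorm_leI)
      fix x assume x: "x \<in> ns_carrier ?X" "ns_norm ?X x \<le> 1"
      then have "lp_norm p k (B x) \<le> n (A (B x))" using B FE by (intro l) auto
      then show "ns_norm ?Y (B x) \<le> 1" using x AB' by simp
    qed
    have 2: "ns_opnorm ?Y ?X (inv_into (ns_carrier ?X) B) \<le> ennreal C"
    proof (rule ns_opnorm_leI)
      fix y assume y: "y \<in> ns_carrier ?Y" "ns_norm ?Y y \<le> 1"
      then have "n (A y) \<le> C * lp_norm p k y" using u by simp
      also have "\<dots> \<le> C * 1" using y C by (intro mult_left_mono) auto
      finally show "ns_norm ?X (inv_into (ns_carrier ?X) B y) \<le> C" using y inv by simp
    qed
    have "banach_mazur ?X ?Y \<le> ns_opnorm ?X ?Y B * ns_opnorm ?Y ?X (inv_into (ns_carrier ?X) B)"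
      unfolding banach_mazur_def using iso by (intro INF_lower) auto
    also have "\<dots> \<le> ennreal 1 * ennreal C" using 1 2 by (intro mult_mono) auto
    finally show ?thesis by (simp add: C_isomorphic_def)
  qed
  ultimately show ?thesis unfolding contains_complemented_lp_def by blast
qed

text \<open>The facts about the model norm that the limit argument uses. The bound on coordinates
  yields definiteness and bounds the matrix entries.\<close>

definition lp_admissible :: "ereal \<Rightarrow> bool" where
  "lp_admissible p \<longleftrightarrow> (\<forall>k. \<forall>y\<in>rvecs k. (\<forall>a. lp_norm p k (a *\<^sub>R y) = \<bar>a\<bar> * lp_norm p k y) \<and>
     (\<forall>j<k. \<bar>y j\<bar> \<le> lp_norm p k y) \<and> lp_norm p k y \<ge> 0)"

lemma lp_admissibleD:
  assumes "lp_admissible p" "y \<in> rvecs k"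
  shows "lp_norm p k (a *\<^sub>R y) = \<bar>a\<bar> * lp_norm p k y" "j < k \<Longrightarrow> \<bar>y j\<bar> \<le> lp_norm p k y" "lp_norm p k y \<ge> 0"
  using assms by (auto simp: lp_admissible_def)

text \<open>A converse of \<open>contains_complemented_lpI\<close> up to \<open>\<eta>\<close>, in
  terms of matrices of fixed size. For this purpose \<open>B\<close> is precomposed with the
  projection onto \<open>E\<close>, so that it is defined on all of \<open>rvecs N\<close>.\<close>

lemma contains_complemented_lpD:
  assumes E: "E \<in> grassmannian d N" and C: "C \<ge> 0" and k: "k \<ge> 1" and \<eta>: "\<eta> > 0" and p: "lp_admissible p"
    and n: "\<And>a x. x \<in> E \<Longrightarrow> n (a *\<^sub>R x) = \<bar>a\<bar> * n x" "\<And>x i. x \<in> E \<Longrightarrow> \<bar>x i\<bar> \<le> n x"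
    and X: "contains_complemented_lp C p k (espace E n)"
  shows "\<exists>A B. (\<forall>y\<in>rvecs k. mv N k A y \<in> E) \<and> (\<forall>x\<in>rvecs N. mv k N B x = mv k N B (pmv N E x)) \<and>
    (\<forall>y\<in>rvecs k. mv k N B (mv N k A y) = y) \<and> (\<forall>x\<in>E. n (mv N k A (mv k N B x)) \<le> C * n x) \<and>
    (\<forall>y\<in>rvecs k. lp_norm p k y \<le> n (mv N k A y) \<and> n (mv N k A y) \<le> (C + \<eta>) * lp_norm p k y)"
proof -
  have sE: "subspace E" and EN: "E \<subseteq> rvecs N" using grassmannianD[OF E] by auto
  have n0: "n x \<ge> 0" if "x \<in> E" for x using n(2)[OF that, of 0] by linarith
  have nz: "x = 0" if "x \<in> E" "n x = 0" for x
    using n(2)[OF that(1)] that(2) by (auto simp: fun_eq_iff zero_fun_apply)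
  have lz: "y = 0" if "y \<in> rvecs k" "lp_norm p k y = 0" for y
  proof
    fix j show "y j = 0 j"
      using lp_admissibleD(2)[OF p that(1), of j] that(2) rvecs_memD[OF that(1), of j]
      by (cases "j < k") (auto simp: zero_fun_apply)
  qed
  obtain F where F: "ns_subspace (espace E n) F" "C_complemented C (espace E n) F"
    "C_isomorphic C (ns_restrict (espace E n) F) (lp_space p k)"
    using X by (auto simp: contains_complemented_lp_def)
  have FE: "F \<subseteq> E" and F1: "\<And>x y. x \<in> F \<Longrightarrow> y \<in> F \<Longrightarrow> x + y \<in> F" "\<And>a x. x \<in> F \<Longrightarrow> a *\<^sub>R x \<in> F"
    using F(1) by (auto simp: ns_subspace_def)
  obtain Q where Q: "ns_linear (espace E n) (espace E n) Q" "Q ` E = F" "\<forall>x\<in>F. Q x = x"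
    "ns_opnorm (espace E n) (espace E n) Q \<le> ennreal C"
    using F(2) by (auto simp: C_complemented_def)
  have QF: "Q x \<in> F" if "x \<in> E" for x using Q(2) that by auto
  have Ql: "\<And>x y. x \<in> E \<Longrightarrow> y \<in> E \<Longrightarrow> Q (x + y) = Q x + Q y" "\<And>a x. x \<in> E \<Longrightarrow> Q (a *\<^sub>R x) = a *\<^sub>R Q x"
    using Q(1) by (auto simp: ns_linear_def)
  have Qn: "n (Q x) \<le> C * n x" if "x \<in> E" for x
  proof -
    have "ns_norm (espace E n) (Q x) \<le> C * ns_norm (espace E n) x"
    proof (rule ns_opnorm_bound[OF Q(4) C])
      show "ns_norm (espace E n) x = 0 \<Longrightarrow> ns_norm (espace E n) (Q x) = 0"
        using nz[OF that] Ql(2)[of 0 0] n(1)[of 0 0] subspace_0[OF sE] by simp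
      have QE: "Q x \<in> E" using QF[OF that] FE by auto
      show "ns_norm (espace E n) (Q (ns_scale (espace E n) a x)) = \<bar>a\<bar> * ns_norm (espace E n) (Q x)" for a
        using Ql(2)[OF that] n(1)[OF QE] by simp
    qed (use that n n0 subspace_scale[OF sE] in auto)
    then show ?thesis by simp
  qed
  let ?X = "ns_restrict (espace E n) F" and ?Y = "lp_space p k"
  have "banach_mazur ?X ?Y < ennreal (C + \<eta>)"
  proof -
    have "banach_mazur ?X ?Y \<le> ennreal C" using F(3) by (simp add: C_isomorphic_def)
    also have "\<dots> < ennreal (C + \<eta>)" using C \<eta> by (simp add: ennreal_less_iff)
    finally show ?thesis .
  qed
  then obtain T where T: "ns_iso ?X ?Y T"
    "ns_opnorm ?X ?Y T * ns_opnorm ?Y ?X (inv_into (ns_carrier ?X) T) < ennreal (C + \<eta>)"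
    unfolding banach_mazur_def INF_less_iff by auto
  define S where "S = inv_into F T"
  have Tb: "bij_betw T F (rvecs k)" using T(1) by (simp add: ns_iso_def)
  have Tl: "\<And>x y. x \<in> F \<Longrightarrow> y \<in> F \<Longrightarrow> T (x + y) = T x + T y" "\<And>a x. x \<in> F \<Longrightarrow> T (a *\<^sub>R x) = a *\<^sub>R T x"
    "\<And>x. x \<in> F \<Longrightarrow> T x \<in> rvecs k"
    using T(1) by (auto simp: ns_iso_def ns_linear_def)
  have ST: "S (T x) = x" if "x \<in> F" for x
    using that Tb by (simp add: S_def bij_betw_inv_into_left)
  have TS: "T (S y) = y" "S y \<in> F" if "y \<in> rvecs k" for y
    using that Tb unfolding S_def by (simp add: bij_betw_inv_into_right, metis bij_betwE bij_betw_inv_into)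
  have Sl: "S (x + y) = S x + S y" if "x \<in> rvecs k" "y \<in> rvecs k" for x y
    using ST[OF F1(1)[OF TS(2)[OF that(1)] TS(2)[OF that(2)]]] Tl(1) TS that by simp
  have Ss: "S (a *\<^sub>R x) = a *\<^sub>R S x" if "x \<in> rvecs k" for a x
    using ST[OF F1(2)[OF TS(2)[OF that]], of a] Tl(2) TS that by simp
  define \<alpha> where "\<alpha> = ns_opnorm ?X ?Y T"
  define \<beta> where "\<beta> = ns_opnorm ?Y ?X S"
  have ab: "\<alpha> * \<beta> < ennreal (C + \<eta>)" using T(2) by (simp add: \<alpha>_def \<beta>_def S_def)
  have F0: "0 \<in> F" using F1(2)[OF QF[OF subspace_0[OF sE]], of 0] by simp
  have T0: "T 0 = 0" using Tl(2)[OF F0, of 0] by simp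
  have r0: "(0 :: nat \<Rightarrow> real) \<in> rvecs k" by (rule subspace_0[OF subspace_rvecs])
  have S0: "S 0 = 0" using Ss[OF r0, of 0] by simp
  have u: "uvec 0 \<in> rvecs k" using k by (intro uvec_rvecs) auto
  have u0: "lp_norm p k (uvec 0) > 0" using lp_admissibleD(2)[OF p u, of 0] k by (simp add: uvec_def)
  have Su0: "n (S (uvec 0)) > 0"
  proof -
    have "uvec 0 0 \<noteq> (0 :: nat \<Rightarrow> real) 0" by (simp add: uvec_def zero_fun_apply)
    then have "S (uvec 0) \<noteq> 0" using TS(1)[OF u] T0 by metis
    then have "n (S (uvec 0)) \<noteq> 0" using nz TS(2)[OF u] FE by blast
    moreover have "n (S (uvec 0)) \<ge> 0" using n0 TS(2)[OF u] FE by blast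
    ultimately show ?thesis by simp
  qed
  \<comment> \<open>In \<open>ennreal\<close> the product of 0 and infinity is 0, so a finite
    product bounds its factors only if neither vanishes. The vector \<open>uvec 0\<close>, available
    as k \<ge> 1, excludes 0.\<close>
  have \<alpha>0: "\<alpha> \<noteq> 0"
  proof
    assume "\<alpha> = 0"
    then have "ns_opnorm ?X ?Y T \<le> ennreal 0" by (simp add: \<alpha>_def)
    from ns_opnorm_bound[OF this, of "S (uvec 0)"] 
    have "lp_norm p k (T (S (uvec 0))) \<le> 0 * n (S (uvec 0))"
      using TS[OF u] F1 n FE n0 Tl lp_admissibleD(1)[OF p u] Su0 by (auto simp: subset_iff)
    then show False using TS(1)[OF u] u0 by simp
  qed
  have \<beta>0: "\<beta> \<noteq> 0"
  proof
    assume "\<beta> = 0"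
    then have "ns_opnorm ?Y ?X S \<le> ennreal 0" by (simp add: \<beta>_def)
    from ns_opnorm_bound[OF this, of "uvec 0"] 
    have "n (S (uvec 0)) \<le> 0 * lp_norm p k (uvec 0)"
      using TS[OF u] F1 n FE n0 Ss lp_admissibleD[OF p u] u u0 by (auto simp: subset_iff subspace_scale[OF subspace_rvecs])
    then show False using Su0 by simp
  qed
  have fin: "\<alpha> \<noteq> \<top>" "\<beta> \<noteq> \<top>" using ab \<alpha>0 \<beta>0 by (auto simp: ennreal_mult_top ennreal_top_mult)
  obtain a b where a: "\<alpha> = ennreal a" "a \<ge> 0" and b: "\<beta> = ennreal b" "b \<ge> 0"
    using fin by (metis ennreal_enn2real enn2real_nonneg less_top)
  have apos: "a > 0" using \<alpha>0 a by (cases "a = 0") auto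
  have "ennreal (a * b) < ennreal (C + \<eta>)" using ab unfolding a(1) b(1) ennreal_mult[OF a(2) b(2)] .
  then have abC: "a * b < C + \<eta>" using a b by (simp only: ennreal_less_iff mult_nonneg_nonneg)
  have Tn: "lp_norm p k (T x) \<le> a * n x" if "x \<in> F" for x
  proof -
    have "ns_norm ?Y (T x) \<le> a * ns_norm ?X x"
    proof (rule ns_opnorm_bound)
      show "ns_opnorm ?X ?Y T \<le> ennreal a" using a by (simp add: \<alpha>_def)
      have xE: "x \<in> E" using that FE by auto
      have l0: "lp_norm p k 0 = 0" using lp_admissibleD(1)[OF p r0, of 0] by simp
      show "ns_norm ?X x = 0 \<Longrightarrow> ns_norm ?Y (T x) = 0" using nz[OF xE] T0 l0 by simp
      show "ns_norm ?Y (T (ns_scale ?X c x)) = \<bar>c\<bar> * ns_norm ?Y (T x)" for c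
        using Tl(2)[OF that] lp_admissibleD(1)[OF p Tl(3)[OF that]] by simp
      show "ns_norm ?X x \<ge> 0" using n0[OF xE] by simp
      show "ns_norm ?X (ns_scale ?X c x) = \<bar>c\<bar> * ns_norm ?X x" for c using n(1)[OF xE] by simp
    qed (use that F1 a in auto)
    then show ?thesis by simp
  qed
  have Sn: "n (S y) \<le> b * lp_norm p k y" if "y \<in> rvecs k" for y
  proof -
    have "ns_norm ?X (S y) \<le> b * ns_norm ?Y y"
    proof (rule ns_opnorm_bound)
      show "ns_opnorm ?Y ?X S \<le> ennreal b" using b by (simp add: \<beta>_def)
      have yE: "S y \<in> E" using TS(2)[OF that] FE by auto
      have l0: "n 0 = 0" using n(1)[OF subspace_0[OF sE], of 0] by simp
      show "ns_norm ?Y y = 0 \<Longrightarrow> ns_norm ?X (S y) = 0" using lz[OF that] S0 l0 by simp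
      show "ns_norm ?X (S (ns_scale ?Y c y)) = \<bar>c\<bar> * ns_norm ?X (S y)" for c
        using Ss[OF that] n(1)[OF yE] by simp
      show "ns_norm ?Y y \<ge> 0" using lp_admissibleD(3)[OF p that] by simp
      show "ns_norm ?Y (ns_scale ?Y c y) = \<bar>c\<bar> * ns_norm ?Y y" for c using lp_admissibleD(1)[OF p that] by simp
      show "ns_scale ?Y c y \<in> ns_carrier ?Y" for c using that subspace_scale[OF subspace_rvecs] by simp
    qed (use that b in auto)
    then show ?thesis by simp
  qed
  \<comment> \<open>Rescaling by the norm \<open>a\<close> of the isomorphism makes the lower
    constant 1 and the upper constant a b < C + \<eta>.\<close>
  define A0 where "A0 y = a *\<^sub>R S y" for y
  define B0 where "B0 x = (1 / a) *\<^sub>R T (Q (pmv N E x))" for x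
  note pE = pmv_mem[OF E] and pl = linear_add[OF linear_pmv] linear_scale[OF linear_pmv]
  let ?A = "\<lambda>i j. A0 (uvec j) i" and ?B = "\<lambda>i j. B0 (uvec j) i"
  have A0F: "A0 y \<in> F" if "y \<in> rvecs k" for y
    unfolding A0_def using F1(2)[OF TS(2)[OF that]] .
  have Am: "A0 y = mv N k ?A y" if "y \<in> rvecs k" for y
  proof (rule mv_of_additive[OF _ _ _ that])
    show "A0 (x + y) = A0 x + A0 y" if "x \<in> rvecs k" "y \<in> rvecs k" for x y
      using Sl[OF that] by (simp add: A0_def scaleR_add_right)
    show "A0 (c *\<^sub>R x) = c *\<^sub>R A0 x" if "x \<in> rvecs k" for c x
      using Ss[OF that] by (simp add: A0_def mult.commute)
    show "A0 x \<in> rvecs N" if "x \<in> rvecs k" for x using A0F[OF that] FE EN by auto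
  qed
  have B0r: "B0 x \<in> rvecs k" for x
    unfolding B0_def by (intro subspace_scale[OF subspace_rvecs] Tl(3) QF pE)
  have Bm: "B0 x = mv k N ?B x" if "x \<in> rvecs N" for x
  proof (rule mv_of_additive[OF _ _ _ that])
    show "B0 (x + y) = B0 x + B0 y" for x y
      using pE QF by (simp add: B0_def pl Ql Tl scaleR_add_right)
    show "B0 (c *\<^sub>R x) = c *\<^sub>R B0 x" for c x
      using pE QF by (simp add: B0_def pl Ql Tl mult.commute)
  qed (rule B0r)
  have ABx: "A0 (B0 x) = Q (pmv N E x)" for x
  proof -
    have q: "Q (pmv N E x) \<in> F" using QF pE by blast
    then have "S (B0 x) = (1 / a) *\<^sub>R Q (pmv N E x)"
      unfolding B0_def using Ss[OF Tl(3)[OF q]] ST[OF q] by simp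
    then show ?thesis using apos by (simp add: A0_def)
  qed
  show ?thesis
  proof (rule exI[of _ ?A], rule exI[of _ ?B], intro conjI ballI)
    fix y assume y: "y \<in> rvecs k"
    have Ay: "A0 y \<in> F" "A0 y \<in> E" using A0F[OF y] FE by auto
    show "mv N k ?A y \<in> E" using Am[OF y] Ay by simp
    have "B0 (A0 y) = (1 / a) *\<^sub>R T (A0 y)" unfolding B0_def using pmv_fix[OF E Ay(2)] Q(3) Ay(1) by simp
    also have "\<dots> = y" unfolding A0_def using Tl(2)[OF TS(2)[OF y]] TS(1)[OF y] apos by simp
    finally show "mv k N ?B (mv N k ?A y) = y" using Am[OF y] Bm[of "A0 y"] Ay(2) EN by auto
    have SyE: "S y \<in> E" using TS(2)[OF y] FE by auto
    have nA: "n (A0 y) = a * n (S y)" using n(1)[OF SyE, of a] apos by (simp add: A0_def)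
    show "lp_norm p k y \<le> n (mv N k ?A y)" using Tn[OF TS(2)[OF y]] TS(1)[OF y] nA Am[OF y] by simp
    have "n (A0 y) \<le> a * (b * lp_norm p k y)" unfolding nA using Sn[OF y] a by (intro mult_left_mono) auto
    also have "\<dots> = (a * b) * lp_norm p k y" by simp
    also have "\<dots> \<le> (C + \<eta>) * lp_norm p k y" using abC lp_admissibleD(3)[OF p y] by (intro mult_right_mono) auto
    finally show "n (mv N k ?A y) \<le> (C + \<eta>) * lp_norm p k y" using Am[OF y] by simp
  next
    fix x assume "x \<in> rvecs N"
    have "pmv N E x \<in> rvecs N" using pE EN by auto
    moreover have "B0 x = B0 (pmv N E x)" unfolding B0_def using pmv_fix[OF E pE] by simp
    ultimately show "mv k N ?B x = mv k N ?B (pmv N E x)" using Bm \<open>x \<in> rvecs N\<close> by metis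
  next
    fix x assume x: "x \<in> E"
    have "mv N k ?A (mv k N ?B x) = A0 (B0 x)" using Bm[of x] Am[OF B0r] x EN by auto
    then show "n (mv N k ?A (mv k N ?B x)) \<le> C * n x" using ABx[of x] pmv_fix[OF E x] Qn[OF x] by simp
  qed
qed

section \<open>Compactness and measurability\<close>

lemma bounded_family_subseq:
  fixes f :: "nat \<Rightarrow> 'i \<Rightarrow> real"
  assumes "finite I" "\<And>n i. i \<in> I \<Longrightarrow> \<bar>f n i\<bar> \<le> K"
  shows "\<exists>s. strict_mono s \<and> (\<forall>i\<in>I. convergent (\<lambda>n. f (s n) i))"
  using assms
proof (induction I rule: finite_induct)
  case empty
  show ?case by (intro exI[of _ id]) (auto simp: strict_mono_def)
next
  case (insert i I)
  then obtain s where s: "strict_mono s" "\<And>j. j \<in> I \<Longrightarrow> convergent (\<lambda>n. f (s n) j)" by auto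
  have "bounded (range (\<lambda>n. f (s n) i))"
    using insert.prems by (intro boundedI[of _ K]) auto
  then obtain l r where r: "strict_mono r" "((\<lambda>n. f (s n) i) \<circ> r) \<longlonglongrightarrow> l"
    using bounded_imp_convergent_subsequence by blast
  have "convergent (\<lambda>n. f ((s \<circ> r) n) j)" if "j \<in> insert i I" for j
  proof (cases "j = i")
    case True then show ?thesis using r(2) by (auto simp: convergent_def comp_def)
  next
    case False
    then have "convergent (\<lambda>n. f (s n) j)" using s(2) that by auto
    from convergent_subseq_convergent[OF this r(1)] show ?thesis by (simp add: comp_def)
  qed
  then show ?case using strict_mono_o[OF s(1) r(1)] by blast
qed

text \<open>The entrywise sum, matched to the l_1 norm: it bounds the l_1 norm of the difference of
  two projections of a vector.\<close>

definition gdist1 :: "nat \<Rightarrow> (nat \<Rightarrow> real) set \<Rightarrow> (nat \<Rightarrow> real) set \<Rightarrow> real" where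
  "gdist1 N E F = (\<Sum>i<N. \<Sum>j<N. \<bar>proj_matrix N E i j - proj_matrix N F i j\<bar>)"

text \<open>Covers the sup norm and the quotient norm, the latter varying with \<open>E\<close>. The
  last axiom is joint continuity in the subspace and the vector; the other bounds keep the matrices
  in a compact set.\<close>

locale norm_family =
  fixes N d :: nat and nf :: "(nat \<Rightarrow> real) set \<Rightarrow> (nat \<Rightarrow> real) \<Rightarrow> real"
  assumes nf_scale: "\<And>E a x. E \<in> grassmannian d N \<Longrightarrow> x \<in> E \<Longrightarrow> nf E (a *\<^sub>R x) = \<bar>a\<bar> * nf E x"
    and nf_coord: "\<And>E x i. E \<in> grassmannian d N \<Longrightarrow> x \<in> E \<Longrightarrow> \<bar>x i\<bar> \<le> nf E x"
    and nf_upper: "\<And>E x. E \<in> grassmannian d N \<Longrightarrow> x \<in> E \<Longrightarrow> nf E x \<le> (\<Sum>i<N. \<bar>x i\<bar>)"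
    and nf_lipschitz: "\<And>E F x y. E \<in> grassmannian d N \<Longrightarrow> F \<in> grassmannian d N \<Longrightarrow> x \<in> E \<Longrightarrow> y \<in> F \<Longrightarrow>
      nf F y \<le> nf E x + (\<Sum>i<N. \<bar>x i - y i\<bar>) + 2 * gdist1 N E F * (\<Sum>i<N. \<bar>x i\<bar>)"
begin

lemma nf_tendsto:
  assumes E: "\<And>m. E m \<in> grassmannian d N" "F \<in> grassmannian d N"
    and P: "\<And>i j. (\<lambda>m. proj_matrix N (E m) i j) \<longlonglongrightarrow> proj_matrix N F i j"
    and x: "\<And>m. x m \<in> E m" "y \<in> F" "\<And>i. (\<lambda>m. x m i) \<longlonglongrightarrow> y i"
  shows "(\<lambda>m. nf (E m) (x m)) \<longlonglongrightarrow> nf F y"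
proof -
  define D where "D m = (\<Sum>i<N. \<bar>x m i - y i\<bar>)" for m
  define G where "G m = gdist1 N (E m) F" for m
  have "(\<lambda>m. \<Sum>i<N. \<bar>x m i - y i\<bar>) \<longlonglongrightarrow> (\<Sum>i<N. \<bar>y i - y i\<bar>)"
    by (intro tendsto_sum tendsto_rabs tendsto_diff x tendsto_const)
  then have D: "D \<longlonglongrightarrow> 0" unfolding D_def by simp
  have "(\<lambda>m. \<Sum>i<N. \<Sum>j<N. \<bar>proj_matrix N (E m) i j - proj_matrix N F i j\<bar>) \<longlonglongrightarrow>
     (\<Sum>i<N. \<Sum>j<N. \<bar>proj_matrix N F i j - proj_matrix N F i j\<bar>)"
    by (intro tendsto_sum tendsto_rabs tendsto_diff P tendsto_const)
  then have G: "G \<longlonglongrightarrow> 0" unfolding G_def gdist1_def by simp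
  have X: "(\<lambda>m. \<Sum>i<N. \<bar>x m i\<bar>) \<longlonglongrightarrow> (\<Sum>i<N. \<bar>y i\<bar>)" by (intro tendsto_sum tendsto_rabs x)
  have Gs: "gdist1 N F (E m) = G m" for m unfolding G_def gdist1_def by (simp add: abs_minus_commute)
  have Ds: "(\<Sum>i<N. \<bar>y i - x m i\<bar>) = D m" for m unfolding D_def by (simp add: abs_minus_commute)
  have lo: "nf F y - D m - 2 * G m * (\<Sum>i<N. \<bar>x m i\<bar>) \<le> nf (E m) (x m)" for m
    using nf_lipschitz[OF E(1) E(2) x(1) x(2), of m] by (simp add: D_def G_def)
  have up: "nf (E m) (x m) \<le> nf F y + D m + 2 * G m * (\<Sum>i<N. \<bar>y i\<bar>)" for m
    using nf_lipschitz[OF E(2) E(1)[of m] x(2) x(1)] by (simp add: Ds Gs)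
  have l: "(\<lambda>m. nf F y - D m - 2 * G m * (\<Sum>i<N. \<bar>x m i\<bar>)) \<longlonglongrightarrow> nf F y - 0 - 2 * 0 * (\<Sum>i<N. \<bar>y i\<bar>)"
    by (intro tendsto_intros D G X)
  have u: "(\<lambda>m. nf F y + D m + 2 * G m * (\<Sum>i<N. \<bar>y i\<bar>)) \<longlonglongrightarrow> nf F y + 0 + 2 * 0 * (\<Sum>i<N. \<bar>y i\<bar>)"
    by (intro tendsto_intros D G)
  show ?thesis
    by (rule tendsto_sandwich[of "\<lambda>m. nf F y - D m - 2 * G m * (\<Sum>i<N. \<bar>x m i\<bar>)" _ _ "\<lambda>m. nf F y + D m + 2 * G m * (\<Sum>i<N. \<bar>y i\<bar>)"])
      (use lo up l u in \<open>auto intro: always_eventually\<close>)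
qed

text \<open>
  The Banach--Mazur distance is an infimum, so the \<open>m\<close>-th space only provides an isomorphism with constant
  \<open>C + 1 / (m + 1)\<close>; the slack disappears in the limit.
\<close>

lemma contains_complemented_lp_limit:
  assumes p: "lp_admissible p" and C: "C \<ge> 0" and k: "k \<ge> 1"
    and E: "\<And>m. E m \<in> grassmannian d N" "F \<in> grassmannian d N"
    and P: "\<And>i j. (\<lambda>m. proj_matrix N (E m) i j) \<longlonglongrightarrow> proj_matrix N F i j"
    and X: "\<And>m. contains_complemented_lp C p k (espace (E m) (nf (E m)))"
  shows "contains_complemented_lp C p k (espace F (nf F))"
proof -
  let ?\<eta> = "\<lambda>m::nat. 1 / real (Suc m)"
  define W where "W m A B \<longleftrightarrow> (\<forall>y\<in>rvecs k. mv N k A y \<in> E m) \<and>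
    (\<forall>x\<in>rvecs N. mv k N B x = mv k N B (pmv N (E m) x)) \<and>
    (\<forall>y\<in>rvecs k. mv k N B (mv N k A y) = y) \<and> (\<forall>x\<in>E m. nf (E m) (mv N k A (mv k N B x)) \<le> C * nf (E m) x) \<and>
    (\<forall>y\<in>rvecs k. lp_norm p k y \<le> nf (E m) (mv N k A y) \<and> nf (E m) (mv N k A y) \<le> (C + ?\<eta> m) * lp_norm p k y)"
    for m A B
  have "\<exists>A B. W m A B" for m
    unfolding W_def using nf_scale[OF E(1)] nf_coord[OF E(1)]
    by (intro contains_complemented_lpD[OF E(1) C k _ p _ _ X]) auto
  then obtain A B where W: "\<And>m. W m (A m) (B m)" by metis
  note W = W[unfolded W_def]
  have
    A: "\<And>m y. y \<in> rvecs k \<Longrightarrow> mv N k (A m) y \<in> E m" and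
    Bp: "\<And>m x. x \<in> rvecs N \<Longrightarrow> mv k N (B m) x = mv k N (B m) (pmv N (E m) x)" and
    BA: "\<And>m y. y \<in> rvecs k \<Longrightarrow> mv k N (B m) (mv N k (A m) y) = y" and
    Q: "\<And>m x. x \<in> E m \<Longrightarrow> nf (E m) (mv N k (A m) (mv k N (B m) x)) \<le> C * nf (E m) x" and
    l: "\<And>m y. y \<in> rvecs k \<Longrightarrow> lp_norm p k y \<le> nf (E m) (mv N k (A m) y)" and
    u: "\<And>m y. y \<in> rvecs k \<Longrightarrow> nf (E m) (mv N k (A m) y) \<le> (C + ?\<eta> m) * lp_norm p k y"
    using W by blast+
  have l0: "lp_norm p k y \<ge> 0" if "y \<in> rvecs k" for y using lp_admissibleD(3)[OF p that] .
  have u1: "nf (E m) (mv N k (A m) y) \<le> (C + 1) * lp_norm p k y" if "y \<in> rvecs k" for m y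
  proof -
    have "?\<eta> m \<le> 1" by simp
    then have "(C + ?\<eta> m) * lp_norm p k y \<le> (C + 1) * lp_norm p k y" using l0[OF that] by (intro mult_right_mono) auto
    then show ?thesis using u[OF that, of m] by linarith
  qed
  \<comment> \<open>Column j of \<open>A m\<close> is the image of \<open>uvec j\<close>, whose
    coordinates are bounded by its norm in \<open>E m\<close>.\<close>
  define KA where "KA = (\<Sum>j<k. (C + 1) * lp_norm p k (uvec j))"
  have KA: "\<bar>A m i j\<bar> \<le> KA" if "i < N" "j < k" for m i j
  proof -
    have uj: "uvec j \<in> rvecs k" using that by (intro uvec_rvecs)
    have "\<bar>A m i j\<bar> = \<bar>mv N k (A m) (uvec j) i\<bar>" using mv_uvec[OF that(2,1)] by simp
    also have "\<dots> \<le> nf (E m) (mv N k (A m) (uvec j))" using nf_coord[OF E(1) A[OF uj]] .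
    also have "\<dots> \<le> (C + 1) * lp_norm p k (uvec j)" using u1[OF uj] .
    also have "\<dots> \<le> KA" unfolding KA_def using that l0[OF uvec_rvecs] C
      by (intro member_le_sum[of j _ "\<lambda>j. (C + 1) * lp_norm p k (uvec j)"]) auto
    finally show ?thesis .
  qed
  have "convergent (\<lambda>m. \<Sum>i<N. \<Sum>j<N. \<bar>proj_matrix N (E m) i j\<bar>)"
    unfolding convergent_def
    by (intro exI[of _ "\<Sum>i<N. \<Sum>j<N. \<bar>proj_matrix N F i j\<bar>"] tendsto_sum tendsto_rabs P)
  then have "Bseq (\<lambda>m. \<Sum>i<N. \<Sum>j<N. \<bar>proj_matrix N (E m) i j\<bar>)" by (rule convergent_imp_Bseq)
  then obtain KP where KP: "\<And>m. \<bar>\<Sum>i<N. \<Sum>j<N. \<bar>proj_matrix N (E m) i j\<bar>\<bar> \<le> KP"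
    unfolding Bseq_def real_norm_def by blast
  \<comment> \<open>The chain is: norm of B x \<le> norm of A B x \<le> C times norm of x, applied
    to the projection of a unit vector.\<close>
  have KB: "\<bar>B m i j\<bar> \<le> C * KP" if "i < k" "j < N" for m i j
  proof -
    let ?x = "pmv N (E m) (uvec j)"
    have uj: "uvec j \<in> rvecs N" using that by (intro uvec_rvecs)
    have xE: "?x \<in> E m" by (rule pmv_mem[OF E(1)])
    have "\<bar>B m i j\<bar> = \<bar>mv k N (B m) (uvec j) i\<bar>" using mv_uvec[OF that(2,1)] by simp
    also have "\<dots> \<le> lp_norm p k (mv k N (B m) (uvec j))" using lp_admissibleD(2)[OF p mv_rvecs that(1)] .
    also have "\<dots> = lp_norm p k (mv k N (B m) ?x)" using Bp[OF uj] by simp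
    also have "\<dots> \<le> nf (E m) (mv N k (A m) (mv k N (B m) ?x))" by (intro l mv_rvecs)
    also have "\<dots> \<le> C * nf (E m) ?x" using Q[OF xE] .
    also have "\<dots> \<le> C * (\<Sum>i<N. \<bar>?x i\<bar>)" using nf_upper[OF E(1) xE] C by (intro mult_left_mono)
    also have "(\<Sum>i<N. \<bar>?x i\<bar>) = (\<Sum>i<N. \<bar>proj_matrix N (E m) i j\<bar>)"
      using that mv_uvec[of j N _ N] by (simp add: pmv_def)
    also have "\<dots> \<le> (\<Sum>i<N. \<Sum>j<N. \<bar>proj_matrix N (E m) i j\<bar>)"
      using that by (intro sum_mono member_le_sum) auto
    also have "\<dots> \<le> KP" using KP[of m] by linarith
    finally show ?thesis using C by (simp add: mult_left_mono)
  qed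
  obtain s where s: "strict_mono s" "\<And>q. q \<in> {..<N} \<times> {..<k} \<Longrightarrow> convergent (\<lambda>m. A (s m) (fst q) (snd q))"
    using bounded_family_subseq[of "{..<N} \<times> {..<k}" "\<lambda>m q. A m (fst q) (snd q)" KA] KA by auto
  obtain r where r: "strict_mono r" "\<And>q. q \<in> {..<k} \<times> {..<N} \<Longrightarrow> convergent (\<lambda>m. B (s (r m)) (fst q) (snd q))"
    using bounded_family_subseq[of "{..<k} \<times> {..<N}" "\<lambda>m q. B (s m) (fst q) (snd q)" "C * KP"] KB by auto
  define t where "t = s \<circ> r"
  have t: "strict_mono t" unfolding t_def using s r by (intro strict_mono_o)
  define A' where "A' i j = lim (\<lambda>m. A (t m) i j)" for i j
  define B' where "B' i j = lim (\<lambda>m. B (t m) i j)" for i j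
  have A': "(\<lambda>m. A (t m) i j) \<longlonglongrightarrow> A' i j" if "i < N" "j < k" for i j
    using convergent_subseq_convergent[OF s(2)[of "(i, j)"] r(1)] that
    unfolding A'_def by (simp add: convergent_LIMSEQ_iff t_def comp_def)
  have B': "(\<lambda>m. B (t m) i j) \<longlonglongrightarrow> B' i j" if "i < k" "j < N" for i j
    using r(2)[of "(i, j)"] that unfolding B'_def by (simp add: convergent_LIMSEQ_iff t_def)
  have P': "(\<lambda>m. proj_matrix N (E (t m)) i j) \<longlonglongrightarrow> proj_matrix N F i j" for i j
    using LIMSEQ_subseq_LIMSEQ[OF P t] by (simp add: comp_def)
  have mvA: "(\<lambda>m. mv N k (A (t m)) (z m) i) \<longlonglongrightarrow> mv N k A' w i" if "\<And>j. (\<lambda>m. z m j) \<longlonglongrightarrow> w j" for z w i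
    unfolding mv_def using that A' by (cases "i < N") (auto intro!: tendsto_sum tendsto_mult)
  have mvB: "(\<lambda>m. mv k N (B (t m)) (z m) i) \<longlonglongrightarrow> mv k N B' w i" if "\<And>j. (\<lambda>m. z m j) \<longlonglongrightarrow> w j" for z w i
    unfolding mv_def using that B' by (cases "i < k") (auto intro!: tendsto_sum tendsto_mult)
  have mvP: "(\<lambda>m. pmv N (E (t m)) (z m) i) \<longlonglongrightarrow> pmv N F w i" if "\<And>j. (\<lambda>m. z m j) \<longlonglongrightarrow> w j" for z w i
    unfolding mv_def pmv_def using that P' by (cases "i < N") (auto intro!: tendsto_sum tendsto_mult)
  \<comment> \<open>Membership in a subspace is the equation that the projection fixes the vector,
    and this equation survives the limit.\<close>
  have AF: "mv N k A' y \<in> F" if y: "y \<in> rvecs k" for y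
  proof -
    have "pmv N F (mv N k A' y) i = mv N k A' y i" for i
    proof (rule LIMSEQ_unique)
      show "(\<lambda>m. pmv N (E (t m)) (mv N k (A (t m)) y) i) \<longlonglongrightarrow> pmv N F (mv N k A' y) i"
        by (intro mvP mvA tendsto_const)
      have "(\<lambda>m. mv N k (A (t m)) y i) \<longlonglongrightarrow> mv N k A' y i" by (intro mvA tendsto_const)
      then show "(\<lambda>m. pmv N (E (t m)) (mv N k (A (t m)) y) i) \<longlonglongrightarrow> mv N k A' y i"
        using pmv_fix[OF E(1) A[OF y]] by simp
    qed
    then have "pmv N F (mv N k A' y) = mv N k A' y" by (rule ext)
    then show ?thesis using pmv_mem[OF E(2), of "mv N k A' y"] by simp
  qed
  have nA: "(\<lambda>m. nf (E (t m)) (mv N k (A (t m)) y)) \<longlonglongrightarrow> nf F (mv N k A' y)" if y: "y \<in> rvecs k" for y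
    by (rule nf_tendsto[OF E(1) E(2) P' A[OF y] AF[OF y]]) (intro mvA tendsto_const)
  show ?thesis
  proof (rule contains_complemented_lpI[of F "mv N k A'" "mv k N B'"])
    show "subspace F" using grassmannianD[OF E(2)] by simp
    show "mv N k A' y \<in> F" if "y \<in> rvecs k" for y using AF[OF that] .
    show "mv k N B' (mv N k A' y) = y" if y: "y \<in> rvecs k" for y
    proof
      fix i
      have "(\<lambda>m. mv k N (B (t m)) (mv N k (A (t m)) y) i) \<longlonglongrightarrow> mv k N B' (mv N k A' y) i"
        by (intro mvB mvA tendsto_const)
      then have "(\<lambda>m. y i) \<longlonglongrightarrow> mv k N B' (mv N k A' y) i" using BA[OF y] by simp
      then show "mv k N B' (mv N k A' y) i = y i" using LIMSEQ_unique tendsto_const by blast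
    qed
    show "nf F (mv N k A' (mv k N B' x)) \<le> C * nf F x" if x: "x \<in> F" for x
    proof -
      \<comment> \<open>A vector of the limit space need not lie in \<open>E (t m)\<close>; its
        projections do, and they converge to it.\<close>
      let ?x = "\<lambda>m. pmv N (E (t m)) x"
      have xE: "?x m \<in> E (t m)" for m by (rule pmv_mem[OF E(1)])
      have xl: "(\<lambda>m. ?x m i) \<longlonglongrightarrow> x i" for i
        using mvP[of "\<lambda>_. x" x i] pmv_fix[OF E(2) x] by simp
      have 1: "(\<lambda>m. nf (E (t m)) (?x m)) \<longlonglongrightarrow> nf F x"
        by (rule nf_tendsto[OF E(1) E(2) P' xE x xl])
      have 2: "(\<lambda>m. nf (E (t m)) (mv N k (A (t m)) (mv k N (B (t m)) (?x m)))) \<longlonglongrightarrow> nf F (mv N k A' (mv k N B' x))"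
        by (rule nf_tendsto[OF E(1) E(2) P' A[OF mv_rvecs] AF[OF mv_rvecs]]) (intro mvA mvB xl)
      show ?thesis
        by (rule LIMSEQ_le[OF 2 tendsto_mult_left[OF 1]]) (use Q[OF xE] in blast)
    qed
    show "lp_norm p k y \<le> nf F (mv N k A' y)" if y: "y \<in> rvecs k" for y
      by (rule LIMSEQ_le_const[OF nA[OF y]]) (use l[OF y] in blast)
    show "nf F (mv N k A' y) \<le> C * lp_norm p k y" if y: "y \<in> rvecs k" for y
    proof (rule LIMSEQ_le[OF nA[OF y]])
      have "(\<lambda>m. ?\<eta> (t m)) \<longlonglongrightarrow> 0"
        using LIMSEQ_subseq_LIMSEQ[OF LIMSEQ_inverse_real_of_nat t] by (simp add: comp_def inverse_eq_divide)
      then have "(\<lambda>m. (C + ?\<eta> (t m)) * lp_norm p k y) \<longlonglongrightarrow> (C + 0) * lp_norm p k y"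
        by (intro tendsto_intros)
      then show "(\<lambda>m. (C + ?\<eta> (t m)) * lp_norm p k y) \<longlonglongrightarrow> C * lp_norm p k y" by simp
      show "\<exists>M. \<forall>n\<ge>M. nf (E (t n)) (mv N k (A (t n)) y) \<le> (C + ?\<eta> (t n)) * lp_norm p k y"
        using u[OF y] by blast
    qed
  qed (use C linear_mv mv_rvecs in auto)
qed

text \<open>By the limit lemma the set is relatively closed: it is the preimage of the closure of
  its own image among the matrices.\<close>

lemma contains_complemented_lp_sets:
  assumes "lp_admissible p" "C \<ge> 0" "k \<ge> 1"
  shows "{E \<in> grassmannian d N. contains_complemented_lp C p k (espace E (nf E))} \<in> sets (grassmann_borel d N)"
proof -
  let ?S = "{E \<in> grassmannian d N. contains_complemented_lp C p k (espace E (nf E))}"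
  let ?K = "closure (proj_matrix N ` ?S)"
  have "?S = proj_matrix N -` ?K \<inter> grassmannian d N"
  proof (intro set_eqI iffI)
    fix E assume "E \<in> ?S"
    then show "E \<in> proj_matrix N -` ?K \<inter> grassmannian d N" using closure_subset by fastforce
  next
    fix F assume F: "F \<in> proj_matrix N -` ?K \<inter> grassmannian d N"
    then obtain x where x: "\<And>m. x m \<in> proj_matrix N ` ?S" "x \<longlonglongrightarrow> proj_matrix N F"
      by (auto simp: closure_sequential)
    have "\<forall>m. \<exists>E. E \<in> ?S \<and> x m = proj_matrix N E" using x(1) by blast
    from choice[OF this] obtain E where E: "\<And>m. E m \<in> ?S" "\<And>m. x m = proj_matrix N (E m)" by blast
    have "(\<lambda>m. proj_matrix N (E m)) \<longlonglongrightarrow> proj_matrix N F" using x(2) unfolding E(2)[symmetric] by simp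
    then have "(\<lambda>m. proj_matrix N (E m) i j) \<longlonglongrightarrow> proj_matrix N F i j" for i j
      by (rule tendsto_componentwiseD[OF tendsto_componentwiseD])
    moreover have "E m \<in> grassmannian d N" "contains_complemented_lp C p k (espace (E m) (nf (E m)))" for m
      using E(1)[of m] by simp_all
    moreover have FG: "F \<in> grassmannian d N" using F by (rule IntD2)
    ultimately have "contains_complemented_lp C p k (espace F (nf F))"
      using contains_complemented_lp_limit[OF assms, of E F] by blast
    then show "F \<in> ?S" using FG by simp
  qed
  also have "\<dots> \<in> sets (grassmann_borel d N)"
    unfolding grassmann_borel_def by (intro in_vimage_algebra borel_closed closed_closure)
  finally show ?thesis .
qed

end

section \<open>Subspaces of \<open>\<ell>\<^sub>\<infinity>\<^sup>N\<close> and quotients of \<open>\<ell>\<^sub>1\<^sup>N\<close>\<close>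

lemma lp_norm_inf_le_iff: "c \<ge> 0 \<Longrightarrow> lp_norm \<infinity> n x \<le> c \<longleftrightarrow> (\<forall>i<n. \<bar>x i\<bar> \<le> c)"
  by (auto simp: lp_norm_def)

lemma lp_norm_inf_nonneg: "lp_norm \<infinity> n x \<ge> 0"
  by (simp add: lp_norm_def)

lemma lp_norm_inf_coord: "i < n \<Longrightarrow> \<bar>x i\<bar> \<le> lp_norm \<infinity> n x"
  using lp_norm_inf_le_iff[OF lp_norm_inf_nonneg] by blast

lemma lp_norm_inf_scale: "lp_norm \<infinity> n (a *\<^sub>R x) = \<bar>a\<bar> * lp_norm \<infinity> n x"
proof (rule antisym)
  have le: "lp_norm \<infinity> n (a *\<^sub>R x) \<le> \<bar>a\<bar> * lp_norm \<infinity> n x" for a x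
    using lp_norm_inf_coord[of _ n x] lp_norm_inf_nonneg[of n x]
    by (subst lp_norm_inf_le_iff) (auto simp: fun_apply abs_mult intro: mult_left_mono)
  show "lp_norm \<infinity> n (a *\<^sub>R x) \<le> \<bar>a\<bar> * lp_norm \<infinity> n x" by (rule le)
  show "\<bar>a\<bar> * lp_norm \<infinity> n x \<le> lp_norm \<infinity> n (a *\<^sub>R x)"
  proof (cases "a = 0")
    case False
    have "lp_norm \<infinity> n ((1 / a) *\<^sub>R (a *\<^sub>R x)) \<le> \<bar>1 / a\<bar> * lp_norm \<infinity> n (a *\<^sub>R x)" by (rule le)
    then show ?thesis using False by (simp add: field_simps)
  qed (simp add: lp_norm_inf_nonneg)
qed

lemma lp_norm_inf_triangle: "lp_norm \<infinity> n (x + y) \<le> lp_norm \<infinity> n x + lp_norm \<infinity> n y"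
proof (subst lp_norm_inf_le_iff)
  show "0 \<le> lp_norm \<infinity> n x + lp_norm \<infinity> n y" using lp_norm_inf_nonneg[of n x] lp_norm_inf_nonneg[of n y] by simp
  show "\<forall>i<n. \<bar>(x + y) i\<bar> \<le> lp_norm \<infinity> n x + lp_norm \<infinity> n y"
  proof (intro allI impI)
    fix i assume "i < n"
    then show "\<bar>(x + y) i\<bar> \<le> lp_norm \<infinity> n x + lp_norm \<infinity> n y"
      using lp_norm_inf_coord[of i n x] lp_norm_inf_coord[of i n y] abs_triangle_ineq[of "x i" "y i"]
      by (simp add: fun_apply)
  qed
qed

lemma lp_norm_1: "lp_norm 1 n x = (\<Sum>i<n. \<bar>x i\<bar>)"
  by (simp add: lp_norm_def sum_nonneg)

lemma lp_norm_2: "lp_norm 2 n x = sqrt (\<Sum>i<n. (x i)\<^sup>2)"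
proof -
  have "\<bar>x i\<bar> powr 2 = (x i)\<^sup>2" for i by simp
  then show ?thesis by (simp add: lp_norm_def powr_half_sqrt sum_nonneg)
qed

lemma lp_admissible_inf: "lp_admissible \<infinity>"
  by (simp add: lp_admissible_def lp_norm_inf_scale lp_norm_inf_coord lp_norm_inf_nonneg)

lemma lp_admissible_1: "lp_admissible 1"
  unfolding lp_admissible_def lp_norm_1
proof (intro ballI conjI allI impI)
  fix k j :: nat and y :: "nat \<Rightarrow> real" assume "j < k"
  then show "\<bar>y j\<bar> \<le> (\<Sum>i<k. \<bar>y i\<bar>)" by (intro member_le_sum) auto
qed (auto simp: fun_apply abs_mult sum_distrib_left intro: sum_nonneg)

lemma lp_admissible_2: "lp_admissible 2"
  unfolding lp_admissible_def lp_norm_2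
proof (intro ballI conjI allI impI)
  fix k j :: nat and y :: "nat \<Rightarrow> real" assume "j < k"
  then have "(y j)\<^sup>2 \<le> (\<Sum>i<k. (y i)\<^sup>2)" by (intro member_le_sum) auto
  then show "\<bar>y j\<bar> \<le> sqrt (\<Sum>i<k. (y i)\<^sup>2)" by (simp add: real_le_rsqrt)
next
  fix k :: nat and a and y :: "nat \<Rightarrow> real"
  show "sqrt (\<Sum>i<k. ((a *\<^sub>R y) i)\<^sup>2) = \<bar>a\<bar> * sqrt (\<Sum>i<k. (y i)\<^sup>2)"
    by (simp add: fun_apply power_mult_distrib real_sqrt_mult flip: sum_distrib_left)
qed (simp add: sum_nonneg)

lemma norm_family_inf: "norm_family N d (\<lambda>E. lp_norm \<infinity> N)"
proof
  fix E x assume E: "E \<in> grassmannian d N" "x \<in> E"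
  have xr: "x \<in> rvecs N" using E grassmannianD by blast
  show "lp_norm \<infinity> N (a *\<^sub>R x) = \<bar>a\<bar> * lp_norm \<infinity> N x" for a by (rule lp_norm_inf_scale)
  show "\<bar>x i\<bar> \<le> lp_norm \<infinity> N x" for i
    using lp_norm_inf_coord[of i N x] lp_norm_inf_nonneg[of N x] rvecs_memD[OF xr, of i] by (cases "i < N") auto
  have c: "\<bar>x i\<bar> \<le> (\<Sum>i<N. \<bar>x i\<bar>)" if "i < N" for i using that by (intro member_le_sum) auto
  then show "lp_norm \<infinity> N x \<le> (\<Sum>i<N. \<bar>x i\<bar>)" by (subst lp_norm_inf_le_iff) (auto intro: sum_nonneg)
next
  fix E F and x y :: "nat \<Rightarrow> real"
  let ?s = "\<Sum>i<N. \<bar>x i - y i\<bar>" and ?t = "2 * gdist1 N E F * (\<Sum>i<N. \<bar>x i\<bar>)"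
  have t: "?t \<ge> 0" "?s \<ge> 0" by (auto simp: gdist1_def intro!: mult_nonneg_nonneg sum_nonneg)
  show "lp_norm \<infinity> N y \<le> lp_norm \<infinity> N x + ?s + ?t"
  proof (subst lp_norm_inf_le_iff)
    show "0 \<le> lp_norm \<infinity> N x + ?s + ?t" using t lp_norm_inf_nonneg[of N x] by linarith
    show "\<forall>i<N. \<bar>y i\<bar> \<le> lp_norm \<infinity> N x + ?s + ?t"
    proof (intro allI impI)
      fix i assume i: "i < N"
      have "\<bar>x i - y i\<bar> \<le> ?s" using i by (intro member_le_sum) auto
      then show "\<bar>y i\<bar> \<le> lp_norm \<infinity> N x + ?s + ?t" using lp_norm_inf_coord[OF i, of x] t by linarith
    qed
  qed
qed

text \<open>The norm of the coset of \<open>x\<close> in the quotient of l_1 by the orthogonal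
  complement of \<open>E\<close>. As \<open>E\<close> meets every coset in exactly one point,
  \<open>E\<close> with this norm is a copy of the quotient.\<close>

definition quot_norm :: "nat \<Rightarrow> (nat \<Rightarrow> real) set \<Rightarrow> (nat \<Rightarrow> real) \<Rightarrow> real" where
  "quot_norm N E x = (INF z\<in>orth_compl N E. \<Sum>i<N. \<bar>x i + z i\<bar>)"

lemma orth_compl_0: "0 \<in> orth_compl N E"
  by (simp add: orth_compl_def subspace_0[OF subspace_rvecs])

lemma subspace_orth_compl: "subspace (orth_compl N E)"
  using orth_compl_0[of N E] subspace_rvecs[of N]
  by (auto simp: subspace_def orth_compl_def rinner_left)

lemma quot_norm_le: "z \<in> orth_compl N E \<Longrightarrow> quot_norm N E x \<le> (\<Sum>i<N. \<bar>x i + z i\<bar>)"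
  unfolding quot_norm_def by (intro cINF_lower bdd_belowI2[of _ 0] sum_nonneg) auto

lemma quot_norm_geI:
  "(\<And>z. z \<in> orth_compl N E \<Longrightarrow> c \<le> (\<Sum>i<N. \<bar>x i + z i\<bar>)) \<Longrightarrow> c \<le> quot_norm N E x"
  unfolding quot_norm_def using orth_compl_0[of N E] by (intro cINF_greatest) auto

lemma pmv_orth_compl:
  assumes "E \<in> grassmannian d N" "z \<in> orth_compl N E" shows "pmv N E z = 0"
proof -
  have p: "pmv N E z \<in> E" by (rule pmv_mem[OF assms(1)])
  have "rinner N (pmv N E z) (pmv N E z) = rinner N z (pmv N E z) - rinner N (z - pmv N E z) (pmv N E z)"
    by (simp add: rinner_diff_left)
  also have "\<dots> = 0" using pmv_orth[OF assms(1) p] assms(2) p by (simp add: orth_compl_def)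
  finally show ?thesis using rinner_self_eq_0 p grassmannianD(2)[OF assms(1)] by blast
qed

lemma orth_compl_residual:
  assumes "E \<in> grassmannian d N" "x \<in> rvecs N" shows "x - pmv N E x \<in> orth_compl N E"
  using pmv_orth[OF assms(1)] pmv_mem[OF assms(1), of x] grassmannianD(2)[OF assms(1)] assms(2)
  by (auto simp: orth_compl_def intro!: subspace_diff[OF subspace_rvecs])

text \<open>Coordinates are controlled through the Euclidean norm, for which \<open>x\<close> is the
  shortest vector of its coset. For the continuity in \<open>E\<close>, a representative for
  \<open>E\<close> is corrected to one for \<open>F\<close> by projecting.\<close>

lemma norm_family_quot: "norm_family N d (quot_norm N)"
proof
  fix E x assume E: "E \<in> grassmannian d N" "x \<in> E"
  have xr: "x \<in> rvecs N" using E grassmannianD by blast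
  have le: "quot_norm N E (a *\<^sub>R x) \<le> \<bar>a\<bar> * quot_norm N E x" if "a \<noteq> 0" for a x
  proof -
    have "quot_norm N E (a *\<^sub>R x) / \<bar>a\<bar> \<le> quot_norm N E x"
    proof (rule quot_norm_geI)
      fix z assume z: "z \<in> orth_compl N E"
      have "quot_norm N E (a *\<^sub>R x) \<le> (\<Sum>i<N. \<bar>(a *\<^sub>R x) i + (a *\<^sub>R z) i\<bar>)"
        by (intro quot_norm_le subspace_scale[OF subspace_orth_compl] z)
      also have "\<dots> = \<bar>a\<bar> * (\<Sum>i<N. \<bar>x i + z i\<bar>)"
        by (simp add: fun_apply sum_distrib_left flip: abs_mult distrib_left)
      finally show "quot_norm N E (a *\<^sub>R x) / \<bar>a\<bar> \<le> (\<Sum>i<N. \<bar>x i + z i\<bar>)" using that by (simp add: field_simps)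
    qed
    then show ?thesis using that by (simp add: field_simps)
  qed
  have ge0: "quot_norm N E x \<ge> 0" for x by (rule quot_norm_geI) (auto intro: sum_nonneg)
  show "quot_norm N E (a *\<^sub>R x) = \<bar>a\<bar> * quot_norm N E x" for a
  proof (cases "a = 0")
    case True
    then show ?thesis using quot_norm_le[OF orth_compl_0, of N E 0] ge0[of 0] by (simp add: zero_fun_apply)
  next
    case False
    have "quot_norm N E ((1 / a) *\<^sub>R (a *\<^sub>R x)) \<le> \<bar>1 / a\<bar> * quot_norm N E (a *\<^sub>R x)" using False by (intro le) auto
    then have "\<bar>a\<bar> * quot_norm N E x \<le> quot_norm N E (a *\<^sub>R x)" using False by (simp add: field_simps)
    then show ?thesis using le[OF False, of x] by simp
  qed
  show "quot_norm N E x \<le> (\<Sum>i<N. \<bar>x i\<bar>)"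
    using quot_norm_le[OF orth_compl_0, of N E x] by (simp add: zero_fun_apply)
  show "\<bar>x i\<bar> \<le> quot_norm N E x" for i
  proof (cases "i < N")
    case True
    show ?thesis
    proof (rule quot_norm_geI)
      fix z assume z: "z \<in> orth_compl N E"
      \<comment> \<open>By Pythagoras the Euclidean norm of x + z is at least that of x, and it is
        at most the l_1 norm.\<close>
      have zx: "rinner N z x = 0" using z E by (simp add: orth_compl_def)
      have "(x i)\<^sup>2 \<le> (\<Sum>i<N. (x i)\<^sup>2)" using True by (intro member_le_sum) auto
      also have "\<dots> \<le> rinner N (x + z) (x + z)"
      proof -
        have "rinner N (x + z) (x + z) = rinner N x x + rinner N z z"
          using zx by (simp add: rinner_left rinner_right rinner_commute[of N x z])
        then show ?thesis using rinner_self_nonneg[of N z] by (simp add: rinner_def power2_eq_square)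
      qed
      also have "\<dots> = (\<Sum>i<N. \<bar>x i + z i\<bar>\<^sup>2)" by (simp add: rinner_def fun_apply power2_eq_square)
      also have "\<dots> \<le> (\<Sum>i<N. \<bar>x i + z i\<bar> * (\<Sum>i<N. \<bar>x i + z i\<bar>))"
        unfolding power2_eq_square by (intro sum_mono mult_left_mono member_le_sum) auto
      also have "\<dots> = (\<Sum>i<N. \<bar>x i + z i\<bar>)\<^sup>2" by (simp add: power2_eq_square flip: sum_distrib_right)
      finally have "\<bar>x i\<bar> \<le> \<bar>\<Sum>i<N. \<bar>x i + z i\<bar>\<bar>" by (simp only: abs_le_square_iff)
      also have "\<dots> = (\<Sum>i<N. \<bar>x i + z i\<bar>)" by (intro abs_of_nonneg sum_nonneg) auto
      finally show "\<bar>x i\<bar> \<le> (\<Sum>i<N. \<bar>x i + z i\<bar>)" .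
    qed
  qed (use rvecs_memD[OF xr] ge0 in auto)
next
  fix E F x y assume EF: "E \<in> grassmannian d N" "F \<in> grassmannian d N" "x \<in> E" "y \<in> F"
  let ?s = "\<Sum>i<N. \<bar>x i - y i\<bar>" and ?X = "\<Sum>i<N. \<bar>x i\<bar>"
  have g0: "gdist1 N E F \<ge> 0" by (auto simp: gdist1_def intro!: sum_nonneg)
  have t0: "2 * gdist1 N E F * ?X \<ge> 0" using g0 by (intro mult_nonneg_nonneg sum_nonneg) auto
  have "quot_norm N F y - ?s - 2 * gdist1 N E F * ?X \<le> quot_norm N E x"
  proof (rule quot_norm_geI)
    fix z assume z: "z \<in> orth_compl N E"
    let ?q = "\<Sum>i<N. \<bar>x i + z i\<bar>"
    show "quot_norm N F y - ?s - 2 * gdist1 N E F * ?X \<le> ?q"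
    \<comment> \<open>If x + z is no shorter than x itself, then z = 0 serves as well; otherwise the
      l_1 norm of z is at most twice that of x.\<close>
    proof (cases "?X \<le> ?q")
      case True
      have "quot_norm N F y \<le> (\<Sum>i<N. \<bar>y i\<bar>)"
        using quot_norm_le[OF orth_compl_0, of N F y] by (simp add: zero_fun_apply)
      also have "\<dots> \<le> (\<Sum>i<N. \<bar>x i\<bar> + \<bar>x i - y i\<bar>)" by (intro sum_mono) linarith
      also have "\<dots> = ?X + ?s" by (simp add: sum.distrib)
      finally show ?thesis using True t0 by linarith
    next
      case False
      have "(\<Sum>i<N. \<bar>z i\<bar>) \<le> (\<Sum>i<N. \<bar>x i + z i\<bar> + \<bar>x i\<bar>)" by (intro sum_mono) linarith
      also have "\<dots> = ?q + ?X" by (simp add: sum.distrib)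
      finally have zX: "(\<Sum>i<N. \<bar>z i\<bar>) \<le> 2 * ?X" using False by linarith
      have zr: "z \<in> rvecs N" using z by (simp add: orth_compl_def)
      \<comment> \<open>Hence the projection of z to \<open>F\<close> equals the difference of the
        two projections of z, which is small. Subtracting it from z gives an element of the
        complement of \<open>F\<close>.\<close>
      have Ez: "pmv N E z = 0" by (rule pmv_orth_compl[OF EF(1) z])
      have "(\<Sum>i<N. \<bar>pmv N F z i\<bar>) \<le> (\<Sum>i<N. \<Sum>j<N. \<bar>proj_matrix N E i j - proj_matrix N F i j\<bar> * (\<Sum>i<N. \<bar>z i\<bar>))"
      proof (rule sum_mono)
        fix i assume i: "i \<in> {..<N}"
        have "pmv N F z i = pmv N F z i - pmv N E z i" using Ez by (simp add: zero_fun_apply)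
        also have "\<dots> = (\<Sum>j<N. (proj_matrix N F i j - proj_matrix N E i j) * z j)"
          using i by (simp add: pmv_def mv_def sum_subtractf left_diff_distrib)
        finally have "\<bar>pmv N F z i\<bar> \<le> (\<Sum>j<N. \<bar>(proj_matrix N F i j - proj_matrix N E i j) * z j\<bar>)"
          using sum_abs by metis
        also have "\<dots> \<le> (\<Sum>j<N. \<bar>proj_matrix N E i j - proj_matrix N F i j\<bar> * (\<Sum>i<N. \<bar>z i\<bar>))"
          unfolding abs_mult by (intro sum_mono mult_mono member_le_sum) (auto intro: sum_nonneg)
        finally show "\<bar>pmv N F z i\<bar> \<le> (\<Sum>j<N. \<bar>proj_matrix N E i j - proj_matrix N F i j\<bar> * (\<Sum>i<N. \<bar>z i\<bar>))" .
      qed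
      also have "\<dots> = gdist1 N E F * (\<Sum>i<N. \<bar>z i\<bar>)" by (simp add: gdist1_def sum_distrib_right)
      also have "\<dots> \<le> gdist1 N E F * (2 * ?X)" using zX g0 by (rule mult_left_mono)
      finally have PF: "(\<Sum>i<N. \<bar>pmv N F z i\<bar>) \<le> 2 * gdist1 N E F * ?X" by simp
      have "quot_norm N F y \<le> (\<Sum>i<N. \<bar>y i + (z - pmv N F z) i\<bar>)"
        by (rule quot_norm_le[OF orth_compl_residual[OF EF(2) zr]])
      also have "\<dots> \<le> (\<Sum>i<N. \<bar>x i + z i\<bar> + \<bar>x i - y i\<bar> + \<bar>pmv N F z i\<bar>)"
        by (intro sum_mono) (auto simp: fun_apply)
      also have "\<dots> = ?q + ?s + (\<Sum>i<N. \<bar>pmv N F z i\<bar>)" by (simp add: sum.distrib)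
      finally show ?thesis using PF by linarith
    qed
  qed
  then show "quot_norm N F y \<le> quot_norm N E x + ?s + 2 * gdist1 N E F * ?X" by linarith
qed

section \<open>Transport along isometries\<close>

definition ns_closed :: "'a nspace \<Rightarrow> bool" where
  "ns_closed X \<longleftrightarrow> (\<forall>x\<in>ns_carrier X. \<forall>y\<in>ns_carrier X. ns_add X x y \<in> ns_carrier X) \<and>
    (\<forall>a. \<forall>x\<in>ns_carrier X. ns_scale X a x \<in> ns_carrier X)"

definition ns_isometry :: "'a nspace \<Rightarrow> 'b nspace \<Rightarrow> ('a \<Rightarrow> 'b) \<Rightarrow> bool" where
  "ns_isometry X Y J \<longleftrightarrow> ns_iso X Y J \<and> (\<forall>x\<in>ns_carrier X. ns_norm Y (J x) = ns_norm X x)"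

lemma ns_isometry_inverse:
  assumes J: "ns_isometry X Y J" and X: "ns_closed X"
  shows "ns_isometry Y X (inv_into (ns_carrier X) J)" "ns_closed Y"
proof -
  let ?K = "inv_into (ns_carrier X) J"
  have bij: "bij_betw J (ns_carrier X) (ns_carrier Y)" and
    lin: "\<And>x y. x \<in> ns_carrier X \<Longrightarrow> y \<in> ns_carrier X \<Longrightarrow> J (ns_add X x y) = ns_add Y (J x) (J y)"
    "\<And>a x. x \<in> ns_carrier X \<Longrightarrow> J (ns_scale X a x) = ns_scale Y a (J x)"
    and JY: "\<And>x. x \<in> ns_carrier X \<Longrightarrow> J x \<in> ns_carrier Y"
    and nm: "\<And>x. x \<in> ns_carrier X \<Longrightarrow> ns_norm Y (J x) = ns_norm X x"
    using J by (auto simp: ns_isometry_def ns_iso_def ns_linear_def)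
  have KJ: "?K (J x) = x" if "x \<in> ns_carrier X" for x using bij_betw_inv_into_left[OF bij that] .
  have JK: "J (?K y) = y" "?K y \<in> ns_carrier X" if "y \<in> ns_carrier Y" for y
    using bij_betw_inv_into_right[OF bij that] bij_betwE[OF bij_betw_inv_into[OF bij]] that by auto
  have cl: "ns_add X x y \<in> ns_carrier X" "ns_scale X a x \<in> ns_carrier X"
    if "x \<in> ns_carrier X" "y \<in> ns_carrier X" for x y a
    using X that by (auto simp: ns_closed_def)
  have "?K (ns_add Y y z) = ns_add X (?K y) (?K z)" if "y \<in> ns_carrier Y" "z \<in> ns_carrier Y" for y z
    using KJ[OF cl(1)[OF JK(2)[OF that(1)] JK(2)[OF that(2)]]] lin(1) JK that by simp
  moreover have "?K (ns_scale Y a y) = ns_scale X a (?K y)" if "y \<in> ns_carrier Y" for a y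
    using KJ[OF cl(2)[OF JK(2)[OF that] JK(2)[OF that]]] lin(2) JK that by simp
  moreover have "ns_norm X (?K y) = ns_norm Y y" if "y \<in> ns_carrier Y" for y
    using nm[OF JK(2)[OF that]] JK(1)[OF that] by simp
  ultimately show "ns_isometry Y X ?K"
    using JK(2) bij_betw_inv_into[OF bij] by (auto simp: ns_isometry_def ns_iso_def ns_linear_def)
  have "ns_add Y y z \<in> ns_carrier Y" if "y \<in> ns_carrier Y" "z \<in> ns_carrier Y" for y z
    using JY[OF cl(1)[OF JK(2)[OF that(1)] JK(2)[OF that(2)]]] lin(1) JK that by simp
  moreover have "ns_scale Y a y \<in> ns_carrier Y" if "y \<in> ns_carrier Y" for a y
    using JY[OF cl(2)[OF JK(2)[OF that] JK(2)[OF that]]] lin(2) JK that by simp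
  ultimately show "ns_closed Y" by (simp add: ns_closed_def)
qed

text \<open>Subspace, projection and isomorphism are all conjugated by \<open>J\<close>; this lets
  vectors replace cosets.\<close>

lemma contains_complemented_lp_isometry:
  assumes J: "ns_isometry X Y J" and X: "ns_closed X" and c: "contains_complemented_lp C p k X"
  shows "contains_complemented_lp C p k Y"
proof -
  let ?K = "inv_into (ns_carrier X) J"
  have K: "ns_isometry Y X ?K" by (rule ns_isometry_inverse[OF J X])
  have bij: "bij_betw J (ns_carrier X) (ns_carrier Y)" and
    lin: "\<And>x y. x \<in> ns_carrier X \<Longrightarrow> y \<in> ns_carrier X \<Longrightarrow> J (ns_add X x y) = ns_add Y (J x) (J y)"
    "\<And>a x. x \<in> ns_carrier X \<Longrightarrow> J (ns_scale X a x) = ns_scale Y a (J x)"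
    and JY: "\<And>x. x \<in> ns_carrier X \<Longrightarrow> J x \<in> ns_carrier Y"
    and nm: "\<And>x. x \<in> ns_carrier X \<Longrightarrow> ns_norm Y (J x) = ns_norm X x"
    using J by (auto simp: ns_isometry_def ns_iso_def ns_linear_def)
  have linK: "\<And>x y. x \<in> ns_carrier Y \<Longrightarrow> y \<in> ns_carrier Y \<Longrightarrow> ?K (ns_add Y x y) = ns_add X (?K x) (?K y)"
    "\<And>a x. x \<in> ns_carrier Y \<Longrightarrow> ?K (ns_scale Y a x) = ns_scale X a (?K x)"
    and nmK: "\<And>x. x \<in> ns_carrier Y \<Longrightarrow> ns_norm X (?K x) = ns_norm Y x"
    using K by (auto simp: ns_isometry_def ns_iso_def ns_linear_def)
  have KJ: "?K (J x) = x" if "x \<in> ns_carrier X" for x using bij_betw_inv_into_left[OF bij that] .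
  have JK: "J (?K y) = y" "?K y \<in> ns_carrier X" if "y \<in> ns_carrier Y" for y
    using bij_betw_inv_into_right[OF bij that] bij_betwE[OF bij_betw_inv_into[OF bij]] that by auto
  obtain F where F: "ns_subspace X F" "C_complemented C X F" "C_isomorphic C (ns_restrict X F) (lp_space p k)"
    using c by (auto simp: contains_complemented_lp_def)
  have FX: "\<And>x. x \<in> F \<Longrightarrow> x \<in> ns_carrier X" using F(1) by (auto simp: ns_subspace_def)
  define F' where "F' = J ` F"
  have F'Y: "F' \<subseteq> ns_carrier Y" using JY FX by (auto simp: F'_def)
  have "ns_subspace Y F'"
    using F(1) F'Y unfolding ns_subspace_def F'_def by (auto simp: lin(1)[OF FX FX, symmetric] lin(2)[OF FX, symmetric])
  moreover have "C_complemented C Y F'"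
  proof -
    obtain Q where Q: "ns_linear X X Q" "Q ` ns_carrier X = F" "\<forall>x\<in>F. Q x = x" "ns_opnorm X X Q \<le> ennreal C"
      using F(2) by (auto simp: C_complemented_def)
    have QX: "Q x \<in> F" if "x \<in> ns_carrier X" for x using that Q(2) by auto
    have Ql: "\<And>x y. x \<in> ns_carrier X \<Longrightarrow> y \<in> ns_carrier X \<Longrightarrow> Q (ns_add X x y) = ns_add X (Q x) (Q y)"
      "\<And>a x. x \<in> ns_carrier X \<Longrightarrow> Q (ns_scale X a x) = ns_scale X a (Q x)"
      using Q(1) by (auto simp: ns_linear_def)
    show ?thesis unfolding C_complemented_def
    proof (intro exI[of _ "\<lambda>y. J (Q (?K y))"] conjI)
      show "ns_linear Y Y (\<lambda>y. J (Q (?K y)))"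
        unfolding ns_linear_def using JK linK Ql lin QX FX JY by auto
      show "(\<lambda>y. J (Q (?K y))) ` ns_carrier Y = F'"
      proof
        show "F' \<subseteq> (\<lambda>y. J (Q (?K y))) ` ns_carrier Y"
        proof
          fix y assume "y \<in> F'"
          then obtain x where x: "x \<in> F" "y = J x" by (auto simp: F'_def)
          then have "J (Q (?K y)) = y" using KJ[OF FX] Q(3) by simp
          then show "y \<in> (\<lambda>y. J (Q (?K y))) ` ns_carrier Y" using JY[OF FX] x by (metis imageI)
        qed
      qed (use QX JK in \<open>auto simp: F'_def\<close>)
      show "\<forall>y\<in>F'. J (Q (?K y)) = y" using KJ[OF FX] Q(3) by (auto simp: F'_def)
      have "ns_opnorm Y Y (\<lambda>y. J (Q (?K y))) \<le> ns_opnorm X X Q"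
        unfolding ns_opnorm_def
      proof (rule SUP_mono)
        fix y assume "y \<in> {x \<in> ns_carrier Y. ns_norm Y x \<le> 1}"
        then show "\<exists>x\<in>{x \<in> ns_carrier X. ns_norm X x \<le> 1}. ennreal (ns_norm Y (J (Q (?K y)))) \<le> ennreal (ns_norm X (Q x))"
          using JK(2) nmK nm[OF FX[OF QX]] by (intro bexI[of _ "?K y"]) auto
      qed
      then show "ns_opnorm Y Y (\<lambda>y. J (Q (?K y))) \<le> ennreal C" using Q(4) by (rule order_trans)
    qed
  qed
  moreover have "C_isomorphic C (ns_restrict Y F') (lp_space p k)"
  proof -
    let ?Z = "lp_space p k"
    have "banach_mazur (ns_restrict Y F') ?Z \<le> banach_mazur (ns_restrict X F) ?Z"
      unfolding banach_mazur_def
    proof (rule INF_mono)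
      fix T assume "T \<in> {T. ns_iso (ns_restrict X F) ?Z T}"
      then have T: "bij_betw T F (rvecs k)" "\<And>x. x \<in> F \<Longrightarrow> T x \<in> rvecs k"
        "\<And>x y. x \<in> F \<Longrightarrow> y \<in> F \<Longrightarrow> T (ns_add X x y) = T x + T y" "\<And>a x. x \<in> F \<Longrightarrow> T (ns_scale X a x) = a *\<^sub>R T x"
        by (auto simp: ns_iso_def ns_linear_def)
      let ?T = "\<lambda>y. T (?K y)"
      have KF: "?K y \<in> F" if "y \<in> F'" for y using that KJ[OF FX] by (auto simp: F'_def)
      have F'm: "y \<in> ns_carrier Y" if "y \<in> F'" for y using that F'Y by auto
      have bijK: "bij_betw ?K F' F"
        by (rule bij_betw_byWitness[where f'=J]) (use KJ FX JK F'm KF in \<open>auto simp: F'_def\<close>)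
      have bT: "bij_betw ?T F' (rvecs k)" using bij_betw_trans[OF bijK T(1)] by (simp add: comp_def)
      have iso: "ns_iso (ns_restrict Y F') ?Z ?T"
        unfolding ns_iso_def ns_linear_def using bT T KF F'm linK by auto
      have 1: "ns_opnorm (ns_restrict Y F') ?Z ?T \<le> ns_opnorm (ns_restrict X F) ?Z T"
        unfolding ns_opnorm_def
      proof (rule SUP_mono)
        fix y assume "y \<in> {x \<in> ns_carrier (ns_restrict Y F'). ns_norm (ns_restrict Y F') x \<le> 1}"
        then show "\<exists>x\<in>{x \<in> ns_carrier (ns_restrict X F). ns_norm (ns_restrict X F) x \<le> 1}. ennreal (ns_norm ?Z (?T y)) \<le> ennreal (ns_norm ?Z (T x))"
          using KF nmK F'm by (intro bexI[of _ "?K y"]) auto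
      qed
      have inv: "inv_into F' ?T z = J (inv_into F T z)" "inv_into F T z \<in> F" if "z \<in> rvecs k" for z
      proof -
        show x: "inv_into F T z \<in> F" using bij_betwE[OF bij_betw_inv_into[OF T(1)]] that by auto
        have "?T (J (inv_into F T z)) = z" using KJ[OF FX[OF x]] bij_betw_inv_into_right[OF T(1) that] by simp
        then show "inv_into F' ?T z = J (inv_into F T z)"
          using bT x by (intro inv_into_f_eq) (auto simp: bij_betw_def F'_def)
      qed
      have 2: "ns_opnorm ?Z (ns_restrict Y F') (inv_into F' ?T) \<le> ns_opnorm ?Z (ns_restrict X F) (inv_into F T)"
        unfolding ns_opnorm_def using inv nm FX by (intro SUP_mono) auto
      show "\<exists>T'\<in>{T. ns_iso (ns_restrict Y F') ?Z T}.
          ns_opnorm (ns_restrict Y F') ?Z T' * ns_opnorm ?Z (ns_restrict Y F') (inv_into (ns_carrier (ns_restrict Y F')) T')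
          \<le> ns_opnorm (ns_restrict X F) ?Z T * ns_opnorm ?Z (ns_restrict X F) (inv_into (ns_carrier (ns_restrict X F)) T)"
        using iso 1 2 by (intro bexI[of _ ?T] mult_mono) auto
    qed
    then show ?thesis using F(3) by (auto simp: C_isomorphic_def intro: order_trans)
  qed
  ultimately show ?thesis unfolding contains_complemented_lp_def by blast
qed

text \<open>Surjectivity: every coset contains the projection of its representatives to
  \<open>E\<close>. Injectivity: \<open>E\<close> meets its orthogonal complement in 0 only.\<close>

lemma quotient_isometry:
  assumes E: "E \<in> grassmannian d N"
  shows "ns_isometry (espace E (quot_norm N E)) (ns_quotient (lp_space 1 N) (orth_compl N E))
    (\<lambda>x. (+) x ` orth_compl N E)"
proof -
  let ?M = "orth_compl N E"
  let ?J = "\<lambda>x. (+) x ` ?M"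
  let ?Y = "ns_quotient (lp_space 1 N) ?M"
  have M: "0 \<in> ?M" "\<And>x y. x \<in> ?M \<Longrightarrow> y \<in> ?M \<Longrightarrow> x + y \<in> ?M" "\<And>x y. x \<in> ?M \<Longrightarrow> y \<in> ?M \<Longrightarrow> x - y \<in> ?M"
    "\<And>a x. x \<in> ?M \<Longrightarrow> a *\<^sub>R x \<in> ?M"
    using subspace_orth_compl[of N E] by (auto simp: subspace_def intro: subspace_diff[OF subspace_orth_compl])
  have sE: "subspace E" "E \<subseteq> rvecs N" using grassmannianD[OF E] by auto
  have Y: "ns_carrier ?Y = {?J x | x. x \<in> rvecs N}" "ns_add ?Y A B = {a + b | a b. a \<in> A \<and> b \<in> B}"
    "ns_scale ?Y r A = {r *\<^sub>R a + m | a m. a \<in> A \<and> m \<in> ?M}" "ns_norm ?Y A = (INF x\<in>A. lp_norm 1 N x)" for A B r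
    by (simp_all add: ns_quotient_def)
  have add: "?J (x + y) = {a + b | a b. a \<in> ?J x \<and> b \<in> ?J y}" for x y
  proof (intro set_eqI iffI)
    fix w assume "w \<in> ?J (x + y)"
    then obtain m where "m \<in> ?M" "w = x + y + m" by auto
    then have "w = (x + m) + (y + 0)" "x + m \<in> ?J x" "y + 0 \<in> ?J y" using M(1) by auto
    then show "w \<in> {a + b | a b. a \<in> ?J x \<and> b \<in> ?J y}" by blast
  next
    fix w assume "w \<in> {a + b | a b. a \<in> ?J x \<and> b \<in> ?J y}"
    then obtain m m' where "m \<in> ?M" "m' \<in> ?M" "w = (x + m) + (y + m')" by auto
    then have "w = (x + y) + (m + m')" "m + m' \<in> ?M" using M(2) by (auto simp: algebra_simps)
    then show "w \<in> ?J (x + y)" by blast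
  qed
  have scale: "?J (r *\<^sub>R x) = {r *\<^sub>R a + m | a m. a \<in> ?J x \<and> m \<in> ?M}" for r x
  proof (intro set_eqI iffI)
    fix w assume "w \<in> ?J (r *\<^sub>R x)"
    then obtain m where "m \<in> ?M" "w = r *\<^sub>R x + m" by auto
    then have "w = r *\<^sub>R (x + 0) + m" "x + 0 \<in> ?J x" "m \<in> ?M" using M(1) by (auto simp del: add_0_right)
    then show "w \<in> {r *\<^sub>R a + m | a m. a \<in> ?J x \<and> m \<in> ?M}" by blast
  next
    fix w assume "w \<in> {r *\<^sub>R a + m | a m. a \<in> ?J x \<and> m \<in> ?M}"
    then obtain m m' where "m \<in> ?M" "m' \<in> ?M" "w = r *\<^sub>R (x + m) + m'" by auto
    then have "w = r *\<^sub>R x + (r *\<^sub>R m + m')" "r *\<^sub>R m + m' \<in> ?M" using M by (auto simp: scaleR_add_right algebra_simps)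
    then show "w \<in> ?J (r *\<^sub>R x)" by blast
  qed
  have inj: "inj_on ?J E"
  proof (rule inj_onI)
    fix x y assume xy: "x \<in> E" "y \<in> E" "?J x = ?J y"
    have "x + 0 \<in> ?J x" using M(1) by (rule imageI)
    then have "x \<in> ?J y" using xy(3) by simp
    then obtain m where "m \<in> ?M" "x = y + m" by auto
    then have m: "x - y \<in> ?M" by simp
    have "x - y \<in> E" using xy sE(1) by (intro subspace_diff)
    then have "rinner N (x - y) (x - y) = 0" using m by (simp add: orth_compl_def)
    then have "x - y = 0" using rinner_self_eq_0 \<open>x - y \<in> E\<close> sE(2) by blast
    then show "x = y" by simp
  qed
  have surj: "?J ` E = {?J x | x. x \<in> rvecs N}"
  proof (intro set_eqI iffI)
    fix A assume "A \<in> {?J x | x. x \<in> rvecs N}"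
    then obtain w where w: "w \<in> rvecs N" "A = ?J w" by auto
    have r: "w - pmv N E w \<in> ?M" by (rule orth_compl_residual[OF E w(1)])
    have "?J w = ?J (pmv N E w)"
    proof (intro set_eqI iffI)
      fix v assume "v \<in> ?J w"
      then obtain m where "m \<in> ?M" "v = w + m" by auto
      then have "v = pmv N E w + ((w - pmv N E w) + m)" "(w - pmv N E w) + m \<in> ?M" using M(2) r by auto
      then show "v \<in> ?J (pmv N E w)" by blast
    next
      fix v assume "v \<in> ?J (pmv N E w)"
      then obtain m where "m \<in> ?M" "v = pmv N E w + m" by auto
      then have "v = w + (m - (w - pmv N E w))" "m - (w - pmv N E w) \<in> ?M" using M(3) r by auto
      then show "v \<in> ?J w" by blast
    qed
    then show "A \<in> ?J ` E" using w pmv_mem[OF E] by auto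
  qed (use sE in auto)
  have "ns_iso (espace E (quot_norm N E)) ?Y ?J"
    unfolding ns_iso_def ns_linear_def bij_betw_def using inj surj add scale sE(2) by (auto simp: Y)
  moreover have "ns_norm ?Y (?J x) = quot_norm N E x" for x
    by (simp add: Y quot_norm_def lp_norm_1 image_image plus_fun_apply)
  ultimately show ?thesis by (simp add: ns_isometry_def)
qed

lemma contains_complemented_lp_quotient_iff:
  assumes E: "E \<in> grassmannian d N"
  shows "contains_complemented_lp C p k (ns_quotient (lp_space 1 N) (orth_compl N E)) \<longleftrightarrow>
    contains_complemented_lp C p k (espace E (quot_norm N E))"
proof -
  have c: "ns_closed (espace E (quot_norm N E))"
    using grassmannianD(1)[OF E] by (auto simp: ns_closed_def subspace_def)
  show ?thesis
    using contains_complemented_lp_isometry[OF quotient_isometry[OF E] c]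
      contains_complemented_lp_isometry[OF ns_isometry_inverse[OF quotient_isometry[OF E] c]] by blast
qed

lemma ns_restrict_linf: "ns_restrict (lp_space \<infinity> N) E = espace E (lp_norm \<infinity> N)"
  by (simp add: ns_restrict_def lp_space_def espace_def)

section \<open>Duality\<close>

text \<open>The one-dimensional step of the Hahn-Banach theorem for the sublinear function M times
  the sup norm, with functionals represented by vectors.\<close>

lemma functional_extend_one:
  assumes V: "subspace V" "V \<subseteq> rvecs N" and v: "v \<in> rvecs N" "v \<notin> V" and z: "z \<in> rvecs N" and M: "M \<ge> 0"
    and b: "\<And>y. y \<in> V \<Longrightarrow> rinner N z y \<le> M * lp_norm \<infinity> N y"
  shows "\<exists>z'\<in>rvecs N. (\<forall>y\<in>V. rinner N z' y = rinner N z y) \<and>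
    (\<forall>y\<in>span (insert v V). rinner N z' y \<le> M * lp_norm \<infinity> N y)"
proof -
  have VG: "V \<in> grassmannian (dim V) N" using V by (simp add: grassmannian_def)
  define u where "u = v - pmv N V v"
  have pV: "pmv N V v \<in> V" by (rule pmv_mem[OF VG])
  have u0: "u \<noteq> 0" using pV v(2) by (auto simp: u_def)
  have ur: "u \<in> rvecs N" unfolding u_def using pV V(2) v by (intro subspace_diff[OF subspace_rvecs]) auto
  have uu: "rinner N u u > 0" using rinner_self_eq_0[OF ur] u0 rinner_self_nonneg[of N u] by fastforce
  have uV: "rinner N u y = 0" if "y \<in> V" for y unfolding u_def using pmv_orth[OF VG that] .
  have uv: "rinner N u v = rinner N u u"
  proof -
    have "rinner N u v = rinner N u u + rinner N u (pmv N V v)" by (simp add: u_def rinner_right)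
    then show ?thesis using uV[OF pV] by simp
  qed
  \<comment> \<open>Orthogonal to \<open>V\<close> with inner product 1 with \<open>v\<close>:
    adding multiples of it prescribes the value at \<open>v\<close> and changes nothing on
    \<open>V\<close>.\<close>
  define w where "w = (1 / rinner N u u) *\<^sub>R u"
  have wr: "w \<in> rvecs N" unfolding w_def using ur by (rule subspace_scale[OF subspace_rvecs])
  have wV: "rinner N w y = 0" if "y \<in> V" for y using uV[OF that] by (simp add: w_def rinner_left)
  have wv: "rinner N w v = 1" using uv uu by (simp add: w_def rinner_left)
  let ?p = "\<lambda>x. M * lp_norm \<infinity> N x"
  have tri: "?p (x + y) \<le> ?p x + ?p y" for x y
    using mult_left_mono[OF lp_norm_inf_triangle[of N x y] M] by (simp add: distrib_left)
  have psc: "?p (t *\<^sub>R x) = \<bar>t\<bar> * ?p x" for t x by (simp add: lp_norm_inf_scale)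
  \<comment> \<open>Subadditivity leaves room for the value at \<open>v\<close> between a supremum
    and an infimum; \<open>c\<close> is the supremum.\<close>
  have key: "rinner N z y1 - ?p (y1 - v) \<le> ?p (y2 + v) - rinner N z y2" if "y1 \<in> V" "y2 \<in> V" for y1 y2
  proof -
    have "rinner N z y1 + rinner N z y2 = rinner N z (y1 + y2)" by (simp add: rinner_right)
    also have "\<dots> \<le> ?p (y1 + y2)" using that V(1) by (intro b subspace_add)
    also have "y1 + y2 = (y1 - v) + (y2 + v)" by simp
    also have "?p \<dots> \<le> ?p (y1 - v) + ?p (y2 + v)" by (rule tri)
    finally show ?thesis by simp
  qed
  define c where "c = (SUP y\<in>V. rinner N z y - ?p (y - v))"
  have V0: "0 \<in> V" by (rule subspace_0[OF V(1)])
  have cu: "c \<le> ?p (y + v) - rinner N z y" if "y \<in> V" for y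
    unfolding c_def using V0 key[OF _ that] by (intro cSUP_least) auto
  have cl: "rinner N z y - ?p (y - v) \<le> c" if "y \<in> V" for y
    unfolding c_def using that key[OF _ V0] by (intro cSUP_upper bdd_aboveI2) auto
  define z' where "z' = z + (c - rinner N z v) *\<^sub>R w"
  have z'V: "rinner N z' y = rinner N z y" if "y \<in> V" for y
    using wV[OF that] by (simp add: z'_def rinner_left)
  have z'v: "rinner N z' v = c" using wv by (simp add: z'_def rinner_left)
  have "rinner N z' x \<le> ?p x" if xin: "x \<in> span (insert v V)" for x
  proof -
    have sV: "span V = V" using V(1) by (rule span_eq_iff[THEN iffD2])
    obtain t where t: "x - t *\<^sub>R v \<in> V"
      using xin unfolding span_breakdown_eq sV by blast
    define y where "y = x - t *\<^sub>R v"
    have x: "x = y + t *\<^sub>R v" and y: "y \<in> V" using t by (simp_all add: y_def)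
    have e: "rinner N z' x = rinner N z y + t * c"
      unfolding x using z'V[OF y] z'v by (simp add: rinner_right)
    consider "t = 0" | "t > 0" | "t < 0" by linarith
    then show ?thesis
    proof cases
      case 1 then show ?thesis using e b[OF y] x by simp
    next
      case 2
      \<comment> \<open>Dividing by t reduces to t = 1, where the upper bound on \<open>c\<close>
        applies; negative t uses the lower bound in the same way.\<close>
      have "t * c \<le> t * (?p ((1 / t) *\<^sub>R y + v) - rinner N z ((1 / t) *\<^sub>R y))"
        using 2 cu[OF subspace_scale[OF V(1) y]] by (intro mult_left_mono) auto
      also have "\<dots> = ?p (t *\<^sub>R ((1 / t) *\<^sub>R y + v)) - rinner N z y"
        unfolding psc using 2 by (simp add: right_diff_distrib rinner_right)
      also have "t *\<^sub>R ((1 / t) *\<^sub>R y + v) = x" using 2 by (simp add: x scaleR_add_right)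
      finally show ?thesis using e by simp
    next
      case 3
      have "(- t) * (rinner N z ((1 / (- t)) *\<^sub>R y) - ?p ((1 / (- t)) *\<^sub>R y - v)) \<le> (- t) * c"
        by (rule mult_left_mono[OF cl[OF subspace_scale[OF V(1) y]]]) (use 3 in simp)
      moreover have "(- t) * (rinner N z ((1 / (- t)) *\<^sub>R y) - ?p ((1 / (- t)) *\<^sub>R y - v)) =
         rinner N z y - ?p ((- t) *\<^sub>R ((1 / (- t)) *\<^sub>R y - v))"
      proof -
        have r: "(- t) * rinner N z ((1 / (- t)) *\<^sub>R y) = rinner N z y"
          unfolding rinner_scale_right using 3 by simp
        show ?thesis unfolding psc right_diff_distrib[of "- t"] r using 3 by simp
      qed
      moreover have "(- t) *\<^sub>R ((1 / (- t)) *\<^sub>R y - v) = x" using 3 by (simp add: x scaleR_diff_right)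
      ultimately show ?thesis using e by simp
    qed
  qed
  moreover have "z' \<in> rvecs N" unfolding z'_def using z wr by (intro subspace_add subspace_scale subspace_rvecs)
  ultimately show ?thesis using z'V by blast
qed

text \<open>Finite-dimensional Hahn-Banach: unit vectors are adjoined one at a time. Functionals of
  sup-norm at most \<open>M\<close> on the whole space are the vectors of l_1 norm at most
  \<open>M\<close>.\<close>

lemma functional_extend:
  assumes E: "subspace E" "E \<subseteq> rvecs N" and z: "z \<in> rvecs N" and M: "M \<ge> 0"
    and b: "\<And>y. y \<in> E \<Longrightarrow> rinner N z y \<le> M * lp_norm \<infinity> N y"
  shows "\<exists>z'\<in>rvecs N. (\<forall>y\<in>E. rinner N z' y = rinner N z y) \<and> (\<Sum>i<N. \<bar>z' i\<bar>) \<le> M"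
proof -
  let ?V = "\<lambda>n. span (E \<union> uvec ` {..<n})"
  have "\<exists>z'\<in>rvecs N. (\<forall>y\<in>E. rinner N z' y = rinner N z y) \<and> (\<forall>y\<in>?V n. rinner N z' y \<le> M * lp_norm \<infinity> N y)"
    if "n \<le> N" for n using that
  proof (induction n)
    case 0
    have sE: "span E = E" using E(1) by (rule span_eq_iff[THEN iffD2])
    show ?case unfolding lessThan_0 image_empty Un_empty_right sE using z b by blast
  next
    case (Suc n)
    then obtain z1 where z1: "z1 \<in> rvecs N" "\<And>y. y \<in> E \<Longrightarrow> rinner N z1 y = rinner N z y"
      "\<And>y. y \<in> ?V n \<Longrightarrow> rinner N z1 y \<le> M * lp_norm \<infinity> N y" by auto
    have VS: "?V (Suc n) = span (insert (uvec n) (?V n))"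
    proof -
      have "E \<union> uvec ` {..<Suc n} = insert (uvec n) (E \<union> uvec ` {..<n})" by (auto simp: lessThan_Suc)
      then show ?thesis by (simp only: span_insert span_span)
    qed
    have un: "uvec n \<in> rvecs N" using Suc.prems by (intro uvec_rvecs) auto
    show ?case
    proof (cases "uvec n \<in> ?V n")
      case True
      then have "?V (Suc n) = ?V n" unfolding VS by (simp add: insert_absorb)
      then show ?thesis using z1 by auto
    next
      case False
      have "E \<union> uvec ` {..<n} \<subseteq> rvecs N" using E(2) Suc.prems by (auto intro: uvec_rvecs)
      then have VN: "?V n \<subseteq> rvecs N" by (rule span_minimal[OF _ subspace_rvecs])
      have EV: "E \<subseteq> ?V n" by (meson Un_upper1 span_superset subset_trans)
      have "\<exists>z2\<in>rvecs N. (\<forall>y\<in>?V n. rinner N z2 y = rinner N z1 y) \<and>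
        (\<forall>y\<in>span (insert (uvec n) (?V n)). rinner N z2 y \<le> M * lp_norm \<infinity> N y)"
        by (rule functional_extend_one[OF subspace_span VN un False z1(1) M]) (rule z1(3))
      then obtain z2 where "z2 \<in> rvecs N" "\<forall>y\<in>?V n. rinner N z2 y = rinner N z1 y"
        "\<forall>y\<in>span (insert (uvec n) (?V n)). rinner N z2 y \<le> M * lp_norm \<infinity> N y"
        by (elim bexE conjE)
      then show ?thesis unfolding VS using z1(2) EV by (intro bexI[of _ z2]) auto
    qed
  qed
  from this[of N] obtain z' where z': "z' \<in> rvecs N" "\<forall>y\<in>E. rinner N z' y = rinner N z y"
    "\<And>y. y \<in> ?V N \<Longrightarrow> rinner N z' y \<le> M * lp_norm \<infinity> N y" by auto
  \<comment> \<open>The sign vector has sup norm at most 1 and recovers the l_1 norm of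
    \<open>z'\<close>.\<close>
  define s where "s = (\<lambda>i. if i < N then sgn (z' i) else 0)"
  have "s \<in> rvecs N" by (simp add: s_def rvecs_def)
  also have "rvecs N = span (uvec ` {..<N})" using onb_uvec by (simp add: onb_def)
  also have "\<dots> \<subseteq> ?V N" by (intro span_mono) auto
  finally have "rinner N z' s \<le> M * lp_norm \<infinity> N s" by (rule z'(3))
  also have "\<dots> \<le> M * 1"
    using M by (intro mult_left_mono, subst lp_norm_inf_le_iff) (auto simp: s_def abs_sgn_eq)
  also have "rinner N z' s = (\<Sum>i<N. \<bar>z' i\<bar>)" by (simp add: rinner_def s_def abs_sgn)
  finally show ?thesis using z' by auto
qed

text \<open>The norm for \<open>q\<close> is dual to that for \<open>p\<close>: Hoelder's inequality
  together with a norming vector, which supplies attainment.\<close>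

definition lp_dual :: "ereal \<Rightarrow> ereal \<Rightarrow> bool" where
  "lp_dual p q \<longleftrightarrow> (\<forall>k. \<forall>u\<in>rvecs k. (\<forall>v\<in>rvecs k. rinner k u v \<le> lp_norm q k u * lp_norm p k v) \<and>
     (\<exists>v\<in>rvecs k. lp_norm p k v \<le> 1 \<and> rinner k u v = lp_norm q k u))"

lemma lp_dual_inf_1: "lp_dual \<infinity> 1"
  unfolding lp_dual_def
proof (intro allI ballI conjI)
  fix k and u v :: "nat \<Rightarrow> real"
  have "rinner k u v \<le> (\<Sum>i<k. \<bar>u i\<bar> * lp_norm \<infinity> k v)"
    unfolding rinner_def
  proof (rule sum_mono)
    fix i assume "i \<in> {..<k}"
    then have "\<bar>u i\<bar> * \<bar>v i\<bar> \<le> \<bar>u i\<bar> * lp_norm \<infinity> k v" by (intro mult_left_mono lp_norm_inf_coord) auto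
    then show "u i * v i \<le> \<bar>u i\<bar> * lp_norm \<infinity> k v" using abs_ge_self[of "u i * v i"] by (simp add: abs_mult)
  qed
  then show "rinner k u v \<le> lp_norm 1 k u * lp_norm \<infinity> k v" by (simp add: lp_norm_1 sum_distrib_right)
  define s where "s = (\<lambda>i. if i < k then sgn (u i) else 0)"
  have "lp_norm \<infinity> k s \<le> 1" by (subst lp_norm_inf_le_iff) (auto simp: s_def abs_sgn_eq)
  moreover have "rinner k u s = lp_norm 1 k u" by (simp add: rinner_def s_def abs_sgn lp_norm_1)
  moreover have "s \<in> rvecs k" by (simp add: s_def rvecs_def)
  ultimately show "\<exists>v\<in>rvecs k. lp_norm \<infinity> k v \<le> 1 \<and> rinner k u v = lp_norm 1 k u" by blast
qed

lemma lp_norm_2_sq: "(lp_norm 2 k u)\<^sup>2 = rinner k u u"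
proof -
  have "(\<Sum>i<k. (u i)\<^sup>2) \<ge> 0" by (simp add: sum_nonneg)
  then have "(lp_norm 2 k u)\<^sup>2 = (\<Sum>i<k. (u i)\<^sup>2)" unfolding lp_norm_2 by (rule real_sqrt_pow2)
  then show ?thesis by (simp only: rinner_def power2_eq_square)
qed

lemma lp_dual_2_2: "lp_dual 2 2"
  unfolding lp_dual_def
proof (intro allI ballI conjI)
  fix k and u v :: "nat \<Rightarrow> real" assume u: "u \<in> rvecs k"
  have "(rinner k u v)\<^sup>2 \<le> (\<Sum>i<k. (u i)\<^sup>2) * (\<Sum>i<k. (v i)\<^sup>2)"
    unfolding rinner_def by (rule Cauchy_Schwarz_ineq_sum)
  then have "sqrt ((rinner k u v)\<^sup>2) \<le> sqrt ((\<Sum>i<k. (u i)\<^sup>2) * (\<Sum>i<k. (v i)\<^sup>2))" by (rule real_sqrt_le_mono)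
  then show "rinner k u v \<le> lp_norm 2 k u * lp_norm 2 k v"
    unfolding lp_norm_2 by (simp add: real_sqrt_mult)
  let ?n = "lp_norm 2 k u"
  define v where "v = (1 / ?n) *\<^sub>R u"
  have "lp_norm 2 k v = \<bar>1 / ?n\<bar> * ?n" unfolding v_def by (rule lp_admissibleD(1)[OF lp_admissible_2 u])
  also have "\<dots> \<le> 1"
  proof -
    have "\<bar>1 / t\<bar> * t \<le> 1" for t :: real by (cases "t > 0") auto
    then show ?thesis .
  qed
  finally have "lp_norm 2 k v \<le> 1" .
  moreover have "rinner k u v = ?n"
    by (simp add: v_def rinner_right flip: lp_norm_2_sq) (simp add: power2_eq_square)
  moreover have "v \<in> rvecs k" unfolding v_def using u by (rule subspace_scale[OF subspace_rvecs])
  ultimately show "\<exists>v\<in>rvecs k. lp_norm 2 k v \<le> 1 \<and> rinner k u v = ?n" by blast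
qed

text \<open>The quotient of l_1 is the dual of \<open>E\<close> with the sup norm. Transposing B A =
  1 gives a factorisation of the identity of the dual model space, with the roles of
  \<open>A\<close> and \<open>B\<close> and of their bounds exchanged; so one construction serves
  both halves of the theorem.\<close>

lemma contains_complemented_lp_dual_pair:
  assumes E: "E \<in> grassmannian d N" and AB: "linear A" "linear B"
    and p: "lp_admissible p" "lp_admissible q" "lp_dual p q"
    and ab: "a > 0" "b > 0" "a * b \<le> C"
    and A: "\<And>y. y \<in> rvecs k \<Longrightarrow> A y \<in> E" and B: "\<And>x. x \<in> E \<Longrightarrow> B x \<in> rvecs k"
    and BA: "\<And>y. y \<in> rvecs k \<Longrightarrow> B (A y) = y"
    and nA: "\<And>y. y \<in> rvecs k \<Longrightarrow> lp_norm \<infinity> N (A y) \<le> a * lp_norm p k y"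
    and nB: "\<And>x. x \<in> E \<Longrightarrow> lp_norm p k (B x) \<le> b * lp_norm \<infinity> N x"
  shows "contains_complemented_lp C p k (ns_restrict (lp_space \<infinity> N) E)"
    and "contains_complemented_lp C q k (ns_quotient (lp_space 1 N) (orth_compl N E))"
proof -
  have sE: "subspace E" and EN: "E \<subseteq> rvecs N" using grassmannianD[OF E] by auto
  have Cge: "C \<ge> 0" using ab by (smt (verit) mult_pos_pos)
  note rsc = subspace_scale[OF subspace_rvecs]
  show "contains_complemented_lp C p k (ns_restrict (lp_space \<infinity> N) E)"
    unfolding ns_restrict_linf
  \<comment> \<open>Scaling by the bound \<open>b\<close> of \<open>B\<close> normalises the lower
    constant to 1; the upper one becomes a b. In the dual case the scaling is by
    \<open>a\<close>.\<close>
  proof (rule contains_complemented_lpI[of E "\<lambda>y. A (b *\<^sub>R y)" "\<lambda>x. (1 / b) *\<^sub>R B x"])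
    show "linear (\<lambda>y. A (b *\<^sub>R y))" "linear (\<lambda>x. (1 / b) *\<^sub>R B x)"
      using AB by (auto intro!: linearI simp: linear_add linear_scale scaleR_add_right mult.commute)
    have Ab: "A (b *\<^sub>R y) = b *\<^sub>R A y" for y using AB(1) by (rule linear_scale)
    show "(1 / b) *\<^sub>R B (A (b *\<^sub>R y)) = y" if "y \<in> rvecs k" for y
      using BA[OF rsc[OF that]] ab(2) by simp
    show "lp_norm p k y \<le> lp_norm \<infinity> N (A (b *\<^sub>R y))" if "y \<in> rvecs k" for y
      using nB[OF A[OF that]] BA[OF that] ab(2) by (simp add: Ab lp_norm_inf_scale)
    show "lp_norm \<infinity> N (A (b *\<^sub>R y)) \<le> C * lp_norm p k y" if "y \<in> rvecs k" for y
    proof -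
      have "lp_norm \<infinity> N (A (b *\<^sub>R y)) \<le> b * (a * lp_norm p k y)"
        using nA[OF that] ab(2) by (simp add: Ab lp_norm_inf_scale)
      also have "\<dots> = (a * b) * lp_norm p k y" by simp
      also have "\<dots> \<le> C * lp_norm p k y" using ab(3) lp_admissibleD(3)[OF p(1) that] by (rule mult_right_mono)
      finally show ?thesis .
    qed
    show "lp_norm \<infinity> N (A (b *\<^sub>R (1 / b) *\<^sub>R B x)) \<le> C * lp_norm \<infinity> N x" if "x \<in> E" for x
    proof -
      have "lp_norm \<infinity> N (A (b *\<^sub>R (1 / b) *\<^sub>R B x)) \<le> a * lp_norm p k (B x)" using nA[OF B[OF that]] ab(2) by simp
      also have "\<dots> \<le> a * (b * lp_norm \<infinity> N x)" using nB[OF that] ab(1) by (intro mult_left_mono) auto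
      also have "\<dots> = (a * b) * lp_norm \<infinity> N x" by simp
      also have "\<dots> \<le> C * lp_norm \<infinity> N x" using ab(3) lp_norm_inf_nonneg by (rule mult_right_mono)
      finally show ?thesis .
    qed
  qed (use sE A B rsc Cge in auto)
  define Bm where "Bm i j = B (pmv N E (uvec j)) i" for i j
  define Am where "Am i j = A (uvec j) i" for i j
  note pE = pmv_mem[OF E]
  have Bmv: "B (pmv N E x) = mv k N Bm x" if "x \<in> rvecs N" for x
    unfolding Bm_def
  proof (rule mv_of_additive[of N "\<lambda>x. B (pmv N E x)" k, OF _ _ _ that])
    show "B (pmv N E (x + y)) = B (pmv N E x) + B (pmv N E y)" for x y
      by (simp add: linear_add[OF linear_pmv] linear_add[OF AB(2)])
    show "B (pmv N E (c *\<^sub>R x)) = c *\<^sub>R B (pmv N E x)" for c x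
      by (simp add: linear_scale[OF linear_pmv] linear_scale[OF AB(2)])
  qed (intro B pE)
  have Amv: "A y = mv N k Am y" if "y \<in> rvecs k" for y
    unfolding Am_def
  proof (rule mv_of_additive[OF _ _ _ that])
    show "A x \<in> rvecs N" if "x \<in> rvecs k" for x using A[OF that] EN by auto
  qed (use AB in \<open>auto simp: linear_add linear_scale\<close>)
  have adj: "rinner n (mv n m M x) y = rinner m x (mv m n (\<lambda>i j. M j i) y)" for n m M x y
  proof -
    have "rinner n (mv n m M x) y = (\<Sum>i<n. \<Sum>j<m. M i j * x j * y i)"
      by (simp add: rinner_def mv_def sum_distrib_right)
    also have "\<dots> = (\<Sum>j<m. \<Sum>i<n. M i j * x j * y i)" by (rule sum.swap)
    also have "\<dots> = rinner m x (mv m n (\<lambda>i j. M j i) y)"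
      by (simp add: rinner_def mv_def sum_distrib_left algebra_simps)
    finally show ?thesis .
  qed
  \<comment> \<open>The functional x \<mapsto> <w, B x> on \<open>E\<close>, represented by a vector
    of \<open>rvecs N\<close>; \<open>A'\<close> projects this vector to \<open>E\<close>, which
    changes none of its values on \<open>E\<close>.\<close>
  define t where "t w = mv N k (\<lambda>i j. Bm j i) w" for w
  define A' where "A' w = pmv N E (t w)" for w
  define B' where "B' x = mv k N (\<lambda>i j. Am j i) x" for x
  have tB: "rinner N (t w) x = rinner k w (B x)" if "x \<in> E" for w x
    using adj[of N k "\<lambda>i j. Bm j i" w x] Bmv[of x] pmv_fix[OF E that] that EN by (auto simp: t_def)
  have B'A: "rinner k (B' x) y = rinner N x (A y)" if "y \<in> rvecs k" for x y
    using adj[of k N "\<lambda>i j. Am j i" x y] Amv[OF that] by (simp add: B'_def)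
  have tr: "t w \<in> rvecs N" for w by (simp add: t_def mv_rvecs)
  have A'E: "A' w \<in> E" for w unfolding A'_def by (rule pE)
  have B'r: "B' x \<in> rvecs k" for x by (simp add: B'_def mv_rvecs)
  have A'x: "rinner N (A' w) x = rinner N (t w) x" if "x \<in> E" for w x
    using pmv_orth[OF E that, of "t w"] by (simp add: A'_def rinner_diff_left)
  have B'A': "B' (A' w) = w" if w: "w \<in> rvecs k" for w
  proof
    fix j
    show "B' (A' w) j = w j"
    proof (cases "j < k")
      case True
      have uj: "uvec j \<in> rvecs k" using True by (rule uvec_rvecs)
      have "B' (A' w) j = rinner k (B' (A' w)) (uvec j)" using True by (simp add: rinner_uvec)
      also have "\<dots> = rinner N (t w) (A (uvec j))" using B'A[OF uj] A'x[OF A[OF uj]] by simp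
      also have "\<dots> = rinner k w (uvec j)" using tB[OF A[OF uj]] BA[OF uj] by simp
      finally show ?thesis using True by (simp add: rinner_uvec)
    next
      case False
      then show ?thesis using rvecs_memD[OF B'r] rvecs_memD[OF w] by simp
    qed
  qed
  have lin: "linear A'" "linear B'"
    unfolding A'_def t_def B'_def using linear_compose[OF linear_mv linear_pmv] linear_mv by (auto simp: comp_def)
  \<comment> \<open>The functional has norm at most b times that of \<open>w\<close>. A Hahn-Banach
    extension with the same bound represents the same coset as \<open>A' w\<close>.\<close>
  have qA: "quot_norm N E (A' w) \<le> b * lp_norm q k w" if w: "w \<in> rvecs k" for w
  proof -
    have M0: "b * lp_norm q k w \<ge> 0" using ab(2) lp_admissibleD(3)[OF p(2) w] by simp
    have "rinner N (t w) y \<le> b * lp_norm q k w * lp_norm \<infinity> N y" if "y \<in> E" for y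
    proof -
      have "rinner N (t w) y = rinner k w (B y)" by (rule tB[OF that])
      also have "\<dots> \<le> lp_norm q k w * lp_norm p k (B y)" using p(3) w B[OF that] by (auto simp: lp_dual_def)
      also have "\<dots> \<le> lp_norm q k w * (b * lp_norm \<infinity> N y)"
        using nB[OF that] lp_admissibleD(3)[OF p(2) w] by (rule mult_left_mono)
      finally show ?thesis by (simp add: algebra_simps)
    qed
    from functional_extend[OF sE EN tr M0 this] obtain z
      where z: "z \<in> rvecs N" "\<And>y. y \<in> E \<Longrightarrow> rinner N z y = rinner N (t w) y" "(\<Sum>i<N. \<bar>z i\<bar>) \<le> b * lp_norm q k w"
      by auto
    have "z - A' w \<in> orth_compl N E"
      using z A'x A'E[of w] EN by (auto simp: orth_compl_def rinner_diff_left intro!: subspace_diff[OF subspace_rvecs])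
    then have "quot_norm N E (A' w) \<le> (\<Sum>i<N. \<bar>A' w i + (z - A' w) i\<bar>)" by (rule quot_norm_le)
    also have "\<dots> = (\<Sum>i<N. \<bar>z i\<bar>)" by (simp add: fun_apply)
    finally show ?thesis using z(3) by simp
  qed
  \<comment> \<open>A norming vector v is used: A v lies in \<open>E\<close>, so its inner product
    with x is the same for all representatives x + z.\<close>
  have qB: "lp_norm q k (B' x) \<le> a * quot_norm N E x" if x: "x \<in> E" for x
  proof -
    obtain v where v: "v \<in> rvecs k" "lp_norm p k v \<le> 1" "rinner k (B' x) v = lp_norm q k (B' x)"
      using p(3) B'r[of x] unfolding lp_dual_def by blast
    have "lp_norm q k (B' x) / a \<le> quot_norm N E x"
    proof (rule quot_norm_geI)
      fix z assume z: "z \<in> orth_compl N E"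
      have Av: "A v \<in> E" by (rule A[OF v(1)])
      have "lp_norm \<infinity> N (A v) \<le> a * lp_norm p k v" by (rule nA[OF v(1)])
      also have "\<dots> \<le> a * 1" using v(2) ab(1) by (intro mult_left_mono) auto
      finally have Av1: "lp_norm \<infinity> N (A v) \<le> a" by simp
      have "lp_norm q k (B' x) = rinner N x (A v)" using v B'A by metis
      also have "\<dots> = rinner N (x + z) (A v)" using z Av by (simp add: orth_compl_def rinner_left)
      also have "\<dots> \<le> (\<Sum>i<N. \<bar>x i + z i\<bar> * a)"
        unfolding rinner_def
      proof (rule sum_mono)
        fix i assume "i \<in> {..<N}"
        then have "\<bar>A v i\<bar> \<le> a" using lp_norm_inf_coord[of i N "A v"] Av1 by simp
        then have "\<bar>x i + z i\<bar> * \<bar>A v i\<bar> \<le> \<bar>x i + z i\<bar> * a" by (intro mult_left_mono) auto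
        then show "(x + z) i * A v i \<le> \<bar>x i + z i\<bar> * a"
          using abs_ge_self[of "(x + z) i * A v i"] by (simp add: abs_mult fun_apply)
      qed
      also have "\<dots> = (\<Sum>i<N. \<bar>x i + z i\<bar>) * a" by (simp add: sum_distrib_right)
      finally show "lp_norm q k (B' x) / a \<le> (\<Sum>i<N. \<bar>x i + z i\<bar>)" using ab(1) by (simp add: field_simps)
    qed
    then show ?thesis using ab(1) by (simp add: field_simps)
  qed
  interpret norm_family N d "quot_norm N" by (rule norm_family_quot)
  have "contains_complemented_lp C q k (espace E (quot_norm N E))"
  proof (rule contains_complemented_lpI[of E "\<lambda>w. A' (a *\<^sub>R w)" "\<lambda>x. (1 / a) *\<^sub>R B' x"])
    show "linear (\<lambda>y. A' (a *\<^sub>R y))" "linear (\<lambda>x. (1 / a) *\<^sub>R B' x)"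
      using lin by (auto intro!: linearI simp: linear_add linear_scale scaleR_add_right mult.commute)
    have Aa: "A' (a *\<^sub>R y) = a *\<^sub>R A' y" for y using lin(1) by (rule linear_scale)
    have na: "quot_norm N E (A' (a *\<^sub>R y)) = a * quot_norm N E (A' y)" for y
      unfolding Aa using nf_scale[OF E A'E] ab(1) by simp
    show "(1 / a) *\<^sub>R B' (A' (a *\<^sub>R y)) = y" if "y \<in> rvecs k" for y
      using B'A'[OF rsc[OF that]] ab(1) by simp
    show "lp_norm q k y \<le> quot_norm N E (A' (a *\<^sub>R y))" if "y \<in> rvecs k" for y
      using qB[OF A'E, of y] B'A'[OF that] by (simp add: na)
    show "quot_norm N E (A' (a *\<^sub>R y)) \<le> C * lp_norm q k y" if "y \<in> rvecs k" for y
    proof -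
      have "quot_norm N E (A' (a *\<^sub>R y)) \<le> a * (b * lp_norm q k y)"
        unfolding na using qA[OF that] ab(1) by (intro mult_left_mono) auto
      also have "\<dots> = (a * b) * lp_norm q k y" by simp
      also have "\<dots> \<le> C * lp_norm q k y" using ab(3) lp_admissibleD(3)[OF p(2) that] by (rule mult_right_mono)
      finally show ?thesis .
    qed
    show "quot_norm N E (A' (a *\<^sub>R (1 / a) *\<^sub>R B' x)) \<le> C * quot_norm N E x" if "x \<in> E" for x
    proof -
      have "quot_norm N E (A' (a *\<^sub>R (1 / a) *\<^sub>R B' x)) \<le> b * lp_norm q k (B' x)" using qA[OF B'r] ab(1) by simp
      also have "\<dots> \<le> b * (a * quot_norm N E x)" using qB[OF that] ab(2) by (intro mult_left_mono) auto
      also have "\<dots> = (a * b) * quot_norm N E x" by simp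
      also have "\<dots> \<le> C * quot_norm N E x"
        using ab(3) nf_coord[OF E that, of 0] by (intro mult_right_mono) auto
      finally show ?thesis .
    qed
  qed (use sE A'E B'r rsc Cge in auto)
  then show "contains_complemented_lp C q k (ns_quotient (lp_space 1 N) (orth_compl N E))"
    using contains_complemented_lp_quotient_iff[OF E] by blast
qed

section \<open>Deterministic criteria\<close>

definition gmap :: "nat \<Rightarrow> nat \<Rightarrow> (nat \<times> nat \<Rightarrow> real) \<Rightarrow> (nat \<Rightarrow> real) \<Rightarrow> nat \<Rightarrow> real" where
  "gmap N d G = mv N d (\<lambda>i l. G (i, l))"

text \<open>The Gram matrix of the rows.\<close>

definition rip :: "nat \<Rightarrow> (nat \<times> nat \<Rightarrow> real) \<Rightarrow> nat \<Rightarrow> nat \<Rightarrow> real" where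
  "rip d G i j = (\<Sum>l<d. G (i, l) * G (j, l))"

lemma linear_gmap: "linear (gmap N d G)"
  unfolding gmap_def by (rule linear_mv)

lemma gmap_apply: "i < N \<Longrightarrow> gmap N d G x i = (\<Sum>l<d. G (i, l) * x l)"
  by (simp add: gmap_def mv_def)

lemma gmap_expand: "gmap N d G x = (\<Sum>l<d. x l *\<^sub>R col N G l)"
  by (auto simp: gmap_def mv_def col_def fun_eq_iff sum_fun_apply fun_apply mult.commute)

lemma gmap_mem: "gmap N d G x \<in> span (col N G ` {..<d})"
  unfolding gmap_expand by (intro span_sum span_scale span_base imageI)

lemma gmap_image: "span (col N G ` {..<d}) = gmap N d G ` rvecs d"
proof
  have "col N G l = gmap N d G (uvec l)" if "l < d" for l
  proof -
    have "gmap N d G (uvec l) = (\<Sum>m<d. if m = l then col N G m else 0)"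
      unfolding gmap_expand by (intro sum.cong) (auto simp: uvec_def)
    then show ?thesis using that by simp
  qed
  then have "col N G ` {..<d} \<subseteq> gmap N d G ` rvecs d" using uvec_rvecs by auto
  then show "span (col N G ` {..<d}) \<subseteq> gmap N d G ` rvecs d"
    by (intro span_minimal linear_subspace_image[OF linear_gmap subspace_rvecs])
qed (use gmap_mem in auto)

text \<open>A missed vector would extend the image of the unit basis to k + 1 independent vectors in
  dimension k.\<close>

lemma linear_inj_rvecs_surj:
  assumes M: "linear M" "M ` rvecs k \<subseteq> rvecs k" "inj_on M (rvecs k)"
  shows "M ` rvecs k = rvecs k"
proof (rule ccontr)
  assume "M ` rvecs k \<noteq> rvecs k"
  then obtain v where v: "v \<in> rvecs k" "v \<notin> M ` rvecs k" using M(2) by blast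
  let ?S = "uvec ` {..<k}"
  have sp: "span ?S = rvecs k" using onb_uvec[of k] by (simp add: onb_def)
  have on: "orthonormal k uvec k" using onb_uvec[of k] by (simp add: onb_def)
  have inj: "inj_on M (span ?S)" using M(3) sp by simp
  have ind: "independent (M ` ?S)"
    by (rule linear_independent_injective_image[OF M(1) orthonormal_independent[OF on] inj])
  have spM: "span (M ` ?S) = M ` rvecs k" using linear_span_image[OF M(1), of ?S] sp by simp
  then have ins: "independent (insert v (M ` ?S))" using v(2) ind by (simp add: independent_insertI)
  have "M ` ?S \<subseteq> rvecs k" using M(2) sp span_superset[of ?S] by blast
  then have "card (insert v (M ` ?S)) \<le> k" using independent_rvecs_finite[OF ins] v(1) by auto
  moreover have "card (M ` ?S) = k"
    using card_image[OF inj_on_subset[OF inj span_superset]] card_image[OF orthonormal_inj[OF on]] by simp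
  moreover have "v \<notin> M ` ?S" using v(2) spM span_superset[of "M ` ?S"] by blast
  ultimately show False by simp
qed

text \<open>The Gram matrix on the block, with columns divided by the diagonal, differs from the
  identity by at most 1/2 in the sup norm and is therefore invertible. The hypothesis on all rows,
  not only those of the block, bounds the embedding into the N coordinates.\<close>

lemma good_block_inf:
  assumes nd: "nondeg N d G" and d: "d > 0" and o: "o' + k \<le> N"
    and r: "\<And>t. t < k \<Longrightarrow> rip d G (o' + t) (o' + t) \<ge> real d / 4"
    and off: "\<And>i. i < N \<Longrightarrow> (\<Sum>t\<in>{..<k} - {t. o' + t = i}. \<bar>rip d G i (o' + t)\<bar>) \<le> real d / 8"
  defines "E \<equiv> span (col N G ` {..<d})"
  shows "contains_complemented_lp 32 \<infinity> k (ns_restrict (lp_space \<infinity> N) E)"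
    and "contains_complemented_lp 32 1 k (ns_quotient (lp_space 1 N) (orth_compl N E))"
proof -
  have EG: "E \<in> grassmannian d N" unfolding E_def by (rule onb_grassmannian[OF nondeg_onb[OF nd]])
  define R where "R t = rip d G (o' + t) (o' + t)" for t
  have R: "R t \<ge> real d / 4" "R t > 0" if "t < k" for t using r[OF that] d unfolding R_def by auto
  \<comment> \<open>The combination of the block rows divided by their squared lengths; after
    applying \<open>gmap\<close>, coordinate o' + t is w t up to the off-diagonal terms.\<close>
  define A0 where "A0 = mv d k (\<lambda>l t. G (o' + t, l) / R t)"
  define A1 where "A1 w = gmap N d G (A0 w)" for w
  define B where "B = mv k N (\<lambda>t i. of_bool (i = o' + t))"
  have Bt: "B x t = x (o' + t)" if "t < k" for x t
  proof -
    have "B x t = (\<Sum>i<N. if i = o' + t then x i else 0)" using that by (auto simp: B_def mv_def intro: sum.cong)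
    then show ?thesis using that o by simp
  qed
  have A1i: "A1 w i = (\<Sum>t<k. rip d G i (o' + t) / R t * w t)" if "i < N" for w i
  proof -
    have "A1 w i = (\<Sum>l<d. \<Sum>t<k. G (i, l) * (G (o' + t, l) / R t * w t))"
      using that by (simp add: A1_def gmap_apply A0_def mv_def sum_distrib_left)
    also have "\<dots> = (\<Sum>t<k. \<Sum>l<d. G (i, l) * (G (o' + t, l) / R t * w t))" by (rule sum.swap)
    also have "\<dots> = (\<Sum>t<k. rip d G i (o' + t) / R t * w t)"
      by (intro sum.cong refl) (simp add: rip_def sum_distrib_right sum_divide_distrib mult.assoc)
    finally show ?thesis .
  qed
  \<comment> \<open>The factor 1/2 is (d/8) (4/d), since the diagonal entries are at least
    d/4.\<close>
  have offb: "(\<Sum>t\<in>{..<k} - {t. o' + t = i}. \<bar>rip d G i (o' + t) / R t * w t\<bar>) \<le> 1 / 2 * lp_norm \<infinity> k w"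
    if "i < N" for i w
  proof -
    have "(\<Sum>t\<in>{..<k} - {t. o' + t = i}. \<bar>rip d G i (o' + t) / R t * w t\<bar>) \<le>
      (\<Sum>t\<in>{..<k} - {t. o' + t = i}. \<bar>rip d G i (o' + t)\<bar> * (4 / real d * lp_norm \<infinity> k w))"
    proof (rule sum_mono)
      fix t assume "t \<in> {..<k} - {t. o' + t = i}"
      then have t: "t < k" by simp
      have "\<bar>rip d G i (o' + t) / R t * w t\<bar> = \<bar>rip d G i (o' + t)\<bar> * (1 / R t * \<bar>w t\<bar>)"
        using R(2)[OF t] by (simp add: abs_mult)
      also have "1 / R t \<le> 4 / real d" using R[OF t] d by (simp add: field_simps)
      then have "\<bar>rip d G i (o' + t)\<bar> * (1 / R t * \<bar>w t\<bar>) \<le> \<bar>rip d G i (o' + t)\<bar> * (4 / real d * lp_norm \<infinity> k w)"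
        using lp_norm_inf_coord[OF t, of w] R(2)[OF t] d by (intro mult_left_mono mult_mono) auto
      finally show "\<bar>rip d G i (o' + t) / R t * w t\<bar> \<le> \<bar>rip d G i (o' + t)\<bar> * (4 / real d * lp_norm \<infinity> k w)" .
    qed
    also have "\<dots> = (\<Sum>t\<in>{..<k} - {t. o' + t = i}. \<bar>rip d G i (o' + t)\<bar>) * (4 / real d * lp_norm \<infinity> k w)"
      by (rule sum_distrib_right[symmetric])
    also have "\<dots> \<le> real d / 8 * (4 / real d * lp_norm \<infinity> k w)"
      using off[OF that] lp_norm_inf_nonneg[of k w] by (intro mult_right_mono) auto
    also have "\<dots> = 1 / 2 * lp_norm \<infinity> k w" using d by simp
    finally show ?thesis .
  qed
  \<comment> \<open>For a row in the block the diagonal term contributes 1 in addition to the 1/2;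
    for other rows there is no such term.\<close>
  have A1n: "lp_norm \<infinity> N (A1 w) \<le> 3 / 2 * lp_norm \<infinity> k w" for w
  proof (subst lp_norm_inf_le_iff)
    show "0 \<le> 3 / 2 * lp_norm \<infinity> k w" using lp_norm_inf_nonneg[of k w] by simp
    show "\<forall>i<N. \<bar>A1 w i\<bar> \<le> 3 / 2 * lp_norm \<infinity> k w"
    proof (intro allI impI)
      fix i assume i: "i < N"
      let ?f = "\<lambda>t. rip d G i (o' + t) / R t * w t"
      have "A1 w i = (\<Sum>t\<in>{..<k} - {t. o' + t = i}. ?f t) + (\<Sum>t\<in>{..<k} \<inter> {t. o' + t = i}. ?f t)"
        unfolding A1i[OF i] by (subst sum.union_disjoint[symmetric]) (auto intro!: sum.cong)
      moreover have "\<bar>\<Sum>t\<in>{..<k} - {t. o' + t = i}. ?f t\<bar> \<le> 1 / 2 * lp_norm \<infinity> k w"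
        using offb[OF i, of w] sum_abs[of ?f "{..<k} - {t. o' + t = i}"] by linarith
      moreover have "\<bar>\<Sum>t\<in>{..<k} \<inter> {t. o' + t = i}. ?f t\<bar> \<le> lp_norm \<infinity> k w"
      proof (cases "\<exists>t<k. o' + t = i")
        case True
        then obtain t where t: "t < k" "o' + t = i" by auto
        then have "{..<k} \<inter> {t. o' + t = i} = {t}" by auto
        moreover have "?f t = w t" using R(2)[OF t(1)] t(2) by (simp add: R_def)
        ultimately show ?thesis using lp_norm_inf_coord[OF t(1), of w] by simp
      next
        case False
        then have e: "{..<k} \<inter> {t. o' + t = i} = {}" by auto
        show ?thesis unfolding e using lp_norm_inf_nonneg[of k w] by simp
      qed
      ultimately show "\<bar>A1 w i\<bar> \<le> 3 / 2 * lp_norm \<infinity> k w" by linarith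
    qed
  qed
  define M where "M w = B (A1 w)" for w
  have linA1: "linear A1" unfolding A1_def A0_def using linear_compose[OF linear_mv linear_gmap] by (simp add: comp_def)
  have linB: "linear B" unfolding B_def by (rule linear_mv)
  have linM: "linear M" unfolding M_def using linear_compose[OF linA1 linB] by (simp add: comp_def)
  have Br: "B x \<in> rvecs k" for x unfolding B_def by (rule mv_rvecs)
  \<comment> \<open>\<open>M\<close> differs from the identity by at most 1/2, which bounds its
    inverse by 2.\<close>
  have Mw: "lp_norm \<infinity> k w \<le> 2 * lp_norm \<infinity> k (M w)" for w
  proof -
    have d1: "lp_norm \<infinity> k w \<le> lp_norm \<infinity> k (M w) + 1 / 2 * lp_norm \<infinity> k w"
    proof (subst lp_norm_inf_le_iff)
      show "0 \<le> lp_norm \<infinity> k (M w) + 1 / 2 * lp_norm \<infinity> k w"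
        using lp_norm_inf_nonneg[of k w] lp_norm_inf_nonneg[of k "M w"] by simp
      show "\<forall>i<k. \<bar>w i\<bar> \<le> lp_norm \<infinity> k (M w) + 1 / 2 * lp_norm \<infinity> k w"
      proof (intro allI impI)
        fix t assume t: "t < k"
        have i: "o' + t < N" using t o by simp
        let ?f = "\<lambda>s. rip d G (o' + t) (o' + s) / R s * w s"
        have "M w t = (\<Sum>s\<in>{..<k}. ?f s)" using t Bt A1i[OF i] by (simp add: M_def)
        also have "\<dots> = ?f t + (\<Sum>s\<in>{..<k} - {t}. ?f s)" using t by (intro sum.remove) auto
        also have "?f t = w t" using R(2)[OF t] by (simp add: R_def)
        finally have "w t = M w t - (\<Sum>s\<in>{..<k} - {t}. ?f s)" by simp
        moreover have "\<bar>\<Sum>s\<in>{..<k} - {t}. ?f s\<bar> \<le> 1 / 2 * lp_norm \<infinity> k w"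
          using offb[OF i, of w] sum_abs[of ?f "{..<k} - {t}"] by simp
        ultimately show "\<bar>w t\<bar> \<le> lp_norm \<infinity> k (M w) + 1 / 2 * lp_norm \<infinity> k w"
          using lp_norm_inf_coord[OF t, of "M w"] by linarith
      qed
    qed
    then show ?thesis by linarith
  qed
  have injM: "inj_on M (rvecs k)"
  proof (rule inj_onI)
    fix x y assume xy: "x \<in> rvecs k" "y \<in> rvecs k" "M x = M y"
    have "M (x - y) = 0" using xy(3) linear_diff[OF linM] by simp
    then have "lp_norm \<infinity> k (x - y) \<le> 0"
      using Mw[of "x - y"] lp_norm_inf_scale[of k 0 0] by simp
    then have "x t = y t" if "t < k" for t
      using lp_norm_inf_coord[OF that, of "x - y"] by (simp add: fun_apply)
    then show "x = y" using rvecs_memD[OF xy(1)] rvecs_memD[OF xy(2)] by (metis ext not_less)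
  qed
  have surjM: "M ` rvecs k = rvecs k"
    using Br by (intro linear_inj_rvecs_surj[OF linM _ injM]) (auto simp: M_def)
  \<comment> \<open>Correcting by the inverse of \<open>M\<close> makes B A the identity; the
    embedding then has norm at most (3/2) 2 = 3.\<close>
  obtain L where L: "L ` UNIV \<subseteq> rvecs k" "linear L" "\<And>y. y \<in> rvecs k \<Longrightarrow> M (L y) = y"
    using linear_exists_right_inverse_on[OF linM subspace_rvecs, of k] surjM by auto
  define A where "A y = A1 (L y)" for y
  have linA: "linear A" unfolding A_def using linear_compose[OF L(2) linA1] by (simp add: comp_def)
  note hyps = EG linA linB lp_admissible_inf lp_admissible_1 lp_dual_inf_1
  have AE: "A y \<in> E" for y unfolding A_def A1_def E_def by (rule gmap_mem)
  have BA: "B (A y) = y" if "y \<in> rvecs k" for y using L(3)[OF that] by (simp add: A_def M_def)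
  have nA: "lp_norm \<infinity> N (A y) \<le> 3 * lp_norm \<infinity> k y" if "y \<in> rvecs k" for y
    using A1n[of "L y"] Mw[of "L y"] L(3)[OF that] by (simp add: A_def)
  have nB: "lp_norm \<infinity> k (B x) \<le> 1 * lp_norm \<infinity> N x" for x
    using Bt o lp_norm_inf_coord[of _ N x] by (subst lp_norm_inf_le_iff) (auto simp: lp_norm_inf_nonneg)
  show "contains_complemented_lp 32 \<infinity> k (ns_restrict (lp_space \<infinity> N) E)"
    "contains_complemented_lp 32 1 k (ns_quotient (lp_space 1 N) (orth_compl N E))"
    using contains_complemented_lp_dual_pair[OF hyps, of 3 1 32] AE Br BA nA nB by auto
qed

text \<open>Here the block consists of coordinates of the parameter space, not of rows. The lower
  bound makes the parametrisation injective, so \<open>B\<close> can read off the block of the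
  parameter; its norm is at most 1/\<rho>, and \<open>A\<close> has norm at most \<open>S\<close> by
  Cauchy-Schwarz.\<close>

lemma good_block_2:
  assumes nd: "nondeg N d G" and o: "o' + k \<le> d" and \<rho>: "\<rho> > 0" and S: "S > 0" "S \<le> 32 * \<rho>"
    and low: "\<And>x. x \<in> rvecs d \<Longrightarrow> \<rho> * lp_norm 2 d x \<le> lp_norm \<infinity> N (gmap N d G x)"
    and up: "\<And>i. i < N \<Longrightarrow> (\<Sum>t<k. (G (i, o' + t))\<^sup>2) \<le> S\<^sup>2"
  defines "E \<equiv> span (col N G ` {..<d})"
  shows "contains_complemented_lp 32 2 k (ns_restrict (lp_space \<infinity> N) E)"
    and "contains_complemented_lp 32 2 k (ns_quotient (lp_space 1 N) (orth_compl N E))"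
proof -
  have EG: "E \<in> grassmannian d N" unfolding E_def by (rule onb_grassmannian[OF nondeg_onb[OF nd]])
  have inj: "inj_on (gmap N d G) (rvecs d)"
  proof (rule inj_onI)
    fix x y assume xy: "x \<in> rvecs d" "y \<in> rvecs d" "gmap N d G x = gmap N d G y"
    have r: "x - y \<in> rvecs d" using xy by (intro subspace_diff[OF subspace_rvecs])
    have "gmap N d G (x - y) = 0" using xy(3) linear_diff[OF linear_gmap] by simp
    then have "\<rho> * lp_norm 2 d (x - y) \<le> 0" using low[OF r] lp_norm_inf_scale[of N 0 0] by simp
    then have "lp_norm 2 d (x - y) \<le> 0" using \<rho> by (simp add: mult_le_0_iff)
    then have "x t = y t" if "t < d" for t
      using lp_admissibleD(2)[OF lp_admissible_2 r that] by (simp add: fun_apply)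
    then show "x = y" using rvecs_memD[OF xy(1)] rvecs_memD[OF xy(2)] by (metis ext not_less)
  qed
  \<comment> \<open>Defined on all sequences, so that the composite \<open>B\<close> is linear
    everywhere.\<close>
  obtain H where H: "H ` UNIV \<subseteq> rvecs d" "linear H" "\<And>x. x \<in> rvecs d \<Longrightarrow> H (gmap N d G x) = x"
    using linear_exists_left_inverse_on[OF linear_gmap subspace_rvecs inj] by auto
  define emb where "emb = mv d k (\<lambda>l t. of_bool (l = o' + t))"
  define blk where "blk = mv k d (\<lambda>t l. of_bool (l = o' + t))"
  define A where "A w = gmap N d G (emb w)" for w
  define B where "B x = blk (H x)" for x
  have linA: "linear A" unfolding A_def emb_def using linear_compose[OF linear_mv linear_gmap] by (simp add: comp_def)
  have linB: "linear B" unfolding B_def blk_def using linear_compose[OF H(2) linear_mv] by (simp add: comp_def)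
  have embr: "emb w \<in> rvecs d" for w unfolding emb_def by (rule mv_rvecs)
  have blkt: "blk x t = x (o' + t)" if "t < k" for x t
  proof -
    have "blk x t = (\<Sum>l<d. if l = o' + t then x l else 0)" using that by (auto simp: blk_def mv_def intro: sum.cong)
    then show ?thesis using that o by simp
  qed
  have embt: "emb w (o' + t) = w t" if "t < k" for w t
  proof -
    have "emb w (o' + t) = (\<Sum>s<k. if t = s then w s else 0)" using that o by (auto simp: emb_def mv_def intro: sum.cong)
    then show ?thesis using that by simp
  qed
  have blkr: "blk x \<in> rvecs k" for x unfolding blk_def by (rule mv_rvecs)
  have BA: "B (A w) = w" if w: "w \<in> rvecs k" for w
  proof
    fix t show "B (A w) t = w t"
      using rvecs_memD[OF blkr[of "H (A w)"], of t] rvecs_memD[OF w, of t] blkt[of t] embt[of t w] H(3)[OF embr]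
      by (cases "t < k") (auto simp: B_def A_def)
  qed
  have Ai: "A w i = (\<Sum>t<k. G (i, o' + t) * w t)" if i: "i < N" for w i
  proof -
    have "A w i = (\<Sum>l<d. \<Sum>t<k. G (i, l) * (of_bool (l = o' + t) * w t))"
      unfolding A_def gmap_apply[OF i] emb_def mv_def sum_distrib_left[symmetric]
      by (intro sum.cong refl) simp
    also have "\<dots> = (\<Sum>t<k. \<Sum>l<d. G (i, l) * (of_bool (l = o' + t) * w t))" by (rule sum.swap)
    also have "\<dots> = (\<Sum>t<k. G (i, o' + t) * w t)"
    proof (intro sum.cong refl)
      fix t assume t: "t \<in> {..<k}"
      have "(\<Sum>l<d. G (i, l) * (of_bool (l = o' + t) * w t)) = (\<Sum>l<d. if l = o' + t then G (i, l) * w t else 0)"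
        by (intro sum.cong) auto
      then show "(\<Sum>l<d. G (i, l) * (of_bool (l = o' + t) * w t)) = G (i, o' + t) * w t" using t o by simp
    qed
    finally show ?thesis .
  qed
  have nA: "lp_norm \<infinity> N (A w) \<le> S * lp_norm 2 k w" for w
  proof (subst lp_norm_inf_le_iff)
    have l0: "lp_norm 2 k w \<ge> 0" unfolding lp_norm_2 by (simp add: sum_nonneg)
    show "0 \<le> S * lp_norm 2 k w" using S l0 by simp
    show "\<forall>i<N. \<bar>A w i\<bar> \<le> S * lp_norm 2 k w"
    proof (intro allI impI)
      fix i assume i: "i < N"
      have "(A w i)\<^sup>2 \<le> (\<Sum>t<k. (G (i, o' + t))\<^sup>2) * (\<Sum>t<k. (w t)\<^sup>2)"
        unfolding Ai[OF i] by (rule Cauchy_Schwarz_ineq_sum)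
      also have "\<dots> \<le> S\<^sup>2 * (\<Sum>t<k. (w t)\<^sup>2)" using up[OF i] by (intro mult_right_mono sum_nonneg) auto
      finally have "sqrt ((A w i)\<^sup>2) \<le> sqrt (S\<^sup>2 * (\<Sum>t<k. (w t)\<^sup>2))" by (rule real_sqrt_le_mono)
      then show "\<bar>A w i\<bar> \<le> S * lp_norm 2 k w" unfolding lp_norm_2 using S(1) by (simp add: real_sqrt_mult)
    qed
  qed
  have nB: "lp_norm 2 k (B x) \<le> (1 / \<rho>) * lp_norm \<infinity> N x" if xE: "x \<in> E" for x
  proof -
    obtain y where y: "y \<in> rvecs d" "x = gmap N d G y" using xE unfolding E_def gmap_image by auto
    have "B x = blk y" using y H(3) by (simp add: B_def)
    moreover have "lp_norm 2 k (blk y) \<le> lp_norm 2 d y"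
    proof -
      have "(\<Sum>t<k. (blk y t)\<^sup>2) = (\<Sum>t<k. (y (o' + t))\<^sup>2)" using blkt by (intro sum.cong) auto
      also have "\<dots> = (\<Sum>l\<in>(+) o' ` {..<k}. (y l)\<^sup>2)" by (subst sum.reindex) auto
      also have "\<dots> \<le> (\<Sum>l<d. (y l)\<^sup>2)" using o by (intro sum_mono2) auto
      finally show ?thesis unfolding lp_norm_2 by (rule real_sqrt_le_mono)
    qed
    moreover have "lp_norm 2 d y \<le> (1 / \<rho>) * lp_norm \<infinity> N x" using low[OF y(1)] y(2) \<rho> by (simp add: field_simps)
    ultimately show ?thesis by simp
  qed
  have AE: "A y \<in> E" for y unfolding A_def E_def by (rule gmap_mem)
  have Br: "B x \<in> rvecs k" for x unfolding B_def by (rule blkr)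
  have SC: "S * (1 / \<rho>) \<le> 32" using S \<rho> by (simp add: field_simps)
  note hyps = EG linA linB lp_admissible_2 lp_admissible_2 lp_dual_2_2
  show "contains_complemented_lp 32 2 k (ns_restrict (lp_space \<infinity> N) E)"
    "contains_complemented_lp 32 2 k (ns_quotient (lp_space 1 N) (orth_compl N E))"
    using contains_complemented_lp_dual_pair[OF hyps S(1) _ SC] \<rho> AE Br BA nA nB by auto
qed

text \<open>A line always works, with constant 1. This settles all dimensions in which c sqrt d is
  at most 1.\<close>

lemma contains_complemented_lp_one:
  assumes E: "E \<in> grassmannian d N" and d: "d \<ge> 1"
  shows "contains_complemented_lp 32 \<infinity> 1 (ns_restrict (lp_space \<infinity> N) E)"
    and "contains_complemented_lp 32 1 1 (ns_quotient (lp_space 1 N) (orth_compl N E))"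
proof -
  obtain e where e: "onb N e d E" using grassmannian_onb[OF E] by blast
  define x where "x = e 0"
  have x: "x \<in> E" "x \<in> rvecs N" "rinner N x x = 1"
    using onb_mem[OF e, of 0] e d by (auto simp: x_def onb_def orthonormal_def)
  have ne: "{..<N} \<noteq> {}"
  proof
    assume "{..<N} = {}"
    then have "rinner N x x = 0" by (simp add: rinner_def)
    then show False using x(3) by simp
  qed
  let ?m = "Max ((\<lambda>i. \<bar>x i\<bar>) ` {..<N})"
  have "?m \<in> (\<lambda>i. \<bar>x i\<bar>) ` {..<N}" using ne by (intro Max_in) auto
  then obtain i where i: "i < N" "?m = \<bar>x i\<bar>" by auto
  have mx: "\<bar>x j\<bar> \<le> \<bar>x i\<bar>" if "j < N" for j
  proof -
    have "\<bar>x j\<bar> \<le> ?m" using that by (intro Max_ge) auto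
    then show ?thesis using i by simp
  qed
  have xi: "x i \<noteq> 0"
  proof
    assume "x i = 0"
    then have "x j = 0" if "j < N" for j using mx[OF that] by simp
    then have "rinner N x x = 0" by (simp add: rinner_def)
    then show False using x(3) by simp
  qed
  \<comment> \<open>Normalising by a coordinate of maximal modulus makes both the embedding and the
    evaluation at that coordinate contractions.\<close>
  define A where "A = mv N 1 (\<lambda>j _. x j / x i)"
  define B where "B = mv 1 N (\<lambda>_ j. of_bool (j = i))"
  have lin: "linear A" "linear B" unfolding A_def B_def by (rule linear_mv)+
  have Ay: "A y = (y 0 / x i) *\<^sub>R x" for y
    using rvecs_memD[OF x(2)] by (auto simp: A_def mv_def fun_eq_iff fun_apply)
  have By: "B y 0 = y i" for y
  proof -
    have "B y 0 = (\<Sum>j<N. if j = i then y j else 0)" by (auto simp: B_def mv_def intro: sum.cong)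
    then show ?thesis using i by simp
  qed
  have Br: "B y \<in> rvecs 1" for y unfolding B_def by (rule mv_rvecs)
  have AE: "A y \<in> E" for y unfolding Ay using x(1) grassmannianD(1)[OF E] by (rule subspace_scale[rotated])
  have BA: "B (A y) = y" if y: "y \<in> rvecs 1" for y
  proof
    fix t show "B (A y) t = y t"
      using By[of "A y"] xi rvecs_memD[OF y, of t] rvecs_memD[OF Br[of "A y"], of t]
      by (cases "t = 0") (auto simp: Ay fun_apply)
  qed
  have nA: "lp_norm \<infinity> N (A y) \<le> 1 * lp_norm \<infinity> 1 y" for y
  proof (subst lp_norm_inf_le_iff)
    show "\<forall>j<N. \<bar>A y j\<bar> \<le> 1 * lp_norm \<infinity> 1 y"
    proof (intro allI impI)
      fix j assume "j < N"
      then have "\<bar>x j\<bar> / \<bar>x i\<bar> \<le> 1" using mx xi by (simp add: divide_le_eq_1)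
      then have "\<bar>y 0\<bar> * (\<bar>x j\<bar> / \<bar>x i\<bar>) \<le> \<bar>y 0\<bar> * 1" by (intro mult_left_mono) auto
      then show "\<bar>A y j\<bar> \<le> 1 * lp_norm \<infinity> 1 y"
        using lp_norm_inf_coord[of 0 1 y] by (simp add: Ay fun_apply abs_mult)
    qed
  qed (simp add: lp_norm_inf_nonneg)
  have nB: "lp_norm \<infinity> 1 (B y) \<le> 1 * lp_norm \<infinity> N y" for y
    using By lp_norm_inf_coord[OF i(1), of y] by (subst lp_norm_inf_le_iff) (auto simp: lp_norm_inf_nonneg)
  note hyps = E lin lp_admissible_inf lp_admissible_1 lp_dual_inf_1
  show "contains_complemented_lp 32 \<infinity> 1 (ns_restrict (lp_space \<infinity> N) E)"
    "contains_complemented_lp 32 1 1 (ns_quotient (lp_space 1 N) (orth_compl N E))"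
    using contains_complemented_lp_dual_pair[OF hyps, of 1 1 32] AE Br BA nA nB by auto
qed

section \<open>Gaussian estimates\<close>

lemma measurable_gauss_coord: "p \<in> I \<Longrightarrow> (\<lambda>x. x p) \<in> borel_measurable (gauss I)"
  by (subst measurable_cong_sets[OF sets_gauss refl]) (rule measurable_component_singleton)

lemma nn_integral_gauss_prod:
  assumes "finite I" "\<And>p. p \<in> I \<Longrightarrow> f p \<in> borel_measurable borel"
  shows "(\<integral>\<^sup>+x. (\<Prod>p\<in>I. f p (x p)) \<partial>gauss I) = (\<Prod>p\<in>I. \<integral>\<^sup>+t. ennreal (std_normal_density t) * f p t \<partial>lborel)"
proof -
  have "(\<integral>\<^sup>+x. (\<Prod>p\<in>I. f p (x p)) \<partial>gauss I) = (\<Prod>p\<in>I. \<integral>\<^sup>+t. f p t \<partial>density lborel std_normal_density)"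
    unfolding gauss_def using assms by (intro gauss.product_nn_integral_prod) auto
  also have "\<dots> = (\<Prod>p\<in>I. \<integral>\<^sup>+t. ennreal (std_normal_density t) * f p t \<partial>lborel)"
    using assms by (intro prod.cong refl nn_integral_density) auto
  finally show ?thesis .
qed

lemma nn_integral_normal_density: "\<sigma> > 0 \<Longrightarrow> (\<integral>\<^sup>+t. ennreal (normal_density \<mu> \<sigma> t) \<partial>lborel) = 1"
  using prob_space.emeasure_space_1[OF prob_space_normal_density[of \<sigma> \<mu>]]
  by (simp add: emeasure_density)

lemma std_normal_exp_linear:
  "(\<integral>\<^sup>+t. ennreal (std_normal_density t) * ennreal (exp (a * t)) \<partial>lborel) = ennreal (exp (a\<^sup>2 / 2))"
proof -
  have "std_normal_density t * exp (a * t) = exp (a\<^sup>2 / 2) * normal_density a 1 t" for t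
  proof -
    have "- t\<^sup>2 / 2 + a * t = a\<^sup>2 / 2 + - (t - a)\<^sup>2 / 2" by (simp add: power2_eq_square field_simps)
    then have "exp (- t\<^sup>2 / 2) * exp (a * t) = exp (a\<^sup>2 / 2) * exp (- (t - a)\<^sup>2 / 2)" by (simp flip: exp_add)
    then show ?thesis unfolding std_normal_density_def normal_density_def by simp
  qed
  then have "(\<integral>\<^sup>+t. ennreal (std_normal_density t) * ennreal (exp (a * t)) \<partial>lborel) =
      (\<integral>\<^sup>+t. ennreal (exp (a\<^sup>2 / 2)) * ennreal (normal_density a 1 t) \<partial>lborel)"
    by (intro nn_integral_cong) (simp flip: ennreal_mult)
  also have "\<dots> = ennreal (exp (a\<^sup>2 / 2))"
    by (subst nn_integral_cmult) (auto simp: nn_integral_normal_density)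
  finally show ?thesis .
qed

lemma std_normal_exp_square:
  assumes s: "s < 1 / 2"
  shows "(\<integral>\<^sup>+t. ennreal (std_normal_density t) * ennreal (exp (s * t\<^sup>2)) \<partial>lborel) = ennreal (1 / sqrt (1 - 2 * s))"
proof -
  define \<sigma> where "\<sigma> = 1 / sqrt (1 - 2 * s)"
  have \<sigma>: "\<sigma> > 0" "\<sigma>\<^sup>2 = 1 / (1 - 2 * s)" using s by (auto simp: \<sigma>_def power_divide)
  have "std_normal_density t * exp (s * t\<^sup>2) = \<sigma> * normal_density 0 \<sigma> t" for t
  proof -
    have "- t\<^sup>2 / 2 + s * t\<^sup>2 = - (t - 0)\<^sup>2 / (2 * \<sigma>\<^sup>2)" unfolding \<sigma>(2) using s by (simp add: field_simps)
    then have "exp (- t\<^sup>2 / 2) * exp (s * t\<^sup>2) = exp (- (t - 0)\<^sup>2 / (2 * \<sigma>\<^sup>2))" by (simp flip: exp_add)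
    moreover have "1 / sqrt (2 * pi) = \<sigma> * (1 / sqrt (2 * pi * \<sigma>\<^sup>2))" using \<sigma>(1) by (simp add: real_sqrt_mult)
    ultimately show ?thesis unfolding std_normal_density_def normal_density_def by (simp add: mult.assoc)
  qed
  then have "(\<integral>\<^sup>+t. ennreal (std_normal_density t) * ennreal (exp (s * t\<^sup>2)) \<partial>lborel) =
      (\<integral>\<^sup>+t. ennreal \<sigma> * ennreal (normal_density 0 \<sigma> t) \<partial>lborel)"
    using \<sigma>(1) by (intro nn_integral_cong) (simp flip: ennreal_mult)
  also have "\<dots> = ennreal \<sigma>"
    using \<sigma>(1) by (subst nn_integral_cmult) (auto simp: nn_integral_normal_density)
  finally show ?thesis by (simp add: \<sigma>_def)
qed

lemma measure_leI: "emeasure M A \<le> ennreal c \<Longrightarrow> c \<ge> 0 \<Longrightarrow> measure M A \<le> c"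
  by (simp add: measure_def enn2real_leI)

lemma gauss_exp_square_sum:
  assumes I: "finite I" "K \<subseteq> I" and s: "s < 1 / 2"
  shows "(\<integral>\<^sup>+x. ennreal (exp (s * (\<Sum>p\<in>K. (x p)\<^sup>2))) \<partial>gauss I) = ennreal ((1 / sqrt (1 - 2 * s)) ^ card K)"
proof -
  have K: "finite K" using I finite_subset by blast
  define f where "f p t = (if p \<in> K then ennreal (exp (s * t\<^sup>2)) else 1)" for p and t :: real
  have "(\<integral>\<^sup>+x. ennreal (exp (s * (\<Sum>p\<in>K. (x p)\<^sup>2))) \<partial>gauss I) = (\<integral>\<^sup>+x. (\<Prod>p\<in>I. f p (x p)) \<partial>gauss I)"
  proof (rule nn_integral_cong)
    fix x :: "'a \<Rightarrow> real"
    have "(\<Prod>p\<in>I. f p (x p)) = (\<Prod>p\<in>K. ennreal (exp (s * (x p)\<^sup>2)))"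
      using I by (intro prod.mono_neutral_cong_right) (auto simp: f_def)
    also have "\<dots> = ennreal (\<Prod>p\<in>K. exp (s * (x p)\<^sup>2))" by (rule prod_ennreal) simp
    also have "(\<Prod>p\<in>K. exp (s * (x p)\<^sup>2)) = exp (s * (\<Sum>p\<in>K. (x p)\<^sup>2))"
      using K by (simp add: exp_sum sum_distrib_left)
    finally show "ennreal (exp (s * (\<Sum>p\<in>K. (x p)\<^sup>2))) = (\<Prod>p\<in>I. f p (x p))" by simp
  qed
  also have "\<dots> = (\<Prod>p\<in>I. \<integral>\<^sup>+t. ennreal (std_normal_density t) * f p t \<partial>lborel)"
    using I(1) by (intro nn_integral_gauss_prod) (auto simp: f_def)
  also have "\<dots> = (\<Prod>p\<in>K. ennreal (1 / sqrt (1 - 2 * s)))"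
    using I std_normal_exp_square[OF s] nn_integral_normal_density[of 1 0]
    by (intro prod.mono_neutral_cong_right) (auto simp: f_def)
  also have "\<dots> = ennreal ((1 / sqrt (1 - 2 * s)) ^ card K)" using s by (simp add: ennreal_power)
  finally show ?thesis .
qed

text \<open>The Chernoff bound with parameter 1/4, where the moment generating function of a squared
  standard normal variable is sqrt 2.\<close>

lemma gauss_square_sum_upper:
  assumes I: "finite I" "K \<subseteq> I"
  shows "measure (gauss I) {x\<in>space (gauss I). t \<le> (\<Sum>p\<in>K. (x p)\<^sup>2)} \<le> sqrt 2 ^ card K * exp (- t / 4)"
proof (rule measure_leI)
  have K: "finite K" using I finite_subset by blast
  let ?S = "\<lambda>x. \<Sum>p\<in>K. (x p)\<^sup>2"
  have m[measurable]: "?S \<in> borel_measurable (gauss I)"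
    using I by (intro borel_measurable_sum borel_measurable_power measurable_gauss_coord) auto
  have "emeasure (gauss I) {x\<in>space (gauss I). t \<le> ?S x} = (\<integral>\<^sup>+x. indicator {x\<in>space (gauss I). t \<le> ?S x} x \<partial>gauss I)"
    by simp
  also have "\<dots> \<le> (\<integral>\<^sup>+x. ennreal (exp (- t / 4)) * ennreal (exp (1 / 4 * ?S x)) \<partial>gauss I)"
  proof (rule nn_integral_mono)
    fix x
    show "indicator {x\<in>space (gauss I). t \<le> ?S x} x \<le> ennreal (exp (- t / 4)) * ennreal (exp (1 / 4 * ?S x))"
      by (auto simp: indicator_def simp flip: ennreal_mult exp_add)
  qed
  also have "\<dots> = ennreal (exp (- t / 4)) * ennreal ((1 / sqrt (1 - 2 * (1 / 4))) ^ card K)"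
    by (subst nn_integral_cmult) (auto simp: gauss_exp_square_sum[OF I, of "1/4", simplified])
  also have "1 / sqrt (1 - 2 * (1 / 4)) = sqrt (2 :: real)" by (simp add: real_sqrt_divide)
  finally show "emeasure (gauss I) {x\<in>space (gauss I). t \<le> ?S x} \<le> ennreal (sqrt 2 ^ card K * exp (- t / 4))"
    by (simp add: mult.commute flip: ennreal_mult)
qed simp

text \<open>The Chernoff bound with parameter -1, where the moment generating function is 1 / sqrt
  3.\<close>

lemma gauss_square_sum_lower:
  assumes I: "finite I" "K \<subseteq> I"
  shows "measure (gauss I) {x\<in>space (gauss I). (\<Sum>p\<in>K. (x p)\<^sup>2) \<le> t} \<le> (1 / sqrt 3) ^ card K * exp t"
proof (rule measure_leI)
  have K: "finite K" using I finite_subset by blast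
  let ?S = "\<lambda>x. \<Sum>p\<in>K. (x p)\<^sup>2"
  have m[measurable]: "?S \<in> borel_measurable (gauss I)"
    using I by (intro borel_measurable_sum borel_measurable_power measurable_gauss_coord) auto
  have "emeasure (gauss I) {x\<in>space (gauss I). ?S x \<le> t} = (\<integral>\<^sup>+x. indicator {x\<in>space (gauss I). ?S x \<le> t} x \<partial>gauss I)"
    by simp
  also have "\<dots> \<le> (\<integral>\<^sup>+x. ennreal (exp t) * ennreal (exp (- 1 * ?S x)) \<partial>gauss I)"
  proof (rule nn_integral_mono)
    fix x
    show "indicator {x\<in>space (gauss I). ?S x \<le> t} x \<le> ennreal (exp t) * ennreal (exp (- 1 * ?S x))"
      by (auto simp: indicator_def simp flip: ennreal_mult exp_add)
  qed
  also have "\<dots> = ennreal (exp t) * ennreal ((1 / sqrt 3) ^ card K)"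
    by (subst nn_integral_cmult) (auto simp: gauss_exp_square_sum[OF I, of "-1", simplified])
  finally show "emeasure (gauss I) {x\<in>space (gauss I). ?S x \<le> t} \<le> ennreal ((1 / sqrt 3) ^ card K * exp t)"
    by (simp add: mult.commute flip: ennreal_mult)
qed simp

text \<open>The density is estimated on an interval of length \<sigma> starting at 2 \<sigma>
  \<rho>, which is at least \<rho> because \<sigma> \<ge> 1/2. With this choice \<sigma> drops out
  of the bound.\<close>

lemma normal_tail_lower:
  assumes \<sigma>: "\<sigma> \<ge> 1 / 2" and \<rho>: "\<rho> \<ge> 0"
  shows "(\<integral>\<^sup>+t. ennreal (normal_density 0 \<sigma> t) * indicator {t. \<rho> \<le> \<bar>t\<bar>} t \<partial>lborel)
    \<ge> ennreal (exp (- (2 * \<rho> + 1)\<^sup>2 / 2) / sqrt (2 * pi))"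
proof -
  define u where "u = 2 * \<sigma> * \<rho>"
  define h where "h = exp (- (2 * \<rho> + 1)\<^sup>2 / 2) / sqrt (2 * pi * \<sigma>\<^sup>2)"
  have s0: "\<sigma> > 0" using \<sigma> by simp
  have "1 * \<rho> \<le> (2 * \<sigma>) * \<rho>" using \<sigma> \<rho> by (intro mult_right_mono) auto
  then have u: "u \<ge> \<rho>" by (simp add: u_def)
  have "ennreal (exp (- (2 * \<rho> + 1)\<^sup>2 / 2) / sqrt (2 * pi)) = ennreal h * ennreal \<sigma>"
    using s0 by (simp add: h_def real_sqrt_mult flip: ennreal_mult)
  also have "\<dots> = (\<integral>\<^sup>+t. ennreal h * indicator {u..u + \<sigma>} t \<partial>lborel)"
    using s0 by (subst nn_integral_cmult_indicator) auto
  also have "\<dots> \<le> (\<integral>\<^sup>+t. ennreal (normal_density 0 \<sigma> t) * indicator {t. \<rho> \<le> \<bar>t\<bar>} t \<partial>lborel)"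
  proof (rule nn_integral_mono)
    fix t :: real
    show "ennreal h * indicator {u..u + \<sigma>} t \<le> ennreal (normal_density 0 \<sigma> t) * indicator {t. \<rho> \<le> \<bar>t\<bar>} t"
    proof (cases "t \<in> {u..u + \<sigma>}")
      case True
      have t: "0 \<le> t" "t \<le> \<sigma> * (2 * \<rho> + 1)" "\<rho> \<le> \<bar>t\<bar>" using True u \<rho> by (auto simp: u_def algebra_simps)
      have "t\<^sup>2 \<le> (\<sigma> * (2 * \<rho> + 1))\<^sup>2" using t by (intro power_mono) auto
      then have "t\<^sup>2 / (2 * \<sigma>\<^sup>2) \<le> (\<sigma> * (2 * \<rho> + 1))\<^sup>2 / (2 * \<sigma>\<^sup>2)" by (intro divide_right_mono) auto
      also have "\<dots> = (2 * \<rho> + 1)\<^sup>2 / 2" using s0 by (simp add: power_mult_distrib)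
      finally have "h \<le> normal_density 0 \<sigma> t"
        unfolding h_def normal_density_def by (simp add: divide_right_mono)
      then show ?thesis using True t by (simp add: ennreal_leI)
    qed simp
  qed
  finally show ?thesis .
qed

text \<open>The rows are independent, and the inner product of each with \<open>y\<close> is centred
  normal with standard deviation the length of \<open>y\<close>, hence at least 1/2.\<close>

lemma gauss_row_small:
  assumes \<rho>: "\<rho> \<ge> 0" and y: "(\<Sum>l<d. (y l)\<^sup>2) \<ge> 1 / 4"
  shows "measure (gauss (idx N d)) {G\<in>space (gauss (idx N d)). \<forall>i<N. \<bar>\<Sum>l<d. G (i, l) * y l\<bar> < \<rho>}
    \<le> (1 - exp (- (2 * \<rho> + 1)\<^sup>2 / 2) / sqrt (2 * pi)) ^ N"
proof (cases "N = 0")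
  case False
  let ?g = "gauss (idx N d)"
  interpret prob_space ?g by (rule prob_space_gauss)
  let ?q = "exp (- (2 * \<rho> + 1)\<^sup>2 / 2) / sqrt (2 * pi)"
  define X where "X i G = (\<Sum>l<d. G (i, l) * y l)" for i and G :: "nat \<times> nat \<Rightarrow> real"
  have d: "d \<noteq> 0" using y by (cases "d = 0") auto
  have ne: "idx N d \<noteq> {}" using False d by (auto simp: idx_def)
  have ind: "indep_vars (\<lambda>_. borel) X {..<N}"
  proof -
    \<comment> \<open>Independence of the coordinates is grouped by rows and then pushed through the
      linear forms.\<close>
    have "indep_vars (\<lambda>i. PiM ({i} \<times> {..<d}) (\<lambda>_. borel)) (\<lambda>i G. restrict (\<lambda>p. G p) ({i} \<times> {..<d})) {..<N}"
      by (rule indep_vars_restrict[OF gauss_indep[OF ne]]) (auto simp: idx_def disjoint_family_on_def)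
    from indep_vars_compose2[OF this, of "\<lambda>i f. \<Sum>l<d. f (i, l) * y l" "\<lambda>_. borel"]
    have "indep_vars (\<lambda>_. borel) (\<lambda>i G. \<Sum>l<d. restrict (\<lambda>p. G p) ({i} \<times> {..<d}) (i, l) * y l) {..<N}"
      by auto
    then show ?thesis unfolding X_def by (rule indep_vars_cong[THEN iffD1, rotated -1]) auto
  qed
  have Xm: "X i \<in> borel_measurable ?g" if "i < N" for i
    unfolding X_def using that by (intro borel_measurable_sum borel_measurable_times measurable_gauss_coord) (auto simp: idx_def)
  have row: "prob (X i -` {t. \<bar>t\<bar> < \<rho>} \<inter> space ?g) \<le> 1 - ?q" if i: "i < N" for i
  proof -
    define a where "a p = (if fst p = i then y (snd p) else 0)" for p :: "nat \<times> nat"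
    have sm: "(\<Sum>p\<in>idx N d. f p) = (\<Sum>l<d. f (i, l))" if "\<And>p. fst p \<noteq> i \<Longrightarrow> f p = 0" for f :: "nat \<times> nat \<Rightarrow> real"
    proof -
      have "(\<Sum>p\<in>idx N d. f p) = (\<Sum>p\<in>(\<lambda>l. (i, l)) ` {..<d}. f p)"
      proof (intro sum.mono_neutral_right ballI)
        fix p assume p: "p \<in> idx N d - (\<lambda>l. (i, l)) ` {..<d}"
        have "fst p \<noteq> i"
        proof
          assume "fst p = i"
          then have "p = (i, snd p)" "snd p \<in> {..<d}" using p by (auto simp: idx_def)
          then show False using p by blast
        qed
        then show "f p = 0" by (rule that)
      qed (use i in \<open>auto simp: idx_def\<close>)
      then show ?thesis by (simp add: sum.reindex inj_on_def)
    qed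
    have Xa: "(\<Sum>p\<in>idx N d. a p * x p) = X i x" for x
      by (subst sm) (auto simp: a_def X_def mult.commute)
    have Sa: "(\<Sum>p\<in>idx N d. (a p)\<^sup>2) = (\<Sum>l<d. (y l)\<^sup>2)"
      by (subst sm) (auto simp: a_def)
    define \<sigma> where "\<sigma> = sqrt (\<Sum>l<d. (y l)\<^sup>2)"
    have "sqrt (1 / 4) \<le> \<sigma>" unfolding \<sigma>_def using y by (rule real_sqrt_le_mono)
    then have \<sigma>: "\<sigma> \<ge> 1 / 2" by (simp add: real_sqrt_divide)
    have "\<exists>p\<in>idx N d. a p \<noteq> 0"
    proof (rule ccontr)
      assume "\<not> ?thesis"
      then have "(\<Sum>p\<in>idx N d. (a p)\<^sup>2) = 0" by (intro sum.neutral) auto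
      then show False using Sa y by simp
    qed
    from gauss_linear_form[OF _ this] have D: "distributed ?g lborel (X i) (normal_density 0 \<sigma>)"
      by (simp add: Xa Sa \<sigma>_def)
    have "ennreal ?q \<le> (\<integral>\<^sup>+t. ennreal (normal_density 0 \<sigma> t) * indicator {t. \<rho> \<le> \<bar>t\<bar>} t \<partial>lborel)"
      by (rule normal_tail_lower[OF \<sigma> \<rho>])
    also have "\<dots> = emeasure ?g (X i -` {t. \<rho> \<le> \<bar>t\<bar>} \<inter> space ?g)"
      by (rule distributed_emeasure[OF D, symmetric]) measurable
    also have "\<dots> = ennreal (prob (X i -` {t. \<rho> \<le> \<bar>t\<bar>} \<inter> space ?g))" by (rule emeasure_eq_measure)
    finally have q: "?q \<le> prob (X i -` {t. \<rho> \<le> \<bar>t\<bar>} \<inter> space ?g)" by simp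
    have "X i -` {t. \<bar>t\<bar> < \<rho>} \<inter> space ?g = space ?g - (X i -` {t. \<rho> \<le> \<bar>t\<bar>} \<inter> space ?g)" by auto
    moreover have "X i -` {t. \<rho> \<le> \<bar>t\<bar>} \<inter> space ?g \<in> events"
      by (rule measurable_sets[OF Xm[OF i]]) measurable
    ultimately show ?thesis using q prob_compl by simp
  qed
  have "{G\<in>space ?g. \<forall>i<N. \<bar>\<Sum>l<d. G (i, l) * y l\<bar> < \<rho>} = (\<Inter>i\<in>{..<N}. X i -` {t. \<bar>t\<bar> < \<rho>} \<inter> space ?g)"
    using False by (auto simp: X_def)
  also have "prob \<dots> = (\<Prod>i\<in>{..<N}. prob (X i -` {t. \<bar>t\<bar> < \<rho>} \<inter> space ?g))"
    by (rule indep_varsD_finite[OF ind]) (use False in auto)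
  also have "\<dots> \<le> (\<Prod>i\<in>{..<N}. 1 - ?q)"
    using row by (intro prod_mono) auto
  finally show ?thesis by simp
qed (use prob_space.prob_le_1[OF prob_space_gauss] in simp)

section \<open>Decoupling\<close>

text \<open>For a uniformly random subset S, the event j in S and \<iota> j not in S has probability
  at least 1/4 unless \<iota> j = j. Averaging over all subsets yields a good one. It separates the
  rows j from the rows \<iota> j they are paired with.\<close>

lemma directed_cut:
  fixes a :: "nat \<Rightarrow> real" and \<iota> :: "nat \<Rightarrow> nat"
  assumes a: "\<And>j. j < n \<Longrightarrow> a j \<ge> 0" and \<iota>: "\<And>j. j < n \<Longrightarrow> \<iota> j = j \<Longrightarrow> a j = 0"
  shows "\<exists>S\<subseteq>{..<n}. (\<Sum>j<n. a j) / 4 \<le> (\<Sum>j | j \<in> S \<and> \<iota> j \<notin> S. a j)"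
proof (rule ccontr)
  assume neg: "\<not> ?thesis"
  let ?P = "Pow {..<n}"
  let ?c = "\<lambda>j. card {S\<in>?P. j \<in> S \<and> \<iota> j \<notin> S}"
  have fin: "finite ?P" by simp
  have cnt: "real (?c j) * a j \<ge> 2 ^ n / 4 * a j" if j: "j < n" for j
  proof (cases "\<iota> j = j")
    case False
    \<comment> \<open>Membership of the remaining points is free. If \<iota> j lies outside the
      range, only one point is fixed, which gives even more subsets.\<close>
    let ?D = "{..<n} - {j, \<iota> j}"
    have "insert j ` Pow ?D \<subseteq> {S\<in>?P. j \<in> S \<and> \<iota> j \<notin> S}" using j False by auto
    then have "card (insert j ` Pow ?D) \<le> ?c j" by (intro card_mono) auto
    moreover have "card (insert j ` Pow ?D) = card (Pow ?D)"
      by (intro card_image inj_onI) auto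
    moreover have n2: "n - 2 \<le> card ?D"
      using diff_card_le_card_Diff[of "{j, \<iota> j}" "{..<n}"] False by simp
    moreover have "(2 :: nat) ^ (n - 2) \<le> 2 ^ card ?D" using n2 by (rule power_increasing) simp
    moreover have "card (Pow ?D) = 2 ^ card ?D" by (rule card_Pow) simp
    ultimately have "2 ^ (n - 2) \<le> ?c j" by linarith
    then have "(2 :: real) ^ (n - 2) \<le> real (?c j)" by (metis of_nat_le_iff of_nat_numeral of_nat_power)
    moreover have "(2 :: real) ^ n / 4 \<le> 2 ^ (n - 2)"
    proof (cases "n \<ge> 2")
      case True
      then obtain n' where "n = 2 + n'" using le_Suc_ex by blast
      then show ?thesis by simp
    next
      case False
      \<comment> \<open>The subtraction n - 2 is truncated here, so the exponent is 0.\<close>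
      then have "n = 1" using j by simp
      then show ?thesis by simp
    qed
    ultimately have "2 ^ n / 4 \<le> real (?c j)" by linarith
    then show ?thesis using a[OF j] by (rule mult_right_mono)
  qed (use \<iota> that in simp)
  have "(\<Sum>S\<in>?P. \<Sum>j | j \<in> S \<and> \<iota> j \<notin> S. a j) = (\<Sum>S\<in>?P. \<Sum>j<n. if j \<in> S \<and> \<iota> j \<notin> S then a j else 0)"
  proof (rule sum.cong[OF refl])
    fix S assume "S \<in> ?P"
    then have eq: "{j. j \<in> S \<and> \<iota> j \<notin> S} = {..<n} \<inter> {j. j \<in> S \<and> \<iota> j \<notin> S}" by auto
    show "(\<Sum>j | j \<in> S \<and> \<iota> j \<notin> S. a j) = (\<Sum>j<n. if j \<in> S \<and> \<iota> j \<notin> S then a j else 0)"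
      by (subst eq, subst sum.inter_restrict) auto
  qed
  also have "\<dots> = (\<Sum>j<n. \<Sum>S\<in>?P. if j \<in> S \<and> \<iota> j \<notin> S then a j else 0)" by (rule sum.swap)
  also have "\<dots> = (\<Sum>j<n. real (?c j) * a j)"
    by (intro sum.cong refl) (simp add: sum.If_cases Int_def conj_commute)
  also have "\<dots> \<ge> (\<Sum>j<n. 2 ^ n / 4 * a j)" using cnt by (intro sum_mono) auto
  finally have lo: "2 ^ n * ((\<Sum>j<n. a j) / 4) \<le> (\<Sum>S\<in>?P. \<Sum>j | j \<in> S \<and> \<iota> j \<notin> S. a j)"
    by (simp add: sum_distrib_left sum_divide_distrib)
  have "(\<Sum>S\<in>?P. \<Sum>j | j \<in> S \<and> \<iota> j \<notin> S. a j) < (\<Sum>S\<in>?P. (\<Sum>j<n. a j) / 4)"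
  proof (rule sum_strict_mono[OF fin])
    fix S assume "S \<in> ?P"
    then show "(\<Sum>j | j \<in> S \<and> \<iota> j \<notin> S. a j) < (\<Sum>j<n. a j) / 4" using neg by (meson PowD not_le)
  qed auto
  then show False using lo by (simp add: card_Pow)
qed

lemma measurable_rip:
  "i < N \<Longrightarrow> j < N \<Longrightarrow> (\<lambda>G. rip d G i j) \<in> borel_measurable (gauss (idx N d))"
  unfolding rip_def by (intro borel_measurable_sum borel_measurable_times measurable_gauss_coord) (auto simp: idx_def)

lemma gauss_exp_linear:
  assumes I: "finite I"
  shows "(\<integral>\<^sup>+x. ennreal (exp (\<Sum>p\<in>I. a p * x p)) \<partial>gauss I) = ennreal (exp ((\<Sum>p\<in>I. (a p)\<^sup>2) / 2))"
proof -
  have "(\<integral>\<^sup>+x. ennreal (exp (\<Sum>p\<in>I. a p * x p)) \<partial>gauss I) = (\<integral>\<^sup>+x. (\<Prod>p\<in>I. ennreal (exp (a p * x p))) \<partial>gauss I)"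
    using I by (intro nn_integral_cong) (simp add: exp_sum prod_ennreal)
  also have "\<dots> = (\<Prod>p\<in>I. \<integral>\<^sup>+t. ennreal (std_normal_density t) * ennreal (exp (a p * t)) \<partial>lborel)"
    using I by (intro nn_integral_gauss_prod) auto
  also have "\<dots> = ennreal (exp ((\<Sum>p\<in>I. (a p)\<^sup>2) / 2))"
    using I by (simp add: std_normal_exp_linear prod_ennreal exp_sum sum_divide_distrib)
  finally show ?thesis .
qed

text \<open>
  After conditioning on the rows outside the support of \<open>t\<close>, the bilinear form is a Gaussian linear form
  in the remaining rows, with variance controlled by the norms of the rows conditioned on.
\<close>

lemma gauss_decoupled_tail:
  fixes t :: "nat \<Rightarrow> real" and \<iota> :: "nat \<Rightarrow> nat"
  assumes dN: "d \<le> N" and t: "\<And>j. j < d \<Longrightarrow> t j \<in> {-1, 0, 1}"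
    and \<iota>: "\<And>j. j < d \<Longrightarrow> t j \<noteq> 0 \<Longrightarrow> \<iota> j < N \<and> (\<iota> j < d \<longrightarrow> t (\<iota> j) = 0)"
    and \<theta>: "\<theta> \<ge> 0"
  shows "measure (gauss (idx N d)) {G\<in>space (gauss (idx N d)). (\<forall>i<N. rip d G i i \<le> 4 * real d) \<and>
      \<tau> \<le> (\<Sum>j | j < d \<and> t j \<noteq> 0. t j * rip d G (\<iota> j) j)}
    \<le> exp (2 * \<theta>\<^sup>2 * (real d)\<^sup>2 - \<theta> * \<tau>)"
proof (rule measure_leI)
  let ?g = "gauss (idx N d)"
  define S where "S = {j. j < d \<and> t j \<noteq> 0}"
  have S: "finite S" "S \<subseteq> {..<d}" "card S \<le> d"
  proof -
    show "S \<subseteq> {..<d}" by (auto simp: S_def)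
    then show "finite S" "card S \<le> d" using finite_subset card_mono[of "{..<d}" S] by auto
  qed
  have \<iota>S: "\<iota> j < N" "\<iota> j \<notin> S" if "j \<in> S" for j using \<iota>[of j] that by (auto simp: S_def)
  have t1: "(t j)\<^sup>2 = 1" if "j \<in> S" for j using t[of j] that by (auto simp: S_def)
  define J where "J = S \<times> {..<d}"
  define I where "I = ({..<N} - S) \<times> {..<d}"
  have IJ: "I \<inter> J = {}" "I \<union> J = idx N d" "finite I" "finite J"
    using S dN by (auto simp: I_def J_def idx_def)
  define F where "F G = (\<Sum>j\<in>S. t j * rip d G (\<iota> j) j)" for G
  let ?A = "{G\<in>space ?g. (\<forall>i<N. rip d G i i \<le> 4 * real d) \<and> \<tau> \<le> F G}"
  \<comment> \<open>The norm constraint weakened to the rows outside \<open>S\<close>: it then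
    depends only on the variables conditioned on, and still controls every row \<iota> j.\<close>
  define W where "W x \<longleftrightarrow> (\<forall>i\<in>{..<N} - S. (\<Sum>l<d. x (i, l) * x (i, l)) \<le> 4 * real d)" for x :: "nat \<times> nat \<Rightarrow> real"
  define h where "h G = (if W G then ennreal (exp (\<theta> * F G)) else 0)" for G
  have ripm: "(\<lambda>G. rip d G i j) \<in> borel_measurable ?g" if "i < N" "j < N" for i j
    using measurable_rip that .
  have Fm[measurable]: "F \<in> borel_measurable ?g"
    unfolding F_def using S dN \<iota>S by (intro borel_measurable_sum borel_measurable_times borel_measurable_const ripm) auto
  have Wm[measurable]: "Measurable.pred ?g W"
  proof -
    have "W = (\<lambda>x. \<forall>i\<in>{..<N} - S. rip d x i i \<le> 4 * real d)" by (auto simp: W_def rip_def)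
    moreover have "Measurable.pred ?g (\<lambda>x. rip d x i i \<le> 4 * real d)" if "i \<in> {..<N} - S" for i
    proof -
      have [measurable]: "(\<lambda>x. rip d x i i) \<in> borel_measurable ?g" using ripm[of i i] that by auto
      show ?thesis by measurable
    qed
    ultimately show ?thesis by (auto intro!: pred_intros_finite)
  qed
  have hm: "h \<in> borel_measurable ?g" unfolding h_def by measurable
  have inner: "(\<integral>\<^sup>+y. h (merge I J (x, y)) \<partial>gauss J) \<le> ennreal (exp (2 * \<theta>\<^sup>2 * (real d)\<^sup>2))" for x
  proof -
    let ?m = "\<lambda>y. merge I J (x, y)"
    have mI: "?m y (i, l) = x (i, l)" if "i \<in> {..<N} - S" "l < d" for y i l
      using IJ(1) that by (simp add: I_def)
    have mJ: "?m y (j, l) = y (j, l)" if "j \<in> S" "l < d" for y j l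
      using IJ(1) that by (simp add: J_def)
    have me: "(\<Sum>l<d. ?m y (i, l) * ?m y (i, l)) = (\<Sum>l<d. x (i, l) * x (i, l))" if "i \<in> {..<N} - S" for y i
      using mI[OF that] by (intro sum.cong) auto
    have Wx: "W (?m y) \<longleftrightarrow> W x" for y unfolding W_def by (intro ball_cong refl) (simp only: me)
    show ?thesis
    proof (cases "W x")
      case False
      then show ?thesis by (simp add: h_def Wx)
    next
      case True
      \<comment> \<open>The rows j in \<open>S\<close> are distinct, so the form is linear in
        independent variables even if many of the \<iota> j coincide.\<close>
      define a where "a p = \<theta> * t (fst p) * x (\<iota> (fst p), snd p)" for p
      have Fy: "\<theta> * F (?m y) = (\<Sum>p\<in>J. a p * y p)" for y
      proof -
        have "\<theta> * F (?m y) = (\<Sum>j\<in>S. \<Sum>l<d. \<theta> * (t j * (?m y (\<iota> j, l) * ?m y (j, l))))"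
          by (simp add: F_def rip_def sum_distrib_left)
        also have "\<dots> = (\<Sum>j\<in>S. \<Sum>l<d. a (j, l) * y (j, l))"
          using mI mJ \<iota>S by (intro sum.cong refl) (simp add: a_def)
        finally show ?thesis by (simp add: J_def sum.cartesian_product)
      qed
      have "(\<Sum>p\<in>J. (a p)\<^sup>2) = (\<Sum>j\<in>S. \<Sum>l<d. (a (j, l))\<^sup>2)" by (simp add: J_def sum.cartesian_product)
      also have "\<dots> = (\<Sum>j\<in>S. \<theta>\<^sup>2 * (\<Sum>l<d. x (\<iota> j, l) * x (\<iota> j, l)))"
        using t1 by (intro sum.cong refl) (simp add: a_def power_mult_distrib sum_distrib_left power2_eq_square[of "x _"])
      also have "\<dots> \<le> (\<Sum>j\<in>S. \<theta>\<^sup>2 * (4 * real d))"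
        using True \<iota>S by (intro sum_mono mult_left_mono) (auto simp: W_def)
      also have "\<dots> = real (card S) * (\<theta>\<^sup>2 * (4 * real d))" by simp
      \<comment> \<open>At most d rows, each contributing at most 4 d times the square of
        \<theta>.\<close>
      also have "\<dots> \<le> real d * (\<theta>\<^sup>2 * (4 * real d))" using S(3) by (intro mult_right_mono) auto
      finally have le: "(\<Sum>p\<in>J. (a p)\<^sup>2) / 2 \<le> 2 * \<theta>\<^sup>2 * (real d)\<^sup>2" by (simp add: power2_eq_square algebra_simps)
      have "(\<integral>\<^sup>+y. h (?m y) \<partial>gauss J) = (\<integral>\<^sup>+y. ennreal (exp (\<Sum>p\<in>J. a p * y p)) \<partial>gauss J)"
        using True by (simp add: h_def Wx Fy)
      also have "\<dots> = ennreal (exp ((\<Sum>p\<in>J. (a p)\<^sup>2) / 2))" by (rule gauss_exp_linear[OF IJ(4)])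
      also have "\<dots> \<le> ennreal (exp (2 * \<theta>\<^sup>2 * (real d)\<^sup>2))" using le by (intro ennreal_leI) simp
      finally show ?thesis .
    qed
  qed
  have hm': "h \<in> borel_measurable (PiM (I \<union> J) (\<lambda>_. density lborel std_normal_density))"
    using hm unfolding IJ(2) gauss_def .
  have hint: "(\<integral>\<^sup>+G. h G \<partial>?g) \<le> ennreal (exp (2 * \<theta>\<^sup>2 * (real d)\<^sup>2))"
  proof -
    have "(\<integral>\<^sup>+G. h G \<partial>?g) = (\<integral>\<^sup>+x. (\<integral>\<^sup>+y. h (merge I J (x, y)) \<partial>gauss J) \<partial>gauss I)"
      using gauss.product_nn_integral_fold[OF IJ(1,3,4) hm'] unfolding IJ(2) gauss_def .
    also have "\<dots> \<le> (\<integral>\<^sup>+x. ennreal (exp (2 * \<theta>\<^sup>2 * (real d)\<^sup>2)) \<partial>gauss I)" by (intro nn_integral_mono inner)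
    also have "\<dots> = ennreal (exp (2 * \<theta>\<^sup>2 * (real d)\<^sup>2))"
      using prob_space.emeasure_space_1[OF prob_space_gauss[of I]] by simp
    finally show ?thesis .
  qed
  have Am: "?A \<in> sets ?g"
  proof -
    have 1: "{G\<in>space ?g. \<forall>i\<in>{..<N}. rip d G i i \<le> 4 * real d} \<in> sets ?g"
      using ripm by (intro sets.sets_Collect_finite_All) (auto intro!: borel_measurable_le)
    have 2: "{G\<in>space ?g. \<tau> \<le> F G} \<in> sets ?g" by measurable
    have 3: "?A = {G\<in>space ?g. \<forall>i\<in>{..<N}. rip d G i i \<le> 4 * real d} \<inter> {G\<in>space ?g. \<tau> \<le> F G}" by blast
    show ?thesis unfolding 3 using 1 2 by (rule sets.Int)
  qed
  have "emeasure ?g ?A = (\<integral>\<^sup>+G. indicator ?A G \<partial>?g)" by (rule nn_integral_indicator[OF Am, symmetric])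
  also have "\<dots> \<le> (\<integral>\<^sup>+G. ennreal (exp (- (\<theta> * \<tau>))) * h G \<partial>?g)"
  proof (rule nn_integral_mono)
    fix G
    show "indicator ?A G \<le> ennreal (exp (- (\<theta> * \<tau>))) * h G"
    proof (cases "G \<in> ?A")
      case True
      then have "W G" by (auto simp: W_def rip_def)
      moreover have "\<theta> * \<tau> \<le> \<theta> * F G" using True \<theta> by (intro mult_left_mono) auto
      ultimately show ?thesis using True by (simp add: h_def flip: ennreal_mult exp_add)
    qed simp
  qed
  also have "\<dots> = ennreal (exp (- (\<theta> * \<tau>))) * (\<integral>\<^sup>+G. h G \<partial>?g)" using hm by (rule nn_integral_cmult)
  also have "\<dots> \<le> ennreal (exp (- (\<theta> * \<tau>))) * ennreal (exp (2 * \<theta>\<^sup>2 * (real d)\<^sup>2))" using hint by (rule mult_left_mono) simp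
  also have "\<dots> = ennreal (exp (- (\<theta> * \<tau>)) * exp (2 * \<theta>\<^sup>2 * (real d)\<^sup>2))"
    by (rule ennreal_mult[symmetric]) auto
  also have "exp (- (\<theta> * \<tau>)) * exp (2 * \<theta>\<^sup>2 * (real d)\<^sup>2) = exp (2 * \<theta>\<^sup>2 * (real d)\<^sup>2 - \<theta> * \<tau>)"
    unfolding exp_add[symmetric] by (rule arg_cong[of _ _ exp]) linarith
  finally show "emeasure ?g {G\<in>space ?g. (\<forall>i<N. rip d G i i \<le> 4 * real d) \<and>
      \<tau> \<le> (\<Sum>j | j < d \<and> t j \<noteq> 0. t j * rip d G (\<iota> j) j)} \<le> ennreal (exp (2 * \<theta>\<^sup>2 * (real d)\<^sup>2 - \<theta> * \<tau>))"
    by (simp add: F_def S_def)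
qed simp

section \<open>Exceptional set for moderate \<open>N\<close>\<close>

lemma rip_self: "rip d G i i = (\<Sum>p\<in>{i} \<times> {..<d}. (G p)\<^sup>2)"
proof -
  have "{i} \<times> {..<d} = (\<lambda>l. (i, l)) ` {..<d}" by auto
  then show ?thesis by (simp add: rip_def sum.reindex inj_on_def power2_eq_square)
qed

definition decoupled_event :: "nat \<Rightarrow> nat \<Rightarrow> (nat \<Rightarrow> real) \<Rightarrow> (nat \<Rightarrow> nat) \<Rightarrow> real \<Rightarrow> (nat \<times> nat \<Rightarrow> real) set" where
  "decoupled_event N d t \<iota> \<tau> = {G\<in>space (gauss (idx N d)). (\<forall>i<N. rip d G i i \<le> 4 * real d) \<and>
      \<tau> \<le> (\<Sum>j | j < d \<and> t j \<noteq> 0. t j * rip d G (\<iota> j) j)}"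

definition decoupling :: "nat \<Rightarrow> nat \<Rightarrow> (nat \<Rightarrow> real) \<Rightarrow> (nat \<Rightarrow> nat) \<Rightarrow> bool" where
  "decoupling N d t \<iota> \<longleftrightarrow> (\<forall>j<d. t j \<noteq> 0 \<longrightarrow> \<iota> j < N \<and> (\<iota> j < d \<longrightarrow> t (\<iota> j) = 0))"

lemma decoupled_event_sets:
  assumes "d \<le> N" "decoupling N d t \<iota>"
  shows "decoupled_event N d t \<iota> \<tau> \<in> sets (gauss (idx N d))"
proof -
  let ?g = "gauss (idx N d)"
  have r: "(\<lambda>G. rip d G i j) \<in> borel_measurable ?g" if "i < N" "j < N" for i j
    using measurable_rip that .
  have "(\<lambda>G. \<Sum>j | j < d \<and> t j \<noteq> 0. t j * rip d G (\<iota> j) j) \<in> borel_measurable ?g"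
    using assms by (intro borel_measurable_sum borel_measurable_times borel_measurable_const r) (auto simp: decoupling_def)
  then have 1: "{G\<in>space ?g. \<tau> \<le> (\<Sum>j | j < d \<and> t j \<noteq> 0. t j * rip d G (\<iota> j) j)} \<in> sets ?g" by measurable
  have 2: "{G\<in>space ?g. \<forall>i\<in>{..<N}. rip d G i i \<le> 4 * real d} \<in> sets ?g"
    using r by (intro sets.sets_Collect_finite_All) (auto intro!: borel_measurable_le)
  have 3: "decoupled_event N d t \<iota> \<tau> = {G\<in>space ?g. \<tau> \<le> (\<Sum>j | j < d \<and> t j \<noteq> 0. t j * rip d G (\<iota> j) j)} \<inter>
     {G\<in>space ?g. \<forall>i\<in>{..<N}. rip d G i i \<le> 4 * real d}" unfolding decoupled_event_def by blast
  show ?thesis unfolding 3 using 1 2 by (rule sets.Int)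
qed

text \<open>
  In a pair \<open>(i, t)\<close>, the row \<open>i b\<close> violates the bound for the block \<open>b\<close>, and \<open>t\<close> consists of the signs of the
  inner products, set to \<open>0\<close> outside a decoupled set of rows.
\<close>

definition dec_index :: "nat \<Rightarrow> nat \<Rightarrow> nat \<Rightarrow> nat \<Rightarrow> ((nat \<Rightarrow> nat) \<times> (nat \<Rightarrow> real)) set" where
  "dec_index N d k m = {(i, t). i \<in> PiE {..<m} (\<lambda>_. {..<N}) \<and> t \<in> PiE {..<d} (\<lambda>_. {-1, 0, 1}) \<and>
     decoupling N d t (\<lambda>j. i (j div k))}"

text \<open>Row norms too large, diagonal entries too small for the rows used in blocks, or a large
  decoupled form. The threshold m d / 32 is the sum of m violations of size d/8, of which the cut
  keeps a quarter.\<close>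

definition bad_inf :: "nat \<Rightarrow> nat \<Rightarrow> nat \<Rightarrow> nat \<Rightarrow> (nat \<times> nat \<Rightarrow> real) set" where
  "bad_inf N d k m =
     (\<Union>i\<in>{..<N}. {G\<in>space (gauss (idx N d)). 4 * real d \<le> (\<Sum>p\<in>{i} \<times> {..<d}. (G p)\<^sup>2)}) \<union>
     (\<Union>j\<in>{..<d}. {G\<in>space (gauss (idx N d)). (\<Sum>p\<in>{j} \<times> {..<d}. (G p)\<^sup>2) \<le> real d / 4}) \<union>
     (\<Union>w\<in>dec_index N d k m. decoupled_event N d (snd w) (\<lambda>j. fst w (j div k)) (real m * real d / 32))"

lemma finite_dec_index: "finite (dec_index N d k m)" "card (dec_index N d k m) \<le> N ^ m * 3 ^ d"
proof -
  let ?P = "PiE {..<m} (\<lambda>_. {..<N}) \<times> PiE {..<d} (\<lambda>_. {-1, 0, 1 :: real})"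
  have fin: "finite ?P" by (intro finite_cartesian_product finite_PiE) auto
  have sub: "dec_index N d k m \<subseteq> ?P" by (auto simp: dec_index_def)
  show "finite (dec_index N d k m)" using fin sub finite_subset by blast
  have "card (dec_index N d k m) \<le> card ?P" using fin sub by (rule card_mono)
  also have "\<dots> = N ^ m * 3 ^ d" by (simp add: card_cartesian_product card_PiE numeral_3_eq_3)
  finally show "card (dec_index N d k m) \<le> N ^ m * 3 ^ d" .
qed

lemma square_sum_sets:
  assumes "K \<subseteq> idx N d"
  shows "{G\<in>space (gauss (idx N d)). c \<le> (\<Sum>p\<in>K. (G p)\<^sup>2)} \<in> sets (gauss (idx N d))"
    "{G\<in>space (gauss (idx N d)). (\<Sum>p\<in>K. (G p)\<^sup>2) \<le> c} \<in> sets (gauss (idx N d))"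
proof -
  have [measurable]: "(\<lambda>G. \<Sum>p\<in>K. (G p)\<^sup>2) \<in> borel_measurable (gauss (idx N d))"
    using assms by (intro borel_measurable_sum borel_measurable_power measurable_gauss_coord) auto
  show "{G\<in>space (gauss (idx N d)). c \<le> (\<Sum>p\<in>K. (G p)\<^sup>2)} \<in> sets (gauss (idx N d))"
    "{G\<in>space (gauss (idx N d)). (\<Sum>p\<in>K. (G p)\<^sup>2) \<le> c} \<in> sets (gauss (idx N d))" by measurable
qed

lemma bad_inf_sets:
  assumes "d \<le> N" shows "bad_inf N d k m \<in> sets (gauss (idx N d))"
  unfolding bad_inf_def
proof (intro sets.Un sets.finite_UN square_sum_sets finite_dec_index)
  show "decoupled_event N d (snd w) (\<lambda>j. fst w (j div k)) (real m * real d / 32) \<in> sets (gauss (idx N d))"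
    if "w \<in> dec_index N d k m" for w
    using that by (intro decoupled_event_sets[OF assms]) (auto simp: dec_index_def)
qed (use assms in \<open>auto simp: idx_def\<close>)

lemma measure_UN_le:
  assumes "finite I" "\<And>i. i \<in> I \<Longrightarrow> A i \<in> sets (gauss J)" "\<And>i. i \<in> I \<Longrightarrow> measure (gauss J) (A i) \<le> c"
  shows "measure (gauss J) (\<Union>i\<in>I. A i) \<le> real (card I) * c"
proof -
  interpret prob_space "gauss J" by (rule prob_space_gauss)
  have "prob (\<Union>i\<in>I. A i) \<le> (\<Sum>i\<in>I. prob (A i))"
    using assms by (intro finite_measure_subadditive_finite) auto
  also have "\<dots> \<le> (\<Sum>i\<in>I. c)" using assms by (intro sum_mono) auto
  finally show ?thesis by simp
qed

lemma measure_gauss_Un_le: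
  assumes "A \<in> sets (gauss J)" "B \<in> sets (gauss J)"
  shows "measure (gauss J) (A \<union> B) \<le> measure (gauss J) A + measure (gauss J) B"
proof -
  interpret prob_space "gauss J" by (rule prob_space_gauss)
  show ?thesis using assms by (rule measure_Un_le)
qed

lemma bad_inf_measure:
  assumes dN: "d \<le> N" and d: "d > 0"
  shows "measure (gauss (idx N d)) (bad_inf N d k m) \<le>
    real N * (sqrt 2 ^ d * exp (- real d)) + real d * ((1 / sqrt 3) ^ d * exp (real d / 4)) +
    real (N ^ m * 3 ^ d) * exp (- (real m)\<^sup>2 / 8192)"
proof -
  let ?g = "gauss (idx N d)"
  let ?A = "\<Union>i\<in>{..<N}. {G\<in>space ?g. 4 * real d \<le> (\<Sum>p\<in>{i} \<times> {..<d}. (G p)\<^sup>2)}"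
  let ?B = "\<Union>j\<in>{..<d}. {G\<in>space ?g. (\<Sum>p\<in>{j} \<times> {..<d}. (G p)\<^sup>2) \<le> real d / 4}"
  let ?C = "\<Union>w\<in>dec_index N d k m. decoupled_event N d (snd w) (\<lambda>j. fst w (j div k)) (real m * real d / 32)"
  have rowsub: "{i} \<times> {..<d} \<subseteq> idx N d" if "i < N" for i using that by (auto simp: idx_def)
  have sC: "decoupled_event N d (snd w) (\<lambda>j. fst w (j div k)) \<tau> \<in> sets ?g" if "w \<in> dec_index N d k m" for w \<tau>
    using that by (intro decoupled_event_sets[OF dN]) (auto simp: dec_index_def)
  have As: "?A \<in> sets ?g" using rowsub by (intro sets.finite_UN square_sum_sets) auto
  have Bs: "?B \<in> sets ?g" using rowsub dN by (intro sets.finite_UN square_sum_sets) auto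
  have Cs: "?C \<in> sets ?g" using sC by (intro sets.finite_UN finite_dec_index) auto
  have "measure ?g ?A \<le> real (card {..<N}) * (sqrt 2 ^ d * exp (- real d))"
  proof (rule measure_UN_le)
    fix i assume "i \<in> {..<N}"
    then show "measure ?g {G\<in>space ?g. 4 * real d \<le> (\<Sum>p\<in>{i} \<times> {..<d}. (G p)\<^sup>2)} \<le> sqrt 2 ^ d * exp (- real d)"
      using gauss_square_sum_upper[OF finite_idx rowsub, of i "4 * real d"] by (simp add: card_cartesian_product)
  qed (use rowsub square_sum_sets in auto)
  moreover have "measure ?g ?B \<le> real (card {..<d}) * ((1 / sqrt 3) ^ d * exp (real d / 4))"
  proof (rule measure_UN_le)
    fix j assume "j \<in> {..<d}"
    then show "measure ?g {G\<in>space ?g. (\<Sum>p\<in>{j} \<times> {..<d}. (G p)\<^sup>2) \<le> real d / 4} \<le> (1 / sqrt 3) ^ d * exp (real d / 4)"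
      using gauss_square_sum_lower[OF finite_idx rowsub, of j "real d / 4"] dN by (simp add: card_cartesian_product)
    show "{G\<in>space ?g. (\<Sum>p\<in>{j} \<times> {..<d}. (G p)\<^sup>2) \<le> real d / 4} \<in> sets ?g"
      using \<open>j \<in> {..<d}\<close> dN by (intro square_sum_sets rowsub) auto
  qed simp
  moreover have "measure ?g ?C \<le> real (card (dec_index N d k m)) * exp (- (real m)\<^sup>2 / 8192)"
  proof (rule measure_UN_le[OF finite_dec_index(1)])
    fix w assume w: "w \<in> dec_index N d k m"
    \<comment> \<open>The minimiser of the exponent 2 \<theta>^2 d^2 - \<theta> m d / 32.\<close>
    let ?\<theta> = "real m / (128 * real d)"
    have t: "snd w j \<in> {-1, 0, 1}" if "j < d" for j using w that by (auto simp: dec_index_def PiE_iff)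
    have \<iota>: "fst w (j div k) < N \<and> (fst w (j div k) < d \<longrightarrow> snd w (fst w (j div k)) = 0)"
      if "j < d" "snd w j \<noteq> 0" for j using w that by (auto simp: dec_index_def decoupling_def)
    have "measure ?g (decoupled_event N d (snd w) (\<lambda>j. fst w (j div k)) (real m * real d / 32))
      \<le> exp (2 * ?\<theta>\<^sup>2 * (real d)\<^sup>2 - ?\<theta> * (real m * real d / 32))"
      unfolding decoupled_event_def by (rule gauss_decoupled_tail[where t="snd w" and \<iota>="\<lambda>j. fst w (j div k)"])
        (use dN t \<iota> in auto)
    also have "2 * ?\<theta>\<^sup>2 * (real d)\<^sup>2 - ?\<theta> * (real m * real d / 32) = - (real m)\<^sup>2 / 8192"
      using d by (simp add: power_divide power_mult_distrib) (simp add: power2_eq_square)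
    finally show "measure ?g (decoupled_event N d (snd w) (\<lambda>j. fst w (j div k)) (real m * real d / 32)) \<le> exp (- (real m)\<^sup>2 / 8192)" .
  qed (use sC in auto)
  moreover have "real (card (dec_index N d k m)) * exp (- (real m)\<^sup>2 / 8192) \<le> real (N ^ m * 3 ^ d) * exp (- (real m)\<^sup>2 / 8192)"
    using finite_dec_index(2)[of N d k m] by (intro mult_right_mono) (auto simp only: of_nat_le_iff exp_ge_zero)
  moreover have "measure ?g (bad_inf N d k m) \<le> measure ?g ?A + measure ?g ?B + measure ?g ?C"
    unfolding bad_inf_def
    using measure_gauss_Un_le[OF sets.Un[OF As Bs] Cs] measure_gauss_Un_le[OF As Bs] by linarith
  ultimately show ?thesis unfolding card_lessThan by linarith
qed

text \<open>If every block had an offending row, the sum of all violations would survive a cut as a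
  decoupled form with suitable signs, and such a form is among the excluded ones.\<close>

lemma not_bad_inf:
  assumes G: "G \<in> space (gauss (idx N d))" "G \<notin> bad_inf N d k m" and k: "k \<ge> 1" "m * k \<le> d" and dN: "d \<le> N" and d: "d > 0"
  shows "\<And>j. j < d \<Longrightarrow> rip d G j j \<ge> real d / 4"
    and "\<exists>b<m. \<forall>i<N. (\<Sum>t\<in>{..<k} - {t. b * k + t = i}. \<bar>rip d G i (b * k + t)\<bar>) \<le> real d / 8"
proof -
  have up: "rip d G i i \<le> 4 * real d" if "i < N" for i
    using G that by (force simp: bad_inf_def rip_self)
  show lo: "rip d G j j \<ge> real d / 4" if "j < d" for j
    using G that by (force simp: bad_inf_def rip_self)
  show "\<exists>b<m. \<forall>i<N. (\<Sum>t\<in>{..<k} - {t. b * k + t = i}. \<bar>rip d G i (b * k + t)\<bar>) \<le> real d / 8"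
  proof (rule ccontr)
    assume "\<not> ?thesis"
    then have "\<forall>b\<in>{..<m}. \<exists>i. i < N \<and> real d / 8 < (\<Sum>t\<in>{..<k} - {t. b * k + t = i}. \<bar>rip d G i (b * k + t)\<bar>)"
      by (auto simp: not_le)
    from bchoice[OF this] obtain i0 where i0: "\<And>b. b < m \<Longrightarrow> i0 b < N"
      "\<And>b. b < m \<Longrightarrow> real d / 8 < (\<Sum>t\<in>{..<k} - {t. b * k + t = i0 b}. \<bar>rip d G (i0 b) (b * k + t)\<bar>)" by auto
    \<comment> \<open>Undefined beyond m, so that the choice belongs to the finite index set of the
      union bound.\<close>
    define i where "i = restrict i0 {..<m}"
    define \<iota> where "\<iota> j = i (j div k)" for j
    \<comment> \<open>Set to 0 on the diagonal, as the cut requires, and on the rows left over after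
      the last block.\<close>
    define a where "a j = (if j < m * k \<and> \<iota> j \<noteq> j then \<bar>rip d G (\<iota> j) j\<bar> else 0)" for j
    have dv: "j div k < m" if "j < m * k" for j using that k(1) by (simp add: div_less_iff_less_mult)
    have sum_a: "(\<Sum>j<d. a j) \<ge> real m * (real d / 8)"
    proof -
      have "(\<Sum>j<d. a j) = (\<Sum>j<m * k. a j)" using k(2) by (intro sum.mono_neutral_right) (auto simp: a_def)
      also have "\<dots> = (\<Sum>b<m. sum a {b * k..<b * k + k})" by (rule sum.nat_group[symmetric])
      also have "\<dots> = (\<Sum>b<m. \<Sum>t<k. a (b * k + t))"
      proof (rule sum.cong[OF refl])
        fix b
        show "sum a {b * k..<b * k + k} = (\<Sum>t<k. a (b * k + t))"
          by (rule sum.reindex_bij_witness[of _ "\<lambda>t. b * k + t" "\<lambda>j. j - b * k"]) auto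
      qed
      also have "\<dots> \<ge> (\<Sum>b<m. real d / 8)"
      proof (rule sum_mono)
        fix b assume b: "b \<in> {..<m}"
        have lt: "b * k + t < m * k" if "t < k" for t
        proof -
          have "b * k + t < Suc b * k" using that by simp
          also have "\<dots> \<le> m * k" using b by (intro mult_le_mono1) auto
          finally show ?thesis .
        qed
        have dd: "(b * k + t) div k = b" if "t < k" for t using that by simp
        have "(\<Sum>t<k. a (b * k + t)) = (\<Sum>t<k. if b * k + t = i0 b then 0 else \<bar>rip d G (i0 b) (b * k + t)\<bar>)"
          using lt dd b by (intro sum.cong refl) (auto simp: a_def \<iota>_def i_def)
        also have "\<dots> = (\<Sum>t\<in>{..<k} - {t. b * k + t = i0 b}. \<bar>rip d G (i0 b) (b * k + t)\<bar>)"
          by (intro sum.mono_neutral_cong_right) auto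
        finally show "real d / 8 \<le> (\<Sum>t<k. a (b * k + t))" using i0(2)[of b] b by simp
      qed
      finally show ?thesis by simp
    qed
    have "\<exists>S\<subseteq>{..<d}. (\<Sum>j<d. a j) / 4 \<le> (\<Sum>j | j \<in> S \<and> \<iota> j \<notin> S. a j)"
      by (rule directed_cut) (auto simp: a_def)
    then obtain S where S: "S \<subseteq> {..<d}" "(\<Sum>j<d. a j) / 4 \<le> (\<Sum>j | j \<in> S \<and> \<iota> j \<notin> S. a j)"
      by blast
    \<comment> \<open>The signs turn absolute values into a linear form; the zeros outside the cut
      make the choice decoupled.\<close>
    define t where "t = (\<lambda>j\<in>{..<d}. if j < m * k \<and> j \<in> S \<and> \<iota> j \<notin> S then sgn (rip d G (\<iota> j) j) else 0)"
    have tD: "j < m * k" "j \<in> S" "\<iota> j \<notin> S" if "j < d" "t j \<noteq> 0" for j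
      using that by (auto simp: t_def split: if_splits)
    have dec: "decoupling N d t \<iota>"
      unfolding decoupling_def
    proof (intro allI impI conjI)
      fix j assume j: "j < d" "t j \<noteq> 0"
      show "\<iota> j < N" using tD(1)[OF j] dv i0(1) by (simp add: \<iota>_def i_def)
      show "t (\<iota> j) = 0" if "\<iota> j < d" using tD(3)[OF j] tD(2)[OF that] by blast
    qed
    have "(i, t) \<in> dec_index N d k m"
    proof -
      have "i \<in> PiE {..<m} (\<lambda>_. {..<N})" using i0(1) by (auto simp: i_def)
      moreover have "t \<in> PiE {..<d} (\<lambda>_. {-1, 0, 1})" by (auto simp: t_def sgn_if)
      moreover have "\<iota> = (\<lambda>j. i (j div k))" by (rule ext) (simp add: \<iota>_def)
      ultimately show ?thesis using dec unfolding dec_index_def by simp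
    qed
    moreover have "G \<in> decoupled_event N d t \<iota> (real m * real d / 32)"
    proof -
      have "(\<Sum>j | j \<in> S \<and> \<iota> j \<notin> S. a j) = (\<Sum>j | j < d \<and> t j \<noteq> 0. t j * rip d G (\<iota> j) j)"
      proof (rule sum.mono_neutral_cong_right)
        show "finite {j \<in> S. \<iota> j \<notin> S}" using S(1) finite_subset[of S "{..<d}"] by auto
        show "{j. j < d \<and> t j \<noteq> 0} \<subseteq> {j \<in> S. \<iota> j \<notin> S}" using tD by auto
        show "\<forall>j\<in>{j \<in> S. \<iota> j \<notin> S} - {j. j < d \<and> t j \<noteq> 0}. a j = 0"
          using S(1) by (auto simp: t_def a_def sgn_if split: if_splits)
        show "a j = t j * rip d G (\<iota> j) j" if "j \<in> {j. j < d \<and> t j \<noteq> 0}" for j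
        proof -
          have j: "j < d" "t j \<noteq> 0" using that by auto
          have "\<iota> j \<noteq> j" using tD(2,3)[OF j] by auto
          then show ?thesis using tD[OF j] j by (simp add: a_def t_def abs_sgn mult.commute)
        qed
      qed
      then have "real m * real d / 32 \<le> (\<Sum>j | j < d \<and> t j \<noteq> 0. t j * rip d G (\<iota> j) j)"
        using S(2) sum_a by simp
      then show ?thesis using G(1) up by (simp add: decoupled_event_def)
    qed
    ultimately have "G \<in> bad_inf N d k m" unfolding bad_inf_def \<iota>_def by force
    then show False using G(2) by simp
  qed
qed

section \<open>Exceptional set for large \<open>N\<close>\<close>

text \<open>The entries of row \<open>i b\<close> in the columns of block b. Different blocks use
  different columns, so these entries are distinct, hence independent, even if the same row is
  chosen for several blocks.\<close>

definition block_set :: "nat \<Rightarrow> nat \<Rightarrow> (nat \<Rightarrow> nat) \<Rightarrow> (nat \<times> nat) set" where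
  "block_set k m i = (\<lambda>(b, t). (i b, b * k + t)) ` ({..<m} \<times> {..<k})"

lemma block_inj: "inj_on (\<lambda>(b, t). (i b, b * k + t)) ({..<m} \<times> {..<k :: nat})"
proof (rule inj_onI, clarsimp)
  fix b t b' t' :: nat assume *: "t < k" "t' < k" "b * k + t = b' * k + t'"
  have "(b * k + t) div k = b" "(b' * k + t') div k = b'" using *(1,2) by simp_all
  then have "b = b'" using *(3) by metis
  then show "b = b' \<and> t = t'" using *(3) by simp
qed

lemma block_set_card: "card (block_set k m i) = m * k"
  unfolding block_set_def by (simp add: card_image[OF block_inj])

lemma block_set_sum: "(\<Sum>p\<in>block_set k m i. f p) = (\<Sum>b<m. \<Sum>t<k. f (i b, b * k + t))"
  unfolding block_set_def by (subst sum.reindex[OF block_inj]) (simp add: sum.cartesian_product split_def)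

lemma block_set_subset:
  assumes "m * k \<le> d" "\<And>b. b < m \<Longrightarrow> i b < N" shows "block_set k m i \<subseteq> idx N d"
proof -
  have "b * k + t < d" if "b < m" "t < k" for b t
  proof -
    have "b * k + t < Suc b * k" using that by simp
    also have "\<dots> \<le> m * k" using that by (intro mult_le_mono1) auto
    finally show ?thesis using assms(1) by simp
  qed
  then show ?thesis using assms(2) by (auto simp: block_set_def idx_def)
qed

definition grid_pt :: "nat \<Rightarrow> (nat \<Rightarrow> int) \<Rightarrow> nat \<Rightarrow> real" where
  "grid_pt n z l = real_of_int (z l) / real n"

text \<open>Lattice points standing in for the unit sphere, of length at least 1/2. With mesh of
  order 1/d there are exp (O (d ln d)) of them, which the doubly exponential smallness for a single
  point easily absorbs.\<close>

definition grid :: "nat \<Rightarrow> nat \<Rightarrow> (nat \<Rightarrow> int) set" where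
  "grid d n = {z \<in> PiE {..<d} (\<lambda>_. {- int n..int n}). (\<Sum>l<d. (grid_pt n z l)\<^sup>2) \<ge> 1 / 4}"

text \<open>The first family allows passing from the grid to the sphere, the second gives the lower
  bound on the grid, the third expresses that every block contains a long piece of some row. The
  factor 8 yields exp (- 2 ...) under the Chernoff bound, enough to pay for the choice of
  rows.\<close>

definition bad_two :: "nat \<Rightarrow> nat \<Rightarrow> nat \<Rightarrow> nat \<Rightarrow> (nat \<times> nat \<Rightarrow> real) set" where
  "bad_two N d k m =
     (\<Union>i\<in>{..<N}. {G\<in>space (gauss (idx N d)). 8 * (real d + ln (real N)) \<le> (\<Sum>p\<in>{i} \<times> {..<d}. (G p)\<^sup>2)}) \<union>
     (\<Union>z\<in>grid d (32 * (d + 1)). {G\<in>space (gauss (idx N d)). \<forall>i<N. \<bar>\<Sum>l<d. G (i, l) * grid_pt (32 * (d + 1)) z l\<bar> < sqrt (ln (real N)) / 4}) \<union>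
     (\<Union>i\<in>PiE {..<m} (\<lambda>_. {..<N}). {G\<in>space (gauss (idx N d)). real m * (8 * (real k + ln (real N))) \<le> (\<Sum>p\<in>block_set k m i. (G p)\<^sup>2)})"

lemma grid_finite: "finite (grid d n)" "card (grid d n) \<le> (2 * n + 1) ^ d"
proof -
  let ?P = "PiE {..<d} (\<lambda>_. {- int n..int n})"
  have fin: "finite ?P" by (intro finite_PiE) auto
  have sub: "grid d n \<subseteq> ?P" by (auto simp: grid_def)
  show "finite (grid d n)" using fin sub finite_subset by blast
  have "card (grid d n) \<le> card ?P" using fin sub by (rule card_mono)
  also have "\<dots> = (2 * n + 1) ^ d" by (simp add: card_PiE nat_add_distrib nat_mult_distrib)
  finally show "card (grid d n) \<le> (2 * n + 1) ^ d" .
qed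

lemma row_small_sets: "{G\<in>space (gauss (idx N d)). \<forall>i<N. \<bar>\<Sum>l<d. G (i, l) * y l\<bar> < \<rho>} \<in> sets (gauss (idx N d))"
proof -
  have 1: "{G\<in>space (gauss (idx N d)). \<bar>\<Sum>l<d. G (i, l) * y l\<bar> < \<rho>} \<in> sets (gauss (idx N d))" if "i \<in> {..<N}" for i
  proof -
    have [measurable]: "(\<lambda>G. \<Sum>l<d. G (i, l) * y l) \<in> borel_measurable (gauss (idx N d))"
      using that by (intro borel_measurable_sum borel_measurable_times borel_measurable_const measurable_gauss_coord) (auto simp: idx_def)
    show ?thesis by measurable
  qed
  have "{G\<in>space (gauss (idx N d)). \<forall>i\<in>{..<N}. \<bar>\<Sum>l<d. G (i, l) * y l\<bar> < \<rho>} \<in> sets (gauss (idx N d))"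
    using 1 by (intro sets.sets_Collect_finite_All) auto
  then show ?thesis by (simp only: Ball_def lessThan_iff)
qed

lemma bad_two_sets:
  assumes "m * k \<le> d" shows "bad_two N d k m \<in> sets (gauss (idx N d))"
  unfolding bad_two_def
proof (intro sets.Un sets.finite_UN square_sum_sets row_small_sets grid_finite)
  show "block_set k m i \<subseteq> idx N d" if "i \<in> PiE {..<m} (\<lambda>_. {..<N})" for i
    using that by (intro block_set_subset[OF assms]) auto
qed (auto simp: idx_def intro: finite_PiE)

text \<open>The first and third terms are chi-square tails. For the second, a single row exceeds the
  threshold with probability at least N^(-1/2), so that all N rows stay below it with probability at
  most exp (- sqrt N).\<close>

lemma bad_two_measure:
  assumes mk: "m * k \<le> d" and N: "real N \<ge> 9 ^ 4"
  shows "measure (gauss (idx N d)) (bad_two N d k m) \<le>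
    real N * (sqrt 2 ^ d * exp (- 2 * (real d + ln (real N)))) +
    real ((2 * (32 * (d + 1)) + 1) ^ d) * exp (- sqrt (real N)) +
    real (N ^ m) * (sqrt 2 ^ (m * k) * exp (- 2 * real m * (real k + ln (real N))))"
proof -
  let ?g = "gauss (idx N d)"
  let ?A = "\<Union>i\<in>{..<N}. {G\<in>space ?g. 8 * (real d + ln (real N)) \<le> (\<Sum>p\<in>{i} \<times> {..<d}. (G p)\<^sup>2)}"
  let ?n = "32 * (d + 1)" and ?\<rho> = "sqrt (ln (real N)) / 4"
  let ?B = "\<Union>z\<in>grid d ?n. {G\<in>space ?g. \<forall>i<N. \<bar>\<Sum>l<d. G (i, l) * grid_pt ?n z l\<bar> < ?\<rho>}"
  let ?C = "\<Union>i\<in>PiE {..<m} (\<lambda>_. {..<N}). {G\<in>space ?g. real m * (8 * (real k + ln (real N))) \<le> (\<Sum>p\<in>block_set k m i. (G p)\<^sup>2)}"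
  have N1: "real N > 0" using N by simp
  have rowsub: "{i} \<times> {..<d} \<subseteq> idx N d" if "i < N" for i using that by (auto simp: idx_def)
  have bsub: "block_set k m i \<subseteq> idx N d" if "i \<in> PiE {..<m} (\<lambda>_. {..<N})" for i
    using that by (intro block_set_subset[OF mk]) auto
  have cP: "card (PiE {..<m} (\<lambda>_. {..<N})) = N ^ m" by (simp add: card_PiE)
  have finP: "finite (PiE {..<m} (\<lambda>_. {..<N}))" by (intro finite_PiE) auto
  have As: "?A \<in> sets ?g" using rowsub by (intro sets.finite_UN square_sum_sets) auto
  have Bs: "?B \<in> sets ?g" by (intro sets.finite_UN grid_finite row_small_sets)
  have Cs: "?C \<in> sets ?g" using bsub finP by (intro sets.finite_UN square_sum_sets) auto
  have "measure ?g ?A \<le> real (card {..<N}) * (sqrt 2 ^ d * exp (- 2 * (real d + ln (real N))))"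
  proof (rule measure_UN_le)
    fix i assume i: "i \<in> {..<N}"
    have "measure ?g {G\<in>space ?g. 8 * (real d + ln (real N)) \<le> (\<Sum>p\<in>{i} \<times> {..<d}. (G p)\<^sup>2)}
      \<le> sqrt 2 ^ card ({i} \<times> {..<d}) * exp (- (8 * (real d + ln (real N))) / 4)"
      using i by (intro gauss_square_sum_upper[OF finite_idx rowsub]) auto
    also have "- (8 * (real d + ln (real N))) / 4 = - 2 * (real d + ln (real N))" by simp
    also have "card ({i} \<times> {..<d}) = d" by (simp add: card_cartesian_product)
    finally show "measure ?g {G\<in>space ?g. 8 * (real d + ln (real N)) \<le> (\<Sum>p\<in>{i} \<times> {..<d}. (G p)\<^sup>2)}
      \<le> sqrt 2 ^ d * exp (- 2 * (real d + ln (real N)))" .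
    show "{G\<in>space ?g. 8 * (real d + ln (real N)) \<le> (\<Sum>p\<in>{i} \<times> {..<d}. (G p)\<^sup>2)} \<in> sets ?g"
      using i by (intro square_sum_sets rowsub) auto
  qed simp
  moreover have "measure ?g ?B \<le> real (card (grid d ?n)) * exp (- sqrt (real N))"
  proof (rule measure_UN_le[OF grid_finite(1)])
    fix z assume z: "z \<in> grid d ?n"
    show "{G\<in>space ?g. \<forall>i<N. \<bar>\<Sum>l<d. G (i, l) * grid_pt ?n z l\<bar> < ?\<rho>} \<in> sets ?g" by (rule row_small_sets)
    let ?q = "exp (- (2 * ?\<rho> + 1)\<^sup>2 / 2) / sqrt (2 * pi)"
    have ln0: "ln (real N) \<ge> 0" using N by simp
    have \<rho>0: "?\<rho> \<ge> 0" using ln0 by simp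
    have "measure ?g {G\<in>space ?g. \<forall>i<N. \<bar>\<Sum>l<d. G (i, l) * grid_pt ?n z l\<bar> < ?\<rho>} \<le> (1 - ?q) ^ N"
      by (rule gauss_row_small[OF \<rho>0]) (use z in \<open>simp add: grid_def\<close>)
    also have "\<dots> \<le> exp (- ?q) ^ N"
    proof (rule power_mono)
      show "1 - ?q \<le> exp (- ?q)" using exp_ge_add_one_self[of "- ?q"] by simp
      have "exp (- (2 * ?\<rho> + 1)\<^sup>2 / 2) \<le> 1" by simp
      moreover have "sqrt (2 * pi) \<ge> 1" using pi_gt3 by (intro real_le_rsqrt) simp
      ultimately have "?q \<le> 1 / 1" by (intro frac_le) simp_all
      then show "0 \<le> 1 - ?q" by simp
    qed
    also have "\<dots> = exp (- (real N * ?q))" by (simp flip: exp_of_nat_mult)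
    \<comment> \<open>By (s + 1)^2 / 2 \<le> s^2 + 1 with s = sqrt (ln N) / 2, the tail is at least
      N^(-1/4) up to the factor exp (-1) / sqrt (2 pi).\<close>
    also have "\<dots> \<le> exp (- sqrt (real N))"
    proof -
      have "(2 * ?\<rho> + 1)\<^sup>2 / 2 \<le> (2 * ?\<rho>)\<^sup>2 + 1"
      proof -
        have "(2 * ?\<rho>)\<^sup>2 + 1 - (2 * ?\<rho> + 1)\<^sup>2 / 2 = (2 * ?\<rho> - 1)\<^sup>2 / 2" by (simp add: power2_eq_square field_simps)
        moreover have "(2 * ?\<rho> - 1)\<^sup>2 / 2 \<ge> 0" by simp
        ultimately show ?thesis by linarith
      qed
      also have "(2 * ?\<rho>)\<^sup>2 = ln (real N) / 4" using ln0 by (simp add: power_divide)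
      finally have "exp (- (ln (real N) / 4 + 1)) \<le> exp (- (2 * ?\<rho> + 1)\<^sup>2 / 2)" by simp
      moreover have "exp (- (ln (real N) / 4 + 1)) = exp (- (ln (real N) / 4)) * exp (- 1)" by (simp flip: exp_add)
      ultimately have e: "exp (- (ln (real N) / 4)) * exp (- 1) \<le> exp (- (2 * ?\<rho> + 1)\<^sup>2 / 2)" by (simp only:)
      define w where "w = exp (ln (real N) / 4)"
      have w4: "w ^ 4 = real N" unfolding w_def using N1 by (simp flip: exp_of_nat_mult)
      have w0: "w > 0" by (simp add: w_def)
      \<comment> \<open>w is the fourth root of N. Being at least 9, it absorbs the constant e sqrt
        (2 pi), which is at most 3 times 3.\<close>
      have w9: "w \<ge> 9"
      proof (rule ccontr)
        assume "\<not> w \<ge> 9"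
        then have "w ^ 4 < 9 ^ 4" using w0 by (intro power_strict_mono) auto
        then show False using w4 N by simp
      qed
      have sN: "sqrt (real N) = w\<^sup>2" 
      proof -
        have "real N = (w\<^sup>2)\<^sup>2" using w4 by (simp flip: power_mult)
        then have "sqrt (real N) = sqrt ((w\<^sup>2)\<^sup>2)" by (rule arg_cong)
        also have "\<dots> = w\<^sup>2" unfolding real_sqrt_abs by simp
        finally show ?thesis .
      qed
      have "exp 1 * sqrt (2 * pi) \<le> 9"
      proof -
        have "sqrt (2 * pi) \<le> sqrt (3\<^sup>2)" using pi_less_4 by (intro real_sqrt_le_mono) simp
        then have "sqrt (2 * pi) \<le> 3" by simp
        then have "exp 1 * sqrt (2 * pi) \<le> 3 * 3" using exp_le by (intro mult_mono) auto
        then show ?thesis by simp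
      qed
      then have "exp 1 * sqrt (2 * pi) \<le> w" using w9 by linarith
      moreover have "exp (1 :: real) * sqrt (2 * pi) > 0" by simp
      ultimately have "1 / w \<le> 1 / (exp 1 * sqrt (2 * pi))" using w0 by (intro divide_left_mono) auto
      then have q1: "1 / w \<le> exp (- 1) / sqrt (2 * pi)" by (simp add: exp_minus inverse_eq_divide)
      have "w\<^sup>2 = w ^ 4 * (1 / w * (1 / w))" using w0 by (simp add: field_simps power2_eq_square power4_eq_xxxx)
      also have "\<dots> \<le> w ^ 4 * (1 / w * (exp (- 1) / sqrt (2 * pi)))" using q1 w0 by (intro mult_left_mono) auto
      also have "1 / w * (exp (- 1) / sqrt (2 * pi)) = exp (- (ln (real N) / 4)) * exp (- 1) / sqrt (2 * pi)"
        by (simp add: w_def exp_minus inverse_eq_divide)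
      also have "w ^ 4 * \<dots> \<le> w ^ 4 * ?q" using e w0 by (intro mult_left_mono divide_right_mono) auto
      finally show ?thesis unfolding sN w4 by simp
    qed
    finally show "measure ?g {G\<in>space ?g. \<forall>i<N. \<bar>\<Sum>l<d. G (i, l) * grid_pt ?n z l\<bar> < ?\<rho>} \<le> exp (- sqrt (real N))" .
  qed
  moreover have "real (card (grid d ?n)) * exp (- sqrt (real N)) \<le> real ((2 * ?n + 1) ^ d) * exp (- sqrt (real N))"
    using grid_finite(2)[of d ?n] by (intro mult_right_mono) (simp_all only: of_nat_le_iff exp_ge_zero)
  moreover have "measure ?g ?C \<le> real (card (PiE {..<m} (\<lambda>_. {..<N}))) * (sqrt 2 ^ (m * k) * exp (- 2 * real m * (real k + ln (real N))))"
  proof (rule measure_UN_le[OF finP])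
    fix i assume i: "i \<in> PiE {..<m} (\<lambda>_. {..<N})"
    show "{G\<in>space ?g. real m * (8 * (real k + ln (real N))) \<le> (\<Sum>p\<in>block_set k m i. (G p)\<^sup>2)} \<in> sets ?g"
      by (rule square_sum_sets(1)[OF bsub[OF i]])
    have "measure ?g {G\<in>space ?g. real m * (8 * (real k + ln (real N))) \<le> (\<Sum>p\<in>block_set k m i. (G p)\<^sup>2)}
       \<le> sqrt 2 ^ card (block_set k m i) * exp (- (real m * (8 * (real k + ln (real N)))) / 4)"
      by (rule gauss_square_sum_upper[OF finite_idx bsub[OF i]])
    also have "- (real m * (8 * (real k + ln (real N)))) / 4 = - 2 * real m * (real k + ln (real N))" by simp
    finally show "measure ?g {G\<in>space ?g. real m * (8 * (real k + ln (real N))) \<le> (\<Sum>p\<in>block_set k m i. (G p)\<^sup>2)}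
       \<le> sqrt 2 ^ (m * k) * exp (- 2 * real m * (real k + ln (real N)))" by (simp only: block_set_card)
  qed
  moreover have "measure ?g (bad_two N d k m) \<le> measure ?g ?A + measure ?g ?B + measure ?g ?C"
    unfolding bad_two_def
    using measure_gauss_Un_le[OF sets.Un[OF As Bs] Cs] measure_gauss_Un_le[OF As Bs] by linarith
  ultimately show ?thesis unfolding card_lessThan cP by linarith
qed

text \<open>A grid point near the normalised vector has a row with inner product at least sqrt L /
  4. The rounding error times the length of that row costs at most half of this.\<close>

lemma not_bad_two_lower:
  assumes G: "G \<in> space (gauss (idx N d))" "G \<notin> bad_two N d k m" and N: "ln (real N) \<ge> 1" and x: "x \<in> rvecs d"
  shows "sqrt (ln (real N)) / 8 * lp_norm 2 d x \<le> lp_norm \<infinity> N (gmap N d G x)"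
proof (cases "lp_norm 2 d x = 0")
  case True
  then show ?thesis by (simp add: lp_norm_inf_nonneg)
next
  case False
  let ?n = "32 * (d + 1)"
  define L where "L = ln (real N)"
  have L: "L \<ge> 1" using N by (simp add: L_def)
  have pos: "lp_norm 2 d x > 0" using False lp_admissibleD(3)[OF lp_admissible_2 x] by simp
  define u where "u = (1 / lp_norm 2 d x) *\<^sub>R x"
  have ur: "u \<in> rvecs d" unfolding u_def by (rule subspace_scale[OF subspace_rvecs x])
  have u1: "lp_norm 2 d u = 1" unfolding u_def lp_admissibleD(1)[OF lp_admissible_2 x] using pos by simp
  then have su: "(\<Sum>l<d. (u l)\<^sup>2) = 1" unfolding lp_norm_2 by simp
  \<comment> \<open>Rounding down to the lattice of mesh 1 / (32 (d + 1)).\<close>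
  define z where "z = (\<lambda>l\<in>{..<d}. \<lfloor>u l * real ?n\<rfloor>)"
  define y where "y = grid_pt ?n z"
  have near: "\<bar>u l - y l\<bar> \<le> 1 / real ?n" if "l < d" for l
  proof -
    have n0: "real ?n > 0" by simp
    have "y l = real_of_int \<lfloor>u l * real ?n\<rfloor> / real ?n" using that by (simp add: y_def z_def grid_pt_def)
    then have "u l - y l = (u l * real ?n - real_of_int \<lfloor>u l * real ?n\<rfloor>) / real ?n" using n0 by (simp add: field_simps)
    moreover have "0 \<le> u l * real ?n - real_of_int \<lfloor>u l * real ?n\<rfloor>" "u l * real ?n - real_of_int \<lfloor>u l * real ?n\<rfloor> \<le> 1"
      by linarith+
    ultimately have "0 \<le> u l - y l \<and> u l - y l \<le> 1 / real ?n" using n0 by (simp add: divide_right_mono)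
    then show ?thesis by linarith
  qed
  \<comment> \<open>The mesh is chosen for this bound: multiplied by the squared row length 8 (d +
    L) it is at most L / 128.\<close>
  have dist2: "(\<Sum>l<d. (u l - y l)\<^sup>2) \<le> 1 / (1024 * (real d + 1))"
  proof -
    have "(\<Sum>l<d. (u l - y l)\<^sup>2) \<le> (\<Sum>l<d. (1 / real ?n)\<^sup>2)"
    proof (rule sum_mono)
      fix l assume "l \<in> {..<d}"
      then have "\<bar>u l - y l\<bar> ^ 2 \<le> (1 / real ?n) ^ 2" using near by (intro power_mono) auto
      then show "(u l - y l)\<^sup>2 \<le> (1 / real ?n)\<^sup>2" by simp
    qed
    also have "\<dots> = real d * (1 / real ?n)\<^sup>2" by simp
    also have "\<dots> \<le> (real d + 1) * (1 / real ?n)\<^sup>2" by (intro mult_right_mono) auto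
    also have "\<dots> = 1 / (1024 * (real d + 1))"
    proof -
      have "D * (1 / (32 * D))\<^sup>2 = 1 / (1024 * D)" if "D > 0" for D :: real
        using that by (simp add: power2_eq_square field_simps)
      from this[of "real d + 1"] show ?thesis by (simp add: algebra_simps)
    qed
    finally show ?thesis .
  qed
  have ybig: "(\<Sum>l<d. (y l)\<^sup>2) \<ge> 1 / 4"
  proof -
    have "1 = (\<Sum>l<d. (u l)\<^sup>2)" using su by simp
    also have "\<dots> \<le> (\<Sum>l<d. 2 * (y l)\<^sup>2 + 2 * (u l - y l)\<^sup>2)"
    proof (rule sum_mono)
      fix l
      have "2 * (y l)\<^sup>2 + 2 * (u l - y l)\<^sup>2 - (u l)\<^sup>2 = (2 * y l - u l)\<^sup>2" by (simp add: power2_eq_square algebra_simps)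
      then show "(u l)\<^sup>2 \<le> 2 * (y l)\<^sup>2 + 2 * (u l - y l)\<^sup>2" by (smt (verit) zero_le_power2)
    qed
    also have "\<dots> = 2 * (\<Sum>l<d. (y l)\<^sup>2) + 2 * (\<Sum>l<d. (u l - y l)\<^sup>2)" by (simp add: sum.distrib sum_distrib_left)
    finally have "1 \<le> 2 * (\<Sum>l<d. (y l)\<^sup>2) + 2 * (\<Sum>l<d. (u l - y l)\<^sup>2)" .
    moreover have "1 / (1024 * (real d + 1)) \<le> 1 / 4" by (intro divide_left_mono) auto
    ultimately show ?thesis using dist2 by linarith
  qed
  have "z \<in> grid d ?n"
  proof -
    have "z l \<in> {- int ?n..int ?n}" if "l < d" for l
    proof -
      have "\<bar>u l\<bar> \<le> 1" using lp_admissibleD(2)[OF lp_admissible_2 ur that] u1 by simp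
      then have "- real ?n \<le> u l * real ?n" "u l * real ?n \<le> real ?n"
        using mult_right_mono[of "-1" "u l" "real ?n"] mult_right_mono[of "u l" 1 "real ?n"] by (auto simp: abs_le_iff)
      then have "- int ?n \<le> \<lfloor>u l * real ?n\<rfloor>" "\<lfloor>u l * real ?n\<rfloor> \<le> int ?n" by linarith+
      then show ?thesis using that by (simp add: z_def)
    qed
    then show ?thesis using ybig by (auto simp: grid_def y_def z_def)
  qed
  then have "\<not> (\<forall>i<N. \<bar>\<Sum>l<d. G (i, l) * y l\<bar> < sqrt L / 4)"
    using G unfolding bad_two_def y_def L_def by blast
  then obtain i where i: "i < N" "sqrt L / 4 \<le> \<bar>\<Sum>l<d. G (i, l) * y l\<bar>" by (auto simp: not_less)
  have gi: "(\<Sum>l<d. (G (i, l))\<^sup>2) \<le> 8 * (real d + L)"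
  proof -
    have "(\<Sum>p\<in>{i} \<times> {..<d}. (G p)\<^sup>2) \<le> 8 * (real d + L)"
    proof (rule ccontr)
      assume "\<not> ?thesis"
      then have "G \<in> {G\<in>space (gauss (idx N d)). 8 * (real d + ln (real N)) \<le> (\<Sum>p\<in>{i} \<times> {..<d}. (G p)\<^sup>2)}"
        using G(1) by (simp add: L_def)
      then have "G \<in> bad_two N d k m" unfolding bad_two_def using i(1) by blast
      then show False using G(2) by simp
    qed
    then show ?thesis using rip_self[of d G i] by (simp add: rip_def power2_eq_square)
  qed
  have "\<bar>\<Sum>l<d. G (i, l) * (u l - y l)\<bar> \<le> sqrt L / 8"
  proof -
    have "(\<Sum>l<d. G (i, l) * (u l - y l))\<^sup>2 \<le> (\<Sum>l<d. (G (i, l))\<^sup>2) * (\<Sum>l<d. (u l - y l)\<^sup>2)"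
      by (rule Cauchy_Schwarz_ineq_sum)
    also have "\<dots> \<le> (8 * (real d + L)) * (1 / (1024 * (real d + 1)))"
      using gi dist2 L by (intro mult_mono sum_nonneg) auto
    also have "\<dots> \<le> L / 64"
    proof -
      have "real d * 1 \<le> real d * L" using L by (intro mult_left_mono) auto
      then have "real d + L \<le> (real d + 1) * L" by (simp add: algebra_simps)
      then have "(8 * (real d + L)) * (1 / (1024 * (real d + 1))) \<le> (8 * ((real d + 1) * L)) * (1 / (1024 * (real d + 1)))"
        by (intro mult_right_mono) auto
      also have "\<dots> = L / 128" by (simp add: field_simps)
      finally show ?thesis using L by linarith
    qed
    finally have "sqrt ((\<Sum>l<d. G (i, l) * (u l - y l))\<^sup>2) \<le> sqrt (L / 64)" by (rule real_sqrt_le_mono)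
    then show ?thesis by (simp add: real_sqrt_divide)
  qed
  moreover have "(\<Sum>l<d. G (i, l) * u l) = (\<Sum>l<d. G (i, l) * y l) + (\<Sum>l<d. G (i, l) * (u l - y l))"
    by (simp add: algebra_simps flip: sum.distrib)
  ultimately have "sqrt L / 8 \<le> \<bar>\<Sum>l<d. G (i, l) * u l\<bar>" using i(2) by linarith
  also have "\<dots> = \<bar>gmap N d G u i\<bar>" using i(1) by (simp add: gmap_apply)
  also have "\<dots> \<le> lp_norm \<infinity> N (gmap N d G u)" by (rule lp_norm_inf_coord[OF i(1)])
  also have "gmap N d G u = (1 / lp_norm 2 d x) *\<^sub>R gmap N d G x" unfolding u_def by (rule linear_scale[OF linear_gmap])
  also have "lp_norm \<infinity> N \<dots> = lp_norm \<infinity> N (gmap N d G x) / lp_norm 2 d x" unfolding lp_norm_inf_scale using pos by simp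
  finally show ?thesis using pos by (simp add: L_def field_simps)
qed

text \<open>Choosing an offending row in every block and adding up the squares contradicts the bound
  on the corresponding \<open>block_set\<close>.\<close>

lemma not_bad_two_block:
  assumes G: "G \<in> space (gauss (idx N d))" "G \<notin> bad_two N d k m"
  shows "\<exists>b<m. \<forall>i<N. (\<Sum>t<k. (G (i, b * k + t))\<^sup>2) \<le> 8 * (real k + ln (real N))"
proof (rule ccontr)
  assume "\<not> ?thesis"
  then have "\<forall>b\<in>{..<m}. \<exists>i. i < N \<and> 8 * (real k + ln (real N)) < (\<Sum>t<k. (G (i, b * k + t))\<^sup>2)"
    by (auto simp: not_le)
  from bchoice[OF this] obtain i0 where i0: "\<And>b. b < m \<Longrightarrow> i0 b < N"
    "\<And>b. b < m \<Longrightarrow> 8 * (real k + ln (real N)) < (\<Sum>t<k. (G (i0 b, b * k + t))\<^sup>2)" by auto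
  define i where "i = restrict i0 {..<m}"
  have "(\<Sum>b<m. 8 * (real k + ln (real N))) \<le> (\<Sum>b<m. \<Sum>t<k. (G (i b, b * k + t))\<^sup>2)"
    using i0(2) by (intro sum_mono) (auto simp: i_def intro: less_imp_le)
  then have "real m * (8 * (real k + ln (real N))) \<le> (\<Sum>p\<in>block_set k m i. (G p)\<^sup>2)"
    by (simp add: block_set_sum)
  moreover have "i \<in> PiE {..<m} (\<lambda>_. {..<N})" using i0(1) by (auto simp: i_def)
  ultimately have "G \<in> bad_two N d k m" using G(1) unfolding bad_two_def by blast
  then show False using G(2) by simp
qed

section \<open>Conclusion\<close>

text \<open>The constant 32 is imposed by the Euclidean case, as the ratio of 4 sqrt (ln N) to sqrt
  (ln N) / 8; the sup-norm case would allow 3.\<close>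

definition good_subspace :: "real \<Rightarrow> nat \<Rightarrow> nat \<Rightarrow> (nat \<Rightarrow> real) set \<Rightarrow> bool" where
  "good_subspace c d N E \<longleftrightarrow> (\<exists>k p. real k \<ge> c * sqrt (real d) \<and> p \<in> {\<infinity>, 2} \<and>
     contains_complemented_lp 32 p k (ns_restrict (lp_space \<infinity> N) E))"

definition good_quotient :: "real \<Rightarrow> nat \<Rightarrow> nat \<Rightarrow> (nat \<Rightarrow> real) set \<Rightarrow> bool" where
  "good_quotient c d N E \<longleftrightarrow> (\<exists>k p. real k \<ge> c * sqrt (real d) \<and> p \<in> {1, 2} \<and>
     contains_complemented_lp 32 p k (ns_quotient (lp_space 1 N) (orth_compl N E)))"

text \<open>A countable union over the dimension and the exponent. Positivity of c sqrt d ensures k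
  \<ge> 1, as the compactness argument demands.\<close>

lemma good_sets:
  assumes d: "d \<ge> 1" and c: "c > 0"
  shows "{E \<in> grassmannian d N. good_subspace c d N E} \<in> sets (grassmann_borel d N)"
    and "{E \<in> grassmannian d N. good_quotient c d N E} \<in> sets (grassmann_borel d N)"
proof -
  have k1: "k \<ge> 1" if "real k \<ge> c * sqrt (real d)" for k
  proof -
    have "c * sqrt (real d) > 0" using c d by simp
    then show ?thesis using that by (cases k) auto
  qed
  let ?K = "{k. real k \<ge> c * sqrt (real d)}"
  interpret i: norm_family N d "\<lambda>E. lp_norm \<infinity> N" by (rule norm_family_inf)
  interpret q: norm_family N d "quot_norm N" by (rule norm_family_quot)
  have "{E \<in> grassmannian d N. good_subspace c d N E} =
    (\<Union>k\<in>?K. \<Union>p\<in>{\<infinity>, 2}. {E \<in> grassmannian d N. contains_complemented_lp 32 p k (espace E (lp_norm \<infinity> N))})"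
    unfolding good_subspace_def ns_restrict_linf by blast
  also have "\<dots> \<in> sets (grassmann_borel d N)"
  proof (intro sets.countable_UN'')
    fix k p assume "k \<in> ?K" "p \<in> {\<infinity>, 2 :: ereal}"
    then have "k \<ge> 1" "lp_admissible p" using k1 lp_admissible_inf lp_admissible_2 by blast+
    then show "{E \<in> grassmannian d N. contains_complemented_lp 32 p k (espace E (lp_norm \<infinity> N))} \<in> sets (grassmann_borel d N)"
      by (intro i.contains_complemented_lp_sets) simp_all
  qed simp_all
  finally show "{E \<in> grassmannian d N. good_subspace c d N E} \<in> sets (grassmann_borel d N)" .
  have "{E \<in> grassmannian d N. good_quotient c d N E} =
    (\<Union>k\<in>?K. \<Union>p\<in>{1, 2}. {E \<in> grassmannian d N. contains_complemented_lp 32 p k (espace E (quot_norm N E))})"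
  proof -
    have "good_quotient c d N E \<longleftrightarrow> (\<exists>k\<in>?K. \<exists>p\<in>{1, 2}. contains_complemented_lp 32 p k (espace E (quot_norm N E)))"
      if "E \<in> grassmannian d N" for E
      unfolding good_quotient_def contains_complemented_lp_quotient_iff[OF that] by blast
    then show ?thesis by blast
  qed
  also have "\<dots> \<in> sets (grassmann_borel d N)"
  proof (intro sets.countable_UN'')
    fix k p assume "k \<in> ?K" "p \<in> {1, 2 :: ereal}"
    then have "k \<ge> 1" "lp_admissible p" using k1 lp_admissible_1 lp_admissible_2 by blast+
    then show "{E \<in> grassmannian d N. contains_complemented_lp 32 p k (espace E (quot_norm N E))} \<in> sets (grassmann_borel d N)"
      by (intro q.contains_complemented_lp_sets) simp_all
  qed simp_all
  finally show "{E \<in> grassmannian d N. good_quotient c d N E} \<in> sets (grassmann_borel d N)" .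
qed

lemma good_small_dim:
  assumes E: "E \<in> grassmannian d N" and d: "d \<ge> 1" and c: "c * sqrt (real d) \<le> 1"
  shows "good_subspace c d N E" "good_quotient c d N E"
  unfolding good_subspace_def good_quotient_def
  using contains_complemented_lp_one[OF E d] c by (auto intro!: exI[of _ "1 :: nat"])

lemma good_inf_regime:
  assumes G: "G \<in> space (gauss (idx N d))" "G \<notin> bad_inf N d k m" and nd: "nondeg N d G"
    and k: "k \<ge> 1" "m * k \<le> d" "m \<ge> 1" and dN: "d \<le> N" and ck: "real k \<ge> c * sqrt (real d)"
  shows "good_subspace c d N (span (col N G ` {..<d}))" "good_quotient c d N (span (col N G ` {..<d}))"
proof -
  have d: "d > 0" using k by (cases d) auto
  note nb = not_bad_inf[OF G k(1,2) dN d]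
  obtain b where b: "b < m" "\<And>i. i < N \<Longrightarrow> (\<Sum>t\<in>{..<k} - {t. b * k + t = i}. \<bar>rip d G i (b * k + t)\<bar>) \<le> real d / 8"
    using nb(2) by blast
  have "b * k + k = Suc b * k" by simp
  also have "\<dots> \<le> m * k" using b(1) by (intro mult_le_mono1) auto
  finally have bk: "b * k + k \<le> d" using k(2) by simp
  then have bN: "b * k + k \<le> N" using dN by simp
  have r: "rip d G (b * k + t) (b * k + t) \<ge> real d / 4" if "t < k" for t
    using bk that by (intro nb(1)) auto
  show "good_subspace c d N (span (col N G ` {..<d}))" "good_quotient c d N (span (col N G ` {..<d}))"
    unfolding good_subspace_def good_quotient_def using good_block_inf[OF nd d bN r b(2)] ck by blast+
qed

lemma good_two_regime:
  assumes G: "G \<in> space (gauss (idx N d))" "G \<notin> bad_two N d k m" and nd: "nondeg N d G"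
    and k: "m * k \<le> d" and N: "ln (real N) \<ge> 1" "real k \<le> ln (real N)" and ck: "real k \<ge> c * sqrt (real d)"
  shows "good_subspace c d N (span (col N G ` {..<d}))" "good_quotient c d N (span (col N G ` {..<d}))"
proof -
  obtain b where b: "b < m" "\<And>i. i < N \<Longrightarrow> (\<Sum>t<k. (G (i, b * k + t))\<^sup>2) \<le> 8 * (real k + ln (real N))"
    using not_bad_two_block[OF G] by blast
  have "b * k + k = Suc b * k" by simp
  also have "\<dots> \<le> m * k" using b(1) by (intro mult_le_mono1) auto
  finally have bk: "b * k + k \<le> d" using k by simp
  \<comment> \<open>For k \<le> ln N the bound 8 (k + ln N) is at most 16 ln N, the square of 4 sqrt
    (ln N).\<close>
  let ?\<rho> = "sqrt (ln (real N)) / 8" and ?S = "4 * sqrt (ln (real N))"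
  have L: "ln (real N) > 0" using N by simp
  have \<rho>: "?\<rho> > 0" "?S > 0" "?S \<le> 32 * ?\<rho>" using L by auto
  have low: "?\<rho> * lp_norm 2 d x \<le> lp_norm \<infinity> N (gmap N d G x)" if "x \<in> rvecs d" for x
    by (rule not_bad_two_lower[OF G N(1) that])
  have up: "(\<Sum>t<k. (G (i, b * k + t))\<^sup>2) \<le> ?S\<^sup>2" if "i < N" for i
  proof -
    have "8 * (real k + ln (real N)) \<le> 16 * ln (real N)" using N by simp
    also have "\<dots> = ?S\<^sup>2" using L by (simp add: power_mult_distrib)
    finally show ?thesis using b(2)[OF that] by linarith
  qed
  show "good_subspace c d N (span (col N G ` {..<d}))" "good_quotient c d N (span (col N G ` {..<d}))"
    unfolding good_subspace_def good_quotient_def using good_block_2[OF nd bk \<rho> low up] ck by blast+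
qed

section \<open>Numerical estimates and the choice of the block length\<close>

lemma sqrt2_power_le: "sqrt 2 ^ n \<le> exp (real n * (9 / 25))"
proof -
  \<comment> \<open>A rational slightly above ln (sqrt 2), small enough for three terms of the
    exponential series to prove it.\<close>
  have "(2 :: real) \<le> (1 + 9 / 25 + (9 / 25)\<^sup>2 / 2)\<^sup>2" by (simp add: power2_eq_square)
  also have "\<dots> \<le> (exp (9 / 25))\<^sup>2" by (intro power_mono exp_lower_Taylor_quadratic) auto
  finally have "sqrt 2 \<le> exp (9 / 25)" by (simp add: real_le_lsqrt)
  then have "sqrt 2 ^ n \<le> exp (9 / 25) ^ n" by (intro power_mono) auto
  also have "\<dots> = exp (real n * (9 / 25))" by (rule exp_of_nat_mult[symmetric])
  finally show ?thesis .
qed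

lemma inverse_sqrt3_power_le: "(1 / sqrt 3) ^ n \<le> exp (- real n * (1 / 2))"
proof -
  have "exp (1 / 2 :: real) ^ 2 = exp 1" by (simp flip: exp_of_nat_mult)
  then have "exp (1 / 2 :: real) ^ 2 \<le> 3" using exp_le by simp
  then have "exp (1 / 2) \<le> sqrt 3" by (rule real_le_rsqrt)
  then have "1 / sqrt 3 \<le> 1 / exp (1 / 2)" by (intro divide_left_mono) auto
  also have "\<dots> = exp (- (1 / 2))" by (simp add: exp_minus inverse_eq_divide)
  finally have "(1 / sqrt 3) ^ n \<le> exp (- (1 / 2)) ^ n" by (intro power_mono) auto
  also have "\<dots> = exp (real n * (- (1 / 2)))" by (rule exp_of_nat_mult[symmetric])
  finally show ?thesis by simp
qed

lemma poly_le_exp: "real n \<le> exp (2 * sqrt (real n))"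
proof -
  have "sqrt (real n) \<le> exp (sqrt (real n))" using exp_ge_add_one_self[of "sqrt (real n)"] by linarith
  then have "(sqrt (real n))\<^sup>2 \<le> (exp (sqrt (real n)))\<^sup>2" by (intro power_mono) auto
  then show ?thesis by (simp flip: exp_of_nat_mult)
qed

text \<open>The divisor 16384 is twice 8192: then m is at least 16383 sqrt d, and the tail exponent
  m^2 / 8192 is nearly twice the cost m sqrt d of choosing the rows, with ample room for the d
  signs.\<close>

definition blk_len :: "nat \<Rightarrow> nat" where "blk_len d = nat \<lfloor>sqrt (real d) / 16384\<rfloor>"

definition blk_num :: "nat \<Rightarrow> nat" where "blk_num d = d div blk_len d"

lemma blk:
  assumes d: "real d \<ge> 16384\<^sup>2"
  shows "blk_len d \<ge> 1" "real (blk_len d) \<ge> 1 / 32768 * sqrt (real d)" "real (blk_len d) \<le> sqrt (real d) / 16384"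
    "blk_num d * blk_len d \<le> d" "real (blk_num d) \<ge> 16383 * sqrt (real d)" "real (blk_num d * blk_len d) \<ge> real d / 2"
    "blk_num d \<ge> 1" "sqrt (real d) \<ge> 16384" "sqrt (real d) \<le> real d / 16384"
proof -
  define s where "s = sqrt (real d)"
  have s: "s \<ge> 16384" unfolding s_def using d by (intro real_le_rsqrt) simp
  have s2: "s * s = real d" by (simp add: s_def)
  show "sqrt (real d) \<ge> 16384" using s by (simp add: s_def)
  have "16384 * s \<le> s * s" using s by (intro mult_right_mono) auto
  then show sd: "sqrt (real d) \<le> real d / 16384" using s2 by (simp add: s_def)
  let ?k = "blk_len d" and ?m = "blk_num d"
  have "s / 16384 \<ge> 1" using s by simp
  then have f1: "\<lfloor>s / 16384\<rfloor> \<ge> 1" by linarith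
  have kf: "real ?k = real_of_int \<lfloor>s / 16384\<rfloor>" unfolding blk_len_def s_def[symmetric] using f1 by simp
  show k1: "?k \<ge> 1" using f1 kf by linarith
  show ku: "real ?k \<le> sqrt (real d) / 16384" unfolding kf s_def[symmetric] by (rule of_int_floor_le)
  have "s / 16384 < real ?k + 1" unfolding kf by linarith
  \<comment> \<open>Rounding down a number that is at least 1 loses at most a factor 2; this is the
    origin of the constant 1 / 32768.\<close>
  then show "real ?k \<ge> 1 / 32768 * sqrt (real d)" using k1 unfolding s_def[symmetric] by simp
  show mk: "?m * ?k \<le> d" unfolding blk_num_def by (rule div_times_less_eq_dividend)
  have "d = ?m * ?k + d mod ?k" unfolding blk_num_def by simp
  moreover have "d mod ?k < ?k" using k1 by simp
  ultimately have "d < ?m * ?k + ?k" by linarith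
  then have dm: "real d < real ?m * real ?k + real ?k" by (metis of_nat_add of_nat_less_iff of_nat_mult)
  then have "real d < (real ?m + 1) * real ?k" by (simp add: algebra_simps)
  also have "\<dots> \<le> (real ?m + 1) * (s / 16384)" using ku by (intro mult_left_mono) (auto simp: s_def)
  finally have "s * s < (real ?m + 1) * (s / 16384)" using s2 by simp
  then have "s * (16384 * s) < s * (real ?m + 1)" by (simp add: algebra_simps)
  then have "16384 * s < real ?m + 1" using s by (simp add: mult_less_cancel_left_pos)
  then show ml: "real ?m \<ge> 16383 * sqrt (real d)" using s unfolding s_def[symmetric] by simp
  then have "real ?m \<ge> 1" using s unfolding s_def[symmetric] by linarith
  then show "?m \<ge> 1" by linarith
  show "real (?m * ?k) \<ge> real d / 2" using dm ku sd s unfolding s_def[symmetric] by simp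
qed

text \<open>Each of the three terms is brought below exp (- d / 8 - 2), the extra 2 paying for their
  number. The hypothesis on \<open>N\<close> is used to bound N^m and the number of rows.\<close>

lemma bad_inf_small:
  assumes d: "real d \<ge> 16384\<^sup>2" and dN: "d \<le> N" and N: "real N \<le> exp (sqrt (real d))"
  shows "measure (gauss (idx N d)) (bad_inf N d (blk_len d) (blk_num d)) \<le> exp (- (1 / 8)) ^ d"
proof -
  note B = blk[OF d]
  let ?m = "real (blk_num d)"
  define D where "D = real d"
  have D: "D \<ge> 16384\<^sup>2" "D > 0" using d by (auto simp: D_def)
  have d0: "d > 0" using D by (simp add: D_def)
  have sD: "sqrt D \<le> D / 16384" using B(9) by (simp add: D_def)
  have "real N * (sqrt 2 ^ d * exp (- real d)) \<le> exp (sqrt D) * (exp (D * (9 / 25)) * exp (- D))"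
    using N sqrt2_power_le[of d] unfolding D_def by (intro mult_mono) auto
  also have "\<dots> = exp (sqrt D + D * (9 / 25) + - D)" by (simp only: exp_add mult.assoc)
  also have "\<dots> \<le> exp (- (1 / 8) * D - 2)" using sD D by simp
  finally have 1: "real N * (sqrt 2 ^ d * exp (- real d)) \<le> exp (- (1 / 8) * D - 2)" .
  have "real d * ((1 / sqrt 3) ^ d * exp (real d / 4)) \<le> exp (2 * sqrt D) * (exp (- D * (1 / 2)) * exp (D / 4))"
    using poly_le_exp[of d] inverse_sqrt3_power_le[of d] unfolding D_def by (intro mult_mono) auto
  also have "\<dots> = exp (2 * sqrt D + - D * (1 / 2) + D / 4)" by (simp only: exp_add mult.assoc)
  also have "\<dots> \<le> exp (- (1 / 8) * D - 2)" using sD D by simp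
  finally have 2: "real d * ((1 / sqrt 3) ^ d * exp (real d / 4)) \<le> exp (- (1 / 8) * D - 2)" .
  have "real (N ^ blk_num d * 3 ^ d) = real N ^ blk_num d * 3 ^ d" by simp
  also have "\<dots> \<le> exp (sqrt D) ^ blk_num d * exp 2 ^ d"
  proof (intro mult_mono power_mono)
    have "1 + 2 \<le> exp (2 :: real)" by (rule exp_ge_add_one_self)
    then show "3 \<le> exp (2 :: real)" by simp
  qed (use N in \<open>auto simp: D_def\<close>)
  also have "\<dots> = exp (?m * sqrt D + D * 2)" unfolding D_def by (simp add: exp_add exp_of_nat_mult)
  finally have n: "real (N ^ blk_num d * 3 ^ d) \<le> exp (?m * sqrt D + D * 2)" .
  have "real (N ^ blk_num d * 3 ^ d) * exp (- ?m\<^sup>2 / 8192) \<le> exp (?m * sqrt D + D * 2) * exp (- ?m\<^sup>2 / 8192)"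
    using n by (rule mult_right_mono) simp
  also have "\<dots> = exp (?m * sqrt D + D * 2 + - ?m\<^sup>2 / 8192)" by (rule exp_add[symmetric])
  also have "\<dots> \<le> exp (- (1 / 8) * D - 2)"
  proof -
    \<comment> \<open>The lower bound on m is used twice: to beat m sqrt d by m^2 / 8192, and to
      beat 2 d by what remains of m sqrt d.\<close>
    have "?m \<ge> 16383 * sqrt D" using B(5) by (simp add: D_def)
    then have "?m * (16383 * sqrt D) \<le> ?m * ?m" by (intro mult_left_mono) auto
    then have a: "?m * sqrt D * 16383 \<le> ?m\<^sup>2" by (simp add: power2_eq_square algebra_simps)
    have "(16383 * sqrt D) * sqrt D \<le> ?m * sqrt D" using B(5) D by (intro mult_right_mono) (auto simp: D_def)
    moreover have "(16383 * sqrt D) * sqrt D = 16383 * D" using D by simp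
    ultimately have b: "16383 * D \<le> ?m * sqrt D" by linarith
    have "?m * sqrt D + D * 2 + - ?m\<^sup>2 / 8192 \<le> - (1 / 8) * D - 2" using a b D by simp
    then show ?thesis by simp
  qed
  finally have 3: "real (N ^ blk_num d * 3 ^ d) * exp (- ?m\<^sup>2 / 8192) \<le> exp (- (1 / 8) * D - 2)" .
  have "measure (gauss (idx N d)) (bad_inf N d (blk_len d) (blk_num d)) \<le> 3 * exp (- (1 / 8) * D - 2)"
    using bad_inf_measure[OF dN d0, of "blk_len d" "blk_num d"] 1 2 3 by linarith
  \<comment> \<open>Three terms, and 3 \<le> 1 + 2 \<le> exp 2.\<close>
  also have "\<dots> \<le> exp 2 * exp (- (1 / 8) * D - 2)"
    using exp_ge_add_one_self[of "2 :: real"] by (intro mult_right_mono) auto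
  also have "\<dots> = exp (D * (- (1 / 8)))" by (simp flip: exp_add)
  also have "\<dots> = exp (- (1 / 8)) ^ d" unfolding D_def by (rule exp_of_nat_mult)
  finally show ?thesis .
qed

text \<open>The row terms carry exp (-2 ln N) per chosen row, half of which cancels the choice; the
  net term is the only one that forces \<open>N\<close> to exceed a power of exp (sqrt d), through
  sqrt N against d^2.\<close>

lemma bad_two_small:
  assumes d: "real d \<ge> 16384\<^sup>2" and N: "real N \<ge> exp (sqrt (real d))"
  shows "measure (gauss (idx N d)) (bad_two N d (blk_len d) (blk_num d)) \<le> exp (- (1 / 8)) ^ d"
    and "ln (real N) \<ge> 1" "real (blk_len d) \<le> ln (real N)"
proof -
  note B = blk[OF d]
  let ?m = "blk_num d" and ?k = "blk_len d"
  define D where "D = real d"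
  define L where "L = ln (real N)"
  have D: "D \<ge> 16384\<^sup>2" "D > 0" using d by (auto simp: D_def)
  have N0: "real N > 0" using N exp_gt_zero[of "sqrt (real d)"] by linarith
  have Ls: "L \<ge> sqrt D" unfolding L_def D_def using N N0 by (simp add: ln_ge_iff)
  have s: "sqrt D \<ge> 16384" using B(8) by (simp add: D_def)
  have NL: "real N = exp L" unfolding L_def using N0 by simp
  show l1: "ln (real N) \<ge> 1" using Ls s by (simp add: L_def)
  show "real (blk_len d) \<le> ln (real N)" using B(3) Ls s by (simp add: D_def L_def)
  have "exp (sqrt D) \<ge> exp (ln (9 ^ 4))"
  proof -
    have "ln (9 ^ 4 :: real) \<le> 9 ^ 4 - 1" by (rule ln_le_minus_one) simp
    then have "ln (9 ^ 4 :: real) \<le> sqrt D" using s by simp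
    then show ?thesis by (simp only: exp_le_cancel_iff)
  qed
  then have N9: "real N \<ge> 9 ^ 4" using N unfolding D_def by simp
  have "real N * (sqrt 2 ^ d * exp (- 2 * (real d + ln (real N)))) \<le> exp L * (exp (D * (9 / 25)) * exp (- 2 * (D + L)))"
    using sqrt2_power_le[of d] NL unfolding D_def L_def by (intro mult_mono) auto
  also have "\<dots> = exp (L + D * (9 / 25) + - 2 * (D + L))" by (simp only: exp_add mult.assoc)
  also have "\<dots> \<le> exp (- (1 / 8) * D - 2)" using Ls s D by simp
  finally have 1: "real N * (sqrt 2 ^ d * exp (- 2 * (real d + ln (real N)))) \<le> exp (- (1 / 8) * D - 2)" .
  have 2: "real ((2 * (32 * (d + 1)) + 1) ^ d) * exp (- sqrt (real N)) \<le> exp (- (1 / 8) * D - 2)"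
  proof -
    have "real ((2 * (32 * (d + 1)) + 1) ^ d) = (64 * D + 65) ^ d" by (simp add: D_def algebra_simps)
    \<comment> \<open>A wasteful bound for the size of the net, of order exp (64 d^2), is enough:
      sqrt N is at least exp (sqrt d / 2).\<close>
    also have "\<dots> \<le> exp (64 * D + 64) ^ d"
      using exp_ge_add_one_self[of "64 * D + 64"] D by (intro power_mono) auto
    also have "\<dots> = exp (D * (64 * D + 64))" unfolding D_def by (rule exp_of_nat_mult[symmetric])
    also have "\<dots> \<le> exp (65 * D\<^sup>2 - D - 2)"
    proof -
      have D2: "D \<ge> 2" using D by simp
      have "66 * D \<le> D * D" using D by (intro mult_right_mono) auto
      moreover have "D * (64 * D + 64) = 64 * (D * D) + 64 * D" by (simp add: algebra_simps)
      moreover have "65 * D\<^sup>2 = 65 * (D * D)" by (simp add: power2_eq_square)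
      ultimately have "D * (64 * D + 64) \<le> 65 * D\<^sup>2 - D - 2" using D2 by linarith
      then show ?thesis by (simp only: exp_le_cancel_iff)
    qed
    finally have a: "real ((2 * (32 * (d + 1)) + 1) ^ d) \<le> exp (65 * D\<^sup>2 - D - 2)" .
    have "sqrt (real N) = exp (L / 2)"
    proof -
      have "real N = (exp (L / 2))\<^sup>2" unfolding NL by (simp flip: exp_of_nat_mult)
      then have "sqrt (real N) = sqrt ((exp (L / 2))\<^sup>2)" by (rule arg_cong)
      also have "\<dots> = exp (L / 2)" unfolding real_sqrt_abs by simp
      finally show ?thesis .
    qed
    also have "\<dots> \<ge> exp (sqrt D / 2)" using Ls by simp
    finally have b: "exp (sqrt D / 2) \<le> sqrt (real N)" .
    have "65 * D\<^sup>2 \<le> exp (sqrt D / 2)"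
    proof -
      \<comment> \<open>Scaled so that w^6 \<le> exp (6 w) = exp (sqrt D / 2), while D^2 is only of
        order w^4.\<close>
      define w where "w = sqrt D / 12"
      have w: "w \<ge> 1200" using s by (simp add: w_def)
      have "w \<le> exp w" using exp_ge_add_one_self[of w] by linarith
      then have "w ^ 6 \<le> exp w ^ 6" using w by (intro power_mono) auto
      also have "\<dots> = exp (sqrt D / 2)" by (simp add: w_def flip: exp_of_nat_mult)
      finally have e: "w ^ 6 \<le> exp (sqrt D / 2)" .
      have "D = (12 * w)\<^sup>2" using D by (simp add: w_def)
      then have "65 * D\<^sup>2 = 65 * 20736 * w ^ 4" by (simp add: power_mult_distrib flip: power_mult)
      also have "\<dots> \<le> w ^ 2 * w ^ 4"
      proof -
        have "1200 * 1200 \<le> w * w" using w by (intro mult_mono) auto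
        then have "65 * 20736 \<le> w ^ 2" by (simp add: power2_eq_square)
        then have "65 * 20736 * w ^ 4 \<le> w ^ 2 * w ^ 4" by (intro mult_right_mono) auto
        then show ?thesis by (simp add: algebra_simps)
      qed
      finally show ?thesis using e by (simp flip: power_add)
    qed
    then have c: "65 * D\<^sup>2 \<le> sqrt (real N)" using b by linarith
    have "real ((2 * (32 * (d + 1)) + 1) ^ d) * exp (- sqrt (real N)) \<le> exp (65 * D\<^sup>2 - D - 2) * exp (- sqrt (real N))"
      using a by (rule mult_right_mono) simp
    also have "\<dots> = exp (65 * D\<^sup>2 - D - 2 + - sqrt (real N))" by (rule exp_add[symmetric])
    also have "\<dots> \<le> exp (- (1 / 8) * D - 2)" using c D by simp
    finally show ?thesis .
  qed
  have "real (N ^ ?m) * (sqrt 2 ^ (?m * ?k) * exp (- 2 * real ?m * (real ?k + ln (real N))))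
    \<le> exp (real ?m * L) * (exp (real (?m * ?k) * (9 / 25)) * exp (- 2 * real ?m * (real ?k + L)))"
  proof (intro mult_mono)
    show "real (N ^ ?m) \<le> exp (real ?m * L)" using NL by (simp add: exp_of_nat_mult)
  qed (use sqrt2_power_le[of "?m * ?k"] in \<open>auto simp: L_def\<close>)
  also have "\<dots> = exp (real ?m * L + real (?m * ?k) * (9 / 25) + - 2 * real ?m * (real ?k + L))" by (simp only: exp_add mult.assoc)
  also have "\<dots> \<le> exp (- (1 / 8) * D - 2)"
  proof -
    \<comment> \<open>One of the two copies of m L cancels N^m. The remaining decay is (2 - 9/25) m
      k, and m k is at least d / 2.\<close>
    have "real ?m * L \<ge> 0" using Ls s by (intro mult_nonneg_nonneg) auto
    moreover have "real (?m * ?k) \<ge> D / 2" using B(6) by (simp add: D_def)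
    ultimately have "real ?m * L + real (?m * ?k) * (9 / 25) + - 2 * real ?m * (real ?k + L) \<le> - (1 / 8) * D - 2"
      using D by (simp add: algebra_simps)
    then show ?thesis by simp
  qed
  finally have 3: "real (N ^ ?m) * (sqrt 2 ^ (?m * ?k) * exp (- 2 * real ?m * (real ?k + ln (real N)))) \<le> exp (- (1 / 8) * D - 2)" .
  have "measure (gauss (idx N d)) (bad_two N d ?k ?m) \<le> 3 * exp (- (1 / 8) * D - 2)"
    using bad_two_measure[OF B(4) N9] 1 2 3 by linarith
  also have "\<dots> \<le> exp 2 * exp (- (1 / 8) * D - 2)"
    using exp_ge_add_one_self[of "2 :: real"] by (intro mult_right_mono) auto
  also have "\<dots> = exp (D * (- (1 / 8)))" by (simp flip: exp_add)
  also have "\<dots> = exp (- (1 / 8)) ^ d" unfolding D_def by (rule exp_of_nat_mult)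
  finally show "measure (gauss (idx N d)) (bad_two N d ?k ?m) \<le> exp (- (1 / 8)) ^ d" .
qed

text \<open>The same exceptional set of matrices serves subspaces and quotients, and the base exp (-
  1 / 8) depends on neither d nor N.\<close>

lemma grassmann_haar_good:
  assumes d: "d \<ge> 1" and dN: "d \<le> N"
  shows "measure (grassmann_haar d N) {E \<in> grassmannian d N. good_subspace (1 / 32768) d N E} \<ge> 1 - exp (- (1 / 8)) ^ d"
    and "measure (grassmann_haar d N) {E \<in> grassmannian d N. good_quotient (1 / 32768) d N E} \<ge> 1 - exp (- (1 / 8)) ^ d"
proof -
  let ?c = "1 / 32768 :: real"
  let ?g = "gauss (idx N d)"
  have "\<exists>B\<in>sets ?g. measure ?g B \<le> exp (- (1 / 8)) ^ d \<and> (\<forall>G\<in>space ?g. G \<notin> B \<longrightarrow> nondeg N d G \<longrightarrow>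
    good_subspace ?c d N (span (col N G ` {..<d})) \<and> good_quotient ?c d N (span (col N G ` {..<d})))"
  proof (cases "real d \<ge> 16384\<^sup>2")
    case False
    \<comment> \<open>Below the threshold c sqrt d is at most 16384 / 32768 = 1/2, so a line
      suffices and the exceptional set is empty.\<close>
    have "sqrt (real d) \<le> sqrt (16384\<^sup>2)" using False by (intro real_sqrt_le_mono) simp
    then have "?c * sqrt (real d) \<le> 1" by simp
    then show ?thesis using good_small_dim[OF onb_grassmannian[OF nondeg_onb] d]
      by (intro bexI[of _ "{}"]) auto
  next
    case True
    note B = blk[OF True]
    show ?thesis
    proof (cases "real N \<le> exp (sqrt (real d))")
      case N: True
      show ?thesis
        using bad_inf_sets[OF dN] bad_inf_small[OF True dN N] good_inf_regime[OF _ _ _ B(1,4,7) dN B(2)]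
        by (intro bexI[of _ "bad_inf N d (blk_len d) (blk_num d)"]) auto
    next
      case False
      then have N: "real N \<ge> exp (sqrt (real d))" by simp
      show ?thesis
        using bad_two_sets[OF B(4)] bad_two_small(1)[OF True N] good_two_regime[OF _ _ _ B(4) bad_two_small(2,3)[OF True N] B(2)]
        by (intro bexI[of _ "bad_two N d (blk_len d) (blk_num d)"]) auto
    qed
  qed
  then obtain B where B: "B \<in> sets ?g" "measure ?g B \<le> exp (- (1 / 8)) ^ d"
    "\<And>G. G \<in> space ?g \<Longrightarrow> G \<notin> B \<Longrightarrow> nondeg N d G \<Longrightarrow>
      good_subspace ?c d N (span (col N G ` {..<d})) \<and> good_quotient ?c d N (span (col N G ` {..<d}))"
    by blast
  have c: "?c > 0" by simp
  note S = good_sets[OF d c, of N]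
  have "1 - measure ?g B \<le> measure (grassmann_haar d N) {E \<in> grassmannian d N. good_subspace ?c d N E}"
    by (rule grassmann_haar_ge[OF dN S(1) B(1)]) (use B(3) onb_grassmannian[OF nondeg_onb] in auto)
  then show "measure (grassmann_haar d N) {E \<in> grassmannian d N. good_subspace ?c d N E} \<ge> 1 - exp (- (1 / 8)) ^ d"
    using B(2) by linarith
  have "1 - measure ?g B \<le> measure (grassmann_haar d N) {E \<in> grassmannian d N. good_quotient ?c d N E}"
    by (rule grassmann_haar_ge[OF dN S(2) B(1)]) (use B(3) onb_grassmannian[OF nondeg_onb] in auto)
  then show "measure (grassmann_haar d N) {E \<in> grassmannian d N. good_quotient ?c d N E} \<ge> 1 - exp (- (1 / 8)) ^ d"
    using B(2) by linarith
qed

theorem corollary4p3: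
  shows "\<exists>C c :: real. C > 0 \<and> c > 0 \<and>
    (\<forall>f :: nat \<Rightarrow> nat. mono_on {1..} f \<and> (\<forall>d\<ge>1. d \<le> f d) \<longrightarrow>
      generic_quotient_l1 f
        (\<lambda>d X. \<exists>k p. real k \<ge> c * sqrt (real d) \<and> p \<in> {1, 2} \<and> contains_complemented_lp C p k X) \<and>
      generic_subspace_linf f
        (\<lambda>d X. \<exists>k p. real k \<ge> c * sqrt (real d) \<and> p \<in> {\<infinity>, 2} \<and> contains_complemented_lp C p k X))"
proof (rule exI[of _ "32 :: real"], rule exI[of _ "1 / 32768 :: real"], intro conjI allI impI)
  fix f :: "nat \<Rightarrow> nat" assume f: "mono_on {1..} f \<and> (\<forall>d\<ge>1. d \<le> f d)"
  have e: "0 < exp (- (1 / 8) :: real)" "exp (- (1 / 8) :: real) < 1" by auto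
  show "generic_quotient_l1 f
      (\<lambda>d X. \<exists>k p. real k \<ge> 1 / 32768 * sqrt (real d) \<and> p \<in> {1, 2} \<and> contains_complemented_lp 32 p k X)"
    unfolding generic_quotient_l1_def
    using grassmann_haar_good(2)[unfolded good_quotient_def] f e by (intro exI[of _ "exp (- (1 / 8))"]) auto
  show "generic_subspace_linf f
      (\<lambda>d X. \<exists>k p. real k \<ge> 1 / 32768 * sqrt (real d) \<and> p \<in> {\<infinity>, 2} \<and> contains_complemented_lp 32 p k X)"
    unfolding generic_subspace_linf_def
    using grassmann_haar_good(1)[unfolded good_subspace_def] f e by (intro exI[of _ "exp (- (1 / 8))"]) auto
qed auto

end
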